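(* The assignment $R\mapsto \mathrm{2Spec}({}^R\mathrm{Mod})$ of commutative rings to affine 2-schemes makes the category of (1-)affine schemes into a full sub-2-category of the 2-category of affine 2-schemes. That is, for all commutative rings $R,S$, the functor $\mathrm{Hom}_{\mathrm{CRing}}(R,S)\to\mathrm{Hom}_{\mathrm{Com2Ring}}({}^R\mathrm{Mod},{}^S\mathrm{Mod})$ sending a ring homomorphism to extension of scalars along it (with the set of ring homomorphisms regarded as a category with only identity morphisms) is an equivalence of categories.
   Context: Presentable category: a locally small cocomplete category that is the closure under small colimits of a small set of little objects ($x$ is little if, for some cardinal $\kappa$, $\mathrm{Hom}(x,-)$ preserves $\kappa$-directed colimits). A commutative 2-ring is a presentable symmetric monoidal category whose tensor product preserves small colimits in each variable; 1-morphisms are cocontinuous (strong) symmetric monoidal functors and 2-morphisms are monoidal natural transformations. These form the 2-category $\mathrm{Com2Ring}$; the 2-category of affine 2-schemes is its 1-opposite, and $\mathrm{2Spec}(A)$ is the affine 2-scheme corresponding to $A$. For a commutative ring $R$, ${}^R\mathrm{Mod}$ is the category of all $R$-modules, a commutative 2-ring with $\otimes=\otimes_R$. *)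

theory Defs
  imports "HOL-Algebra.Module" "HOL-Library.Equipollence"
begin

section \<open>Size\<close>

text \<open>
  The type \<open>'u\<close> plays the role of a Grothendieck universe: a set (over any type) is small if
  its cardinality is strictly below that of \<open>'u\<close>, and every small set is in bijection with a
  subset of \<open>'u\<close>.  The cardinality of \<open>'u\<close> is required to be a regular strong limit, that is,
  strongly inaccessible or countable.  In the countable case small means finite; it is not
  excluded.
\<close>

definition small :: "'u itself \<Rightarrow> 'a set \<Rightarrow> bool" where
  "small U A \<longleftrightarrow> A \<prec> (UNIV :: 'u set)"

definition universe :: "'u itself \<Rightarrow> bool" where
  "universe U \<longleftrightarrow>
     infinite (UNIV :: 'u set) \<and>
     (\<forall>A :: 'u set. small U A \<longrightarrow> small U (Pow A)) \<and>
     (\<forall>(I :: 'u set) (A :: 'u \<Rightarrow> 'u set).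
        small U I \<longrightarrow> (\<forall>i\<in>I. small U (A i)) \<longrightarrow> small U (\<Union>i\<in>I. A i))"


section \<open>Categories, functors, natural transformations\<close>

record ('o, 'a) category =
  obj :: "'o set"
  arr :: "'a set"
  src :: "'a \<Rightarrow> 'o"
  tgt :: "'a \<Rightarrow> 'o"
  idn :: "'o \<Rightarrow> 'a"
  cmp :: "'a \<Rightarrow> 'a \<Rightarrow> 'a"  (infixr \<open>\<cdot>\<index>\<close> 70)

definition hom_set :: "('o, 'a, 'z) category_scheme \<Rightarrow> 'o \<Rightarrow> 'o \<Rightarrow> 'a set" where
  "hom_set C x y = {f \<in> arr C. src C f = x \<and> tgt C f = y}"

definition is_category :: "('o, 'a, 'z) category_scheme \<Rightarrow> bool" where
  "is_category C \<longleftrightarrow>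
     (\<forall>f\<in>arr C. src C f \<in> obj C \<and> tgt C f \<in> obj C) \<and>
     (\<forall>x\<in>obj C. idn C x \<in> hom_set C x x) \<and>
     (\<forall>x y z f g. f \<in> hom_set C x y \<longrightarrow> g \<in> hom_set C y z \<longrightarrow> g \<cdot>\<^bsub>C\<^esub> f \<in> hom_set C x z) \<and>
     (\<forall>x y f. f \<in> hom_set C x y \<longrightarrow> f \<cdot>\<^bsub>C\<^esub> idn C x = f \<and> idn C y \<cdot>\<^bsub>C\<^esub> f = f) \<and>
     (\<forall>w x y z f g h. f \<in> hom_set C w x \<longrightarrow> g \<in> hom_set C x y \<longrightarrow> h \<in> hom_set C y z \<longrightarrow>
        (h \<cdot>\<^bsub>C\<^esub> g) \<cdot>\<^bsub>C\<^esub> f = h \<cdot>\<^bsub>C\<^esub> (g \<cdot>\<^bsub>C\<^esub> f))"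

definition is_iso :: "('o, 'a, 'z) category_scheme \<Rightarrow> 'a \<Rightarrow> bool" where
  "is_iso C f \<longleftrightarrow> f \<in> arr C \<and>
     (\<exists>g \<in> hom_set C (tgt C f) (src C f).
        g \<cdot>\<^bsub>C\<^esub> f = idn C (src C f) \<and> f \<cdot>\<^bsub>C\<^esub> g = idn C (tgt C f))"

definition iso_set :: "('o, 'a, 'z) category_scheme \<Rightarrow> 'o \<Rightarrow> 'o \<Rightarrow> 'a set" where
  "iso_set C x y = {f \<in> hom_set C x y. is_iso C f}"

definition discrete_category :: "'o set \<Rightarrow> ('o, 'o) category" where
  "discrete_category X =
     \<lparr>obj = X, arr = X, src = (\<lambda>x. x), tgt = (\<lambda>x. x), idn = (\<lambda>x. x), cmp = (\<lambda>y x. x)\<rparr>"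

record ('o, 'a, 'p, 'b) fctr =
  fobj :: "'o \<Rightarrow> 'p"
  farr :: "'a \<Rightarrow> 'b"

definition is_functor ::
  "('o, 'a, 'y) category_scheme \<Rightarrow> ('p, 'b, 'z) category_scheme \<Rightarrow>
   ('o, 'a, 'p, 'b, 'w) fctr_scheme \<Rightarrow> bool" where
  "is_functor C D F \<longleftrightarrow>
     is_category C \<and> is_category D \<and>
     (\<forall>x\<in>obj C. fobj F x \<in> obj D) \<and>
     (\<forall>x y. \<forall>f\<in>hom_set C x y. farr F f \<in> hom_set D (fobj F x) (fobj F y)) \<and>
     (\<forall>x\<in>obj C. farr F (idn C x) = idn D (fobj F x)) \<and>
     (\<forall>x y z. \<forall>f\<in>hom_set C x y. \<forall>g\<in>hom_set C y z.
        farr F (g \<cdot>\<^bsub>C\<^esub> f) = farr F g \<cdot>\<^bsub>D\<^esub> farr F f)"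

definition id_fctr :: "('o, 'a, 'o, 'a) fctr" where
  "id_fctr = \<lparr>fobj = (\<lambda>x. x), farr = (\<lambda>f. f)\<rparr>"

definition comp_fctr ::
  "('p, 'b, 'q, 'c, 'y) fctr_scheme \<Rightarrow> ('o, 'a, 'p, 'b, 'z) fctr_scheme \<Rightarrow>
   ('o, 'a, 'q, 'c) fctr" where
  "comp_fctr G F = \<lparr>fobj = (\<lambda>x. fobj G (fobj F x)), farr = (\<lambda>f. farr G (farr F f))\<rparr>"

definition nat_trans ::
  "('o, 'a, 'y) category_scheme \<Rightarrow> ('p, 'b, 'z) category_scheme \<Rightarrow>
   ('o, 'a, 'p, 'b, 'v) fctr_scheme \<Rightarrow> ('o, 'a, 'p, 'b, 'w) fctr_scheme \<Rightarrow>
   ('o \<Rightarrow> 'b) \<Rightarrow> bool" where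
  "nat_trans C D F G \<alpha> \<longleftrightarrow>
     (\<forall>x\<in>obj C. \<alpha> x \<in> hom_set D (fobj F x) (fobj G x)) \<and>
     (\<forall>f\<in>arr C. \<alpha> (tgt C f) \<cdot>\<^bsub>D\<^esub> farr F f = farr G f \<cdot>\<^bsub>D\<^esub> \<alpha> (src C f))"

definition nat_iso ::
  "('o, 'a, 'y) category_scheme \<Rightarrow> ('p, 'b, 'z) category_scheme \<Rightarrow>
   ('o, 'a, 'p, 'b, 'v) fctr_scheme \<Rightarrow> ('o, 'a, 'p, 'b, 'w) fctr_scheme \<Rightarrow>
   ('o \<Rightarrow> 'b) \<Rightarrow> bool" where
  "nat_iso C D F G \<alpha> \<longleftrightarrow> nat_trans C D F G \<alpha> \<and> (\<forall>x\<in>obj C. is_iso D (\<alpha> x))"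

definition is_equivalence ::
  "('o, 'a, 'y) category_scheme \<Rightarrow> ('p, 'b, 'z) category_scheme \<Rightarrow>
   ('o, 'a, 'p, 'b, 'w) fctr_scheme \<Rightarrow> bool" where
  "is_equivalence C D F \<longleftrightarrow> is_functor C D F \<and>
     (\<exists>(G :: ('p, 'b, 'o, 'a) fctr) \<eta> \<epsilon>. is_functor D C G \<and>
        nat_iso C C id_fctr (comp_fctr G F) \<eta> \<and>
        nat_iso D D (comp_fctr F G) id_fctr \<epsilon>)"


section \<open>Colimits and presentable categories\<close>

definition is_cocone ::
  "('o, 'a, 'y) category_scheme \<Rightarrow> ('i, 'j, 'z) category_scheme \<Rightarrow>
   ('i, 'j, 'o, 'a, 'w) fctr_scheme \<Rightarrow> 'o \<Rightarrow> ('i \<Rightarrow> 'a) \<Rightarrow> bool" where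
  "is_cocone C J E c \<iota> \<longleftrightarrow> c \<in> obj C \<and>
     (\<forall>j\<in>obj J. \<iota> j \<in> hom_set C (fobj E j) c) \<and>
     (\<forall>u\<in>arr J. \<iota> (tgt J u) \<cdot>\<^bsub>C\<^esub> farr E u = \<iota> (src J u))"

definition is_colimit ::
  "('o, 'a, 'y) category_scheme \<Rightarrow> ('i, 'j, 'z) category_scheme \<Rightarrow>
   ('i, 'j, 'o, 'a, 'w) fctr_scheme \<Rightarrow> 'o \<Rightarrow> ('i \<Rightarrow> 'a) \<Rightarrow> bool" where
  "is_colimit C J E c \<iota> \<longleftrightarrow> is_cocone C J E c \<iota> \<and>
     (\<forall>d \<kappa>. is_cocone C J E d \<kappa> \<longrightarrow>
        (\<exists>!h. h \<in> hom_set C c d \<and> (\<forall>j\<in>obj J. h \<cdot>\<^bsub>C\<^esub> \<iota> j = \<kappa> j)))"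

definition preserves_colimits ::
  "('i, 'j, 'x) category_scheme \<Rightarrow>
   ('o, 'a, 'y) category_scheme \<Rightarrow> ('p, 'b, 'z) category_scheme \<Rightarrow>
   ('o, 'a, 'p, 'b, 'w) fctr_scheme \<Rightarrow> bool" where
  "preserves_colimits J C D F \<longleftrightarrow>
     (\<forall>(E :: ('i, 'j, 'o, 'a) fctr) c \<iota>. is_functor J C E \<longrightarrow> is_colimit C J E c \<iota> \<longrightarrow>
        is_colimit D J (comp_fctr F E) (fobj F c) (\<lambda>j. farr F (\<iota> j)))"

text \<open>
  Every small category is isomorphic to one whose objects and arrows are elements of \<open>'u\<close>, so
  small diagrams are indexed by categories of type \<open>('u, 'u) category\<close>.
\<close>

definition small_category :: "'u itself \<Rightarrow> ('u, 'u) category \<Rightarrow> bool" where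
  "small_category U J \<longleftrightarrow> is_category J \<and> small U (obj J) \<and> small U (arr J)"

definition cocomplete :: "'u itself \<Rightarrow> ('o, 'a, 'z) category_scheme \<Rightarrow> bool" where
  "cocomplete U C \<longleftrightarrow>
     (\<forall>(J :: ('u, 'u) category) (E :: ('u, 'u, 'o, 'a) fctr).
        small_category U J \<longrightarrow> is_functor J C E \<longrightarrow> (\<exists>c \<iota>. is_colimit C J E c \<iota>))"

definition cocontinuous ::
  "'u itself \<Rightarrow> ('o, 'a, 'y) category_scheme \<Rightarrow> ('p, 'b, 'z) category_scheme \<Rightarrow>
   ('o, 'a, 'p, 'b, 'w) fctr_scheme \<Rightarrow> bool" where
  "cocontinuous U C D F \<longleftrightarrow>
     (\<forall>J :: ('u, 'u) category. small_category U J \<longrightarrow> preserves_colimits J C D F)"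

definition locally_small :: "'u itself \<Rightarrow> ('o, 'a, 'z) category_scheme \<Rightarrow> bool" where
  "locally_small U C \<longleftrightarrow> (\<forall>x\<in>obj C. \<forall>y\<in>obj C. small U (hom_set C x y))"

definition small_sets :: "'u itself \<Rightarrow> ('s set, 's set \<times> ('s \<Rightarrow> 's) \<times> 's set) category" where
  "small_sets U =
     \<lparr>obj = {A. small U A},
      arr = {(A, f, B). small U A \<and> small U B \<and> f \<in> A \<rightarrow>\<^sub>E B},
      src = (\<lambda>(A, f, B). A),
      tgt = (\<lambda>(A, f, B). B),
      idn = (\<lambda>A. (A, \<lambda>x\<in>A. x, A)),
      cmp = (\<lambda>(B', g, C) (A, f, B). (A, compose A g f, C))\<rparr>"

text \<open>
  The functor \<open>Hom(x, -)\<close> takes values in small subsets of \<open>'a + 'u\<close> rather than of the arrow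
  type \<open>'a\<close>: the summand \<open>'u\<close> guarantees that every small set is isomorphic to an object of the
  target category, whatever the type \<open>'a\<close> is.
\<close>

definition hom_fctr ::
  "'u itself \<Rightarrow> ('o, 'a, 'z) category_scheme \<Rightarrow> 'o \<Rightarrow>
   ('o, 'a, ('a + 'u) set, ('a + 'u) set \<times> ('a + 'u \<Rightarrow> 'a + 'u) \<times> ('a + 'u) set) fctr" where
  "hom_fctr U C x =
     \<lparr>fobj = (\<lambda>y. Inl ` hom_set C x y),
      farr = (\<lambda>f. (Inl ` hom_set C x (src C f),
                    \<lambda>g \<in> Inl ` hom_set C x (src C f). Inl (f \<cdot>\<^bsub>C\<^esub> projl g),
                    Inl ` hom_set C x (tgt C f)))\<rparr>"

text \<open>
  A cardinal \<open>\<kappa>\<close> is represented by a set \<open>K\<close> of that cardinality, a poset by a category with at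
  most one arrow between any two objects and no nontrivial isomorphisms.
\<close>

definition directed_poset :: "'k set \<Rightarrow> ('i, 'j, 'z) category_scheme \<Rightarrow> bool" where
  "directed_poset K J \<longleftrightarrow> is_category J \<and>
     (\<forall>x y. \<forall>f\<in>hom_set J x y. \<forall>g\<in>hom_set J x y. f = g) \<and>
     (\<forall>x y. hom_set J x y \<noteq> {} \<and> hom_set J y x \<noteq> {} \<longrightarrow> x = y) \<and>
     (\<forall>X\<subseteq>obj J. X \<prec> K \<longrightarrow> (\<exists>u\<in>obj J. \<forall>x\<in>X. hom_set J x u \<noteq> {}))"

definition little :: "'u itself \<Rightarrow> ('o, 'a, 'z) category_scheme \<Rightarrow> 'o \<Rightarrow> bool" where
  "little U C x \<longleftrightarrow> x \<in> obj C \<and>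
     (\<exists>K :: 'u set. small U K \<and>
        (\<forall>J :: ('u, 'u) category. small_category U J \<longrightarrow> directed_poset K J \<longrightarrow>
           preserves_colimits J C (small_sets U) (hom_fctr U C x)))"

definition colimit_closed ::
  "'u itself \<Rightarrow> ('o, 'a, 'z) category_scheme \<Rightarrow> 'o set \<Rightarrow> bool" where
  "colimit_closed U C P \<longleftrightarrow>
     (\<forall>(J :: ('u, 'u) category) (E :: ('u, 'u, 'o, 'a) fctr) c \<iota>.
        small_category U J \<longrightarrow> is_functor J C E \<longrightarrow> (\<forall>j\<in>obj J. fobj E j \<in> P) \<longrightarrow>
        is_colimit C J E c \<iota> \<longrightarrow> c \<in> P)"

definition presentable :: "'u itself \<Rightarrow> ('o, 'a, 'z) category_scheme \<Rightarrow> bool" where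
  "presentable U C \<longleftrightarrow> is_category C \<and> locally_small U C \<and> cocomplete U C \<and>
     (\<exists>G\<subseteq>obj C. small U G \<and> (\<forall>x\<in>G. little U C x) \<and>
        (\<forall>P. G \<subseteq> P \<longrightarrow> P \<subseteq> obj C \<longrightarrow> colimit_closed U C P \<longrightarrow> P = obj C))"


section \<open>Commutative 2-rings\<close>

record ('o, 'a) smcat = "('o, 'a) category" +
  tobj :: "'o \<Rightarrow> 'o \<Rightarrow> 'o"
  tarr :: "'a \<Rightarrow> 'a \<Rightarrow> 'a"
  tunit :: 'o
  asc :: "'o \<Rightarrow> 'o \<Rightarrow> 'o \<Rightarrow> 'a"
  lun :: "'o \<Rightarrow> 'a"
  run :: "'o \<Rightarrow> 'a"
  brd :: "'o \<Rightarrow> 'o \<Rightarrow> 'a"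

definition symmetric_monoidal_category :: "('o, 'a, 'z) smcat_scheme \<Rightarrow> bool" where
  "symmetric_monoidal_category A \<longleftrightarrow>
     is_category A \<and>
     (\<forall>x\<in>obj A. \<forall>y\<in>obj A. tobj A x y \<in> obj A) \<and>
     (\<forall>f\<in>arr A. \<forall>g\<in>arr A.
        tarr A f g \<in> hom_set A (tobj A (src A f) (src A g)) (tobj A (tgt A f) (tgt A g))) \<and>
     (\<forall>x\<in>obj A. \<forall>y\<in>obj A. tarr A (idn A x) (idn A y) = idn A (tobj A x y)) \<and>
     (\<forall>f\<in>arr A. \<forall>f'\<in>arr A. \<forall>g\<in>arr A. \<forall>g'\<in>arr A.
        tgt A f = src A f' \<longrightarrow> tgt A g = src A g' \<longrightarrow>
        tarr A (f' \<cdot>\<^bsub>A\<^esub> f) (g' \<cdot>\<^bsub>A\<^esub> g) = tarr A f' g' \<cdot>\<^bsub>A\<^esub> tarr A f g) \<and>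
     tunit A \<in> obj A \<and>
     (\<forall>x\<in>obj A. \<forall>y\<in>obj A. \<forall>z\<in>obj A.
        asc A x y z \<in> iso_set A (tobj A (tobj A x y) z) (tobj A x (tobj A y z))) \<and>
     (\<forall>f\<in>arr A. \<forall>g\<in>arr A. \<forall>h\<in>arr A.
        asc A (tgt A f) (tgt A g) (tgt A h) \<cdot>\<^bsub>A\<^esub> tarr A (tarr A f g) h =
        tarr A f (tarr A g h) \<cdot>\<^bsub>A\<^esub> asc A (src A f) (src A g) (src A h)) \<and>
     (\<forall>x\<in>obj A. lun A x \<in> iso_set A (tobj A (tunit A) x) x) \<and>
     (\<forall>f\<in>arr A. lun A (tgt A f) \<cdot>\<^bsub>A\<^esub> tarr A (idn A (tunit A)) f = f \<cdot>\<^bsub>A\<^esub> lun A (src A f)) \<and>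
     (\<forall>x\<in>obj A. run A x \<in> iso_set A (tobj A x (tunit A)) x) \<and>
     (\<forall>f\<in>arr A. run A (tgt A f) \<cdot>\<^bsub>A\<^esub> tarr A f (idn A (tunit A)) = f \<cdot>\<^bsub>A\<^esub> run A (src A f)) \<and>
     (\<forall>x\<in>obj A. \<forall>y\<in>obj A. brd A x y \<in> iso_set A (tobj A x y) (tobj A y x)) \<and>
     (\<forall>f\<in>arr A. \<forall>g\<in>arr A.
        brd A (tgt A f) (tgt A g) \<cdot>\<^bsub>A\<^esub> tarr A f g =
        tarr A g f \<cdot>\<^bsub>A\<^esub> brd A (src A f) (src A g)) \<and>
     (\<forall>w\<in>obj A. \<forall>x\<in>obj A. \<forall>y\<in>obj A. \<forall>z\<in>obj A.
        asc A w x (tobj A y z) \<cdot>\<^bsub>A\<^esub> asc A (tobj A w x) y z =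
        tarr A (idn A w) (asc A x y z) \<cdot>\<^bsub>A\<^esub> asc A w (tobj A x y) z \<cdot>\<^bsub>A\<^esub>
          tarr A (asc A w x y) (idn A z)) \<and>
     (\<forall>x\<in>obj A. \<forall>y\<in>obj A.
        tarr A (idn A x) (lun A y) \<cdot>\<^bsub>A\<^esub> asc A x (tunit A) y = tarr A (run A x) (idn A y)) \<and>
     (\<forall>x\<in>obj A. \<forall>y\<in>obj A. \<forall>z\<in>obj A.
        asc A y z x \<cdot>\<^bsub>A\<^esub> brd A x (tobj A y z) \<cdot>\<^bsub>A\<^esub> asc A x y z =
        tarr A (idn A y) (brd A x z) \<cdot>\<^bsub>A\<^esub> asc A y x z \<cdot>\<^bsub>A\<^esub> tarr A (brd A x y) (idn A z)) \<and>
     (\<forall>x\<in>obj A. \<forall>y\<in>obj A. brd A y x \<cdot>\<^bsub>A\<^esub> brd A x y = idn A (tobj A x y))"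

definition com_two_ring :: "'u itself \<Rightarrow> ('o, 'a, 'z) smcat_scheme \<Rightarrow> bool" where
  "com_two_ring U A \<longleftrightarrow> symmetric_monoidal_category A \<and> presentable U A \<and>
     (\<forall>x\<in>obj A.
        cocontinuous U A A \<lparr>fobj = tobj A x, farr = tarr A (idn A x)\<rparr> \<and>
        cocontinuous U A A \<lparr>fobj = (\<lambda>y. tobj A y x), farr = (\<lambda>f. tarr A f (idn A x))\<rparr>)"

record ('o, 'a, 'p, 'b) smfctr = "('o, 'a, 'p, 'b) fctr" +
  fmul :: "'o \<Rightarrow> 'o \<Rightarrow> 'b"
  fone :: 'b

definition strong_symmetric_monoidal_functor ::
  "('o, 'a, 'y) smcat_scheme \<Rightarrow> ('p, 'b, 'z) smcat_scheme \<Rightarrow>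
   ('o, 'a, 'p, 'b, 'w) smfctr_scheme \<Rightarrow> bool" where
  "strong_symmetric_monoidal_functor A B F \<longleftrightarrow>
     is_functor A B F \<and>
     fone F \<in> iso_set B (tunit B) (fobj F (tunit A)) \<and>
     (\<forall>x\<in>obj A. \<forall>y\<in>obj A.
        fmul F x y \<in> iso_set B (tobj B (fobj F x) (fobj F y)) (fobj F (tobj A x y))) \<and>
     (\<forall>f\<in>arr A. \<forall>g\<in>arr A.
        fmul F (tgt A f) (tgt A g) \<cdot>\<^bsub>B\<^esub> tarr B (farr F f) (farr F g) =
        farr F (tarr A f g) \<cdot>\<^bsub>B\<^esub> fmul F (src A f) (src A g)) \<and>
     (\<forall>x\<in>obj A. \<forall>y\<in>obj A. \<forall>z\<in>obj A.
        farr F (asc A x y z) \<cdot>\<^bsub>B\<^esub> fmul F (tobj A x y) z \<cdot>\<^bsub>B\<^esub>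
          tarr B (fmul F x y) (idn B (fobj F z)) =
        fmul F x (tobj A y z) \<cdot>\<^bsub>B\<^esub> tarr B (idn B (fobj F x)) (fmul F y z) \<cdot>\<^bsub>B\<^esub>
          asc B (fobj F x) (fobj F y) (fobj F z)) \<and>
     (\<forall>x\<in>obj A.
        farr F (lun A x) \<cdot>\<^bsub>B\<^esub> fmul F (tunit A) x \<cdot>\<^bsub>B\<^esub> tarr B (fone F) (idn B (fobj F x)) =
        lun B (fobj F x)) \<and>
     (\<forall>x\<in>obj A.
        farr F (run A x) \<cdot>\<^bsub>B\<^esub> fmul F x (tunit A) \<cdot>\<^bsub>B\<^esub> tarr B (idn B (fobj F x)) (fone F) =
        run B (fobj F x)) \<and>
     (\<forall>x\<in>obj A. \<forall>y\<in>obj A.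
        farr F (brd A x y) \<cdot>\<^bsub>B\<^esub> fmul F x y = fmul F y x \<cdot>\<^bsub>B\<^esub> brd B (fobj F x) (fobj F y))"

definition monoidal_nat_trans ::
  "('o, 'a, 'y) smcat_scheme \<Rightarrow> ('p, 'b, 'z) smcat_scheme \<Rightarrow>
   ('o, 'a, 'p, 'b, 'v) smfctr_scheme \<Rightarrow> ('o, 'a, 'p, 'b, 'w) smfctr_scheme \<Rightarrow>
   ('o \<Rightarrow> 'b) \<Rightarrow> bool" where
  "monoidal_nat_trans A B F G \<alpha> \<longleftrightarrow>
     nat_trans A B F G \<alpha> \<and>
     \<alpha> (tunit A) \<cdot>\<^bsub>B\<^esub> fone F = fone G \<and>
     (\<forall>x\<in>obj A. \<forall>y\<in>obj A.
        \<alpha> (tobj A x y) \<cdot>\<^bsub>B\<^esub> fmul F x y = fmul G x y \<cdot>\<^bsub>B\<^esub> tarr B (\<alpha> x) (\<alpha> y))"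

text \<open>
  The hom-category from \<open>A\<close> to \<open>B\<close> in the 2-category of commutative 2-rings.  Transformations
  are extensional functions, so that equal families of components give equal arrows.  Functors
  are total functions on the object and arrow types; two of them that agree on \<open>A\<close> are
  isomorphic in this category.
\<close>

definition com_two_ring_hom ::
  "'u itself \<Rightarrow> ('o, 'a, 'y) smcat_scheme \<Rightarrow> ('p, 'b, 'z) smcat_scheme \<Rightarrow>
   (('o, 'a, 'p, 'b) smfctr,
    ('o, 'a, 'p, 'b) smfctr \<times> ('o \<Rightarrow> 'b) \<times> ('o, 'a, 'p, 'b) smfctr) category" where
  "com_two_ring_hom U A B =
     (let X = {F. strong_symmetric_monoidal_functor A B F \<and> cocontinuous U A B F} in
      \<lparr>obj = X,
       arr = {(F, \<alpha>, G). F \<in> X \<and> G \<in> X \<and> monoidal_nat_trans A B F G \<alpha> \<and>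
                \<alpha> \<in> extensional (obj A)},
       src = (\<lambda>(F, \<alpha>, G). F),
       tgt = (\<lambda>(F, \<alpha>, G). G),
       idn = (\<lambda>F. (F, \<lambda>x\<in>obj A. idn B (fobj F x), F)),
       cmp = (\<lambda>(G', \<beta>, H) (F, \<alpha>, G). (F, \<lambda>x\<in>obj A. \<beta> x \<cdot>\<^bsub>B\<^esub> \<alpha> x, H))\<rparr>)"


section \<open>The commutative 2-ring of modules over a commutative ring\<close>

text \<open>
  The record type for modules in the library extends that of rings; the fields \<^const>\<open>mult\<close> and
  \<^const>\<open>one\<close> of a module carry no meaning and module homomorphisms ignore them.
\<close>

definition small_modules :: "'u ring \<Rightarrow> ('u, 'u) module set" where
  "small_modules R = {M. module R M \<and> small TYPE('u) (carrier M)}"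

definition mod_hom :: "'u ring \<Rightarrow> ('u, 'u) module \<Rightarrow> ('u, 'u) module \<Rightarrow> ('u \<Rightarrow> 'u) set" where
  "mod_hom R M N =
     {f \<in> carrier M \<rightarrow>\<^sub>E carrier N.
        (\<forall>x\<in>carrier M. \<forall>y\<in>carrier M. f (x \<oplus>\<^bsub>M\<^esub> y) = f x \<oplus>\<^bsub>N\<^esub> f y) \<and>
        (\<forall>r\<in>carrier R. \<forall>x\<in>carrier M. f (r \<odot>\<^bsub>M\<^esub> x) = r \<odot>\<^bsub>N\<^esub> f x)}"

definition bilinear_map ::
  "'u ring \<Rightarrow> ('u, 'u) module \<Rightarrow> ('u, 'u) module \<Rightarrow> ('u, 'u) module \<Rightarrow>
   ('u \<Rightarrow> 'u \<Rightarrow> 'u) \<Rightarrow> bool" where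
  "bilinear_map R M N P \<beta> \<longleftrightarrow>
     (\<forall>x\<in>carrier M. \<forall>y\<in>carrier N. \<beta> x y \<in> carrier P) \<and>
     (\<forall>x\<in>carrier M. \<forall>x'\<in>carrier M. \<forall>y\<in>carrier N. \<beta> (x \<oplus>\<^bsub>M\<^esub> x') y = \<beta> x y \<oplus>\<^bsub>P\<^esub> \<beta> x' y) \<and>
     (\<forall>x\<in>carrier M. \<forall>y\<in>carrier N. \<forall>y'\<in>carrier N. \<beta> x (y \<oplus>\<^bsub>N\<^esub> y') = \<beta> x y \<oplus>\<^bsub>P\<^esub> \<beta> x y') \<and>
     (\<forall>r\<in>carrier R. \<forall>x\<in>carrier M. \<forall>y\<in>carrier N.
        \<beta> (r \<odot>\<^bsub>M\<^esub> x) y = r \<odot>\<^bsub>P\<^esub> \<beta> x y \<and> \<beta> x (r \<odot>\<^bsub>N\<^esub> y) = r \<odot>\<^bsub>P\<^esub> \<beta> x y)"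

definition is_tensor_product ::
  "'u ring \<Rightarrow> ('u, 'u) module \<Rightarrow> ('u, 'u) module \<Rightarrow>
   ('u, 'u) module \<Rightarrow> ('u \<Rightarrow> 'u \<Rightarrow> 'u) \<Rightarrow> bool" where
  "is_tensor_product R M N T \<tau> \<longleftrightarrow>
     T \<in> small_modules R \<and> bilinear_map R M N T \<tau> \<and>
     (\<forall>P\<in>small_modules R. \<forall>\<beta>. bilinear_map R M N P \<beta> \<longrightarrow>
        (\<exists>!h. h \<in> mod_hom R T P \<and>
           (\<forall>x\<in>carrier M. \<forall>y\<in>carrier N. h (\<tau> x y) = \<beta> x y)))"

text \<open>
  Tensor products of modules exist and are unique up to unique isomorphism; \<open>tens\<close> and \<open>tmul\<close>
  are a fixed choice of the module and of its universal bilinear map.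
\<close>

definition tensor_choice ::
  "'u ring \<Rightarrow> ('u, 'u) module \<Rightarrow> ('u, 'u) module \<Rightarrow> ('u, 'u) module \<times> ('u \<Rightarrow> 'u \<Rightarrow> 'u)" where
  "tensor_choice R M N = (SOME (T, \<tau>). is_tensor_product R M N T \<tau>)"

definition tens :: "'u ring \<Rightarrow> ('u, 'u) module \<Rightarrow> ('u, 'u) module \<Rightarrow> ('u, 'u) module" where
  "tens R M N = fst (tensor_choice R M N)"

definition tmul :: "'u ring \<Rightarrow> ('u, 'u) module \<Rightarrow> ('u, 'u) module \<Rightarrow> 'u \<Rightarrow> 'u \<Rightarrow> 'u" where
  "tmul R M N = snd (tensor_choice R M N)"

definition tens_lift ::
  "'u ring \<Rightarrow> ('u, 'u) module \<Rightarrow> ('u, 'u) module \<Rightarrow> ('u, 'u) module \<Rightarrow>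
   ('u \<Rightarrow> 'u \<Rightarrow> 'u) \<Rightarrow> 'u \<Rightarrow> 'u" where
  "tens_lift R M N P \<beta> =
     (THE h. h \<in> mod_hom R (tens R M N) P \<and>
        (\<forall>x\<in>carrier M. \<forall>y\<in>carrier N. h (tmul R M N x y) = \<beta> x y))"

definition tens_map ::
  "'u ring \<Rightarrow> ('u, 'u) module \<Rightarrow> ('u, 'u) module \<Rightarrow> ('u, 'u) module \<Rightarrow> ('u, 'u) module \<Rightarrow>
   ('u \<Rightarrow> 'u) \<Rightarrow> ('u \<Rightarrow> 'u) \<Rightarrow> 'u \<Rightarrow> 'u" where
  "tens_map R M N M' N' f g =
     tens_lift R M N (tens R M' N') (\<lambda>x y. tmul R M' N' (f x) (g y))"

definition tens_assoc ::
  "'u ring \<Rightarrow> ('u, 'u) module \<Rightarrow> ('u, 'u) module \<Rightarrow> ('u, 'u) module \<Rightarrow> 'u \<Rightarrow> 'u" where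
  "tens_assoc R M N P =
     (THE h. h \<in> mod_hom R (tens R (tens R M N) P) (tens R M (tens R N P)) \<and>
        (\<forall>x\<in>carrier M. \<forall>y\<in>carrier N. \<forall>z\<in>carrier P.
           h (tmul R (tens R M N) P (tmul R M N x y) z) =
           tmul R M (tens R N P) x (tmul R N P y z)))"

definition scalar_module :: "('u \<Rightarrow> 'u) \<Rightarrow> 'u ring \<Rightarrow> ('u, 'u) module" where
  "scalar_module \<phi> S =
     \<lparr>carrier = carrier S, mult = mult S, one = one S, zero = zero S, add = add S,
      smult = (\<lambda>r s. \<phi> r \<otimes>\<^bsub>S\<^esub> s)\<rparr>"

type_synonym 'u mod_arr = "('u, 'u) module \<times> ('u \<Rightarrow> 'u) \<times> ('u, 'u) module"

definition Mod :: "'u ring \<Rightarrow> (('u, 'u) module, 'u mod_arr) smcat" where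
  "Mod R =
     (let I = scalar_module (\<lambda>r. r) R in
      \<lparr>obj = small_modules R,
       arr = {(M, f, N). M \<in> small_modules R \<and> N \<in> small_modules R \<and> f \<in> mod_hom R M N},
       src = (\<lambda>(M, f, N). M),
       tgt = (\<lambda>(M, f, N). N),
       idn = (\<lambda>M. (M, \<lambda>x\<in>carrier M. x, M)),
       cmp = (\<lambda>(N', g, P) (M, f, N). (M, compose (carrier M) g f, P)),
       tobj = tens R,
       tarr = (\<lambda>(M, f, M') (N, g, N'). (tens R M N, tens_map R M N M' N' f g, tens R M' N')),
       tunit = I,
       asc = (\<lambda>M N P. (tens R (tens R M N) P, tens_assoc R M N P, tens R M (tens R N P))),
       lun = (\<lambda>M. (tens R I M, tens_lift R I M M (\<lambda>r x. r \<odot>\<^bsub>M\<^esub> x), M)),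
       run = (\<lambda>M. (tens R M I, tens_lift R M I M (\<lambda>x r. r \<odot>\<^bsub>M\<^esub> x), M)),
       brd = (\<lambda>M N. (tens R M N, tens_lift R M N (tens R N M) (\<lambda>x y. tmul R N M y x),
                     tens R N M))\<rparr>)"


section \<open>Extension of scalars\<close>

text \<open>
  The \<open>S\<close>-module \<open>S \<otimes>\<^sub>R M\<close>, where \<open>S\<close> is an \<open>R\<close>-module via \<open>\<phi>\<close> and a scalar \<open>s\<close> acts as
  \<open>(s \<cdot> -) \<otimes> id\<close>.
\<close>

definition ext_module ::
  "'u ring \<Rightarrow> 'u ring \<Rightarrow> ('u \<Rightarrow> 'u) \<Rightarrow> ('u, 'u) module \<Rightarrow> ('u, 'u) module" where
  "ext_module R S \<phi> M =
     (let S\<phi> = scalar_module \<phi> S in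
      (tens R S\<phi> M)
        \<lparr>smult := (\<lambda>s. tens_map R S\<phi> M S\<phi> M (\<lambda>t\<in>carrier S. s \<otimes>\<^bsub>S\<^esub> t) (\<lambda>x\<in>carrier M. x))\<rparr>)"

definition ext_map ::
  "'u ring \<Rightarrow> 'u ring \<Rightarrow> ('u \<Rightarrow> 'u) \<Rightarrow> 'u mod_arr \<Rightarrow> 'u mod_arr" where
  "ext_map R S \<phi> =
     (\<lambda>(M, f, N).
        (ext_module R S \<phi> M,
         tens_map R (scalar_module \<phi> S) M (scalar_module \<phi> S) N (\<lambda>t\<in>carrier S. t) f,
         ext_module R S \<phi> N))"

text \<open>
  The structure isomorphisms \<open>(s \<otimes> x) \<otimes> (t \<otimes> y) \<mapsto> st \<otimes> (x \<otimes> y)\<close> and \<open>s \<mapsto> s \<otimes> 1\<close> of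
  extension of scalars as a monoidal functor.
\<close>

definition ext_mul ::
  "'u ring \<Rightarrow> 'u ring \<Rightarrow> ('u \<Rightarrow> 'u) \<Rightarrow> ('u, 'u) module \<Rightarrow> ('u, 'u) module \<Rightarrow> 'u mod_arr" where
  "ext_mul R S \<phi> M N =
     (let S\<phi> = scalar_module \<phi> S; E = ext_module R S \<phi> in
      (tens S (E M) (E N),
       (THE h. h \<in> mod_hom S (tens S (E M) (E N)) (E (tens R M N)) \<and>
          (\<forall>s\<in>carrier S. \<forall>t\<in>carrier S. \<forall>x\<in>carrier M. \<forall>y\<in>carrier N.
             h (tmul S (E M) (E N) (tmul R S\<phi> M s x) (tmul R S\<phi> N t y)) =
             tmul R S\<phi> (tens R M N) (s \<otimes>\<^bsub>S\<^esub> t) (tmul R M N x y))),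
       E (tens R M N)))"

definition ext_one :: "'u ring \<Rightarrow> 'u ring \<Rightarrow> ('u \<Rightarrow> 'u) \<Rightarrow> 'u mod_arr" where
  "ext_one R S \<phi> =
     (tunit (Mod S),
      \<lambda>s\<in>carrier S. tmul R (scalar_module \<phi> S) (tunit (Mod R)) s \<one>\<^bsub>R\<^esub>,
      ext_module R S \<phi> (tunit (Mod R)))"

definition ext_scalars ::
  "'u ring \<Rightarrow> 'u ring \<Rightarrow> ('u \<Rightarrow> 'u) \<Rightarrow>
   (('u, 'u) module, 'u mod_arr, ('u, 'u) module, 'u mod_arr) smfctr" where
  "ext_scalars R S \<phi> =
     \<lparr>fobj = ext_module R S \<phi>, farr = ext_map R S \<phi>,
      fmul = ext_mul R S \<phi>, fone = ext_one R S \<phi>\<rparr>"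

text \<open>
  Ring homomorphisms in the library are total functions; extensionality makes two of them equal
  as soon as they agree on the carrier.
\<close>

definition cring_hom :: "'u ring \<Rightarrow> 'u ring \<Rightarrow> ('u \<Rightarrow> 'u) set" where
  "cring_hom R S = ring_hom R S \<inter> extensional (carrier R)"

definition ext_scalars_fctr ::
  "'u ring \<Rightarrow> 'u ring \<Rightarrow>
   ('u \<Rightarrow> 'u, 'u \<Rightarrow> 'u,
    (('u, 'u) module, 'u mod_arr, ('u, 'u) module, 'u mod_arr) smfctr,
    (('u, 'u) module, 'u mod_arr, ('u, 'u) module, 'u mod_arr) smfctr \<times>
      (('u, 'u) module \<Rightarrow> 'u mod_arr) \<times>
      (('u, 'u) module, 'u mod_arr, ('u, 'u) module, 'u mod_arr) smfctr) fctr" where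
  "ext_scalars_fctr R S =
     \<lparr>fobj = ext_scalars R S,
      farr = (\<lambda>\<phi>. idn (com_two_ring_hom TYPE('u) (Mod R) (Mod S)) (ext_scalars R S \<phi>))\<rparr>"

end

theory Submission
  imports Defs
begin


text \<open>
  The unit of \<open>Mod R\<close> is the module \<open>R\<close> itself, and an arrow from it to a module \<open>M\<close> is the same
  thing as an element of \<open>M\<close>.  A cocontinuous monoidal functor \<open>F\<close> from \<open>Mod R\<close> to \<open>Mod S\<close> therefore
  transports elements: its unit constraint singles out an element \<open>u\<close> of \<open>F R\<close>, the image of \<open>1\<close>, and
  an element \<open>x\<close> of \<open>M\<close>, seen as an arrow, carries \<open>u\<close> to an element \<open>F(x)(u)\<close> of \<open>F M\<close>.  Since \<open>u\<close> is
  a basis of \<open>F R\<close>, the elements \<open>r\<close> of \<open>R\<close> give scalars \<open>\<phi> r\<close> with \<open>F(r)(u) = \<phi> r u\<close>.  Functoriality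
  makes \<open>\<phi>\<close> multiplicative, and preservation of finite coproducts makes \<open>F(x)(u)\<close> additive in \<open>x\<close>
  (lemma \<open>gen_add\<close>), so \<open>\<phi>\<close> is a ring homomorphism and \<open>x \<mapsto> F(x)(u)\<close> is linear over it.  By the
  adjunction between extension and restriction of scalars (\<open>ext_lift\<close>) this map extends to an
  \<open>S\<close>-linear comparison \<open>s \<otimes> x \<mapsto> s F(x)(u)\<close> from the extension of scalars of \<open>M\<close> along \<open>\<phi>\<close> to \<open>F M\<close>.
  It is natural, it is monoidal because the unit axiom computes the product of \<open>u\<close> with itself
  (\<open>gen_mul\<close>), and it is invertible at \<open>R\<close>.  Both functors preserve colimits and every module is
  built from \<open>R\<close> by colimits (\<open>unit_generates\<close>), so it is invertible everywhere (\<open>compare_iso\<close>): every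
  \<open>F\<close> is isomorphic to an extension of scalars.
  
  A monoidal transformation fixes the elements \<open>u\<close>, hence is determined on all elements \<open>F(x)(u)\<close>
  (\<open>monoidal_nat_trans_gen\<close>).  For an extension of scalars these are the elements \<open>1 \<otimes> x\<close>, which span.
  So there is at most one transformation out of an extension of scalars, and one between extensions
  along \<open>\<phi>\<close> and \<open>\<psi>\<close> forces \<open>\<phi> = \<psi>\<close>.  This is full faithfulness.
  
  Two constructions underlie everything else.  Tensor products and colimits of modules are both
  obtained from \<open>presented_module\<close>: the module generated by a small set is the free module modulo the
  common kernel of all admissible maps, so that an equation in it may be tested on admissible maps.
  Littleness of \<open>R\<close> needs the element-wise description of directed colimits, whose only delicate part
  is \<open>directed_colimit_kernel\<close>; it is obtained from the product of the diagram modulo the families that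
  eventually vanish.
\<close>

section \<open>Small sets\<close>

lemma small_lepoll: "small U B \<Longrightarrow> A \<lesssim> B \<Longrightarrow> small U A"
  unfolding small_def by (rule lesspoll_trans1)

lemma small_subset: "small U B \<Longrightarrow> A \<subseteq> B \<Longrightarrow> small U A"
  by (blast intro: small_lepoll subset_imp_lepoll)

lemma small_image: "small U A \<Longrightarrow> small U (f ` A)"
  by (blast intro: small_lepoll image_lepoll)

lemma small_inj: "small U B \<Longrightarrow> inj_on f A \<Longrightarrow> f ` A \<subseteq> B \<Longrightarrow> small U A"
  by (erule small_lepoll) (auto simp: lepoll_def)

lemma small_embedding:
  assumes "small TYPE('u) A"
  obtains e :: "'a \<Rightarrow> 'u" where "inj_on e A"
  using assms unfolding small_def lesspoll_def lepoll_def by blast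

lemma small_finite:
  assumes "universe TYPE('u)" and "finite A"
  shows "small TYPE('u) A"
  using assms unfolding universe_def small_def by (metis finite_lesspoll_infinite)

text \<open>
  Regularity is assumed for families of subsets of \<open>'u\<close> indexed by subsets of \<open>'u\<close>.  A family on
  other types is moved there by an injection of \<open>'u \<times> 'u\<close> into \<open>'u\<close>, applied to the index and the
  code of an element.
\<close>

lemma small_UN:
  fixes I :: "'i set" and A :: "'i \<Rightarrow> 'a set"
  assumes U: "universe TYPE('u)" and I: "small TYPE('u) I"
    and A: "\<And>i. i \<in> I \<Longrightarrow> small TYPE('u) (A i)"
  shows "small TYPE('u) (\<Union>i\<in>I. A i)"
proof -
  obtain e :: "'i \<Rightarrow> 'u" where e: "inj_on e I" using small_embedding[OF I] by blast
  have "\<exists>g :: 'a \<Rightarrow> 'u. inj_on g (A i)" if "i \<in> I" for i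
    using small_embedding[OF A[OF that]] by blast
  then obtain g :: "'i \<Rightarrow> 'a \<Rightarrow> 'u" where g: "\<And>i. i \<in> I \<Longrightarrow> inj_on (g i) (A i)" by metis
  have "infinite (UNIV :: 'u set)" using U by (simp add: universe_def)
  then have "(UNIV :: 'u set) \<times> (UNIV :: 'u set) \<approx> (UNIV :: 'u set)"
    unfolding eqpoll_iff_card_of_ordIso by (rule card_of_Times_same_infinite)
  then obtain p :: "'u \<times> 'u \<Rightarrow> 'u" where p: "inj p"
    unfolding eqpoll_def by (metis UNIV_Times_UNIV bij_betw_imp_inj_on)
  define B where "B v = p ` ({v} \<times> g (inv_into I e v) ` A (inv_into I e v))" for v
  have sB: "small TYPE('u) (B v)" if v: "v \<in> e ` I" for v
  proof -
    have "B v = (\<lambda>a. p (v, g (inv_into I e v) a)) ` A (inv_into I e v)"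
      by (auto simp: B_def)
    moreover have "inv_into I e v \<in> I" using v by (rule inv_into_into)
    ultimately show ?thesis using A small_image by metis
  qed
  have "small TYPE('u) (\<Union>v\<in>e ` I. B v)"
    using U sB small_image[OF I] unfolding universe_def by blast
  moreover define c where "c a = (SOME i. i \<in> I \<and> a \<in> A i)" for a
  have c: "c a \<in> I \<and> a \<in> A (c a)" if "a \<in> (\<Union>i\<in>I. A i)" for a
    unfolding c_def using someI_ex[of "\<lambda>i. i \<in> I \<and> a \<in> A i"] that by blast
  have "inj_on (\<lambda>a. p (e (c a), g (c a) a)) (\<Union>i\<in>I. A i)"
  proof (rule inj_onI)
    fix a b assume a: "a \<in> (\<Union>i\<in>I. A i)" and b: "b \<in> (\<Union>i\<in>I. A i)"
      and "p (e (c a), g (c a) a) = p (e (c b), g (c b) b)"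
    then have "e (c a) = e (c b)" "g (c a) a = g (c b) b" using p by (auto dest: injD)
    then have "c a = c b" using e c[OF a] c[OF b] by (auto dest: inj_onD)
    then show "a = b" using \<open>g (c a) a = g (c b) b\<close> g c[OF a] c[OF b] by (metis inj_onD)
  qed
  moreover have "(\<lambda>a. p (e (c a), g (c a) a)) ` (\<Union>i\<in>I. A i) \<subseteq> (\<Union>v\<in>e ` I. B v)"
  proof
    fix y assume "y \<in> (\<lambda>a. p (e (c a), g (c a) a)) ` (\<Union>i\<in>I. A i)"
    then obtain a where a: "a \<in> (\<Union>i\<in>I. A i)" and y: "y = p (e (c a), g (c a) a)" by blast
    have "y \<in> B (e (c a))" unfolding B_def y using c[OF a] e by (simp add: inv_into_f_f)
    then show "y \<in> (\<Union>v\<in>e ` I. B v)" using c[OF a] by blast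
  qed
  ultimately show ?thesis by (rule small_inj)
qed

lemma small_Sigma:
  assumes "universe TYPE('u)" "small TYPE('u) I" "\<And>i. i \<in> I \<Longrightarrow> small TYPE('u) (A i)"
  shows "small TYPE('u) (Sigma I A)"
proof -
  have "Sigma I A = (\<Union>i\<in>I. Pair i ` A i)" by auto
  then show ?thesis using assms by (simp add: small_UN small_image)
qed

lemma small_Pow:
  fixes A :: "'a set"
  assumes U: "universe TYPE('u)" and A: "small TYPE('u) A"
  shows "small TYPE('u) (Pow A)"
proof -
  obtain e :: "'a \<Rightarrow> 'u" where e: "inj_on e A" using small_embedding[OF A] by blast
  have "small TYPE('u) (Pow (e ` A))"
    using U small_image[OF A] unfolding universe_def by blast
  then show ?thesis
    by (rule small_inj[of _ _ "image e"]) (auto intro: inj_on_image_Pow e)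
qed

text \<open>
  A function in the product is determined by its graph, so the strong limit property bounds the
  product without a case distinction on finiteness.
\<close>

lemma small_PiE:
  assumes U: "universe TYPE('u)" and I: "small TYPE('u) I"
    and A: "\<And>i. i \<in> I \<Longrightarrow> small TYPE('u) (A i)"
  shows "small TYPE('u) (Pi\<^sub>E I A)"
proof (rule small_inj)
  show "small TYPE('u) (Pow (Sigma I A))" by (intro small_Pow small_Sigma assms)
  show "inj_on (\<lambda>f. (\<lambda>i. (i, f i)) ` I) (Pi\<^sub>E I A)"
    by (rule inj_onI, rule PiE_ext) auto
qed auto


section \<open>Modules by generators and relations\<close>

text \<open>
  Linearity is stated separately from extensionality and for arbitrary types, because the auxiliary
  modules below (free modules, products) do not live on \<open>'u\<close>.
\<close>

definition linear ::
  "('r, 'z) ring_scheme \<Rightarrow> ('r, 'a) module \<Rightarrow> ('r, 'b) module \<Rightarrow> ('a \<Rightarrow> 'b) \<Rightarrow> bool" where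
  "linear R M N f \<longleftrightarrow> f \<in> carrier M \<rightarrow> carrier N \<and>
     (\<forall>x\<in>carrier M. \<forall>y\<in>carrier M. f (x \<oplus>\<^bsub>M\<^esub> y) = f x \<oplus>\<^bsub>N\<^esub> f y) \<and>
     (\<forall>r\<in>carrier R. \<forall>x\<in>carrier M. f (r \<odot>\<^bsub>M\<^esub> x) = r \<odot>\<^bsub>N\<^esub> f x)"

lemma linearI:
  assumes "\<And>x. x \<in> carrier M \<Longrightarrow> f x \<in> carrier N"
    and "\<And>x y. x \<in> carrier M \<Longrightarrow> y \<in> carrier M \<Longrightarrow> f (x \<oplus>\<^bsub>M\<^esub> y) = f x \<oplus>\<^bsub>N\<^esub> f y"
    and "\<And>r x. r \<in> carrier R \<Longrightarrow> x \<in> carrier M \<Longrightarrow> f (r \<odot>\<^bsub>M\<^esub> x) = r \<odot>\<^bsub>N\<^esub> f x"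
  shows "linear R M N f"
  using assms unfolding linear_def by blast

lemma linear_closed: "linear R M N f \<Longrightarrow> x \<in> carrier M \<Longrightarrow> f x \<in> carrier N"
  and linear_add:
    "linear R M N f \<Longrightarrow> x \<in> carrier M \<Longrightarrow> y \<in> carrier M \<Longrightarrow> f (x \<oplus>\<^bsub>M\<^esub> y) = f x \<oplus>\<^bsub>N\<^esub> f y"
  and linear_smult:
    "linear R M N f \<Longrightarrow> r \<in> carrier R \<Longrightarrow> x \<in> carrier M \<Longrightarrow> f (r \<odot>\<^bsub>M\<^esub> x) = r \<odot>\<^bsub>N\<^esub> f x"
  unfolding linear_def by blast+

lemma linear_zero:
  assumes "linear R M N f" "module R M" "module R N"
  shows "f \<zero>\<^bsub>M\<^esub> = \<zero>\<^bsub>N\<^esub>"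
proof -
  interpret M: module R M by fact
  interpret N: module R N by fact
  have "f \<zero>\<^bsub>M\<^esub> = f (\<zero>\<^bsub>R\<^esub> \<odot>\<^bsub>M\<^esub> \<zero>\<^bsub>M\<^esub>)" by simp
  also have "\<dots> = \<zero>\<^bsub>R\<^esub> \<odot>\<^bsub>N\<^esub> f \<zero>\<^bsub>M\<^esub>" using assms(1) by (rule linear_smult) auto
  also have "\<dots> = \<zero>\<^bsub>N\<^esub>" by (simp add: linear_closed[OF assms(1)])
  finally show ?thesis .
qed

lemma linear_minus:
  assumes f: "linear R M N f" and M: "module R M" and N: "module R N"
    and x: "x \<in> carrier M" and y: "y \<in> carrier M"
  shows "f (x \<ominus>\<^bsub>M\<^esub> y) = f x \<ominus>\<^bsub>N\<^esub> f y"
proof -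
  interpret M: module R M by fact
  interpret N: module R N by fact
  note c = linear_closed[OF f]
  have "f (x \<ominus>\<^bsub>M\<^esub> y) \<oplus>\<^bsub>N\<^esub> f y = f ((x \<ominus>\<^bsub>M\<^esub> y) \<oplus>\<^bsub>M\<^esub> y)"
    using x y by (simp add: linear_add[OF f])
  also have "(x \<ominus>\<^bsub>M\<^esub> y) \<oplus>\<^bsub>M\<^esub> y = x"
    using x y by (simp add: a_minus_def M.a_assoc M.l_neg)
  finally have "f (x \<ominus>\<^bsub>M\<^esub> y) \<oplus>\<^bsub>N\<^esub> f y = f x" .
  then have "f x \<ominus>\<^bsub>N\<^esub> f y = (f (x \<ominus>\<^bsub>M\<^esub> y) \<oplus>\<^bsub>N\<^esub> f y) \<ominus>\<^bsub>N\<^esub> f y" by simp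
  also have "\<dots> = f (x \<ominus>\<^bsub>M\<^esub> y)"
    using x y c by (simp add: a_minus_def N.a_assoc N.r_neg)
  finally show ?thesis by simp
qed

lemma (in abelian_group) eq_iff_diff_zero:
  assumes "x \<in> carrier G" "y \<in> carrier G"
  shows "x = y \<longleftrightarrow> x \<ominus> y = \<zero>"
  using assms by (metis a_minus_def minus_equality minus_minus r_neg a_inv_closed)

lemma linear_comp:
  assumes "linear R M N f" "linear R N P g"
  shows "linear R M P (\<lambda>x. g (f x))"
  using assms unfolding linear_def by (auto simp: Pi_iff)

lemma linear_cong:
  assumes "linear R M N f" "\<And>x. x \<in> carrier M \<Longrightarrow> g x = f x" "module R M"
  shows "linear R M N g"
proof -
  interpret M: module R M by fact
  show ?thesis using assms(1,2) by (auto simp: linear_def Pi_iff)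
qed

lemma mod_hom_iff: "f \<in> mod_hom R M N \<longleftrightarrow> linear R M N f \<and> f \<in> extensional (carrier M)"
  unfolding mod_hom_def linear_def PiE_def by blast

text \<open>
  Additive inverses come for free from \<open>-1\<close>, which leaves only equations to be checked.
\<close>

lemma module_by_equations:
  fixes M :: "('r, 'a) module"
  assumes R: "cring R"
    and add: "\<And>x y. x \<in> carrier M \<Longrightarrow> y \<in> carrier M \<Longrightarrow> x \<oplus>\<^bsub>M\<^esub> y \<in> carrier M"
    and zero: "\<zero>\<^bsub>M\<^esub> \<in> carrier M"
    and assoc: "\<And>x y z. x \<in> carrier M \<Longrightarrow> y \<in> carrier M \<Longrightarrow> z \<in> carrier M \<Longrightarrow>
      (x \<oplus>\<^bsub>M\<^esub> y) \<oplus>\<^bsub>M\<^esub> z = x \<oplus>\<^bsub>M\<^esub> (y \<oplus>\<^bsub>M\<^esub> z)"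
    and comm: "\<And>x y. x \<in> carrier M \<Longrightarrow> y \<in> carrier M \<Longrightarrow> x \<oplus>\<^bsub>M\<^esub> y = y \<oplus>\<^bsub>M\<^esub> x"
    and lzero: "\<And>x. x \<in> carrier M \<Longrightarrow> \<zero>\<^bsub>M\<^esub> \<oplus>\<^bsub>M\<^esub> x = x"
    and smult: "\<And>r x. r \<in> carrier R \<Longrightarrow> x \<in> carrier M \<Longrightarrow> r \<odot>\<^bsub>M\<^esub> x \<in> carrier M"
    and null: "\<And>x. x \<in> carrier M \<Longrightarrow> \<zero>\<^bsub>R\<^esub> \<odot>\<^bsub>M\<^esub> x = \<zero>\<^bsub>M\<^esub>"
    and l: "\<And>a b x. a \<in> carrier R \<Longrightarrow> b \<in> carrier R \<Longrightarrow> x \<in> carrier M \<Longrightarrow>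
      (a \<oplus>\<^bsub>R\<^esub> b) \<odot>\<^bsub>M\<^esub> x = (a \<odot>\<^bsub>M\<^esub> x) \<oplus>\<^bsub>M\<^esub> (b \<odot>\<^bsub>M\<^esub> x)"
    and r: "\<And>a x y. a \<in> carrier R \<Longrightarrow> x \<in> carrier M \<Longrightarrow> y \<in> carrier M \<Longrightarrow>
      a \<odot>\<^bsub>M\<^esub> (x \<oplus>\<^bsub>M\<^esub> y) = (a \<odot>\<^bsub>M\<^esub> x) \<oplus>\<^bsub>M\<^esub> (a \<odot>\<^bsub>M\<^esub> y)"
    and sassoc: "\<And>a b x. a \<in> carrier R \<Longrightarrow> b \<in> carrier R \<Longrightarrow> x \<in> carrier M \<Longrightarrow>
      (a \<otimes>\<^bsub>R\<^esub> b) \<odot>\<^bsub>M\<^esub> x = a \<odot>\<^bsub>M\<^esub> (b \<odot>\<^bsub>M\<^esub> x)"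
    and one: "\<And>x. x \<in> carrier M \<Longrightarrow> \<one>\<^bsub>R\<^esub> \<odot>\<^bsub>M\<^esub> x = x"
  shows "module R M"
proof -
  interpret R: cring R by fact
  have inv: "\<exists>y\<in>carrier M. y \<oplus>\<^bsub>M\<^esub> x = \<zero>\<^bsub>M\<^esub>" if x: "x \<in> carrier M" for x
  proof
    show "(\<ominus>\<^bsub>R\<^esub> \<one>\<^bsub>R\<^esub>) \<odot>\<^bsub>M\<^esub> x \<in> carrier M" using x by (simp add: smult)
    have "(\<ominus>\<^bsub>R\<^esub> \<one>\<^bsub>R\<^esub>) \<odot>\<^bsub>M\<^esub> x \<oplus>\<^bsub>M\<^esub> \<one>\<^bsub>R\<^esub> \<odot>\<^bsub>M\<^esub> x = \<zero>\<^bsub>M\<^esub>"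
      using x by (simp add: l[symmetric] null R.l_neg)
    then show "(\<ominus>\<^bsub>R\<^esub> \<one>\<^bsub>R\<^esub>) \<odot>\<^bsub>M\<^esub> x \<oplus>\<^bsub>M\<^esub> x = \<zero>\<^bsub>M\<^esub>" using x by (simp add: one)
  qed
  have "abelian_group M"
    using add zero assoc comm lzero inv by (intro abelian_groupI) auto
  then show ?thesis using assms by (intro moduleI) auto
qed

text \<open>
  A module structure descends along any map whose fibres form a congruence; the carrier of the
  result is the image of the map, so this both forms quotients and moves modules between types.
\<close>

lemma module_image:
  fixes F :: "('r, 'a) module" and q :: "'a \<Rightarrow> 'b"
  assumes F: "module R F"
    and q_add: "\<And>x x' y y'. \<lbrakk>x \<in> carrier F; x' \<in> carrier F; y \<in> carrier F; y' \<in> carrier F;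
      q x = q x'; q y = q y'\<rbrakk> \<Longrightarrow> q (x \<oplus>\<^bsub>F\<^esub> y) = q (x' \<oplus>\<^bsub>F\<^esub> y')"
    and q_smult: "\<And>r x x'. \<lbrakk>r \<in> carrier R; x \<in> carrier F; x' \<in> carrier F; q x = q x'\<rbrakk> \<Longrightarrow>
      q (r \<odot>\<^bsub>F\<^esub> x) = q (r \<odot>\<^bsub>F\<^esub> x')"
  obtains Q :: "('r, 'b) module" where "module R Q" "carrier Q = q ` carrier F" "linear R F Q q"
    "\<zero>\<^bsub>Q\<^esub> = q \<zero>\<^bsub>F\<^esub>"
proof -
  interpret F: module R F by fact
  let ?p = "inv_into (carrier F) q"
  define Q :: "('r, 'b) module" where "Q = \<lparr>carrier = q ` carrier F, mult = undefined,
    one = undefined, zero = q \<zero>\<^bsub>F\<^esub>, add = (\<lambda>a b. q (?p a \<oplus>\<^bsub>F\<^esub> ?p b)),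
    smult = (\<lambda>r a. q (r \<odot>\<^bsub>F\<^esub> ?p a))\<rparr>"
  have sel: "carrier Q = q ` carrier F" "\<zero>\<^bsub>Q\<^esub> = q \<zero>\<^bsub>F\<^esub>" by (simp_all add: Q_def)
  have p: "?p (q x) \<in> carrier F" "q (?p (q x)) = q x" if "x \<in> carrier F" for x
    using that by (auto intro: inv_into_into f_inv_into_f)
  have add: "q x \<oplus>\<^bsub>Q\<^esub> q y = q (x \<oplus>\<^bsub>F\<^esub> y)" if "x \<in> carrier F" "y \<in> carrier F" for x y
    using that by (auto simp: Q_def p intro!: q_add)
  have smult: "r \<odot>\<^bsub>Q\<^esub> q x = q (r \<odot>\<^bsub>F\<^esub> x)" if "r \<in> carrier R" "x \<in> carrier F" for r x
    using that by (auto simp: Q_def p intro!: q_smult)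
  have "module R Q"
    by (rule module_by_equations)
      (auto simp: sel add smult F.a_ac F.smult_l_distr F.smult_r_distr
         F.smult_assoc1 intro: F.R.cring_axioms)
  moreover have "linear R F Q q" by (rule linearI) (auto simp: sel add smult)
  ultimately show ?thesis using that sel by blast
qed

lemma quotient_module:
  fixes F :: "('u, 'b) module"
  assumes F: "module R F" and small: "small TYPE('u) (carrier F)"
    and N: "N \<subseteq> carrier F" "\<zero>\<^bsub>F\<^esub> \<in> N"
      "\<And>x y. x \<in> N \<Longrightarrow> y \<in> N \<Longrightarrow> x \<oplus>\<^bsub>F\<^esub> y \<in> N"
      "\<And>r x. r \<in> carrier R \<Longrightarrow> x \<in> N \<Longrightarrow> r \<odot>\<^bsub>F\<^esub> x \<in> N"
  obtains Q q where "Q \<in> small_modules R" "linear R F Q q" "q ` carrier F = carrier Q"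
    "\<And>x. x \<in> carrier F \<Longrightarrow> q x = \<zero>\<^bsub>Q\<^esub> \<longleftrightarrow> x \<in> N"
proof -
  interpret F: module R F by fact
  have inv: "\<ominus>\<^bsub>F\<^esub> x \<in> N" if "x \<in> N" for x
  proof -
    have "\<ominus>\<^bsub>F\<^esub> x = (\<ominus>\<^bsub>R\<^esub> \<one>\<^bsub>R\<^esub>) \<odot>\<^bsub>F\<^esub> x" using that N(1) by (auto simp: F.smult_l_minus)
    then show ?thesis using N(4)[OF _ that] by simp
  qed
  define C where "C x = {y \<in> carrier F. x \<ominus>\<^bsub>F\<^esub> y \<in> N}" for x
  have minus: "(x \<ominus>\<^bsub>F\<^esub> y) \<oplus>\<^bsub>F\<^esub> (y \<ominus>\<^bsub>F\<^esub> z) = x \<ominus>\<^bsub>F\<^esub> z"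
    "\<ominus>\<^bsub>F\<^esub> (x \<ominus>\<^bsub>F\<^esub> y) = y \<ominus>\<^bsub>F\<^esub> x"
    if "x \<in> carrier F" "y \<in> carrier F" "z \<in> carrier F" for x y z
    using that by (simp_all add: a_minus_def F.a_assoc F.r_neg1 F.minus_add F.a_comm)
  have C: "C x = C y \<longleftrightarrow> x \<ominus>\<^bsub>F\<^esub> y \<in> N" if x: "x \<in> carrier F" and y: "y \<in> carrier F" for x y
  proof
    assume "C x = C y"
    moreover have "y \<in> C y" using y N(2) by (simp add: C_def a_minus_def F.r_neg)
    ultimately show "x \<ominus>\<^bsub>F\<^esub> y \<in> N" by (auto simp: C_def)
  next
    assume xy: "x \<ominus>\<^bsub>F\<^esub> y \<in> N"
    then have yx: "y \<ominus>\<^bsub>F\<^esub> x \<in> N" using inv minus(2)[OF x y y] by metis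
    show "C x = C y"
      unfolding C_def using N(3)[OF xy] N(3)[OF yx] minus(1) x y by (auto, metis, metis)
  qed
  have "small TYPE('u) (C ` carrier F)" using small by (rule small_image)
  then obtain e :: "'b set \<Rightarrow> 'u" where e: "inj_on e (C ` carrier F)" by (rule small_embedding)
  define q where "q x = e (C x)" for x
  have q: "q x = q y \<longleftrightarrow> x \<ominus>\<^bsub>F\<^esub> y \<in> N" if "x \<in> carrier F" "y \<in> carrier F" for x y
    unfolding q_def C[OF that, symmetric] using that e by (auto dest: inj_onD)
  obtain Q where Q: "module R Q" "carrier Q = q ` carrier F" "linear R F Q q" "\<zero>\<^bsub>Q\<^esub> = q \<zero>\<^bsub>F\<^esub>"
  proof (rule module_image[OF F, of q])
    fix x x' y y' assume c: "x \<in> carrier F" "x' \<in> carrier F" "y \<in> carrier F" "y' \<in> carrier F"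
      and "q x = q x'" "q y = q y'"
    then have "(x \<ominus>\<^bsub>F\<^esub> x') \<oplus>\<^bsub>F\<^esub> (y \<ominus>\<^bsub>F\<^esub> y') \<in> N" using q N(3) by blast
    moreover have "(x \<oplus>\<^bsub>F\<^esub> y) \<ominus>\<^bsub>F\<^esub> (x' \<oplus>\<^bsub>F\<^esub> y') = (x \<ominus>\<^bsub>F\<^esub> x') \<oplus>\<^bsub>F\<^esub> (y \<ominus>\<^bsub>F\<^esub> y')"
      using c by (simp add: a_minus_def F.minus_add F.a_ac)
    ultimately show "q (x \<oplus>\<^bsub>F\<^esub> y) = q (x' \<oplus>\<^bsub>F\<^esub> y')" using c by (simp add: q)
  next
    fix r x x' assume c: "r \<in> carrier R" "x \<in> carrier F" "x' \<in> carrier F" and "q x = q x'"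
    then have "r \<odot>\<^bsub>F\<^esub> (x \<ominus>\<^bsub>F\<^esub> x') \<in> N" using q N(4) by blast
    moreover have "r \<odot>\<^bsub>F\<^esub> (x \<ominus>\<^bsub>F\<^esub> x') = r \<odot>\<^bsub>F\<^esub> x \<ominus>\<^bsub>F\<^esub> r \<odot>\<^bsub>F\<^esub> x'"
      using c by (simp add: a_minus_def F.smult_r_distr F.smult_r_minus)
    ultimately show "q (r \<odot>\<^bsub>F\<^esub> x) = q (r \<odot>\<^bsub>F\<^esub> x')" using c by (simp add: q)
  qed
  show ?thesis
  proof
    show "Q \<in> small_modules R" using Q small by (simp add: small_modules_def small_image)
    show "q x = \<zero>\<^bsub>Q\<^esub> \<longleftrightarrow> x \<in> N" if x: "x \<in> carrier F" for x
      proof -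
      have "\<ominus>\<^bsub>F\<^esub> \<zero>\<^bsub>F\<^esub> = \<zero>\<^bsub>F\<^esub>" using F.r_neg[OF F.zero_closed] by simp
      then have "x \<ominus>\<^bsub>F\<^esub> \<zero>\<^bsub>F\<^esub> = x" using x by (simp add: a_minus_def)
      then show ?thesis using q[OF x F.zero_closed] by (simp add: Q(4))
    qed
  qed (use Q in auto)
qed


definition free_module :: "('r, 'z) ring_scheme \<Rightarrow> 'x set \<Rightarrow> ('r, 'x \<Rightarrow> 'r) module" where
  "free_module R X =
     \<lparr>carrier = {f \<in> X \<rightarrow>\<^sub>E carrier R. finite {x \<in> X. f x \<noteq> \<zero>\<^bsub>R\<^esub>}}, mult = undefined,
      one = undefined, zero = (\<lambda>x\<in>X. \<zero>\<^bsub>R\<^esub>), add = (\<lambda>f g. \<lambda>x\<in>X. f x \<oplus>\<^bsub>R\<^esub> g x),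
      smult = (\<lambda>r f. \<lambda>x\<in>X. r \<otimes>\<^bsub>R\<^esub> f x)\<rparr>"

definition free_basis :: "('r, 'z) ring_scheme \<Rightarrow> 'x set \<Rightarrow> 'x \<Rightarrow> 'x \<Rightarrow> 'r" where
  "free_basis R X x = (\<lambda>y\<in>X. if y = x then \<one>\<^bsub>R\<^esub> else \<zero>\<^bsub>R\<^esub>)"

definition free_lift ::
  "('r, 'z) ring_scheme \<Rightarrow> 'x set \<Rightarrow> ('r, 'b) module \<Rightarrow> ('x \<Rightarrow> 'b) \<Rightarrow> ('x \<Rightarrow> 'r) \<Rightarrow> 'b" where
  "free_lift R X P \<beta> f = (\<Oplus>\<^bsub>P\<^esub>x\<in>{x \<in> X. f x \<noteq> \<zero>\<^bsub>R\<^esub>}. f x \<odot>\<^bsub>P\<^esub> \<beta> x)"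

lemma free_module_module:
  assumes "cring R"
  shows "module R (free_module R X)"
proof -
  interpret R: cring R by fact
  have fin: "finite {x \<in> X. f x \<oplus>\<^bsub>R\<^esub> g x \<noteq> \<zero>\<^bsub>R\<^esub>}"
    if "finite {x \<in> X. f x \<noteq> \<zero>\<^bsub>R\<^esub>}" "finite {x \<in> X. g x \<noteq> \<zero>\<^bsub>R\<^esub>}" for f g
    by (rule finite_subset[OF _ finite_UnI[OF that]]) auto
  have fin2: "finite {x \<in> X. r \<otimes>\<^bsub>R\<^esub> f x \<noteq> \<zero>\<^bsub>R\<^esub>}"
    if "r \<in> carrier R" "finite {x \<in> X. f x \<noteq> \<zero>\<^bsub>R\<^esub>}" for f r
    using that(1) by (auto intro: finite_subset[OF _ that(2)])
  have restr: "{x. (x \<in> X \<longrightarrow> A x) \<and> x \<in> X} = {x \<in> X. A x}" for A :: "'c \<Rightarrow> bool"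
    by auto
  show ?thesis
  proof (rule module_by_equations)
    show "cring R" by fact
  qed (auto simp: free_module_def restr PiE_iff extensional_def fin fin2 R.a_ac
      R.l_distr R.r_distr R.m_assoc fun_eq_iff)
qed


lemma free_lift_superset:
  assumes P: "module R P" and f: "f \<in> carrier (free_module R X)" and \<beta>: "\<beta> \<in> X \<rightarrow> carrier P"
    and A: "finite A" "{x \<in> X. f x \<noteq> \<zero>\<^bsub>R\<^esub>} \<subseteq> A" "A \<subseteq> X"
  shows "free_lift R X P \<beta> f = (\<Oplus>\<^bsub>P\<^esub>x\<in>A. f x \<odot>\<^bsub>P\<^esub> \<beta> x)"
proof -
  interpret P: module R P by fact
  show ?thesis
    unfolding free_lift_def
    by (rule P.add.finprod_mono_neutral_cong_left)
      (use f \<beta> A in \<open>auto simp: free_module_def Pi_iff PiE_iff subset_iff\<close>)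
qed

lemma free_lift_linear:
  assumes P: "module R P" and \<beta>: "\<beta> \<in> X \<rightarrow> carrier P"
  shows "linear R (free_module R X) P (free_lift R X P \<beta>)"
proof -
  interpret P: module R P by fact
  interpret F: module R "free_module R X" by (rule free_module_module) (rule P.R.is_cring)
  have fin: "finite {x \<in> X. f x \<noteq> \<zero>\<^bsub>R\<^esub>}" and c: "\<And>x. x \<in> X \<Longrightarrow> f x \<in> carrier R"
    if "f \<in> carrier (free_module R X)" for f
    using that by (auto simp: free_module_def)
  show ?thesis
  proof (rule linearI)
    fix f assume f: "f \<in> carrier (free_module R X)"
    show "free_lift R X P \<beta> f \<in> carrier P"
      unfolding free_lift_def by (rule P.finsum_closed) (use c[OF f] \<beta> in auto)
    fix g assume g: "g \<in> carrier (free_module R X)"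
    define A where "A = {x \<in> X. f x \<noteq> \<zero>\<^bsub>R\<^esub>} \<union> {x \<in> X. g x \<noteq> \<zero>\<^bsub>R\<^esub>}"
    have A: "finite A" "A \<subseteq> X" using fin[OF f] fin[OF g] by (auto simp: A_def)
    have fg: "(f \<oplus>\<^bsub>free_module R X\<^esub> g) x = f x \<oplus>\<^bsub>R\<^esub> g x" if "x \<in> X" for x
      using that by (simp add: free_module_def)
    have "free_lift R X P \<beta> (f \<oplus>\<^bsub>free_module R X\<^esub> g) =
        (\<Oplus>\<^bsub>P\<^esub>x\<in>A. (f \<oplus>\<^bsub>free_module R X\<^esub> g) x \<odot>\<^bsub>P\<^esub> \<beta> x)"
      by (rule free_lift_superset[OF P _ \<beta> A(1) _ A(2)]) (use f g fg in \<open>auto simp: A_def\<close>)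
    also have "\<dots> = (\<Oplus>\<^bsub>P\<^esub>x\<in>A. f x \<odot>\<^bsub>P\<^esub> \<beta> x \<oplus>\<^bsub>P\<^esub> g x \<odot>\<^bsub>P\<^esub> \<beta> x)"
      by (rule P.finsum_cong')
        (use A fg c[OF f] c[OF g] \<beta> in \<open>auto simp: subset_iff Pi_iff P.smult_l_distr\<close>)
    also have "\<dots> = (\<Oplus>\<^bsub>P\<^esub>x\<in>A. f x \<odot>\<^bsub>P\<^esub> \<beta> x) \<oplus>\<^bsub>P\<^esub> (\<Oplus>\<^bsub>P\<^esub>x\<in>A. g x \<odot>\<^bsub>P\<^esub> \<beta> x)"
      by (rule P.finsum_addf) (use A c[OF f] c[OF g] \<beta> in \<open>auto simp: subset_iff Pi_iff\<close>)
    also have "(\<Oplus>\<^bsub>P\<^esub>x\<in>A. f x \<odot>\<^bsub>P\<^esub> \<beta> x) = free_lift R X P \<beta> f"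
      by (rule free_lift_superset[OF P f \<beta> A(1) _ A(2), symmetric]) (auto simp: A_def)
    also have "(\<Oplus>\<^bsub>P\<^esub>x\<in>A. g x \<odot>\<^bsub>P\<^esub> \<beta> x) = free_lift R X P \<beta> g"
      by (rule free_lift_superset[OF P g \<beta> A(1) _ A(2), symmetric]) (auto simp: A_def)
    finally show "free_lift R X P \<beta> (f \<oplus>\<^bsub>free_module R X\<^esub> g) =
      free_lift R X P \<beta> f \<oplus>\<^bsub>P\<^esub> free_lift R X P \<beta> g" .
  next
    fix r f assume r: "r \<in> carrier R" and f: "f \<in> carrier (free_module R X)"
    define A where "A = {x \<in> X. f x \<noteq> \<zero>\<^bsub>R\<^esub>}"
    have A: "finite A" "A \<subseteq> X" using fin[OF f] by (auto simp: A_def)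
    have rf: "(r \<odot>\<^bsub>free_module R X\<^esub> f) x = r \<otimes>\<^bsub>R\<^esub> f x" if "x \<in> X" for x
      using that by (simp add: free_module_def)
    have "free_lift R X P \<beta> (r \<odot>\<^bsub>free_module R X\<^esub> f) =
        (\<Oplus>\<^bsub>P\<^esub>x\<in>A. (r \<odot>\<^bsub>free_module R X\<^esub> f) x \<odot>\<^bsub>P\<^esub> \<beta> x)"
      by (rule free_lift_superset[OF P _ \<beta> A(1) _ A(2)]) (use r f rf in \<open>auto simp: A_def\<close>)
    also have "\<dots> = (\<Oplus>\<^bsub>P\<^esub>x\<in>A. r \<odot>\<^bsub>P\<^esub> (f x \<odot>\<^bsub>P\<^esub> \<beta> x))"
      by (rule P.finsum_cong')
        (use A rf r c[OF f] \<beta> in \<open>auto simp: subset_iff Pi_iff P.smult_assoc1\<close>)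
    also have "\<dots> = r \<odot>\<^bsub>P\<^esub> (\<Oplus>\<^bsub>P\<^esub>x\<in>A. f x \<odot>\<^bsub>P\<^esub> \<beta> x)"
      by (rule P.finsum_smult_ldistr[symmetric])
        (use A r c[OF f] \<beta> in \<open>auto simp: subset_iff Pi_iff\<close>)
    finally show "free_lift R X P \<beta> (r \<odot>\<^bsub>free_module R X\<^esub> f) = r \<odot>\<^bsub>P\<^esub> free_lift R X P \<beta> f"
      by (simp add: free_lift_def A_def)
  qed
qed

lemma free_basis_carrier:
  assumes "cring R" "x \<in> X"
  shows "free_basis R X x \<in> carrier (free_module R X)"
proof -
  interpret R: cring R by fact
  have "{y \<in> X. free_basis R X x y \<noteq> \<zero>\<^bsub>R\<^esub>} \<subseteq> {x}" by (auto simp: free_basis_def)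
  then have "finite {y \<in> X. free_basis R X x y \<noteq> \<zero>\<^bsub>R\<^esub>}" by (rule finite_subset) simp
  then show ?thesis by (auto simp: free_module_def free_basis_def)
qed

lemma free_lift_basis:
  assumes P: "module R P" and \<beta>: "\<beta> \<in> X \<rightarrow> carrier P" and x: "x \<in> X"
  shows "free_lift R X P \<beta> (free_basis R X x) = \<beta> x"
proof -
  interpret P: module R P by fact
  have b: "\<beta> x \<in> carrier P" using \<beta> x by auto
  have "free_lift R X P \<beta> (free_basis R X x) = (\<Oplus>\<^bsub>P\<^esub>y\<in>{x}. free_basis R X x y \<odot>\<^bsub>P\<^esub> \<beta> y)"
    by (rule free_lift_superset[OF P free_basis_carrier[OF P.R.is_cring x] \<beta>])
      (use x in \<open>auto simp: free_basis_def\<close>)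
  also have "\<dots> = \<one>\<^bsub>R\<^esub> \<odot>\<^bsub>P\<^esub> \<beta> x" using x b by (simp add: free_basis_def)
  finally show ?thesis using b by simp
qed

lemma free_module_induct:
  assumes R: "cring R"
    and H: "\<And>x. x \<in> X \<Longrightarrow> free_basis R X x \<in> H" "\<zero>\<^bsub>free_module R X\<^esub> \<in> H"
      "\<And>f g. f \<in> H \<Longrightarrow> g \<in> H \<Longrightarrow> f \<oplus>\<^bsub>free_module R X\<^esub> g \<in> H"
      "\<And>r f. r \<in> carrier R \<Longrightarrow> f \<in> H \<Longrightarrow> r \<odot>\<^bsub>free_module R X\<^esub> f \<in> H"
    and f: "f \<in> carrier (free_module R X)"
  shows "f \<in> H"
proof -
  interpret R: cring R by fact
  have "f \<in> H" if "finite A" "f \<in> X \<rightarrow>\<^sub>E carrier R" "{x \<in> X. f x \<noteq> \<zero>\<^bsub>R\<^esub>} \<subseteq> A" for A f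
    using that
  proof (induction A arbitrary: f)
    case empty
    then have "f = \<zero>\<^bsub>free_module R X\<^esub>"
      by (intro extensionalityI[of _ X]) (auto simp: free_module_def PiE_iff)
    then show ?case using H(2) by simp
  next
    case (insert a A)
    show ?case
    proof (cases "a \<in> X")
      case False
      then have "{x \<in> X. f x \<noteq> \<zero>\<^bsub>R\<^esub>} \<subseteq> A" using insert.prems(2) by auto
      then show ?thesis using insert by blast
    next
      case True
      define g where "g = f(a := \<zero>\<^bsub>R\<^esub>)"
      have "g \<in> H"
        by (rule insert.IH) (use insert.prems True in \<open>auto simp: g_def PiE_iff extensional_def\<close>)
      moreover have "f = g \<oplus>\<^bsub>free_module R X\<^esub> (f a \<odot>\<^bsub>free_module R X\<^esub> free_basis R X a)"
      proof
        fix x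
        show "f x = (g \<oplus>\<^bsub>free_module R X\<^esub> (f a \<odot>\<^bsub>free_module R X\<^esub> free_basis R X a)) x"
          using insert.prems(1) True
          by (auto simp: g_def free_module_def free_basis_def PiE_iff extensional_def)
      qed
      moreover have "f a \<in> carrier R" using True insert.prems by auto
      ultimately show ?thesis using H True by metis
    qed
  qed
  then show ?thesis using f by (auto simp: free_module_def)
qed

locale small_cring =
  fixes R :: "'u ring"
  assumes universe: "universe TYPE('u)" and cring: "cring R"
    and small_carrier: "small TYPE('u) (carrier R)"

lemma small_modulesD: "M \<in> small_modules R \<Longrightarrow> module R M"
  and small_modules_small: "M \<in> small_modules (R :: 'u ring) \<Longrightarrow> small TYPE('u) (carrier M)"
  by (simp_all add: small_modules_def)

text \<open>
  Spanning is expressed as an induction principle, which avoids linear combinations.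
\<close>

definition spans :: "('r, 'z) ring_scheme \<Rightarrow> ('r, 'a) module \<Rightarrow> 'a set \<Rightarrow> bool" where
  "spans R M B \<longleftrightarrow> (\<forall>H. B \<subseteq> H \<longrightarrow> \<zero>\<^bsub>M\<^esub> \<in> H \<longrightarrow>
     (\<forall>a\<in>H \<inter> carrier M. \<forall>b\<in>H \<inter> carrier M. a \<oplus>\<^bsub>M\<^esub> b \<in> H) \<longrightarrow>
     (\<forall>r\<in>carrier R. \<forall>a\<in>H \<inter> carrier M. r \<odot>\<^bsub>M\<^esub> a \<in> H) \<longrightarrow> carrier M \<subseteq> H)"

lemma spansD:
  assumes "spans R M B" "\<And>b. b \<in> B \<Longrightarrow> b \<in> H" "\<zero>\<^bsub>M\<^esub> \<in> H"
    and "\<And>a b. \<lbrakk>a \<in> H; b \<in> H; a \<in> carrier M; b \<in> carrier M\<rbrakk> \<Longrightarrow> a \<oplus>\<^bsub>M\<^esub> b \<in> H"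
    and "\<And>r a. \<lbrakk>r \<in> carrier R; a \<in> H; a \<in> carrier M\<rbrakk> \<Longrightarrow> r \<odot>\<^bsub>M\<^esub> a \<in> H"
    and "x \<in> carrier M"
  shows "x \<in> H"
proof -
  have "B \<subseteq> H \<longrightarrow> \<zero>\<^bsub>M\<^esub> \<in> H \<longrightarrow> (\<forall>a\<in>H \<inter> carrier M. \<forall>b\<in>H \<inter> carrier M. a \<oplus>\<^bsub>M\<^esub> b \<in> H) \<longrightarrow>
     (\<forall>r\<in>carrier R. \<forall>a\<in>H \<inter> carrier M. r \<odot>\<^bsub>M\<^esub> a \<in> H) \<longrightarrow> carrier M \<subseteq> H"
    using assms(1) unfolding spans_def by (rule spec)
  then show ?thesis using assms(2-) by blast
qed

lemma linear_agree:
  assumes M: "module R M" and N: "module R N" and f: "linear R M N f" and g: "linear R M N g"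
    and span: "spans R M B" and eq: "\<And>b. b \<in> B \<Longrightarrow> f b = g b" and a: "a \<in> carrier M"
  shows "f a = g a"
proof -
  have "a \<in> {a. f a = g a}"
  proof (rule spansD[OF span _ _ _ _ a])
    show "b \<in> {a. f a = g a}" if "b \<in> B" for b using eq[OF that] by simp
    show "\<zero>\<^bsub>M\<^esub> \<in> {a. f a = g a}" using linear_zero[OF f M N] linear_zero[OF g M N] by simp
    show "a \<oplus>\<^bsub>M\<^esub> b \<in> {a. f a = g a}"
      if "a \<in> {a. f a = g a}" "b \<in> {a. f a = g a}" "a \<in> carrier M" "b \<in> carrier M" for a b
      using that linear_add[OF f that(3,4)] linear_add[OF g that(3,4)] by simp
    show "r \<odot>\<^bsub>M\<^esub> a \<in> {a. f a = g a}"
      if "r \<in> carrier R" "a \<in> {a. f a = g a}" "a \<in> carrier M" for r a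
      using that linear_smult[OF f that(1,3)] linear_smult[OF g that(1,3)] by simp
  qed
  then show ?thesis by simp
qed

text \<open>
  The module generated by \<open>X\<close> subject to the relations that hold for every \<open>\<Phi>\<close>-admissible map
  from \<open>X\<close> to a module is the quotient of the free module by the intersection of the kernels of
  all these maps.  An equation between its elements therefore holds as soon as every admissible
  map respects it; this is how relations among the generators are verified later on.
\<close>

lemma (in small_cring) presented_module:
  fixes X :: "'x set" and \<Phi> :: "('u, 'u) module \<Rightarrow> ('x \<Rightarrow> 'u) \<Rightarrow> bool"
  assumes X: "small TYPE('u) X"
  obtains Q \<gamma> where "Q \<in> small_modules R" "\<gamma> \<in> X \<rightarrow> carrier Q"
    "spans R Q (\<gamma> ` X)"
    "\<And>P \<beta>. \<lbrakk>P \<in> small_modules R; \<beta> \<in> X \<rightarrow> carrier P; \<Phi> P \<beta>\<rbrakk> \<Longrightarrow>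
      \<exists>h. linear R Q P h \<and> (\<forall>x\<in>X. h (\<gamma> x) = \<beta> x)"
    "\<And>a b. \<lbrakk>a \<in> carrier Q; b \<in> carrier Q; \<And>P \<beta> h. \<lbrakk>P \<in> small_modules R; \<beta> \<in> X \<rightarrow> carrier P; \<Phi> P \<beta>;
      linear R Q P h; \<And>x. x \<in> X \<Longrightarrow> h (\<gamma> x) = \<beta> x\<rbrakk> \<Longrightarrow> h a = h b\<rbrakk> \<Longrightarrow> a = b"
proof -
  define F where "F = free_module R X"
  interpret F: module R F unfolding F_def by (rule free_module_module) (rule cring)
  have sF: "small TYPE('u) (carrier F)"
    by (rule small_subset[OF small_PiE[OF universe X small_carrier]]) (auto simp: F_def free_module_def)
  define adm where
    "adm P \<beta> \<longleftrightarrow> P \<in> small_modules R \<and> \<beta> \<in> X \<rightarrow> carrier P \<and> \<Phi> P \<beta>" for P \<beta>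
  define l :: "('u, 'u) module \<Rightarrow> ('x \<Rightarrow> 'u) \<Rightarrow> ('x \<Rightarrow> 'u) \<Rightarrow> 'u" where "l = free_lift R X"
  define N where "N = {f \<in> carrier F. \<forall>P \<beta>. adm P \<beta> \<longrightarrow> l P \<beta> f = \<zero>\<^bsub>P\<^esub>}"
  have mP: "module R P" if "adm P \<beta>" for P \<beta> using that by (simp add: adm_def small_modulesD)
  have lin: "linear R F P (l P \<beta>)" if "adm P \<beta>" for P \<beta>
    unfolding F_def l_def using that by (intro free_lift_linear) (auto simp: adm_def small_modulesD)
  have N: "N \<subseteq> carrier F" "\<zero>\<^bsub>F\<^esub> \<in> N" by (auto simp: N_def linear_zero[OF lin F.module_axioms mP])
  have N_add: "x \<oplus>\<^bsub>F\<^esub> y \<in> N" if "x \<in> N" "y \<in> N" for x y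
    using that abelian_monoid.l_zero[OF abelian_group.axioms(1)[OF module.axioms(2)[OF mP]]]
      abelian_monoid.zero_closed[OF abelian_group.axioms(1)[OF module.axioms(2)[OF mP]]]
    by (auto simp: N_def linear_add[OF lin])
  have N_smult: "r \<odot>\<^bsub>F\<^esub> x \<in> N" if "r \<in> carrier R" "x \<in> N" for r x
    using that module.smult_r_null[OF mP] by (auto simp: N_def linear_smult[OF lin])
  obtain Q q where Q: "Q \<in> small_modules R" "linear R F Q q" "q ` carrier F = carrier Q"
    "\<And>x. x \<in> carrier F \<Longrightarrow> q x = \<zero>\<^bsub>Q\<^esub> \<longleftrightarrow> x \<in> N"
    using quotient_module[OF F.module_axioms sF N N_add N_smult] by blast
  interpret Q: module R Q using Q(1) by (rule small_modulesD)
  define \<gamma> where "\<gamma> x = q (free_basis R X x)" for x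
  have basis: "free_basis R X x \<in> carrier F" if "x \<in> X" for x
    using free_basis_carrier[OF cring that] by (simp add: F_def)
  have factor: "\<exists>h. linear R Q P h \<and> (\<forall>f\<in>carrier F. h (q f) = l P \<beta> f)" if adm: "adm P \<beta>" for P \<beta>
  proof -
    interpret P: module R P using adm by (rule mP)
    note L = lin[OF adm]
    have ker: "l P \<beta> f = l P \<beta> g" if f: "f \<in> carrier F" and g: "g \<in> carrier F" and "q f = q g" for f g
    proof -
      have "q f \<ominus>\<^bsub>Q\<^esub> q g = \<zero>\<^bsub>Q\<^esub>"
        using that linear_closed[OF Q(2)] by (simp add: Q.eq_iff_diff_zero[symmetric])
      then have "q (f \<ominus>\<^bsub>F\<^esub> g) = \<zero>\<^bsub>Q\<^esub>"
        by (simp add: linear_minus[OF Q(2) F.module_axioms Q.module_axioms f g])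
      then have "l P \<beta> (f \<ominus>\<^bsub>F\<^esub> g) = \<zero>\<^bsub>P\<^esub>" using Q(4) f g adm by (simp add: N_def)
      then have "l P \<beta> f \<ominus>\<^bsub>P\<^esub> l P \<beta> g = \<zero>\<^bsub>P\<^esub>"
        by (simp add: linear_minus[OF L F.module_axioms P.module_axioms f g])
      then show ?thesis using linear_closed[OF L] f g by (simp add: P.eq_iff_diff_zero[symmetric])
    qed
    let ?p = "inv_into (carrier F) q"
    have p: "?p a \<in> carrier F" "q (?p a) = a" if "a \<in> carrier Q" for a
      using that inv_into_into[of a q "carrier F"] f_inv_into_f[of a q "carrier F"] by (simp_all add: Q(3))
    have h: "l P \<beta> (?p (q f)) = l P \<beta> f" if "f \<in> carrier F" for f
      using that p linear_closed[OF Q(2)] by (intro ker) auto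
    have "linear R Q P (\<lambda>a. l P \<beta> (?p a))"
    proof (rule linearI)
      fix a assume a: "a \<in> carrier Q"
      show "l P \<beta> (?p a) \<in> carrier P" using linear_closed[OF L] p a by simp
      fix b assume b: "b \<in> carrier Q"
      have "a \<oplus>\<^bsub>Q\<^esub> b = q (?p a \<oplus>\<^bsub>F\<^esub> ?p b)" using a b p by (simp add: linear_add[OF Q(2)])
      then show "l P \<beta> (?p (a \<oplus>\<^bsub>Q\<^esub> b)) = l P \<beta> (?p a) \<oplus>\<^bsub>P\<^esub> l P \<beta> (?p b)"
        using a b p by (simp add: h linear_add[OF L])
    next
      fix r a assume r: "r \<in> carrier R" and a: "a \<in> carrier Q"
      have "r \<odot>\<^bsub>Q\<^esub> a = q (r \<odot>\<^bsub>F\<^esub> ?p a)" using r a p by (simp add: linear_smult[OF Q(2)])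
      then show "l P \<beta> (?p (r \<odot>\<^bsub>Q\<^esub> a)) = r \<odot>\<^bsub>P\<^esub> l P \<beta> (?p a)"
        using r a p by (simp add: h linear_smult[OF L])
    qed
    then show ?thesis using h by blast
  qed
  have univ: "\<exists>h. linear R Q P h \<and> (\<forall>f\<in>carrier F. h (q f) = l P \<beta> f) \<and> (\<forall>x\<in>X. h (\<gamma> x) = \<beta> x)"
    if adm: "adm P \<beta>" for P \<beta>
    using factor[OF adm] basis free_lift_basis[OF mP[OF adm], of \<beta> X] adm
    by (auto simp: \<gamma>_def l_def adm_def)
  show ?thesis
  proof
    show "Q \<in> small_modules R" by fact
    show "\<gamma> \<in> X \<rightarrow> carrier Q" using basis linear_closed[OF Q(2)] by (auto simp: \<gamma>_def)
    show "\<exists>h. linear R Q P h \<and> (\<forall>x\<in>X. h (\<gamma> x) = \<beta> x)"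
      if "P \<in> small_modules R" "\<beta> \<in> X \<rightarrow> carrier P" "\<Phi> P \<beta>" for P \<beta>
      using univ[of P \<beta>] that by (auto simp: adm_def)
  next
    have "carrier Q \<subseteq> H" if H: "\<gamma> ` X \<subseteq> H" "\<zero>\<^bsub>Q\<^esub> \<in> H"
      "\<And>a b. \<lbrakk>a \<in> H; b \<in> H; a \<in> carrier Q; b \<in> carrier Q\<rbrakk> \<Longrightarrow> a \<oplus>\<^bsub>Q\<^esub> b \<in> H"
      "\<And>r a. \<lbrakk>r \<in> carrier R; a \<in> H; a \<in> carrier Q\<rbrakk> \<Longrightarrow> r \<odot>\<^bsub>Q\<^esub> a \<in> H" for H
    proof -
    define H' where "H' = {f \<in> carrier F. q f \<in> H}"
    have "f \<in> H'" if f: "f \<in> carrier F" for f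
    proof (rule free_module_induct[OF cring])
      show "free_basis R X x \<in> H'" if "x \<in> X" for x
        using basis[OF that] H(1) that by (auto simp: \<gamma>_def H'_def)
      show "\<zero>\<^bsub>free_module R X\<^esub> \<in> H'"
        unfolding F_def[symmetric] H'_def
        using H(2) linear_zero[OF Q(2) F.module_axioms Q.module_axioms] by simp
      show "f \<oplus>\<^bsub>free_module R X\<^esub> g \<in> H'" if "f \<in> H'" "g \<in> H'" for f g
      proof -
        from that have c: "f \<in> carrier F" "g \<in> carrier F" and "q f \<in> H" "q g \<in> H"
          by (auto simp: H'_def)
        then have "q f \<oplus>\<^bsub>Q\<^esub> q g \<in> H" by (intro H(3) linear_closed[OF Q(2)])
        then show ?thesis
          unfolding F_def[symmetric] H'_def using c linear_add[OF Q(2) c] by simp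
      qed
      show "r \<odot>\<^bsub>free_module R X\<^esub> f \<in> H'" if r: "r \<in> carrier R" and "f \<in> H'" for r f
      proof -
        from that have c: "f \<in> carrier F" and "q f \<in> H" by (auto simp: H'_def)
        then have "r \<odot>\<^bsub>Q\<^esub> q f \<in> H" using r by (intro H(4) linear_closed[OF Q(2)])
        then show ?thesis
          unfolding F_def[symmetric] H'_def using c r linear_smult[OF Q(2) r c] by simp
      qed
      show "f \<in> carrier (free_module R X)" using f by (simp add: F_def)
    qed
    then have "carrier F \<subseteq> H'" by blast
    then have "q ` carrier F \<subseteq> H" by (auto simp: H'_def)
    then show ?thesis by (simp add: Q(3))
    qed
    then show "spans R Q (\<gamma> ` X)" by (simp add: spans_def)
  next
    fix a b assume ab: "a \<in> carrier Q" "b \<in> carrier Q"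
      and sep: "\<And>P \<beta> h. \<lbrakk>P \<in> small_modules R; \<beta> \<in> X \<rightarrow> carrier P; \<Phi> P \<beta>;
        linear R Q P h; \<And>x. x \<in> X \<Longrightarrow> h (\<gamma> x) = \<beta> x\<rbrakk> \<Longrightarrow> h a = h b"
    have "a \<ominus>\<^bsub>Q\<^esub> b \<in> q ` carrier F" using ab by (simp add: Q(3))
    then obtain f where f: "f \<in> carrier F" "q f = a \<ominus>\<^bsub>Q\<^esub> b" by (metis imageE)
    have "l P \<beta> f = \<zero>\<^bsub>P\<^esub>" if adm: "adm P \<beta>" for P \<beta>
    proof -
      interpret P: module R P using adm by (rule mP)
      obtain h where h: "linear R Q P h" "\<And>f. f \<in> carrier F \<Longrightarrow> h (q f) = l P \<beta> f"
        "\<And>x. x \<in> X \<Longrightarrow> h (\<gamma> x) = \<beta> x" using univ[OF adm] by blast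
      have "h a = h b" using sep[of P \<beta> h] h adm by (simp add: adm_def)
      then have "h (a \<ominus>\<^bsub>Q\<^esub> b) = \<zero>\<^bsub>P\<^esub>"
        using linear_closed[OF h(1)] ab
        by (simp add: linear_minus[OF h(1) Q.module_axioms P.module_axioms ab] P.eq_iff_diff_zero[symmetric])
      then show ?thesis using h(2)[OF f(1)] f(2) by simp
    qed
    then have "q f = \<zero>\<^bsub>Q\<^esub>" using Q(4)[OF f(1)] f(1) by (simp add: N_def)
    then show "a = b" using Q.eq_iff_diff_zero ab f(2) by simp
  qed
qed


section \<open>Tensor products\<close>

lemma bilinear_mapI:
  assumes "\<And>x y. x \<in> carrier M \<Longrightarrow> y \<in> carrier N \<Longrightarrow> \<beta> x y \<in> carrier P"
    and "\<And>x x' y. x \<in> carrier M \<Longrightarrow> x' \<in> carrier M \<Longrightarrow> y \<in> carrier N \<Longrightarrow>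
      \<beta> (x \<oplus>\<^bsub>M\<^esub> x') y = \<beta> x y \<oplus>\<^bsub>P\<^esub> \<beta> x' y"
    and "\<And>x y y'. x \<in> carrier M \<Longrightarrow> y \<in> carrier N \<Longrightarrow> y' \<in> carrier N \<Longrightarrow>
      \<beta> x (y \<oplus>\<^bsub>N\<^esub> y') = \<beta> x y \<oplus>\<^bsub>P\<^esub> \<beta> x y'"
    and "\<And>r x y. r \<in> carrier R \<Longrightarrow> x \<in> carrier M \<Longrightarrow> y \<in> carrier N \<Longrightarrow> \<beta> (r \<odot>\<^bsub>M\<^esub> x) y = r \<odot>\<^bsub>P\<^esub> \<beta> x y"
    and "\<And>r x y. r \<in> carrier R \<Longrightarrow> x \<in> carrier M \<Longrightarrow> y \<in> carrier N \<Longrightarrow> \<beta> x (r \<odot>\<^bsub>N\<^esub> y) = r \<odot>\<^bsub>P\<^esub> \<beta> x y"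
  shows "bilinear_map R M N P \<beta>"
  using assms unfolding bilinear_map_def by blast

lemma bilinear_map_linear:
  assumes "bilinear_map R M N P \<beta>"
  shows "x \<in> carrier M \<Longrightarrow> linear R N P (\<lambda>y. \<beta> x y)"
    and "y \<in> carrier N \<Longrightarrow> linear R M P (\<lambda>x. \<beta> x y)"
  using assms unfolding bilinear_map_def by (auto intro!: linearI)

lemma bilinear_map_flip: "bilinear_map R M N P \<beta> \<Longrightarrow> bilinear_map R N M P (\<lambda>y x. \<beta> x y)"
  unfolding bilinear_map_def by blast

lemma linear_sum:
  assumes P: "module R P" and f: "linear R M P f" and g: "linear R M P g"
  shows "linear R M P (\<lambda>x. f x \<oplus>\<^bsub>P\<^esub> g x)"
proof -
  interpret P: module R P by fact
  show ?thesis
    by (rule linearI) (simp_all add: linear_closed[OF f] linear_closed[OF g] linear_add[OF f]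
        linear_add[OF g] linear_smult[OF f] linear_smult[OF g] P.a_ac P.smult_r_distr)
qed

lemma linear_scale:
  assumes P: "module R P" and f: "linear R M P f" and r: "r \<in> carrier R"
  shows "linear R M P (\<lambda>x. r \<odot>\<^bsub>P\<^esub> f x)"
proof -
  interpret P: module R P by fact
  show ?thesis
    by (rule linearI) (simp_all add: r linear_closed[OF f] linear_add[OF f] linear_smult[OF f]
        P.smult_r_distr P.smult_assoc1[symmetric] P.R.m_comm)
qed

lemma mod_hom_linear: "f \<in> mod_hom R M N \<Longrightarrow> linear R M N f"
  by (simp add: mod_hom_iff)

lemma mod_hom_closed: "f \<in> mod_hom R M N \<Longrightarrow> x \<in> carrier M \<Longrightarrow> f x \<in> carrier N"
  by (erule linear_closed[OF mod_hom_linear])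

lemma restrict_mod_hom:
  assumes "linear R M N f" "module R M"
  shows "restrict f (carrier M) \<in> mod_hom R M N"
  by (simp add: mod_hom_iff linear_cong[OF assms(1) _ assms(2)])

lemma mod_hom_eqI:
  assumes "f \<in> mod_hom R M N" "g \<in> mod_hom R M N" "\<And>x. x \<in> carrier M \<Longrightarrow> f x = g x"
  shows "f = g"
  using assms by (intro extensionalityI[of f "carrier M" g]) (auto simp: mod_hom_iff)

lemma mod_hom_compose:
  assumes "f \<in> mod_hom R M N" "g \<in> mod_hom R N P" "module R M"
  shows "compose (carrier M) g f \<in> mod_hom R M P"
  using restrict_mod_hom[OF linear_comp[OF mod_hom_linear mod_hom_linear]] assms
  by (simp add: compose_def)

lemma id_mod_hom:
  assumes "module R M"
  shows "(\<lambda>x\<in>carrier M. x) \<in> mod_hom R M M"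
  using assms by (intro restrict_mod_hom linearI) auto

lemma is_tensor_product_lift:
  assumes "is_tensor_product R M N T \<tau>" "P \<in> small_modules R" "bilinear_map R M N P \<beta>"
  shows "\<exists>!h. h \<in> mod_hom R T P \<and> (\<forall>x\<in>carrier M. \<forall>y\<in>carrier N. h (\<tau> x y) = \<beta> x y)"
  using assms unfolding is_tensor_product_def by blast

context small_cring
begin

lemma tensor_product_exists:
  assumes M: "M \<in> small_modules R" and N: "N \<in> small_modules R"
  shows "\<exists>T \<tau>. is_tensor_product R M N T \<tau>"
proof -
  interpret M: module R M using M by (rule small_modulesD)
  interpret N: module R N using N by (rule small_modulesD)
  let ?X = "carrier M \<times> carrier N"
  have X: "small TYPE('u) ?X"
    using M N by (intro small_Sigma universe small_modules_small)
  obtain Q \<gamma> where Q: "Q \<in> small_modules R" and \<gamma>: "\<gamma> \<in> ?X \<rightarrow> carrier Q"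
    and span: "spans R Q (\<gamma> ` ?X)"
    and lift: "\<And>P \<beta>. \<lbrakk>P \<in> small_modules R; \<beta> \<in> ?X \<rightarrow> carrier P;
        bilinear_map R M N P (\<lambda>x y. \<beta> (x, y))\<rbrakk> \<Longrightarrow>
      \<exists>h. linear R Q P h \<and> (\<forall>x\<in>?X. h (\<gamma> x) = \<beta> x)"
    and sep: "\<And>a b. \<lbrakk>a \<in> carrier Q; b \<in> carrier Q; \<And>P \<beta> h. \<lbrakk>P \<in> small_modules R;
        \<beta> \<in> ?X \<rightarrow> carrier P; bilinear_map R M N P (\<lambda>x y. \<beta> (x, y));
        linear R Q P h; \<And>x. x \<in> ?X \<Longrightarrow> h (\<gamma> x) = \<beta> x\<rbrakk> \<Longrightarrow> h a = h b\<rbrakk> \<Longrightarrow> a = b"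
    using presented_module[OF X, where \<Phi> = "\<lambda>P \<beta>. bilinear_map R M N P (\<lambda>x y. \<beta> (x, y))"]
    by blast
  interpret Q: module R Q using Q by (rule small_modulesD)
  have c: "\<gamma> (x, y) \<in> carrier Q" if "x \<in> carrier M" "y \<in> carrier N" for x y
    using \<gamma> that by auto
  have "bilinear_map R M N Q (\<lambda>x y. \<gamma> (x, y))"
  proof (rule bilinear_mapI)
    show "\<gamma> (x, y) \<in> carrier Q" if "x \<in> carrier M" "y \<in> carrier N" for x y
      using that by (rule c)
    show "\<gamma> (x \<oplus>\<^bsub>M\<^esub> x', y) = \<gamma> (x, y) \<oplus>\<^bsub>Q\<^esub> \<gamma> (x', y)"
      if "x \<in> carrier M" "x' \<in> carrier M" "y \<in> carrier N" for x x' y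
      by (rule sep) (use that in \<open>simp_all add: c linear_add bilinear_map_def\<close>)
    show "\<gamma> (x, y \<oplus>\<^bsub>N\<^esub> y') = \<gamma> (x, y) \<oplus>\<^bsub>Q\<^esub> \<gamma> (x, y')"
      if "x \<in> carrier M" "y \<in> carrier N" "y' \<in> carrier N" for x y y'
      by (rule sep) (use that in \<open>simp_all add: c linear_add bilinear_map_def\<close>)
    show "\<gamma> (r \<odot>\<^bsub>M\<^esub> x, y) = r \<odot>\<^bsub>Q\<^esub> \<gamma> (x, y)"
      if "r \<in> carrier R" "x \<in> carrier M" "y \<in> carrier N" for r x y
      by (rule sep) (use that in \<open>simp_all add: c linear_smult bilinear_map_def\<close>)
    show "\<gamma> (x, r \<odot>\<^bsub>N\<^esub> y) = r \<odot>\<^bsub>Q\<^esub> \<gamma> (x, y)"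
      if "r \<in> carrier R" "x \<in> carrier M" "y \<in> carrier N" for r x y
      by (rule sep) (use that in \<open>simp_all add: c linear_smult bilinear_map_def\<close>)
  qed
  moreover have "\<exists>!h. h \<in> mod_hom R Q P \<and>
      (\<forall>x\<in>carrier M. \<forall>y\<in>carrier N. h (\<gamma> (x, y)) = \<beta> x y)"
    if P: "P \<in> small_modules R" and \<beta>: "bilinear_map R M N P \<beta>" for P \<beta>
  proof (rule ex_ex1I)
    have "case_prod \<beta> \<in> ?X \<rightarrow> carrier P" using \<beta> by (auto simp: bilinear_map_def)
    then obtain h where h: "linear R Q P h" "\<forall>x\<in>?X. h (\<gamma> x) = case_prod \<beta> x"
      using lift[of P "case_prod \<beta>"] P \<beta> by auto
    then show "\<exists>h. h \<in> mod_hom R Q P \<and> (\<forall>x\<in>carrier M. \<forall>y\<in>carrier N. h (\<gamma> (x, y)) = \<beta> x y)"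
      by (intro exI[of _ "restrict h (carrier Q)"])
        (auto simp: c intro: restrict_mod_hom Q.module_axioms)
  next
    fix h h' assume h: "h \<in> mod_hom R Q P \<and> (\<forall>x\<in>carrier M. \<forall>y\<in>carrier N. h (\<gamma> (x, y)) = \<beta> x y)"
      and h': "h' \<in> mod_hom R Q P \<and> (\<forall>x\<in>carrier M. \<forall>y\<in>carrier N. h' (\<gamma> (x, y)) = \<beta> x y)"
    have "h a = h' a" if "a \<in> carrier Q" for a
      by (rule linear_agree[OF Q.module_axioms small_modulesD[OF P] _ _ span])
        (use h h' that in \<open>auto simp: mod_hom_iff\<close>)
    then show "h = h'" using h h' by (blast intro: mod_hom_eqI)
  qed
  ultimately show ?thesis using Q unfolding is_tensor_product_def by blast
qed

lemma tens_is_tensor_product: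
  assumes "M \<in> small_modules R" "N \<in> small_modules R"
  shows "is_tensor_product R M N (tens R M N) (tmul R M N)"
proof -
  have "\<exists>p. case p of (T, \<tau>) \<Rightarrow> is_tensor_product R M N T \<tau>"
    using tensor_product_exists[OF assms] by auto
  then have "case tensor_choice R M N of (T, \<tau>) \<Rightarrow> is_tensor_product R M N T \<tau>"
    unfolding tensor_choice_def by (rule someI_ex)
  then show ?thesis by (simp add: tens_def tmul_def case_prod_beta)
qed

lemma tens_small [simp]:
  "M \<in> small_modules R \<Longrightarrow> N \<in> small_modules R \<Longrightarrow> tens R M N \<in> small_modules R"
  and tmul_bilinear:
  "M \<in> small_modules R \<Longrightarrow> N \<in> small_modules R \<Longrightarrow> bilinear_map R M N (tens R M N) (tmul R M N)"
  using tens_is_tensor_product unfolding is_tensor_product_def by blast+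

lemma tmul_closed [simp]:
  "\<lbrakk>M \<in> small_modules R; N \<in> small_modules R; x \<in> carrier M; y \<in> carrier N\<rbrakk> \<Longrightarrow>
     tmul R M N x y \<in> carrier (tens R M N)"
  and tmul_add_left:
  "\<lbrakk>M \<in> small_modules R; N \<in> small_modules R; x \<in> carrier M; x' \<in> carrier M; y \<in> carrier N\<rbrakk> \<Longrightarrow>
     tmul R M N (x \<oplus>\<^bsub>M\<^esub> x') y = tmul R M N x y \<oplus>\<^bsub>tens R M N\<^esub> tmul R M N x' y"
  and tmul_add_right:
  "\<lbrakk>M \<in> small_modules R; N \<in> small_modules R; x \<in> carrier M; y \<in> carrier N; y' \<in> carrier N\<rbrakk> \<Longrightarrow>
     tmul R M N x (y \<oplus>\<^bsub>N\<^esub> y') = tmul R M N x y \<oplus>\<^bsub>tens R M N\<^esub> tmul R M N x y'"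
  and tmul_smult_left:
  "\<lbrakk>M \<in> small_modules R; N \<in> small_modules R; r \<in> carrier R; x \<in> carrier M; y \<in> carrier N\<rbrakk> \<Longrightarrow>
     tmul R M N (r \<odot>\<^bsub>M\<^esub> x) y = r \<odot>\<^bsub>tens R M N\<^esub> tmul R M N x y"
  and tmul_smult_right:
  "\<lbrakk>M \<in> small_modules R; N \<in> small_modules R; r \<in> carrier R; x \<in> carrier M; y \<in> carrier N\<rbrakk> \<Longrightarrow>
     tmul R M N x (r \<odot>\<^bsub>N\<^esub> y) = r \<odot>\<^bsub>tens R M N\<^esub> tmul R M N x y"
  using tmul_bilinear unfolding bilinear_map_def by blast+

lemmas tmul_simps = tmul_add_left tmul_add_right tmul_smult_left tmul_smult_right

lemma tens_lift:
  assumes "M \<in> small_modules R" "N \<in> small_modules R" "P \<in> small_modules R" "bilinear_map R M N P \<beta>"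
  shows tens_lift_hom: "tens_lift R M N P \<beta> \<in> mod_hom R (tens R M N) P"
    and tens_lift_tmul: "x \<in> carrier M \<Longrightarrow> y \<in> carrier N \<Longrightarrow> tens_lift R M N P \<beta> (tmul R M N x y) = \<beta> x y"
  using theI'[OF is_tensor_product_lift[OF tens_is_tensor_product[OF assms(1,2)] assms(3,4)]]
  unfolding tens_lift_def by blast+

text \<open>
  A map out of a tensor product restricts to a bilinear map, so this is the uniqueness half of the
  universal property.
\<close>

lemma tens_ext:
  assumes M: "M \<in> small_modules R" and N: "N \<in> small_modules R" and P: "P \<in> small_modules R"
    and f: "linear R (tens R M N) P f" and g: "linear R (tens R M N) P g"
    and eq: "\<And>x y. x \<in> carrier M \<Longrightarrow> y \<in> carrier N \<Longrightarrow> f (tmul R M N x y) = g (tmul R M N x y)"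
    and t: "t \<in> carrier (tens R M N)"
  shows "f t = g t"
proof -
  let ?T = "tens R M N"
  have T: "module R ?T" using M N by (simp add: small_modulesD)
  have "bilinear_map R M N P (\<lambda>x y. f (tmul R M N x y))"
    using M N by (intro bilinear_mapI)
      (simp_all add: tmul_simps linear_closed[OF f] linear_add[OF f] linear_smult[OF f])
  then have "\<exists>!h. h \<in> mod_hom R ?T P \<and>
      (\<forall>x\<in>carrier M. \<forall>y\<in>carrier N. h (tmul R M N x y) = f (tmul R M N x y))"
    using is_tensor_product_lift[OF tens_is_tensor_product[OF M N] P] by blast
  moreover have "restrict f (carrier ?T) \<in> mod_hom R ?T P" "restrict g (carrier ?T) \<in> mod_hom R ?T P"
    using restrict_mod_hom f g T by blast+
  moreover have "restrict f (carrier ?T) (tmul R M N x y) = f (tmul R M N x y)"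
    "restrict g (carrier ?T) (tmul R M N x y) = f (tmul R M N x y)"
    if "x \<in> carrier M" "y \<in> carrier N" for x y
    using that M N eq by simp_all
  ultimately have "restrict f (carrier ?T) = restrict g (carrier ?T)" by blast
  then show ?thesis using t by (metis restrict_apply')
qed

lemma tens_hom_eqI:
  assumes "M \<in> small_modules R" "N \<in> small_modules R" "P \<in> small_modules R"
    and "f \<in> mod_hom R (tens R M N) P" "g \<in> mod_hom R (tens R M N) P"
    and "\<And>x y. x \<in> carrier M \<Longrightarrow> y \<in> carrier N \<Longrightarrow> f (tmul R M N x y) = g (tmul R M N x y)"
  shows "f = g"
  using assms tens_ext[of M N P f g] by (blast intro: mod_hom_eqI mod_hom_linear)

text \<open>For a family of linear maps on a tensor product, linearity in the parameter need only be checked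
  on pure tensors, by uniqueness.  This is how trilinear maps are built.\<close>

lemma bilinear_from_family:
  assumes M: "M \<in> small_modules R" and N: "N \<in> small_modules R" and P: "P \<in> small_modules R"
    and Q: "Q \<in> small_modules R"
    and lin: "\<And>z. z \<in> carrier P \<Longrightarrow> linear R (tens R M N) Q (\<phi> z)"
    and add: "\<And>x y z z'. \<lbrakk>x \<in> carrier M; y \<in> carrier N; z \<in> carrier P; z' \<in> carrier P\<rbrakk> \<Longrightarrow>
      \<phi> (z \<oplus>\<^bsub>P\<^esub> z') (tmul R M N x y) = \<phi> z (tmul R M N x y) \<oplus>\<^bsub>Q\<^esub> \<phi> z' (tmul R M N x y)"
    and smult: "\<And>r x y z. \<lbrakk>r \<in> carrier R; x \<in> carrier M; y \<in> carrier N; z \<in> carrier P\<rbrakk> \<Longrightarrow>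
      \<phi> (r \<odot>\<^bsub>P\<^esub> z) (tmul R M N x y) = r \<odot>\<^bsub>Q\<^esub> \<phi> z (tmul R M N x y)"
  shows "bilinear_map R (tens R M N) P Q (\<lambda>t z. \<phi> z t)"
proof -
  interpret P: module R P using P by (rule small_modulesD)
  have Qm: "module R Q" using Q by (rule small_modulesD)
  show ?thesis
  proof (rule bilinear_mapI)
    show "\<phi> (z \<oplus>\<^bsub>P\<^esub> z') t = \<phi> z t \<oplus>\<^bsub>Q\<^esub> \<phi> z' t"
      if "t \<in> carrier (tens R M N)" "z \<in> carrier P" "z' \<in> carrier P" for t z z'
      by (rule tens_ext[OF M N Q lin linear_sum[OF Qm lin lin] _ that(1)]) (simp_all add: that add)
    show "\<phi> (r \<odot>\<^bsub>P\<^esub> z) t = r \<odot>\<^bsub>Q\<^esub> \<phi> z t"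
      if "r \<in> carrier R" "t \<in> carrier (tens R M N)" "z \<in> carrier P" for r t z
      by (rule tens_ext[OF M N Q lin linear_scale[OF Qm lin] _ that(2)]) (simp_all add: that smult)
  qed (simp_all add: linear_closed[OF lin] linear_add[OF lin] linear_smult[OF lin])
qed

lemma tens_map:
  assumes M: "M \<in> small_modules R" and N: "N \<in> small_modules R"
    and M': "M' \<in> small_modules R" and N': "N' \<in> small_modules R"
    and f: "f \<in> mod_hom R M M'" and g: "g \<in> mod_hom R N N'"
  shows tens_map_hom: "tens_map R M N M' N' f g \<in> mod_hom R (tens R M N) (tens R M' N')"
    and tens_map_tmul: "x \<in> carrier M \<Longrightarrow> y \<in> carrier N \<Longrightarrow>
      tens_map R M N M' N' f g (tmul R M N x y) = tmul R M' N' (f x) (g y)"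
proof -
  note f' = mod_hom_linear[OF f] and g' = mod_hom_linear[OF g]
  have "bilinear_map R M N (tens R M' N') (\<lambda>x y. tmul R M' N' (f x) (g y))"
    by (rule bilinear_mapI) (simp_all add: M' N' linear_closed[OF f'] linear_closed[OF g'] linear_add[OF f']
      linear_add[OF g'] linear_smult[OF f'] linear_smult[OF g'] tmul_simps)
  from tens_lift[OF M N _ this]
  show "tens_map R M N M' N' f g \<in> mod_hom R (tens R M N) (tens R M' N')"
    and "x \<in> carrier M \<Longrightarrow> y \<in> carrier N \<Longrightarrow>
      tens_map R M N M' N' f g (tmul R M N x y) = tmul R M' N' (f x) (g y)"
    unfolding tens_map_def using M' N' by simp_all
qed

lemma tens_ext3:
  assumes M: "M \<in> small_modules R" and N: "N \<in> small_modules R" and P: "P \<in> small_modules R"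
    and Q: "Q \<in> small_modules R"
    and f: "linear R (tens R (tens R M N) P) Q f" and g: "linear R (tens R (tens R M N) P) Q g"
    and eq: "\<And>x y z. \<lbrakk>x \<in> carrier M; y \<in> carrier N; z \<in> carrier P\<rbrakk> \<Longrightarrow>
      f (tmul R (tens R M N) P (tmul R M N x y) z) = g (tmul R (tens R M N) P (tmul R M N x y) z)"
    and t: "t \<in> carrier (tens R (tens R M N) P)"
  shows "f t = g t"
proof (rule tens_ext[OF _ P Q f g _ t])
  show "tens R M N \<in> small_modules R" using M N by simp
  fix s z assume s: "s \<in> carrier (tens R M N)" and z: "z \<in> carrier P"
  have b: "linear R (tens R M N) (tens R (tens R M N) P) (\<lambda>s. tmul R (tens R M N) P s z)"
    using bilinear_map_linear(2)[OF tmul_bilinear z] M N P by simp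
  show "f (tmul R (tens R M N) P s z) = g (tmul R (tens R M N) P s z)"
    by (rule tens_ext[OF M N Q linear_comp[OF b f] linear_comp[OF b g] _ s]) (simp add: eq z)
qed

lemma tens_ext3':
  assumes M: "M \<in> small_modules R" and N: "N \<in> small_modules R" and P: "P \<in> small_modules R"
    and Q: "Q \<in> small_modules R"
    and f: "linear R (tens R M (tens R N P)) Q f" and g: "linear R (tens R M (tens R N P)) Q g"
    and eq: "\<And>x y z. \<lbrakk>x \<in> carrier M; y \<in> carrier N; z \<in> carrier P\<rbrakk> \<Longrightarrow>
      f (tmul R M (tens R N P) x (tmul R N P y z)) = g (tmul R M (tens R N P) x (tmul R N P y z))"
    and t: "t \<in> carrier (tens R M (tens R N P))"
  shows "f t = g t"
proof (rule tens_ext[OF M _ Q f g _ t])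
  show "tens R N P \<in> small_modules R" using N P by simp
  fix x s assume s: "s \<in> carrier (tens R N P)" and x: "x \<in> carrier M"
  have b: "linear R (tens R N P) (tens R M (tens R N P)) (\<lambda>s. tmul R M (tens R N P) x s)"
    using bilinear_map_linear(1)[OF tmul_bilinear x] M N P by simp
  show "f (tmul R M (tens R N P) x s) = g (tmul R M (tens R N P) x s)"
    by (rule tens_ext[OF N P Q linear_comp[OF b f] linear_comp[OF b g] _ s]) (simp add: eq x)
qed

lemma tens_assoc:
  assumes M: "M \<in> small_modules R" and N: "N \<in> small_modules R" and P: "P \<in> small_modules R"
  shows tens_assoc_hom:
      "tens_assoc R M N P \<in> mod_hom R (tens R (tens R M N) P) (tens R M (tens R N P))"
    and tens_assoc_tmul: "\<lbrakk>x \<in> carrier M; y \<in> carrier N; z \<in> carrier P\<rbrakk> \<Longrightarrow>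
      tens_assoc R M N P (tmul R (tens R M N) P (tmul R M N x y) z) =
      tmul R M (tens R N P) x (tmul R N P y z)"
proof -
  let ?Q = "tens R M (tens R N P)" and ?t = "\<lambda>x y z. tmul R M (tens R N P) x (tmul R N P y z)"
  have Q: "?Q \<in> small_modules R" using assms by simp
  have bil: "bilinear_map R M N ?Q (\<lambda>x y. ?t x y z)" if "z \<in> carrier P" for z
    by (rule bilinear_mapI) (use that assms in \<open>simp_all add: tmul_simps\<close>)
  define \<phi> where "\<phi> z = tens_lift R M N ?Q (\<lambda>x y. ?t x y z)" for z
  have \<phi>: "\<phi> z (tmul R M N x y) = ?t x y z" if "x \<in> carrier M" "y \<in> carrier N" "z \<in> carrier P" for x y z
    unfolding \<phi>_def using that by (simp add: tens_lift_tmul[OF M N Q bil])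
  interpret P: module R P using P by (rule small_modulesD)
  have "bilinear_map R (tens R M N) P ?Q (\<lambda>t z. \<phi> z t)"
  proof (rule bilinear_from_family[OF M N P Q])
    show "linear R (tens R M N) ?Q (\<phi> z)" if "z \<in> carrier P" for z
      unfolding \<phi>_def by (rule mod_hom_linear[OF tens_lift_hom[OF M N Q bil[OF that]]])
  qed (simp_all add: \<phi> M N P tmul_simps)
  from tens_lift[OF _ P Q this]
  have h: "\<exists>h. h \<in> mod_hom R (tens R (tens R M N) P) ?Q \<and> (\<forall>x\<in>carrier M. \<forall>y\<in>carrier N. \<forall>z\<in>carrier P.
      h (tmul R (tens R M N) P (tmul R M N x y) z) = ?t x y z)"
    using M N \<phi> by (intro exI[of _ "tens_lift R (tens R M N) P ?Q (\<lambda>t z. \<phi> z t)"]) simp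
  have "\<exists>!h. h \<in> mod_hom R (tens R (tens R M N) P) ?Q \<and> (\<forall>x\<in>carrier M. \<forall>y\<in>carrier N. \<forall>z\<in>carrier P.
      h (tmul R (tens R M N) P (tmul R M N x y) z) = ?t x y z)"
  proof (rule ex_ex1I[OF h], rule mod_hom_eqI)
    fix f g t
    assume f: "f \<in> mod_hom R (tens R (tens R M N) P) ?Q \<and> (\<forall>x\<in>carrier M. \<forall>y\<in>carrier N. \<forall>z\<in>carrier P.
      f (tmul R (tens R M N) P (tmul R M N x y) z) = ?t x y z)"
      and g: "g \<in> mod_hom R (tens R (tens R M N) P) ?Q \<and> (\<forall>x\<in>carrier M. \<forall>y\<in>carrier N. \<forall>z\<in>carrier P.
      g (tmul R (tens R M N) P (tmul R M N x y) z) = ?t x y z)"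
      and t: "t \<in> carrier (tens R (tens R M N) P)"
    show "f t = g t"
      by (rule tens_ext3[OF M N P Q _ _ _ t]) (use f g in \<open>simp_all add: mod_hom_iff\<close>)
  qed auto
  from theI'[OF this]
  show "tens_assoc R M N P \<in> mod_hom R (tens R (tens R M N) P) (tens R M (tens R N P))"
    and "\<lbrakk>x \<in> carrier M; y \<in> carrier N; z \<in> carrier P\<rbrakk> \<Longrightarrow>
      tens_assoc R M N P (tmul R (tens R M N) P (tmul R M N x y) z) = ?t x y z"
    unfolding tens_assoc_def by blast+
qed

lemma tens_assoc_inverse:
  assumes M: "M \<in> small_modules R" and N: "N \<in> small_modules R" and P: "P \<in> small_modules R"
  shows "\<exists>h. h \<in> mod_hom R (tens R M (tens R N P)) (tens R (tens R M N) P) \<and>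
    (\<forall>x\<in>carrier M. \<forall>y\<in>carrier N. \<forall>z\<in>carrier P.
      h (tmul R M (tens R N P) x (tmul R N P y z)) = tmul R (tens R M N) P (tmul R M N x y) z)"
proof -
  let ?Q = "tens R (tens R M N) P" and ?t = "\<lambda>x y z. tmul R (tens R M N) P (tmul R M N x y) z"
  have Q: "?Q \<in> small_modules R" using assms by simp
  have bil: "bilinear_map R N P ?Q (\<lambda>y z. ?t x y z)" if "x \<in> carrier M" for x
    by (rule bilinear_mapI) (use that assms in \<open>simp_all add: tmul_simps\<close>)
  define \<phi> where "\<phi> x = tens_lift R N P ?Q (\<lambda>y z. ?t x y z)" for x
  have \<phi>: "\<phi> x (tmul R N P y z) = ?t x y z" if "x \<in> carrier M" "y \<in> carrier N" "z \<in> carrier P" for x y z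
    unfolding \<phi>_def using that by (simp add: tens_lift_tmul[OF N P Q bil])
  interpret M: module R M using M by (rule small_modulesD)
  have "bilinear_map R (tens R N P) M ?Q (\<lambda>t x. \<phi> x t)"
  proof (rule bilinear_from_family[OF N P M Q])
    show "linear R (tens R N P) ?Q (\<phi> x)" if "x \<in> carrier M" for x
      unfolding \<phi>_def by (rule mod_hom_linear[OF tens_lift_hom[OF N P Q bil[OF that]]])
  qed (simp_all add: \<phi> M N P tmul_simps)
  from tens_lift[OF M _ Q bilinear_map_flip[OF this]]
  show ?thesis
    using N P \<phi> by (intro exI[of _ "tens_lift R M (tens R N P) ?Q (\<lambda>x t. \<phi> x t)"]) simp
qed

end


section \<open>The symmetric monoidal category of modules\<close>

lemma Mod_simps [simp]:
  "obj (Mod R) = small_modules R"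
  "arr (Mod R) = {(M, f, N). M \<in> small_modules R \<and> N \<in> small_modules R \<and> f \<in> mod_hom R M N}"
  "src (Mod R) (M, f, N) = M"
  "tgt (Mod R) (M, f, N) = N"
  "idn (Mod R) M = (M, \<lambda>x\<in>carrier M. x, M)"
  "cmp (Mod R) (N', g, P) (M, f, N) = (M, compose (carrier M) g f, P)"
  "tobj (Mod R) = tens R"
  "tarr (Mod R) (M, f, M') (N, g, N') = (tens R M N, tens_map R M N M' N' f g, tens R M' N')"
  "tunit (Mod R) = scalar_module (\<lambda>r. r) R"
  "asc (Mod R) M N P = (tens R (tens R M N) P, tens_assoc R M N P, tens R M (tens R N P))"
  "lun (Mod R) M = (tens R (scalar_module (\<lambda>r. r) R) M,
     tens_lift R (scalar_module (\<lambda>r. r) R) M M (\<lambda>r x. r \<odot>\<^bsub>M\<^esub> x), M)"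
  "run (Mod R) M = (tens R M (scalar_module (\<lambda>r. r) R),
     tens_lift R M (scalar_module (\<lambda>r. r) R) M (\<lambda>x r. r \<odot>\<^bsub>M\<^esub> x), M)"
  "brd (Mod R) M N = (tens R M N, tens_lift R M N (tens R N M) (\<lambda>x y. tmul R N M y x), tens R N M)"
  by (simp_all add: Mod_def Let_def)

lemma hom_set_Mod:
  "hom_set (Mod R) M N =
     {(M', f, N'). M' = M \<and> N' = N \<and> M \<in> small_modules R \<and> N \<in> small_modules R \<and> f \<in> mod_hom R M N}"
  by (auto simp: hom_set_def)

lemma in_hom_set_Mod [simp]:
  "(M', f, N') \<in> hom_set (Mod R) M N \<longleftrightarrow>
     M' = M \<and> N' = N \<and> M \<in> small_modules R \<and> N \<in> small_modules R \<and> f \<in> mod_hom R M N"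
  by (simp add: hom_set_Mod)

lemma hom_set_ModE:
  assumes "a \<in> hom_set (Mod R) M N"
  obtains f where "a = (M, f, N)" "M \<in> small_modules R" "N \<in> small_modules R" "f \<in> mod_hom R M N"
  using assms by (auto simp: hom_set_Mod)

lemma compose_id_mod_hom:
  assumes "f \<in> mod_hom R M N"
  shows "compose (carrier M) f (\<lambda>x\<in>carrier M. x) = f" "compose (carrier M) (\<lambda>x\<in>carrier N. x) f = f"
  using assms mod_hom_closed[OF assms]
  by (auto simp: mod_hom_iff compose_def extensional_def fun_eq_iff)

lemma Mod_is_category: "is_category (Mod R)"
  unfolding is_category_def
proof (intro conjI ballI allI impI)
  fix w x y z f g h
  assume "f \<in> hom_set (Mod R) w x" "g \<in> hom_set (Mod R) x y" "h \<in> hom_set (Mod R) y z"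
  then show "(h \<cdot>\<^bsub>Mod R\<^esub> g) \<cdot>\<^bsub>Mod R\<^esub> f = h \<cdot>\<^bsub>Mod R\<^esub> (g \<cdot>\<^bsub>Mod R\<^esub> f)"
    by (auto elim!: hom_set_ModE simp: mod_hom_def PiE_iff intro!: compose_assoc[symmetric])
next
  fix x y z f g
  assume "f \<in> hom_set (Mod R) x y" "g \<in> hom_set (Mod R) y z"
  then show "g \<cdot>\<^bsub>Mod R\<^esub> f \<in> hom_set (Mod R) x z"
    by (auto elim!: hom_set_ModE intro!: mod_hom_compose[of _ _ x y] small_modulesD)
qed (auto elim!: hom_set_ModE simp: compose_id_mod_hom id_mod_hom small_modulesD)

text \<open>
  A linear two-sided inverse is automatically an inverse arrow after restriction to the carrier.
\<close>

lemma iso_set_Mod: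
  assumes "M \<in> small_modules R" "N \<in> small_modules R" and f: "f \<in> mod_hom R M N"
    and g: "linear R N M g"
    and "\<And>x. x \<in> carrier M \<Longrightarrow> g (f x) = x" "\<And>y. y \<in> carrier N \<Longrightarrow> f (g y) = y"
  shows "(M, f, N) \<in> iso_set (Mod R) M N"
proof -
  let ?g = "restrict g (carrier N)"
  have "(N, ?g, M) \<in> hom_set (Mod R) N M"
    using assms by (simp add: restrict_mod_hom small_modulesD)
  moreover have "compose (carrier M) ?g f = (\<lambda>x\<in>carrier M. x)"
    "compose (carrier N) f ?g = (\<lambda>x\<in>carrier N. x)"
    using assms mod_hom_closed[OF f] by (auto simp: compose_def)
  ultimately show ?thesis
    using assms by (auto simp: iso_set_def is_iso_def intro!: bexI[of _ "(N, ?g, M)"])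
qed

lemma iso_set_ModE:
  assumes "a \<in> iso_set (Mod R) M N"
  obtains f g where "a = (M, f, N)" "M \<in> small_modules R" "N \<in> small_modules R"
    "f \<in> mod_hom R M N" "g \<in> mod_hom R N M"
    "\<And>x. x \<in> carrier M \<Longrightarrow> g (f x) = x" "\<And>y. y \<in> carrier N \<Longrightarrow> f (g y) = y"
proof -
  obtain f where f: "a = (M, f, N)" "M \<in> small_modules R" "N \<in> small_modules R" "f \<in> mod_hom R M N"
    using assms by (auto simp: iso_set_def elim: hom_set_ModE)
  obtain b where b: "b \<in> hom_set (Mod R) N M" "b \<cdot>\<^bsub>Mod R\<^esub> a = idn (Mod R) M" "a \<cdot>\<^bsub>Mod R\<^esub> b = idn (Mod R) N"
    using assms f(1) by (auto simp: iso_set_def is_iso_def)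
  obtain g where g: "b = (N, g, M)" "g \<in> mod_hom R N M" using b(1) by (auto elim: hom_set_ModE)
  have gf: "compose (carrier M) g f = (\<lambda>x\<in>carrier M. x)" "compose (carrier N) f g = (\<lambda>y\<in>carrier N. y)"
    using b(2,3) by (simp_all add: f(1) g(1))
  have "g (f x) = x" if "x \<in> carrier M" for x
    using fun_cong[OF gf(1), of x] that by (simp add: compose_eq)
  moreover have "f (g y) = y" if "y \<in> carrier N" for y
    using fun_cong[OF gf(2), of y] that by (simp add: compose_eq)
  ultimately show ?thesis using that f g by blast
qed

context small_cring
begin

abbreviation "II \<equiv> scalar_module (\<lambda>r. r) R"

lemma scalar_module_simps [simp]:
  "carrier (scalar_module \<phi> S) = carrier S" "add (scalar_module \<phi> S) = add S"
  "zero (scalar_module \<phi> S) = zero S" "smult (scalar_module \<phi> S) r s = \<phi> r \<otimes>\<^bsub>S\<^esub> s"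
  by (simp_all add: scalar_module_def)

lemma unit_small [simp]: "II \<in> small_modules R"
proof -
  interpret R: cring R by (rule cring)
  have "module R II"
    by (rule module_by_equations) (auto simp: R.cring_axioms R.is_cring cring R.a_ac R.l_distr R.r_distr R.m_assoc)
  then show ?thesis using small_carrier by (simp add: small_modules_def)
qed

lemma lun_bilinear:
  assumes "M \<in> small_modules R"
  shows "bilinear_map R II M M (\<lambda>r x. r \<odot>\<^bsub>M\<^esub> x)"
proof -
  interpret M: module R M using assms by (rule small_modulesD)
  show ?thesis
    by (rule bilinear_mapI)
      (simp_all add: M.smult_l_distr M.smult_r_distr M.smult_assoc1[symmetric] M.R.m_comm)
qed

lemma brd_bilinear:
  assumes "M \<in> small_modules R" "N \<in> small_modules R"
  shows "bilinear_map R M N (tens R N M) (\<lambda>x y. tmul R N M y x)"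
  by (rule bilinear_map_flip[OF tmul_bilinear]) (use assms in simp_all)

lemma lun_hom: "M \<in> small_modules R \<Longrightarrow> tens_lift R II M M (\<lambda>r x. r \<odot>\<^bsub>M\<^esub> x) \<in> mod_hom R (tens R II M) M"
  and run_hom: "M \<in> small_modules R \<Longrightarrow> tens_lift R M II M (\<lambda>x r. r \<odot>\<^bsub>M\<^esub> x) \<in> mod_hom R (tens R M II) M"
  and brd_hom: "M \<in> small_modules R \<Longrightarrow> N \<in> small_modules R \<Longrightarrow>
    tens_lift R M N (tens R N M) (\<lambda>x y. tmul R N M y x) \<in> mod_hom R (tens R M N) (tens R N M)"
  by (simp_all add: tens_lift_hom lun_bilinear bilinear_map_flip[OF lun_bilinear] brd_bilinear)

lemma lun_tmul: "\<lbrakk>M \<in> small_modules R; r \<in> carrier R; x \<in> carrier M\<rbrakk> \<Longrightarrow>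
    tens_lift R II M M (\<lambda>r x. r \<odot>\<^bsub>M\<^esub> x) (tmul R II M r x) = r \<odot>\<^bsub>M\<^esub> x"
  and run_tmul: "\<lbrakk>M \<in> small_modules R; r \<in> carrier R; x \<in> carrier M\<rbrakk> \<Longrightarrow>
    tens_lift R M II M (\<lambda>x r. r \<odot>\<^bsub>M\<^esub> x) (tmul R M II x r) = r \<odot>\<^bsub>M\<^esub> x"
  and brd_tmul: "\<lbrakk>M \<in> small_modules R; N \<in> small_modules R; x \<in> carrier M; y \<in> carrier N\<rbrakk> \<Longrightarrow>
    tens_lift R M N (tens R N M) (\<lambda>x y. tmul R N M y x) (tmul R M N x y) = tmul R N M y x"
  by (simp_all add: tens_lift_tmul lun_bilinear bilinear_map_flip[OF lun_bilinear] brd_bilinear)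

lemma tens_hom_eqI3:
  assumes "M \<in> small_modules R" "N \<in> small_modules R" "P \<in> small_modules R" "Q \<in> small_modules R"
    and "f \<in> mod_hom R (tens R (tens R M N) P) Q" "g \<in> mod_hom R (tens R (tens R M N) P) Q"
    and "\<And>x y z. \<lbrakk>x \<in> carrier M; y \<in> carrier N; z \<in> carrier P\<rbrakk> \<Longrightarrow>
      f (tmul R (tens R M N) P (tmul R M N x y) z) = g (tmul R (tens R M N) P (tmul R M N x y) z)"
  shows "f = g"
  using assms tens_ext3[of M N P Q f g] by (blast intro: mod_hom_eqI mod_hom_linear)

lemma tens_hom_eqI4:
  assumes L: "L \<in> small_modules R" and M: "M \<in> small_modules R" and N: "N \<in> small_modules R"
    and P: "P \<in> small_modules R" and Q: "Q \<in> small_modules R"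
    and f: "f \<in> mod_hom R (tens R (tens R (tens R L M) N) P) Q"
    and g: "g \<in> mod_hom R (tens R (tens R (tens R L M) N) P) Q"
    and eq: "\<And>w x y z. \<lbrakk>w \<in> carrier L; x \<in> carrier M; y \<in> carrier N; z \<in> carrier P\<rbrakk> \<Longrightarrow>
      f (tmul R (tens R (tens R L M) N) P (tmul R (tens R L M) N (tmul R L M w x) y) z) =
      g (tmul R (tens R (tens R L M) N) P (tmul R (tens R L M) N (tmul R L M w x) y) z)"
  shows "f = g"
proof (rule tens_hom_eqI[OF _ P Q f g])
  let ?T = "tens R (tens R L M) N"
  show T: "?T \<in> small_modules R" using L M N by simp
  fix t z assume t: "t \<in> carrier ?T" and z: "z \<in> carrier P"
  have b: "linear R ?T (tens R ?T P) (\<lambda>s. tmul R ?T P s z)"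
    using bilinear_map_linear(2)[OF tmul_bilinear[OF T P] z] .
  show "f (tmul R ?T P t z) = g (tmul R ?T P t z)"
    by (rule tens_ext3[OF L M N Q linear_comp[OF b mod_hom_linear[OF f]]
          linear_comp[OF b mod_hom_linear[OF g]] _ t]) (simp add: eq z)
qed

lemmas tens_eval = tens_map_tmul tens_assoc_tmul lun_tmul run_tmul brd_tmul

lemmas tens_homs [simp] = tens_map_hom tens_assoc_hom lun_hom run_hom brd_hom

lemma id_mod_hom_small [simp]: "M \<in> small_modules R \<Longrightarrow> (\<lambda>x\<in>carrier M. x) \<in> mod_hom R M M"
  by (rule id_mod_hom) (rule small_modulesD)

lemma compose_mod_hom:
  "\<lbrakk>f \<in> mod_hom R M N; g \<in> mod_hom R N P; M \<in> small_modules R\<rbrakk> \<Longrightarrow> compose (carrier M) g f \<in> mod_hom R M P"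
  by (rule mod_hom_compose) (simp_all add: small_modulesD)

lemma asc_iso:
  assumes M: "M \<in> small_modules R" and N: "N \<in> small_modules R" and P: "P \<in> small_modules R"
  shows "asc (Mod R) M N P \<in> iso_set (Mod R) (tens R (tens R M N) P) (tens R M (tens R N P))"
proof -
  obtain h where h: "h \<in> mod_hom R (tens R M (tens R N P)) (tens R (tens R M N) P)"
    "\<forall>x\<in>carrier M. \<forall>y\<in>carrier N. \<forall>z\<in>carrier P.
      h (tmul R M (tens R N P) x (tmul R N P y z)) = tmul R (tens R M N) P (tmul R M N x y) z"
    using tens_assoc_inverse[OF assms] by blast
  note a = mod_hom_linear[OF tens_assoc_hom[OF assms]] and h' = mod_hom_linear[OF h(1)]
  have id: "linear R T T (\<lambda>x. x)" for T :: "('u, 'u) module" by (auto intro: linearI)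
  show ?thesis
    unfolding Mod_simps
  proof (rule iso_set_Mod[OF _ _ tens_assoc_hom[OF assms] h'])
    show "h (tens_assoc R M N P t) = t" if "t \<in> carrier (tens R (tens R M N) P)" for t
      by (rule tens_ext3[OF M N P _ linear_comp[OF a h'] id _ that])
        (use assms h in \<open>simp_all add: tens_assoc_tmul\<close>)
    show "tens_assoc R M N P (h t) = t" if "t \<in> carrier (tens R M (tens R N P))" for t
      by (rule tens_ext3'[OF M N P _ linear_comp[OF h' a] id _ that])
        (use assms h in \<open>simp_all add: tens_assoc_tmul\<close>)
  qed (use assms in simp_all)
qed

lemma lun_iso:
  assumes M: "M \<in> small_modules R"
  shows "lun (Mod R) M \<in> iso_set (Mod R) (tens R II M) M"
    and "run (Mod R) M \<in> iso_set (Mod R) (tens R M II) M"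
proof -
  interpret M: module R M using M by (rule small_modulesD)
  have id: "linear R T T (\<lambda>x. x)" for T :: "('u, 'u) module" by (auto intro: linearI)
  have l: "linear R M (tens R II M) (tmul R II M \<one>\<^bsub>R\<^esub>)"
    "linear R M (tens R M II) (\<lambda>x. tmul R M II x \<one>\<^bsub>R\<^esub>)"
    using bilinear_map_linear[OF tmul_bilinear] M by simp_all
  have e: "tmul R II M \<one>\<^bsub>R\<^esub> (r \<odot>\<^bsub>M\<^esub> x) = tmul R II M r x"
    "tmul R M II (r \<odot>\<^bsub>M\<^esub> x) \<one>\<^bsub>R\<^esub> = tmul R M II x r"
    if "r \<in> carrier R" "x \<in> carrier M" for r x
    using tmul_smult_right[of II M r "\<one>\<^bsub>R\<^esub>" x] tmul_smult_left[of II M r "\<one>\<^bsub>R\<^esub>" x]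
      tmul_smult_right[of M II r x "\<one>\<^bsub>R\<^esub>"] tmul_smult_left[of M II r x "\<one>\<^bsub>R\<^esub>"] M that
    by simp_all
  show "lun (Mod R) M \<in> iso_set (Mod R) (tens R II M) M"
    unfolding Mod_simps
  proof (rule iso_set_Mod[OF _ M lun_hom[OF M] l(1)])
    show "tmul R II M \<one>\<^bsub>R\<^esub> (tens_lift R II M M (\<lambda>r x. r \<odot>\<^bsub>M\<^esub> x) t) = t"
      if "t \<in> carrier (tens R II M)" for t
      by (rule tens_ext[OF unit_small M _ linear_comp[OF mod_hom_linear[OF lun_hom[OF M]] l(1)] id _ that])
        (use M in \<open>simp_all add: lun_tmul e\<close>)
  qed (use M in \<open>simp_all add: lun_tmul\<close>)
  show "run (Mod R) M \<in> iso_set (Mod R) (tens R M II) M"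
    unfolding Mod_simps
  proof (rule iso_set_Mod[OF _ M run_hom[OF M] l(2)])
    show "tmul R M II (tens_lift R M II M (\<lambda>x r. r \<odot>\<^bsub>M\<^esub> x) t) \<one>\<^bsub>R\<^esub> = t"
      if "t \<in> carrier (tens R M II)" for t
      by (rule tens_ext[OF M unit_small _ linear_comp[OF mod_hom_linear[OF run_hom[OF M]] l(2)] id _ that])
        (use M in \<open>simp_all add: run_tmul e\<close>)
  qed (use M in \<open>simp_all add: run_tmul\<close>)
qed

lemma brd_brd:
  assumes M: "M \<in> small_modules R" and N: "N \<in> small_modules R" and t: "t \<in> carrier (tens R M N)"
  shows "tens_lift R N M (tens R M N) (\<lambda>x y. tmul R M N y x)
    (tens_lift R M N (tens R N M) (\<lambda>x y. tmul R N M y x) t) = t"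
proof -
  have id: "linear R T T (\<lambda>x. x)" for T :: "('u, 'u) module" by (auto intro: linearI)
  show ?thesis
    by (rule tens_ext[OF M N _ linear_comp[OF mod_hom_linear[OF brd_hom[OF M N]]
            mod_hom_linear[OF brd_hom[OF N M]]] id _ t]) (use M N in \<open>simp_all add: brd_tmul\<close>)
qed

lemma brd_iso:
  assumes M: "M \<in> small_modules R" and N: "N \<in> small_modules R"
  shows "brd (Mod R) M N \<in> iso_set (Mod R) (tens R M N) (tens R N M)"
  unfolding Mod_simps
  by (rule iso_set_Mod[OF _ _ brd_hom[OF M N] mod_hom_linear[OF brd_hom[OF N M]]])
    (use M N in \<open>simp_all add: brd_brd\<close>)

lemma tens_map_id:
  assumes "M \<in> small_modules R" "N \<in> small_modules R"
  shows "tens_map R M N M N (\<lambda>x\<in>carrier M. x) (\<lambda>x\<in>carrier N. x) = (\<lambda>x\<in>carrier (tens R M N). x)"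
  by (rule tens_hom_eqI[of M N "tens R M N"]) (use assms in \<open>simp_all add: tens_eval\<close>)

lemma tens_map_compose:
  assumes o: "M \<in> small_modules R" "M' \<in> small_modules R" "M'' \<in> small_modules R"
      "N \<in> small_modules R" "N' \<in> small_modules R" "N'' \<in> small_modules R"
    and h: "f \<in> mod_hom R M M'" "f' \<in> mod_hom R M' M''" "g \<in> mod_hom R N N'" "g' \<in> mod_hom R N' N''"
  shows "tens_map R M N M'' N'' (compose (carrier M) f' f) (compose (carrier N) g' g) =
    compose (carrier (tens R M N)) (tens_map R M' N' M'' N'' f' g') (tens_map R M N M' N' f g)"
proof (rule tens_hom_eqI[of M N "tens R M'' N''"])
  note c = compose_mod_hom[OF h(1,2) o(1)] compose_mod_hom[OF h(3,4) o(4)]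
  show "tens_map R M N M'' N'' (compose (carrier M) f' f) (compose (carrier N) g' g)
      \<in> mod_hom R (tens R M N) (tens R M'' N'')"
    using c o by simp
  show "compose (carrier (tens R M N)) (tens_map R M' N' M'' N'' f' g') (tens_map R M N M' N' f g)
      \<in> mod_hom R (tens R M N) (tens R M'' N'')"
    using o h by (intro compose_mod_hom[of _ _ "tens R M' N'"]) simp_all
  fix x y assume "x \<in> carrier M" "y \<in> carrier N"
  then show "tens_map R M N M'' N'' (compose (carrier M) f' f) (compose (carrier N) g' g) (tmul R M N x y) =
      compose (carrier (tens R M N)) (tens_map R M' N' M'' N'' f' g') (tens_map R M N M' N' f g) (tmul R M N x y)"
    using o h mod_hom_closed[OF h(1)] mod_hom_closed[OF h(3)]
    by (simp add: tens_eval c compose_eq)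
qed (use o in simp_all)

lemma asc_natural:
  assumes o: "L \<in> small_modules R" "L' \<in> small_modules R" "M \<in> small_modules R"
      "M' \<in> small_modules R" "N \<in> small_modules R" "N' \<in> small_modules R"
    and h: "f \<in> mod_hom R L L'" "g \<in> mod_hom R M M'" "h \<in> mod_hom R N N'"
  shows "compose (carrier (tens R (tens R L M) N)) (tens_assoc R L' M' N')
      (tens_map R (tens R L M) N (tens R L' M') N' (tens_map R L M L' M' f g) h) =
    compose (carrier (tens R (tens R L M) N))
      (tens_map R L (tens R M N) L' (tens R M' N') f (tens_map R M N M' N' g h)) (tens_assoc R L M N)"
proof (rule tens_hom_eqI3[of L M N "tens R L' (tens R M' N')"])
  show "compose (carrier (tens R (tens R L M) N)) (tens_assoc R L' M' N')
      (tens_map R (tens R L M) N (tens R L' M') N' (tens_map R L M L' M' f g) h)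
    \<in> mod_hom R (tens R (tens R L M) N) (tens R L' (tens R M' N'))"
    using o h by (intro compose_mod_hom[of _ _ "tens R (tens R L' M') N'"]) simp_all
  show "compose (carrier (tens R (tens R L M) N))
      (tens_map R L (tens R M N) L' (tens R M' N') f (tens_map R M N M' N' g h)) (tens_assoc R L M N)
    \<in> mod_hom R (tens R (tens R L M) N) (tens R L' (tens R M' N'))"
    using o h by (intro compose_mod_hom[of _ _ "tens R L (tens R M N)"]) simp_all
qed (use o h mod_hom_closed[OF h(1)] mod_hom_closed[OF h(2)] mod_hom_closed[OF h(3)] in
    \<open>simp_all add: tens_eval compose_eq\<close>)

lemma lun_natural:
  assumes o: "M \<in> small_modules R" "M' \<in> small_modules R" and f: "f \<in> mod_hom R M M'"
  shows "compose (carrier (tens R II M)) (tens_lift R II M' M' (\<lambda>r x. r \<odot>\<^bsub>M'\<^esub> x))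
      (tens_map R II M II M' (\<lambda>x\<in>carrier R. x) f) =
    compose (carrier (tens R II M)) f (tens_lift R II M M (\<lambda>r x. r \<odot>\<^bsub>M\<^esub> x))" (is "?l = ?r")
    and "compose (carrier (tens R M II)) (tens_lift R M' II M' (\<lambda>x r. r \<odot>\<^bsub>M'\<^esub> x))
      (tens_map R M II M' II f (\<lambda>x\<in>carrier R. x)) =
    compose (carrier (tens R M II)) f (tens_lift R M II M (\<lambda>x r. r \<odot>\<^bsub>M\<^esub> x))" (is "?l' = ?r'")
proof -
  have id: "(\<lambda>x\<in>carrier R. x) \<in> mod_hom R II II" using id_mod_hom_small[OF unit_small] by simp
  note s = tens_eval compose_eq id mod_hom_closed[OF f] linear_smult[OF mod_hom_linear[OF f]]
  show "?l = ?r"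
  proof (rule tens_hom_eqI[of II M M'])
    show "?l \<in> mod_hom R (tens R II M) M'"
      using o f id by (intro compose_mod_hom[of _ _ "tens R II M'"]) simp_all
    show "?r \<in> mod_hom R (tens R II M) M'"
      using o f id by (intro compose_mod_hom[of _ _ M]) simp_all
  qed (use o f in \<open>simp_all add: s\<close>)
  show "?l' = ?r'"
  proof (rule tens_hom_eqI[of M II M'])
    show "?l' \<in> mod_hom R (tens R M II) M'"
      using o f id by (intro compose_mod_hom[of _ _ "tens R M' II"]) simp_all
    show "?r' \<in> mod_hom R (tens R M II) M'"
      using o f id by (intro compose_mod_hom[of _ _ M]) simp_all
  qed (use o f in \<open>simp_all add: s\<close>)
qed

lemma brd_natural:
  assumes o: "M \<in> small_modules R" "M' \<in> small_modules R" "N \<in> small_modules R" "N' \<in> small_modules R"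
    and h: "f \<in> mod_hom R M M'" "g \<in> mod_hom R N N'"
  shows "compose (carrier (tens R M N)) (tens_lift R M' N' (tens R N' M') (\<lambda>x y. tmul R N' M' y x))
      (tens_map R M N M' N' f g) =
    compose (carrier (tens R M N)) (tens_map R N M N' M' g f)
      (tens_lift R M N (tens R N M) (\<lambda>x y. tmul R N M y x))" (is "?l = ?r")
proof (rule tens_hom_eqI[of M N "tens R N' M'"])
  show "?l \<in> mod_hom R (tens R M N) (tens R N' M')"
    using o h by (intro compose_mod_hom[of _ _ "tens R M' N'"]) simp_all
  show "?r \<in> mod_hom R (tens R M N) (tens R N' M')"
    using o h by (intro compose_mod_hom[of _ _ "tens R N M"]) simp_all
qed (use o h mod_hom_closed[OF h(1)] mod_hom_closed[OF h(2)] in \<open>simp_all add: tens_eval compose_eq\<close>)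

lemma pentagon:
  assumes o: "L \<in> small_modules R" "M \<in> small_modules R" "N \<in> small_modules R" "P \<in> small_modules R"
  defines "D \<equiv> tens R (tens R (tens R L M) N) P"
  shows "compose (carrier D) (tens_assoc R L M (tens R N P)) (tens_assoc R (tens R L M) N P) =
    compose (carrier D) (tens_map R L (tens R (tens R M N) P) L (tens R M (tens R N P))
        (\<lambda>x\<in>carrier L. x) (tens_assoc R M N P))
      (compose (carrier D) (tens_assoc R L (tens R M N) P)
        (tens_map R (tens R (tens R L M) N) P (tens R L (tens R M N)) P (tens_assoc R L M N)
          (\<lambda>x\<in>carrier P. x)))" (is "?l = ?r")
proof (rule tens_hom_eqI4[of L M N P "tens R L (tens R M (tens R N P))"])
  show "?l \<in> mod_hom R (tens R (tens R (tens R L M) N) P) (tens R L (tens R M (tens R N P)))"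
    unfolding D_def using o by (intro compose_mod_hom[of _ _ "tens R (tens R L M) (tens R N P)"]) simp_all
  show "?r \<in> mod_hom R (tens R (tens R (tens R L M) N) P) (tens R L (tens R M (tens R N P)))"
    unfolding D_def using o
    by (intro compose_mod_hom[of _ _ "tens R L (tens R (tens R M N) P)"]
        compose_mod_hom[of _ _ "tens R (tens R L (tens R M N)) P"]) simp_all
qed (use o in \<open>simp_all add: D_def tens_eval compose_eq\<close>)

lemma triangle:
  assumes o: "M \<in> small_modules R" "N \<in> small_modules R"
  shows "compose (carrier (tens R (tens R M II) N))
      (tens_map R M (tens R II N) M N (\<lambda>x\<in>carrier M. x) (tens_lift R II N N (\<lambda>r x. r \<odot>\<^bsub>N\<^esub> x)))
      (tens_assoc R M II N) =
    tens_map R (tens R M II) N M N (tens_lift R M II M (\<lambda>x r. r \<odot>\<^bsub>M\<^esub> x)) (\<lambda>x\<in>carrier N. x)"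
    (is "?l = ?r")
proof (rule tens_hom_eqI3[of M II N "tens R M N"])
  show "?l \<in> mod_hom R (tens R (tens R M II) N) (tens R M N)"
    using o by (intro compose_mod_hom[of _ _ "tens R M (tens R II N)"]) simp_all
  interpret M: module R M using o by (simp add: small_modulesD)
  interpret N: module R N using o by (simp add: small_modulesD)
  fix x r y assume "x \<in> carrier M" "r \<in> carrier II" "y \<in> carrier N"
  then show "?l (tmul R (tens R M II) N (tmul R M II x r) y) = ?r (tmul R (tens R M II) N (tmul R M II x r) y)"
    using o by (simp add: tens_eval compose_eq tmul_simps)
qed (use o in simp_all)

lemma hexagon:
  assumes o: "L \<in> small_modules R" "M \<in> small_modules R" "N \<in> small_modules R"
  defines "D \<equiv> tens R (tens R L M) N"
  shows "compose (carrier D) (tens_assoc R M N L) (compose (carrier D)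
      (tens_lift R L (tens R M N) (tens R (tens R M N) L) (\<lambda>x y. tmul R (tens R M N) L y x))
      (tens_assoc R L M N)) =
    compose (carrier D) (tens_map R M (tens R L N) M (tens R N L) (\<lambda>x\<in>carrier M. x)
        (tens_lift R L N (tens R N L) (\<lambda>x y. tmul R N L y x)))
      (compose (carrier D) (tens_assoc R M L N)
        (tens_map R (tens R L M) N (tens R M L) N (tens_lift R L M (tens R M L) (\<lambda>x y. tmul R M L y x))
          (\<lambda>x\<in>carrier N. x)))" (is "?l = ?r")
proof (rule tens_hom_eqI3[of L M N "tens R M (tens R N L)"])
  show "?l \<in> mod_hom R (tens R (tens R L M) N) (tens R M (tens R N L))"
    unfolding D_def using o
    by (intro compose_mod_hom[of _ _ "tens R (tens R M N) L"] compose_mod_hom[of _ _ "tens R L (tens R M N)"])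
      simp_all
  show "?r \<in> mod_hom R (tens R (tens R L M) N) (tens R M (tens R N L))"
    unfolding D_def using o
    by (intro compose_mod_hom[of _ _ "tens R M (tens R L N)"] compose_mod_hom[of _ _ "tens R (tens R M L) N"])
      simp_all
qed (use o in \<open>simp_all add: D_def tens_eval compose_eq\<close>)

theorem Mod_symmetric_monoidal: "symmetric_monoidal_category (Mod R)"
  unfolding symmetric_monoidal_category_def
proof (intro conjI ballI impI)
  show "is_category (Mod R)" by (rule Mod_is_category)
next
  fix M N P assume "M \<in> obj (Mod R)" "N \<in> obj (Mod R)" "P \<in> obj (Mod R)"
  then show "asc (Mod R) M N P \<in> iso_set (Mod R) (tobj (Mod R) (tobj (Mod R) M N) P)
      (tobj (Mod R) M (tobj (Mod R) N P))"
    using asc_iso by (simp del: Mod_simps(10))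
next
  fix M assume "M \<in> obj (Mod R)"
  then show "lun (Mod R) M \<in> iso_set (Mod R) (tobj (Mod R) (tunit (Mod R)) M) M"
    using lun_iso(1) by (simp del: Mod_simps(11))
next
  fix M assume "M \<in> obj (Mod R)"
  then show "run (Mod R) M \<in> iso_set (Mod R) (tobj (Mod R) M (tunit (Mod R))) M"
    using lun_iso(2) by (simp del: Mod_simps(12))
next
  fix M N assume "M \<in> obj (Mod R)" "N \<in> obj (Mod R)"
  then show "brd (Mod R) M N \<in> iso_set (Mod R) (tobj (Mod R) M N) (tobj (Mod R) N M)"
    using brd_iso by (simp del: Mod_simps(13))
next
  fix M N assume "M \<in> obj (Mod R)" "N \<in> obj (Mod R)"
  then show "brd (Mod R) N M \<cdot>\<^bsub>Mod R\<^esub> brd (Mod R) M N = idn (Mod R) (tobj (Mod R) M N)"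
    by (auto simp: compose_def brd_brd)
qed (auto simp: tens_map_id tens_map_compose asc_natural lun_natural brd_natural pentagon triangle hexagon)

end


section \<open>Colimits of modules\<close>

lemma is_categoryD:
  assumes "is_category C"
  shows category_src: "f \<in> arr C \<Longrightarrow> src C f \<in> obj C"
    and category_tgt: "f \<in> arr C \<Longrightarrow> tgt C f \<in> obj C"
    and category_idn: "x \<in> obj C \<Longrightarrow> idn C x \<in> hom_set C x x"
    and category_cmp: "f \<in> hom_set C x y \<Longrightarrow> g \<in> hom_set C y z \<Longrightarrow> g \<cdot>\<^bsub>C\<^esub> f \<in> hom_set C x z"
    and category_idn_right: "f \<in> hom_set C x y \<Longrightarrow> f \<cdot>\<^bsub>C\<^esub> idn C x = f"
    and category_idn_left: "f \<in> hom_set C x y \<Longrightarrow> idn C y \<cdot>\<^bsub>C\<^esub> f = f"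
    and category_assoc: "f \<in> hom_set C w x \<Longrightarrow> g \<in> hom_set C x y \<Longrightarrow> h \<in> hom_set C y z \<Longrightarrow>
      (h \<cdot>\<^bsub>C\<^esub> g) \<cdot>\<^bsub>C\<^esub> f = h \<cdot>\<^bsub>C\<^esub> (g \<cdot>\<^bsub>C\<^esub> f)"
  using assms unfolding is_category_def by blast+

lemma arr_in_hom_set: "f \<in> arr C \<Longrightarrow> f \<in> hom_set C (src C f) (tgt C f)"
  by (simp add: hom_set_def)

lemma hom_set_arr: "f \<in> hom_set C x y \<Longrightarrow> f \<in> arr C"
  and hom_set_src: "f \<in> hom_set C x y \<Longrightarrow> src C f = x"
  and hom_set_tgt: "f \<in> hom_set C x y \<Longrightarrow> tgt C f = y"
  by (simp_all add: hom_set_def)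

lemma is_functorD:
  assumes "is_functor C D F"
  shows functor_source: "is_category C" and functor_target: "is_category D"
    and functor_obj: "x \<in> obj C \<Longrightarrow> fobj F x \<in> obj D"
    and functor_hom: "f \<in> hom_set C x y \<Longrightarrow> farr F f \<in> hom_set D (fobj F x) (fobj F y)"
    and functor_idn: "x \<in> obj C \<Longrightarrow> farr F (idn C x) = idn D (fobj F x)"
    and functor_cmp: "f \<in> hom_set C x y \<Longrightarrow> g \<in> hom_set C y z \<Longrightarrow>
      farr F (g \<cdot>\<^bsub>C\<^esub> f) = farr F g \<cdot>\<^bsub>D\<^esub> farr F f"
  using assms unfolding is_functor_def by blast+

lemma comp_fctr_simps [simp]:
  "fobj (comp_fctr G F) x = fobj G (fobj F x)" "farr (comp_fctr G F) f = farr G (farr F f)"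
  by (simp_all add: comp_fctr_def)

lemma is_functor_comp:
  assumes F: "is_functor C D F" and G: "is_functor D E G"
  shows "is_functor C E (comp_fctr G F)"
  unfolding is_functor_def
  using functor_source[OF F] functor_target[OF G] functor_obj[OF F] functor_obj[OF G]
    functor_hom[OF F] functor_hom[OF G] functor_idn[OF F] functor_idn[OF G] functor_cmp[OF F]
    functor_cmp[OF G functor_hom[OF F] functor_hom[OF F]]
  by auto

lemma functor_cocone:
  assumes F: "is_functor C D F" and E: "is_functor J C E" and c: "is_cocone C J E c \<iota>"
  shows "is_cocone D J (comp_fctr F E) (fobj F c) (\<lambda>j. farr F (\<iota> j))"
  unfolding is_cocone_def
proof (intro conjI ballI)
  show "fobj F c \<in> obj D" using c functor_obj[OF F] by (simp add: is_cocone_def)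
  show "farr F (\<iota> j) \<in> hom_set D (fobj (comp_fctr F E) j) (fobj F c)" if "j \<in> obj J" for j
    using c that functor_hom[OF F] by (simp add: is_cocone_def)
  fix u assume u: "u \<in> arr J"
  have J: "is_category J" using functor_source[OF E] .
  have "farr F (\<iota> (tgt J u) \<cdot>\<^bsub>C\<^esub> farr E u) = farr F (\<iota> (tgt J u)) \<cdot>\<^bsub>D\<^esub> farr F (farr E u)"
    using c category_tgt[OF J u] functor_hom[OF E arr_in_hom_set[OF u]]
    by (intro functor_cmp[OF F]) (auto simp: is_cocone_def)
  then show "farr F (\<iota> (tgt J u)) \<cdot>\<^bsub>D\<^esub> farr (comp_fctr F E) u = farr F (\<iota> (src J u))"
    using c u by (simp add: is_cocone_def)
qed

definition mfun :: "'u mod_arr \<Rightarrow> 'u \<Rightarrow> 'u" where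
  "mfun a = fst (snd a)"

definition mk_arr :: "('u, 'u) module \<Rightarrow> ('u, 'u) module \<Rightarrow> ('u \<Rightarrow> 'u) \<Rightarrow> 'u mod_arr" where
  "mk_arr M N f = (M, restrict f (carrier M), N)"

lemma mfun_tuple [simp]: "mfun (M, f, N) = f"
  by (simp add: mfun_def)

lemma mfun_linear: "a \<in> hom_set (Mod R) M N \<Longrightarrow> linear R M N (mfun a)"
  by (auto elim!: hom_set_ModE intro: mod_hom_linear)

lemma mfun_closed: "a \<in> hom_set (Mod R) M N \<Longrightarrow> x \<in> carrier M \<Longrightarrow> mfun a x \<in> carrier N"
  by (auto elim!: hom_set_ModE intro: mod_hom_closed)

lemma mfun_idn: "x \<in> carrier M \<Longrightarrow> mfun (idn (Mod R) M) x = x"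
  by simp

lemma mfun_cmp:
  "a \<in> hom_set (Mod R) M N \<Longrightarrow> b \<in> hom_set (Mod R) N P \<Longrightarrow> x \<in> carrier M \<Longrightarrow>
     mfun (b \<cdot>\<^bsub>Mod R\<^esub> a) x = mfun b (mfun a x)"
  by (auto elim!: hom_set_ModE simp: compose_eq)

lemma hom_set_Mod_obj:
  "a \<in> hom_set (Mod R) M N \<Longrightarrow> M \<in> small_modules R"
  "a \<in> hom_set (Mod R) M N \<Longrightarrow> N \<in> small_modules R"
  by (auto elim!: hom_set_ModE)

lemma Mod_arr_eqI:
  assumes "a \<in> hom_set (Mod R) M N" "b \<in> hom_set (Mod R) M N"
    and "\<And>x. x \<in> carrier M \<Longrightarrow> mfun a x = mfun b x"
  shows "a = b"
  using assms by (auto elim!: hom_set_ModE intro: mod_hom_eqI)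

lemma mk_arr_hom:
  "\<lbrakk>M \<in> small_modules R; N \<in> small_modules R; linear R M N f\<rbrakk> \<Longrightarrow> mk_arr M N f \<in> hom_set (Mod R) M N"
  by (simp add: mk_arr_def restrict_mod_hom small_modulesD)

lemma mfun_mk_arr [simp]: "x \<in> carrier M \<Longrightarrow> mfun (mk_arr M N f) x = f x"
  by (simp add: mk_arr_def)

lemma cocone_Mod:
  assumes E: "is_functor J (Mod R) E" and c: "is_cocone (Mod R) J E c \<iota>"
  shows "c \<in> small_modules R"
    and "j \<in> obj J \<Longrightarrow> \<iota> j \<in> hom_set (Mod R) (fobj E j) c"
    and "u \<in> arr J \<Longrightarrow> x \<in> carrier (fobj E (src J u)) \<Longrightarrow>
      mfun (\<iota> (tgt J u)) (mfun (farr E u) x) = mfun (\<iota> (src J u)) x"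
proof -
  show "c \<in> small_modules R" using c by (simp add: is_cocone_def)
  show h: "\<iota> j \<in> hom_set (Mod R) (fobj E j) c" if "j \<in> obj J" for j
    using c that by (simp add: is_cocone_def)
  assume u: "u \<in> arr J" and x: "x \<in> carrier (fobj E (src J u))"
  have "\<iota> (tgt J u) \<cdot>\<^bsub>Mod R\<^esub> farr E u = \<iota> (src J u)" using c u by (simp add: is_cocone_def)
  then show "mfun (\<iota> (tgt J u)) (mfun (farr E u) x) = mfun (\<iota> (src J u)) x"
    using mfun_cmp[OF functor_hom[OF E arr_in_hom_set[OF u]]
        h[OF category_tgt[OF functor_source[OF E] u]] x] by simp
qed

lemma cocone_ModI:
  assumes E: "is_functor J (Mod R) E" and c: "c \<in> small_modules R"
    and \<iota>: "\<And>j. j \<in> obj J \<Longrightarrow> \<iota> j \<in> hom_set (Mod R) (fobj E j) c"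
    and compat: "\<And>u x. u \<in> arr J \<Longrightarrow> x \<in> carrier (fobj E (src J u)) \<Longrightarrow>
      mfun (\<iota> (tgt J u)) (mfun (farr E u) x) = mfun (\<iota> (src J u)) x"
  shows "is_cocone (Mod R) J E c \<iota>"
  unfolding is_cocone_def
proof (intro conjI ballI)
  fix u assume u: "u \<in> arr J"
  note t = \<iota>[OF category_tgt[OF functor_source[OF E] u]] and s = \<iota>[OF category_src[OF functor_source[OF E] u]]
    and e = functor_hom[OF E arr_in_hom_set[OF u]]
  show "\<iota> (tgt J u) \<cdot>\<^bsub>Mod R\<^esub> farr E u = \<iota> (src J u)"
    by (rule Mod_arr_eqI[OF category_cmp[OF Mod_is_category e t] s])
      (simp add: mfun_cmp[OF e t] compat[OF u])
qed (use c \<iota> in auto)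

text \<open>
  The next three lemmas translate the universal property of a colimit into statements about linear
  maps and elements: \<open>colimit_Mod_desc\<close> and \<open>colimit_Mod_ext\<close> are its existence and uniqueness halves,
  and \<open>colimit_ModI\<close> is the converse.
\<close>

lemma colimit_Mod_desc:
  assumes E: "is_functor J (Mod R) E" and c: "is_colimit (Mod R) J E c \<iota>" and P: "P \<in> small_modules R"
    and \<kappa>: "\<And>j. j \<in> obj J \<Longrightarrow> linear R (fobj E j) P (\<kappa> j)"
    and compat: "\<And>u x. u \<in> arr J \<Longrightarrow> x \<in> carrier (fobj E (src J u)) \<Longrightarrow>
      \<kappa> (tgt J u) (mfun (farr E u) x) = \<kappa> (src J u) x"
  obtains h where "linear R c P h"
    "\<And>j x. j \<in> obj J \<Longrightarrow> x \<in> carrier (fobj E j) \<Longrightarrow> h (mfun (\<iota> j) x) = \<kappa> j x"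
proof -
  let ?\<kappa> = "\<lambda>j. mk_arr (fobj E j) P (\<kappa> j)"
  have o: "fobj E j \<in> small_modules R" if "j \<in> obj J" for j using functor_obj[OF E that] by simp
  have "is_cocone (Mod R) J E P ?\<kappa>"
  proof (rule cocone_ModI[OF E P])
    show "?\<kappa> j \<in> hom_set (Mod R) (fobj E j) P" if "j \<in> obj J" for j
      using that o P \<kappa> by (intro mk_arr_hom)
    show "mfun (?\<kappa> (tgt J u)) (mfun (farr E u) x) = mfun (?\<kappa> (src J u)) x"
      if u: "u \<in> arr J" and x: "x \<in> carrier (fobj E (src J u))" for u x
      using mfun_closed[OF functor_hom[OF E arr_in_hom_set[OF u]] x] x compat[OF u x] by simp
  qed
  then obtain a where a: "a \<in> hom_set (Mod R) c P" "\<And>j. j \<in> obj J \<Longrightarrow> a \<cdot>\<^bsub>Mod R\<^esub> \<iota> j = ?\<kappa> j"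
    using c unfolding is_colimit_def by (metis (no_types, lifting))
  have "mfun a (mfun (\<iota> j) x) = \<kappa> j x" if j: "j \<in> obj J" and x: "x \<in> carrier (fobj E j)" for j x
  proof -
    have "\<iota> j \<in> hom_set (Mod R) (fobj E j) c" using c j by (simp add: is_colimit_def is_cocone_def)
    from mfun_cmp[OF this a(1) x] show ?thesis using a(2)[OF j] x by simp
  qed
  then show ?thesis using that mfun_linear[OF a(1)] by blast
qed

lemma colimit_Mod_ext:
  assumes E: "is_functor J (Mod R) E" and c: "is_colimit (Mod R) J E c \<iota>" and P: "P \<in> small_modules R"
    and f: "linear R c P f" and g: "linear R c P g"
    and eq: "\<And>j x. j \<in> obj J \<Longrightarrow> x \<in> carrier (fobj E j) \<Longrightarrow> f (mfun (\<iota> j) x) = g (mfun (\<iota> j) x)"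
    and x: "x \<in> carrier c"
  shows "f x = g x"
proof -
  have cc: "is_cocone (Mod R) J E c \<iota>" using c by (simp add: is_colimit_def)
  note m = mk_arr_hom[OF cocone_Mod(1)[OF E cc] P]
  let ?\<kappa> = "\<lambda>j. mk_arr c P f \<cdot>\<^bsub>Mod R\<^esub> \<iota> j"
  note \<iota> = cocone_Mod(2)[OF E cc]
  have "is_cocone (Mod R) J E P ?\<kappa>"
  proof (rule cocone_ModI[OF E P])
    show "?\<kappa> j \<in> hom_set (Mod R) (fobj E j) P" if "j \<in> obj J" for j
      using category_cmp[OF Mod_is_category \<iota>[OF that] m[OF f]] .
    fix u x assume u: "u \<in> arr J" and x: "x \<in> carrier (fobj E (src J u))"
    have "mfun (?\<kappa> (tgt J u)) (mfun (farr E u) x) =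
        mfun (mk_arr c P f) (mfun (\<iota> (tgt J u)) (mfun (farr E u) x))"
      using mfun_closed[OF functor_hom[OF E arr_in_hom_set[OF u]] x]
      by (intro mfun_cmp[OF \<iota> m[OF f]] category_tgt[OF functor_source[OF E] u])
    also have "\<dots> = mfun (mk_arr c P f) (mfun (\<iota> (src J u)) x)"
      by (simp add: cocone_Mod(3)[OF E cc u x])
    also have "\<dots> = mfun (?\<kappa> (src J u)) x"
      using x by (intro mfun_cmp[OF \<iota> m[OF f], symmetric] category_src[OF functor_source[OF E] u])
    finally show "mfun (?\<kappa> (tgt J u)) (mfun (farr E u) x) = mfun (?\<kappa> (src J u)) x" .
  qed
  then have "\<exists>!h. h \<in> hom_set (Mod R) c P \<and> (\<forall>j\<in>obj J. h \<cdot>\<^bsub>Mod R\<^esub> \<iota> j = ?\<kappa> j)"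
    using c by (simp add: is_colimit_def)
  moreover have "mk_arr c P g \<cdot>\<^bsub>Mod R\<^esub> \<iota> j = ?\<kappa> j" if j: "j \<in> obj J" for j
  proof (rule Mod_arr_eqI[OF category_cmp[OF Mod_is_category \<iota>[OF j] m[OF g]]
        category_cmp[OF Mod_is_category \<iota>[OF j] m[OF f]]])
    fix x assume x: "x \<in> carrier (fobj E j)"
    show "mfun (mk_arr c P g \<cdot>\<^bsub>Mod R\<^esub> \<iota> j) x = mfun (?\<kappa> j) x"
      using mfun_cmp[OF \<iota>[OF j] m[OF g] x] mfun_cmp[OF \<iota>[OF j] m[OF f] x] eq[OF j x]
        mfun_closed[OF \<iota>[OF j] x] by simp
  qed
  ultimately have "mk_arr c P f = mk_arr c P g" using m[OF f] m[OF g] by blast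
  then show ?thesis using x by (metis mfun_mk_arr)
qed

lemma colimit_ModI:
  assumes E: "is_functor J (Mod R) E" and c: "is_cocone (Mod R) J E c \<iota>"
    and desc: "\<And>P \<kappa>. \<lbrakk>P \<in> small_modules R; \<And>j. j \<in> obj J \<Longrightarrow> linear R (fobj E j) P (\<kappa> j);
      \<And>u x. u \<in> arr J \<Longrightarrow> x \<in> carrier (fobj E (src J u)) \<Longrightarrow> \<kappa> (tgt J u) (mfun (farr E u) x) = \<kappa> (src J u) x\<rbrakk>
      \<Longrightarrow> \<exists>h. linear R c P h \<and> (\<forall>j\<in>obj J. \<forall>x\<in>carrier (fobj E j). h (mfun (\<iota> j) x) = \<kappa> j x)"
    and ext: "\<And>P f g x. \<lbrakk>P \<in> small_modules R; linear R c P f; linear R c P g;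
      \<And>j x. j \<in> obj J \<Longrightarrow> x \<in> carrier (fobj E j) \<Longrightarrow> f (mfun (\<iota> j) x) = g (mfun (\<iota> j) x);
      x \<in> carrier c\<rbrakk> \<Longrightarrow> f x = g x"
  shows "is_colimit (Mod R) J E c \<iota>"
  unfolding is_colimit_def
proof (intro conjI allI impI c)
  note \<iota> = cocone_Mod(2)[OF E c]
  fix P \<kappa> assume \<kappa>: "is_cocone (Mod R) J E P \<kappa>"
  have P: "P \<in> small_modules R" and k: "\<And>j. j \<in> obj J \<Longrightarrow> \<kappa> j \<in> hom_set (Mod R) (fobj E j) P"
    using cocone_Mod[OF E \<kappa>] by auto
  show "\<exists>!h. h \<in> hom_set (Mod R) c P \<and> (\<forall>j\<in>obj J. h \<cdot>\<^bsub>Mod R\<^esub> \<iota> j = \<kappa> j)"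
  proof (rule ex_ex1I)
    obtain h where h: "linear R c P h"
      "\<And>j x. j \<in> obj J \<Longrightarrow> x \<in> carrier (fobj E j) \<Longrightarrow> h (mfun (\<iota> j) x) = mfun (\<kappa> j) x"
      using desc[OF P, of "\<lambda>j. mfun (\<kappa> j)"] mfun_linear[OF k] cocone_Mod(3)[OF E \<kappa>] by blast
    have a: "mk_arr c P h \<in> hom_set (Mod R) c P" using cocone_Mod(1)[OF E c] P h(1) by (rule mk_arr_hom)
    have "mk_arr c P h \<cdot>\<^bsub>Mod R\<^esub> \<iota> j = \<kappa> j" if j: "j \<in> obj J" for j
      by (rule Mod_arr_eqI[OF category_cmp[OF Mod_is_category \<iota>[OF j] a] k[OF j]])
        (simp add: mfun_cmp[OF \<iota>[OF j] a] mfun_closed[OF \<iota>[OF j]] h(2)[OF j])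
    then show "\<exists>h. h \<in> hom_set (Mod R) c P \<and> (\<forall>j\<in>obj J. h \<cdot>\<^bsub>Mod R\<^esub> \<iota> j = \<kappa> j)" using a by blast
  next
    fix a b assume a: "a \<in> hom_set (Mod R) c P \<and> (\<forall>j\<in>obj J. a \<cdot>\<^bsub>Mod R\<^esub> \<iota> j = \<kappa> j)"
      and b: "b \<in> hom_set (Mod R) c P \<and> (\<forall>j\<in>obj J. b \<cdot>\<^bsub>Mod R\<^esub> \<iota> j = \<kappa> j)"
    show "a = b"
    proof (rule Mod_arr_eqI)
      show "a \<in> hom_set (Mod R) c P" "b \<in> hom_set (Mod R) c P" using a b by blast+
      show "mfun a x = mfun b x" if "x \<in> carrier c" for x
      proof (rule ext[OF P _ _ _ that])
        show "mfun a (mfun (\<iota> j) x) = mfun b (mfun (\<iota> j) x)"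
          if j: "j \<in> obj J" and x: "x \<in> carrier (fobj E j)" for j x
          using mfun_cmp[OF \<iota>[OF j] _ x, of a P] mfun_cmp[OF \<iota>[OF j] _ x, of b P] a b j by simp
      qed (use a b mfun_linear in blast)+
    qed
  qed
qed

lemma symmetric_monoidal_categoryD:
  assumes "symmetric_monoidal_category A"
  shows smc_category: "is_category A"
    and smc_tobj: "x \<in> obj A \<Longrightarrow> y \<in> obj A \<Longrightarrow> tobj A x y \<in> obj A"
    and smc_tarr: "f \<in> hom_set A x x' \<Longrightarrow> g \<in> hom_set A y y' \<Longrightarrow>
      tarr A f g \<in> hom_set A (tobj A x y) (tobj A x' y')"
    and smc_tarr_idn: "x \<in> obj A \<Longrightarrow> y \<in> obj A \<Longrightarrow> tarr A (idn A x) (idn A y) = idn A (tobj A x y)"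
    and smc_tarr_cmp: "\<lbrakk>f \<in> hom_set A x x'; f' \<in> hom_set A x' x''; g \<in> hom_set A y y'; g' \<in> hom_set A y' y''\<rbrakk> \<Longrightarrow>
      tarr A (f' \<cdot>\<^bsub>A\<^esub> f) (g' \<cdot>\<^bsub>A\<^esub> g) = tarr A f' g' \<cdot>\<^bsub>A\<^esub> tarr A f g"
    and smc_tunit: "tunit A \<in> obj A"
proof -
  note a = assms[unfolded symmetric_monoidal_category_def]
  show "is_category A" using a by (elim conjE) assumption
  show "tunit A \<in> obj A" using a by (elim conjE) assumption
  have "\<forall>x\<in>obj A. \<forall>y\<in>obj A. tobj A x y \<in> obj A" using a by (elim conjE) assumption
  then show "x \<in> obj A \<Longrightarrow> y \<in> obj A \<Longrightarrow> tobj A x y \<in> obj A" by blast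
  have "\<forall>x\<in>obj A. \<forall>y\<in>obj A. tarr A (idn A x) (idn A y) = idn A (tobj A x y)"
    using a by (elim conjE) assumption
  then show "x \<in> obj A \<Longrightarrow> y \<in> obj A \<Longrightarrow> tarr A (idn A x) (idn A y) = idn A (tobj A x y)" by blast
  have "\<forall>f\<in>arr A. \<forall>g\<in>arr A.
    tarr A f g \<in> hom_set A (tobj A (src A f) (src A g)) (tobj A (tgt A f) (tgt A g))"
    using a by (elim conjE) assumption
  then show "f \<in> hom_set A x x' \<Longrightarrow> g \<in> hom_set A y y' \<Longrightarrow>
      tarr A f g \<in> hom_set A (tobj A x y) (tobj A x' y')"
    using hom_set_arr hom_set_src hom_set_tgt by metis
  have "\<forall>f\<in>arr A. \<forall>f'\<in>arr A. \<forall>g\<in>arr A. \<forall>g'\<in>arr A.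
        tgt A f = src A f' \<longrightarrow> tgt A g = src A g' \<longrightarrow>
        tarr A (f' \<cdot>\<^bsub>A\<^esub> f) (g' \<cdot>\<^bsub>A\<^esub> g) = tarr A f' g' \<cdot>\<^bsub>A\<^esub> tarr A f g"
    using a by (elim conjE) assumption
  then show "\<lbrakk>f \<in> hom_set A x x'; f' \<in> hom_set A x' x''; g \<in> hom_set A y y'; g' \<in> hom_set A y' y''\<rbrakk> \<Longrightarrow>
      tarr A (f' \<cdot>\<^bsub>A\<^esub> f) (g' \<cdot>\<^bsub>A\<^esub> g) = tarr A f' g' \<cdot>\<^bsub>A\<^esub> tarr A f g"
    using hom_set_arr hom_set_src hom_set_tgt by metis
qed

lemma tensor_functor:
  assumes A: "symmetric_monoidal_category A" and x: "x \<in> obj A"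
  shows "is_functor A A \<lparr>fobj = tobj A x, farr = tarr A (idn A x)\<rparr>"
    and "is_functor A A \<lparr>fobj = (\<lambda>y. tobj A y x), farr = (\<lambda>f. tarr A f (idn A x))\<rparr>"
proof -
  note c = smc_category[OF A]
  note i = category_idn[OF c x]
  have ii: "idn A x \<cdot>\<^bsub>A\<^esub> idn A x = idn A x" using category_idn_left[OF c i] .
  show "is_functor A A \<lparr>fobj = tobj A x, farr = tarr A (idn A x)\<rparr>"
    unfolding is_functor_def
  proof (intro conjI ballI allI)
    show "farr \<lparr>fobj = tobj A x, farr = tarr A (idn A x)\<rparr> (g \<cdot>\<^bsub>A\<^esub> f) =
        farr \<lparr>fobj = tobj A x, farr = tarr A (idn A x)\<rparr> g \<cdot>\<^bsub>A\<^esub> farr \<lparr>fobj = tobj A x, farr = tarr A (idn A x)\<rparr> f"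
      if "f \<in> hom_set A y z" "g \<in> hom_set A z w" for y z w f g
      using smc_tarr_cmp[OF A i i that] ii by simp
  qed (use c x smc_tobj[OF A] smc_tarr[OF A i] smc_tarr_idn[OF A] in auto)
  show "is_functor A A \<lparr>fobj = (\<lambda>y. tobj A y x), farr = (\<lambda>f. tarr A f (idn A x))\<rparr>"
    unfolding is_functor_def
  proof (intro conjI ballI allI)
    show "farr \<lparr>fobj = (\<lambda>y. tobj A y x), farr = (\<lambda>f. tarr A f (idn A x))\<rparr> (g \<cdot>\<^bsub>A\<^esub> f) =
        farr \<lparr>fobj = (\<lambda>y. tobj A y x), farr = (\<lambda>f. tarr A f (idn A x))\<rparr> g \<cdot>\<^bsub>A\<^esub>
        farr \<lparr>fobj = (\<lambda>y. tobj A y x), farr = (\<lambda>f. tarr A f (idn A x))\<rparr> f"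
      if "f \<in> hom_set A y z" "g \<in> hom_set A z w" for y z w f g
      using smc_tarr_cmp[OF A that i i] ii by simp
  qed (use c x smc_tobj[OF A] smc_tarr[OF A _ i] smc_tarr_idn[OF A] in auto)
qed

context small_cring
begin

text \<open>
  The colimit is generated by the disjoint union of the members of the diagram, subject to all
  relations valid in cocones.
\<close>

lemma Mod_cocomplete: "cocomplete TYPE('u) (Mod R)"
  unfolding cocomplete_def
proof (intro allI impI)
  fix J :: "('u, 'u) category" and E :: "('u, 'u, ('u, 'u) module, 'u mod_arr) fctr"
  assume J: "small_category TYPE('u) J" and E: "is_functor J (Mod R) E"
  let ?X = "Sigma (obj J) (\<lambda>j. carrier (fobj E j))"
  define \<Phi> where "\<Phi> P \<beta> \<longleftrightarrow> (\<forall>j\<in>obj J. linear R (fobj E j) P (\<lambda>x. \<beta> (j, x))) \<and>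
    (\<forall>u\<in>arr J. \<forall>x\<in>carrier (fobj E (src J u)). \<beta> (tgt J u, mfun (farr E u) x) = \<beta> (src J u, x))"
    for P :: "('u, 'u) module" and \<beta>
  have o: "fobj E j \<in> small_modules R" if "j \<in> obj J" for j using functor_obj[OF E that] by simp
  have X: "small TYPE('u) ?X"
    using J small_modules_small[OF o] by (intro small_Sigma universe) (auto simp: small_category_def)
  obtain Q \<gamma> where Q: "Q \<in> small_modules R" and \<gamma>: "\<gamma> \<in> ?X \<rightarrow> carrier Q"
    and span: "spans R Q (\<gamma> ` ?X)"
    and lift: "\<And>P \<beta>. \<lbrakk>P \<in> small_modules R; \<beta> \<in> ?X \<rightarrow> carrier P; \<Phi> P \<beta>\<rbrakk> \<Longrightarrow>
      \<exists>h. linear R Q P h \<and> (\<forall>x\<in>?X. h (\<gamma> x) = \<beta> x)"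
    and sep: "\<And>a b. \<lbrakk>a \<in> carrier Q; b \<in> carrier Q; \<And>P \<beta> h. \<lbrakk>P \<in> small_modules R;
        \<beta> \<in> ?X \<rightarrow> carrier P; \<Phi> P \<beta>;
        linear R Q P h; \<And>x. x \<in> ?X \<Longrightarrow> h (\<gamma> x) = \<beta> x\<rbrakk> \<Longrightarrow> h a = h b\<rbrakk> \<Longrightarrow> a = b"
    using presented_module[OF X, where \<Phi> = \<Phi>] by blast
  interpret Q: module R Q using Q by (rule small_modulesD)
  have c: "\<gamma> (j, x) \<in> carrier Q" if "j \<in> obj J" "x \<in> carrier (fobj E j)" for j x
    using \<gamma> that by auto
  have lin: "linear R (fobj E j) Q (\<lambda>x. \<gamma> (j, x))" if j: "j \<in> obj J" for j
  proof (rule linearI)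
    interpret Ej: module R "fobj E j" using o[OF j] by (rule small_modulesD)
    show "\<gamma> (j, x) \<in> carrier Q" if "x \<in> carrier (fobj E j)" for x using j that by (rule c)
    show "\<gamma> (j, x \<oplus>\<^bsub>fobj E j\<^esub> y) = \<gamma> (j, x) \<oplus>\<^bsub>Q\<^esub> \<gamma> (j, y)"
      if x: "x \<in> carrier (fobj E j)" and y: "y \<in> carrier (fobj E j)" for x y
    proof (rule sep)
      fix P \<beta> h assume \<Phi>: "\<Phi> P \<beta>" and h: "linear R Q P h" "\<And>x. x \<in> ?X \<Longrightarrow> h (\<gamma> x) = \<beta> x"
      have "linear R (fobj E j) P (\<lambda>x. \<beta> (j, x))" using \<Phi> j by (simp add: \<Phi>_def)
      from linear_add[OF this x y]
      show "h (\<gamma> (j, x \<oplus>\<^bsub>fobj E j\<^esub> y)) = h (\<gamma> (j, x) \<oplus>\<^bsub>Q\<^esub> \<gamma> (j, y))"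
        using j x y by (simp add: linear_add[OF h(1)] c h(2))
    qed (use j x y in \<open>simp_all add: c\<close>)
    show "\<gamma> (j, r \<odot>\<^bsub>fobj E j\<^esub> x) = r \<odot>\<^bsub>Q\<^esub> \<gamma> (j, x)"
      if r: "r \<in> carrier R" and x: "x \<in> carrier (fobj E j)" for r x
    proof (rule sep)
      fix P \<beta> h assume \<Phi>: "\<Phi> P \<beta>" and h: "linear R Q P h" "\<And>x. x \<in> ?X \<Longrightarrow> h (\<gamma> x) = \<beta> x"
      have "linear R (fobj E j) P (\<lambda>x. \<beta> (j, x))" using \<Phi> j by (simp add: \<Phi>_def)
      from linear_smult[OF this r x]
      show "h (\<gamma> (j, r \<odot>\<^bsub>fobj E j\<^esub> x)) = h (r \<odot>\<^bsub>Q\<^esub> \<gamma> (j, x))"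
        using j r x by (simp add: linear_smult[OF h(1)] c h(2))
    qed (use j r x in \<open>simp_all add: c\<close>)
  qed
  define \<iota> where "\<iota> j = mk_arr (fobj E j) Q (\<lambda>x. \<gamma> (j, x))" for j
  note e = functor_hom[OF E arr_in_hom_set]
  have st: "src J u \<in> obj J" "tgt J u \<in> obj J" if "u \<in> arr J" for u
    using category_src[OF functor_source[OF E] that] category_tgt[OF functor_source[OF E] that] .
  have cone: "is_cocone (Mod R) J E Q \<iota>"
  proof (rule cocone_ModI[OF E Q])
    show "\<iota> j \<in> hom_set (Mod R) (fobj E j) Q" if "j \<in> obj J" for j
      unfolding \<iota>_def by (rule mk_arr_hom[OF o[OF that] Q lin[OF that]])
    fix u x assume u: "u \<in> arr J" and x: "x \<in> carrier (fobj E (src J u))"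
    note t = mfun_closed[OF e[OF u] x]
    have "\<gamma> (tgt J u, mfun (farr E u) x) = \<gamma> (src J u, x)"
    proof (rule sep)
      fix P \<beta> h assume \<Phi>: "\<Phi> P \<beta>" and h: "linear R Q P h" "\<And>x. x \<in> ?X \<Longrightarrow> h (\<gamma> x) = \<beta> x"
      show "h (\<gamma> (tgt J u, mfun (farr E u) x)) = h (\<gamma> (src J u, x))"
        using \<Phi> u x h(2)[of "(tgt J u, mfun (farr E u) x)"] h(2)[of "(src J u, x)"] t st[OF u]
        by (simp add: \<Phi>_def)
    qed (simp_all add: c[OF st(2)[OF u] t] c[OF st(1)[OF u] x])
    then show "mfun (\<iota> (tgt J u)) (mfun (farr E u) x) = mfun (\<iota> (src J u)) x"
      by (simp only: \<iota>_def mfun_mk_arr[OF x] mfun_mk_arr[OF t])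
  qed
  have "is_colimit (Mod R) J E Q \<iota>"
  proof (rule colimit_ModI[OF E cone])
    fix P \<kappa> assume P: "P \<in> small_modules R" and \<kappa>: "\<And>j. j \<in> obj J \<Longrightarrow> linear R (fobj E j) P (\<kappa> j)"
      and compat: "\<And>u x. u \<in> arr J \<Longrightarrow> x \<in> carrier (fobj E (src J u)) \<Longrightarrow>
        \<kappa> (tgt J u) (mfun (farr E u) x) = \<kappa> (src J u) x"
    have "case_prod \<kappa> \<in> ?X \<rightarrow> carrier P" using linear_closed[OF \<kappa>] by auto
    moreover have "\<Phi> P (case_prod \<kappa>)" using \<kappa> compat by (simp add: \<Phi>_def)
    ultimately obtain h where h: "linear R Q P h" "\<forall>x\<in>?X. h (\<gamma> x) = case_prod \<kappa> x"
      using lift[OF P] by blast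
    then show "\<exists>h. linear R Q P h \<and> (\<forall>j\<in>obj J. \<forall>x\<in>carrier (fobj E j). h (mfun (\<iota> j) x) = \<kappa> j x)"
      by (intro exI[of _ h]) (auto simp: \<iota>_def)
  next
    fix P f g x assume P: "P \<in> small_modules R" and f: "linear R Q P f" and g: "linear R Q P g"
      and eq: "\<And>j x. j \<in> obj J \<Longrightarrow> x \<in> carrier (fobj E j) \<Longrightarrow> f (mfun (\<iota> j) x) = g (mfun (\<iota> j) x)"
      and x: "x \<in> carrier Q"
    show "f x = g x"
      by (rule linear_agree[OF Q.module_axioms small_modulesD[OF P] f g span _ x])
        (use eq in \<open>auto simp: \<iota>_def\<close>)
  qed
  then show "\<exists>c \<iota>. is_colimit (Mod R) J E c \<iota>" by blast
qed

text \<open>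
  For each fixed left argument the given maps form a cocone, and the maps out of the colimit so
  obtained depend linearly on the left argument by uniqueness.
\<close>

lemma bilinear_colimit:
  assumes E: "is_functor J (Mod R) E" and c: "is_colimit (Mod R) J E c \<iota>"
    and M: "M \<in> small_modules R" and P: "P \<in> small_modules R"
    and \<beta>: "\<And>j. j \<in> obj J \<Longrightarrow> bilinear_map R M (fobj E j) P (\<beta> j)"
    and compat: "\<And>u m x. \<lbrakk>u \<in> arr J; m \<in> carrier M; x \<in> carrier (fobj E (src J u))\<rbrakk> \<Longrightarrow>
      \<beta> (tgt J u) m (mfun (farr E u) x) = \<beta> (src J u) m x"
  shows "\<exists>\<gamma>. bilinear_map R M c P \<gamma> \<and>
    (\<forall>j\<in>obj J. \<forall>m\<in>carrier M. \<forall>x\<in>carrier (fobj E j). \<gamma> m (mfun (\<iota> j) x) = \<beta> j m x)"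
proof -
  interpret M: module R M using M by (rule small_modulesD)
  have Pm: "module R P" using P by (rule small_modulesD)
  have \<iota>: "\<iota> j \<in> hom_set (Mod R) (fobj E j) c" if "j \<in> obj J" for j
    using c that by (simp add: is_colimit_def is_cocone_def)
  have "\<exists>h. linear R c P h \<and> (\<forall>j\<in>obj J. \<forall>x\<in>carrier (fobj E j). h (mfun (\<iota> j) x) = \<beta> j m x)"
    if m: "m \<in> carrier M" for m
  proof (rule colimit_Mod_desc[OF E c P, of "\<lambda>j. \<beta> j m"])
    show "linear R (fobj E j) P (\<beta> j m)" if "j \<in> obj J" for j
      using bilinear_map_linear(1)[OF \<beta>[OF that] m] .
    show "\<beta> (tgt J u) m (mfun (farr E u) x) = \<beta> (src J u) m x"
      if "u \<in> arr J" "x \<in> carrier (fobj E (src J u))" for u x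
      using compat[OF that(1) m that(2)] .
    show ?thesis if "linear R c P h"
      "\<And>j x. j \<in> obj J \<Longrightarrow> x \<in> carrier (fobj E j) \<Longrightarrow> h (mfun (\<iota> j) x) = \<beta> j m x" for h
      using that by blast
  qed
  then obtain \<gamma> where \<gamma>: "\<And>m. m \<in> carrier M \<Longrightarrow> linear R c P (\<gamma> m)"
    "\<And>m j x. m \<in> carrier M \<Longrightarrow> j \<in> obj J \<Longrightarrow> x \<in> carrier (fobj E j) \<Longrightarrow> \<gamma> m (mfun (\<iota> j) x) = \<beta> j m x"
    by metis
  have "bilinear_map R M c P \<gamma>"
  proof (rule bilinear_mapI)
    show "\<gamma> (m \<oplus>\<^bsub>M\<^esub> m') y = \<gamma> m y \<oplus>\<^bsub>P\<^esub> \<gamma> m' y"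
      if "m \<in> carrier M" "m' \<in> carrier M" "y \<in> carrier c" for m m' y
    proof (rule colimit_Mod_ext[OF E c P \<gamma>(1) linear_sum[OF Pm \<gamma>(1) \<gamma>(1)] _ that(3)])
      fix j x assume j: "j \<in> obj J" and x: "x \<in> carrier (fobj E j)"
      show "\<gamma> (m \<oplus>\<^bsub>M\<^esub> m') (mfun (\<iota> j) x) = \<gamma> m (mfun (\<iota> j) x) \<oplus>\<^bsub>P\<^esub> \<gamma> m' (mfun (\<iota> j) x)"
        using linear_add[OF bilinear_map_linear(2)[OF \<beta>[OF j] x] that(1,2)] that(1,2) j x by (simp add: \<gamma>(2))
    qed (use that in simp_all)
    show "\<gamma> (r \<odot>\<^bsub>M\<^esub> m) y = r \<odot>\<^bsub>P\<^esub> \<gamma> m y"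
      if "r \<in> carrier R" "m \<in> carrier M" "y \<in> carrier c" for r m y
    proof (rule colimit_Mod_ext[OF E c P \<gamma>(1) linear_scale[OF Pm \<gamma>(1)] _ that(3)])
      fix j x assume j: "j \<in> obj J" and x: "x \<in> carrier (fobj E j)"
      show "\<gamma> (r \<odot>\<^bsub>M\<^esub> m) (mfun (\<iota> j) x) = r \<odot>\<^bsub>P\<^esub> \<gamma> m (mfun (\<iota> j) x)"
        using linear_smult[OF bilinear_map_linear(2)[OF \<beta>[OF j] x] that(1,2)] that(1,2) j x by (simp add: \<gamma>(2))
    qed (use that in simp_all)
  qed (simp_all add: linear_closed[OF \<gamma>(1)] linear_add[OF \<gamma>(1)] linear_smult[OF \<gamma>(1)])
  then show ?thesis using \<gamma>(2) by blast
qed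

lemma mfun_tarr:
  assumes "a \<in> hom_set (Mod R) M M'" "b \<in> hom_set (Mod R) N N'" "x \<in> carrier M" "y \<in> carrier N"
  shows "mfun (tarr (Mod R) a b) (tmul R M N x y) = tmul R M' N' (mfun a x) (mfun b y)"
  using assms by (auto elim!: hom_set_ModE simp: tens_map_tmul)

text \<open>
  A cocone under \<open>M \<otimes> E\<close> is a compatible family of bilinear maps, and these glue.
\<close>

lemma tensor_left_cocontinuous:
  assumes M: "M \<in> small_modules R"
  shows "cocontinuous TYPE('u) (Mod R) (Mod R) \<lparr>fobj = tobj (Mod R) M, farr = tarr (Mod R) (idn (Mod R) M)\<rparr>"
    (is "cocontinuous _ _ _ ?T")
  unfolding cocontinuous_def preserves_colimits_def
proof (intro allI impI)
  fix J :: "('u, 'u) category" and E :: "('u, 'u, ('u, 'u) module, 'u mod_arr) fctr" and c \<iota>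
  assume E: "is_functor J (Mod R) E" and c: "is_colimit (Mod R) J E c \<iota>"
  have T: "is_functor (Mod R) (Mod R) ?T" using tensor_functor(1)[OF Mod_symmetric_monoidal] M by simp
  note TE = is_functor_comp[OF E T]
  have cc: "is_cocone (Mod R) J E c \<iota>" using c by (simp add: is_colimit_def)
  note \<iota> = cocone_Mod(2)[OF E cc] and cs = cocone_Mod(1)[OF E cc]
  have o: "fobj E j \<in> small_modules R" if "j \<in> obj J" for j using functor_obj[OF E that] by simp
  have i: "idn (Mod R) M \<in> hom_set (Mod R) M M" using M by simp
  have ev: "mfun (farr ?T a) (tmul R M N m x) = tmul R M N' m (mfun a x)"
    if "a \<in> hom_set (Mod R) N N'" "m \<in> carrier M" "x \<in> carrier N" for a N N' m x
    using mfun_tarr[OF i that(1,2,3)] that(2) by (simp add: mfun_idn del: Mod_simps)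
  show "is_colimit (Mod R) J (comp_fctr ?T E) (fobj ?T c) (\<lambda>j. farr ?T (\<iota> j))"
  proof (rule colimit_ModI[OF TE functor_cocone[OF T E cc]])
    fix P \<kappa> assume P: "P \<in> small_modules R"
      and \<kappa>: "\<And>j. j \<in> obj J \<Longrightarrow> linear R (fobj (comp_fctr ?T E) j) P (\<kappa> j)"
      and compat: "\<And>u x. u \<in> arr J \<Longrightarrow> x \<in> carrier (fobj (comp_fctr ?T E) (src J u)) \<Longrightarrow>
        \<kappa> (tgt J u) (mfun (farr (comp_fctr ?T E) u) x) = \<kappa> (src J u) x"
    have \<kappa>': "linear R (tens R M (fobj E j)) P (\<kappa> j)" if "j \<in> obj J" for j using \<kappa>[OF that] by simp
    have bil: "bilinear_map R M (fobj E j) P (\<lambda>m x. \<kappa> j (tmul R M (fobj E j) m x))" if j: "j \<in> obj J" for j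
      using M o[OF j] by (intro bilinear_mapI)
        (simp_all add: linear_closed[OF \<kappa>'[OF j]] linear_add[OF \<kappa>'[OF j]] linear_smult[OF \<kappa>'[OF j]] tmul_simps)
    have com: "\<kappa> (tgt J u) (tmul R M (fobj E (tgt J u)) m (mfun (farr E u) x)) =
        \<kappa> (src J u) (tmul R M (fobj E (src J u)) m x)"
      if "u \<in> arr J" "m \<in> carrier M" "x \<in> carrier (fobj E (src J u))" for u m x
      using compat[OF that(1), of "tmul R M (fobj E (src J u)) m x"] M that
        ev[OF functor_hom[OF E arr_in_hom_set[OF that(1)]] that(2,3)]
        o[OF category_src[OF functor_source[OF E] that(1)]] by (simp del: Mod_simps(8))
    obtain \<gamma> where \<gamma>: "bilinear_map R M c P \<gamma>"
      "\<forall>j\<in>obj J. \<forall>m\<in>carrier M. \<forall>x\<in>carrier (fobj E j). \<gamma> m (mfun (\<iota> j) x) = \<kappa> j (tmul R M (fobj E j) m x)"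
      using bilinear_colimit[OF E c M P, of "\<lambda>j m x. \<kappa> j (tmul R M (fobj E j) m x)"] bil com by blast
    note l = tens_lift[OF M cs P \<gamma>(1)]
    have "tens_lift R M c P \<gamma> (mfun (farr ?T (\<iota> j)) t) = \<kappa> j t"
      if j: "j \<in> obj J" and t: "t \<in> carrier (tens R M (fobj E j))" for j t
    proof (rule tens_ext[OF M o[OF j] P _ \<kappa>'[OF j] _ t])
      show "linear R (tens R M (fobj E j)) P (\<lambda>t. tens_lift R M c P \<gamma> (mfun (farr ?T (\<iota> j)) t))"
        using linear_comp[OF mfun_linear[OF functor_hom[OF T \<iota>[OF j]]]] mod_hom_linear[OF l(1)] by simp
      show "tens_lift R M c P \<gamma> (mfun (farr ?T (\<iota> j)) (tmul R M (fobj E j) m x)) =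
          \<kappa> j (tmul R M (fobj E j) m x)" if "m \<in> carrier M" "x \<in> carrier (fobj E j)" for m x
        using ev[OF \<iota>[OF j] that] that l(2) mfun_closed[OF \<iota>[OF j]] \<gamma>(2) j by simp
    qed
    then show "\<exists>h. linear R (fobj ?T c) P h \<and> (\<forall>j\<in>obj J. \<forall>x\<in>carrier (fobj (comp_fctr ?T E) j).
        h (mfun (farr ?T (\<iota> j)) x) = \<kappa> j x)"
      using mod_hom_linear[OF l(1)] by (intro exI[of _ "tens_lift R M c P \<gamma>"]) simp
  next
    fix P f g t assume P: "P \<in> small_modules R" and f: "linear R (fobj ?T c) P f"
      and g: "linear R (fobj ?T c) P g" and t: "t \<in> carrier (fobj ?T c)"
      and eq: "\<And>j x. j \<in> obj J \<Longrightarrow> x \<in> carrier (fobj (comp_fctr ?T E) j) \<Longrightarrow>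
        f (mfun (farr ?T (\<iota> j)) x) = g (mfun (farr ?T (\<iota> j)) x)"
    have f': "linear R (tens R M c) P f" and g': "linear R (tens R M c) P g" using f g by simp_all
    show "f t = g t"
    proof (rule tens_ext[OF M cs P f' g'])
      show "t \<in> carrier (tens R M c)" using t by simp
      fix m y assume m: "m \<in> carrier M" and y: "y \<in> carrier c"
      note b = bilinear_map_linear(1)[OF tmul_bilinear[OF M cs] m]
      show "f (tmul R M c m y) = g (tmul R M c m y)"
      proof (rule colimit_Mod_ext[OF E c P linear_comp[OF b f'] linear_comp[OF b g'] _ y])
        fix j x assume j: "j \<in> obj J" and x: "x \<in> carrier (fobj E j)"
        show "f (tmul R M c m (mfun (\<iota> j) x)) = g (tmul R M c m (mfun (\<iota> j) x))"
          using eq[OF j, of "tmul R M (fobj E j) m x"] ev[OF \<iota>[OF j] m x] M o[OF j] m x by simp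
      qed
    qed
  qed
qed

end


lemma is_isoE:
  assumes "f \<in> hom_set C x y" "is_iso C f"
  obtains g where "g \<in> hom_set C y x" "g \<cdot>\<^bsub>C\<^esub> f = idn C x" "f \<cdot>\<^bsub>C\<^esub> g = idn C y"
  using assms unfolding is_iso_def by (auto simp: hom_set_src hom_set_tgt)

lemma nat_isoD:
  assumes "nat_iso C D F G \<alpha>"
  shows nat_iso_trans: "nat_trans C D F G \<alpha>" and nat_iso_iso: "x \<in> obj C \<Longrightarrow> is_iso D (\<alpha> x)"
  using assms by (simp_all add: nat_iso_def)

lemma nat_transD:
  assumes "nat_trans C D F G \<alpha>"
  shows nat_trans_hom: "x \<in> obj C \<Longrightarrow> \<alpha> x \<in> hom_set D (fobj F x) (fobj G x)"
    and nat_trans_natural: "f \<in> hom_set C x y \<Longrightarrow> \<alpha> y \<cdot>\<^bsub>D\<^esub> farr F f = farr G f \<cdot>\<^bsub>D\<^esub> \<alpha> x"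
  using assms unfolding nat_trans_def hom_set_def by auto

text \<open>
  Composing with the transformation turns cocones under \<open>G E\<close> into cocones under \<open>F E\<close>; an induced
  arrow out of \<open>F c\<close> is moved to \<open>G c\<close> by the inverse of the component at \<open>c\<close>.
\<close>

lemma preserves_colimits_nat_iso:
  fixes C :: "('o, 'a, 'y) category_scheme" and J :: "('i, 'j, 'x) category_scheme"
  assumes F: "is_functor C D F" and G: "is_functor C D G" and \<alpha>: "nat_iso C D F G \<alpha>"
    and pres: "preserves_colimits J C D F"
  shows "preserves_colimits J C D G"
  unfolding preserves_colimits_def
proof (intro allI impI)
  fix E :: "('i, 'j, 'o, 'a) fctr" and c \<iota>
  assume E: "is_functor J C E" and c: "is_colimit C J E c \<iota>"
  have cc: "is_cocone C J E c \<iota>" using c by (simp add: is_colimit_def)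
  have co: "c \<in> obj C" and \<iota>: "\<And>j. j \<in> obj J \<Longrightarrow> \<iota> j \<in> hom_set C (fobj E j) c"
    using cc by (simp_all add: is_cocone_def)
  note D = functor_target[OF F] and J = functor_source[OF E]
  note D_cmp = category_cmp[OF D] and D_assoc = category_assoc[OF D]
  note \<alpha>h = nat_trans_hom[OF nat_iso_trans[OF \<alpha>]] and nat = nat_trans_natural[OF nat_iso_trans[OF \<alpha>]]
  have Fc: "is_colimit D J (comp_fctr F E) (fobj F c) (\<lambda>j. farr F (\<iota> j))"
    using pres E c by (simp add: preserves_colimits_def)
  obtain \<beta> where \<beta>: "\<beta> \<in> hom_set D (fobj G c) (fobj F c)" "\<beta> \<cdot>\<^bsub>D\<^esub> \<alpha> c = idn D (fobj F c)"
    "\<alpha> c \<cdot>\<^bsub>D\<^esub> \<beta> = idn D (fobj G c)"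
    using is_isoE[OF \<alpha>h[OF co] nat_iso_iso[OF \<alpha> co]] by blast
  show "is_colimit D J (comp_fctr G E) (fobj G c) (\<lambda>j. farr G (\<iota> j))"
    unfolding is_colimit_def
  proof (intro conjI allI impI)
    show "is_cocone D J (comp_fctr G E) (fobj G c) (\<lambda>j. farr G (\<iota> j))"
      using G E cc by (rule functor_cocone)
    fix d \<kappa> assume \<kappa>: "is_cocone D J (comp_fctr G E) d \<kappa>"
    have k: "\<kappa> j \<in> hom_set D (fobj G (fobj E j)) d" if "j \<in> obj J" for j
      using \<kappa> that by (simp add: is_cocone_def)
    have a: "\<alpha> (fobj E j) \<in> hom_set D (fobj F (fobj E j)) (fobj G (fobj E j))" if "j \<in> obj J" for j
      using \<alpha>h functor_obj[OF E that] by blast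
    let ?\<kappa> = "\<lambda>j. \<kappa> j \<cdot>\<^bsub>D\<^esub> \<alpha> (fobj E j)"
    have "is_cocone D J (comp_fctr F E) d ?\<kappa>"
      unfolding is_cocone_def
    proof (intro conjI ballI)
      show "d \<in> obj D" using \<kappa> by (simp add: is_cocone_def)
      show "?\<kappa> j \<in> hom_set D (fobj (comp_fctr F E) j) d" if "j \<in> obj J" for j
        using D_cmp[OF a k] that by simp
      fix u assume u: "u \<in> arr J"
      note s = category_src[OF J u] and t = category_tgt[OF J u] and e = functor_hom[OF E arr_in_hom_set[OF u]]
      have "?\<kappa> (tgt J u) \<cdot>\<^bsub>D\<^esub> farr F (farr E u) =
          \<kappa> (tgt J u) \<cdot>\<^bsub>D\<^esub> (\<alpha> (fobj E (tgt J u)) \<cdot>\<^bsub>D\<^esub> farr F (farr E u))"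
        by (rule D_assoc[OF functor_hom[OF F e] a[OF t] k[OF t]])
      also have "\<dots> = (\<kappa> (tgt J u) \<cdot>\<^bsub>D\<^esub> farr G (farr E u)) \<cdot>\<^bsub>D\<^esub> \<alpha> (fobj E (src J u))"
        by (simp add: nat[OF e] D_assoc[OF a[OF s] functor_hom[OF G e] k[OF t]])
      also have "\<kappa> (tgt J u) \<cdot>\<^bsub>D\<^esub> farr G (farr E u) = \<kappa> (src J u)"
        using \<kappa> u by (simp add: is_cocone_def)
      finally show "?\<kappa> (tgt J u) \<cdot>\<^bsub>D\<^esub> farr (comp_fctr F E) u = ?\<kappa> (src J u)" by simp
    qed
    then have ex1: "\<exists>!h. h \<in> hom_set D (fobj F c) d \<and> (\<forall>j\<in>obj J. h \<cdot>\<^bsub>D\<^esub> farr F (\<iota> j) = ?\<kappa> j)"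
      using Fc by (simp add: is_colimit_def)
    have key: "(g \<cdot>\<^bsub>D\<^esub> \<alpha> c) \<cdot>\<^bsub>D\<^esub> farr F (\<iota> j) = (g \<cdot>\<^bsub>D\<^esub> farr G (\<iota> j)) \<cdot>\<^bsub>D\<^esub> \<alpha> (fobj E j)"
      if g: "g \<in> hom_set D (fobj G c) d" and j: "j \<in> obj J" for g j
      using D_assoc[OF functor_hom[OF F \<iota>[OF j]] \<alpha>h[OF co] g]
        D_assoc[OF a[OF j] functor_hom[OF G \<iota>[OF j]] g] nat[OF \<iota>[OF j]] by simp
    show "\<exists>!h. h \<in> hom_set D (fobj G c) d \<and> (\<forall>j\<in>obj J. h \<cdot>\<^bsub>D\<^esub> farr G (\<iota> j) = \<kappa> j)"
    proof (rule ex_ex1I)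
      obtain h where h: "h \<in> hom_set D (fobj F c) d" "\<And>j. j \<in> obj J \<Longrightarrow> h \<cdot>\<^bsub>D\<^esub> farr F (\<iota> j) = ?\<kappa> j"
        using ex1 by blast
      let ?h = "h \<cdot>\<^bsub>D\<^esub> \<beta>"
      have hh: "?h \<in> hom_set D (fobj G c) d" using D_cmp[OF \<beta>(1) h(1)] .
      have ha: "?h \<cdot>\<^bsub>D\<^esub> \<alpha> c = h"
        using D_assoc[OF \<alpha>h[OF co] \<beta>(1) h(1)] \<beta>(2) category_idn_right[OF D h(1)] by simp
      have "?h \<cdot>\<^bsub>D\<^esub> farr G (\<iota> j) = \<kappa> j" if j: "j \<in> obj J" for j
      proof -
        note g = functor_hom[OF G \<iota>[OF j]]
        obtain b where b: "b \<in> hom_set D (fobj G (fobj E j)) (fobj F (fobj E j))"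
          "\<alpha> (fobj E j) \<cdot>\<^bsub>D\<^esub> b = idn D (fobj G (fobj E j))"
          using is_isoE[OF a[OF j] nat_iso_iso[OF \<alpha> functor_obj[OF E j]]] by blast
        have "(?h \<cdot>\<^bsub>D\<^esub> farr G (\<iota> j)) \<cdot>\<^bsub>D\<^esub> \<alpha> (fobj E j) = \<kappa> j \<cdot>\<^bsub>D\<^esub> \<alpha> (fobj E j)"
          using key[OF hh j] ha h(2)[OF j] by simp
        then have "((?h \<cdot>\<^bsub>D\<^esub> farr G (\<iota> j)) \<cdot>\<^bsub>D\<^esub> \<alpha> (fobj E j)) \<cdot>\<^bsub>D\<^esub> b = (\<kappa> j \<cdot>\<^bsub>D\<^esub> \<alpha> (fobj E j)) \<cdot>\<^bsub>D\<^esub> b" by simp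
        then show ?thesis
          using D_assoc[OF b(1) a[OF j] D_cmp[OF g hh]] D_assoc[OF b(1) a[OF j] k[OF j]] b(2)
            category_idn_right[OF D D_cmp[OF g hh]] category_idn_right[OF D k[OF j]] by simp
      qed
      then show "\<exists>h. h \<in> hom_set D (fobj G c) d \<and> (\<forall>j\<in>obj J. h \<cdot>\<^bsub>D\<^esub> farr G (\<iota> j) = \<kappa> j)" using hh by blast
    next
      fix g g' assume g: "g \<in> hom_set D (fobj G c) d \<and> (\<forall>j\<in>obj J. g \<cdot>\<^bsub>D\<^esub> farr G (\<iota> j) = \<kappa> j)"
        and g': "g' \<in> hom_set D (fobj G c) d \<and> (\<forall>j\<in>obj J. g' \<cdot>\<^bsub>D\<^esub> farr G (\<iota> j) = \<kappa> j)"
      have gh: "g \<in> hom_set D (fobj G c) d" "g' \<in> hom_set D (fobj G c) d" using g g' by blast+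
      have "g \<cdot>\<^bsub>D\<^esub> \<alpha> c = g' \<cdot>\<^bsub>D\<^esub> \<alpha> c"
        using ex1 D_cmp[OF \<alpha>h[OF co] gh(1)] D_cmp[OF \<alpha>h[OF co] gh(2)] key[OF gh(1)] key[OF gh(2)] g g'
        by (metis (no_types, lifting))
      then have "(g \<cdot>\<^bsub>D\<^esub> \<alpha> c) \<cdot>\<^bsub>D\<^esub> \<beta> = (g' \<cdot>\<^bsub>D\<^esub> \<alpha> c) \<cdot>\<^bsub>D\<^esub> \<beta>" by simp
      then show "g = g'"
        using D_assoc[OF \<beta>(1) \<alpha>h[OF co]] gh \<beta>(3) category_idn_right[OF D] by simp
    qed
  qed
qed

text \<open>
  The arrow from the tensor unit that picks out the element \<open>x\<close>.
\<close>

definition pt :: "'u ring \<Rightarrow> ('u, 'u) module \<Rightarrow> 'u \<Rightarrow> 'u mod_arr" where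
  "pt R M x = mk_arr (scalar_module (\<lambda>r. r) R) M (\<lambda>r. r \<odot>\<^bsub>M\<^esub> x)"

definition prod_module :: "'i set \<Rightarrow> ('i \<Rightarrow> ('r, 'a) module) \<Rightarrow> ('r, 'i \<Rightarrow> 'a) module" where
  "prod_module I M =
     \<lparr>carrier = (\<Pi>\<^sub>E i\<in>I. carrier (M i)), mult = undefined, one = undefined,
      zero = (\<lambda>i\<in>I. \<zero>\<^bsub>M i\<^esub>), add = (\<lambda>f g. \<lambda>i\<in>I. f i \<oplus>\<^bsub>M i\<^esub> g i),
      smult = (\<lambda>r f. \<lambda>i\<in>I. r \<odot>\<^bsub>M i\<^esub> f i)\<rparr>"

lemma prod_module_module:
  assumes R: "cring R" and M: "\<And>i. i \<in> I \<Longrightarrow> module R (M i)"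
  shows "module R (prod_module I M)"
proof (rule module_by_equations[OF R])
  note am = abelian_group.axioms(1)[OF module.axioms(2)[OF M]]
  note rules = abelian_monoid.a_closed[OF am] abelian_monoid.zero_closed[OF am]
    abelian_monoid.a_assoc[OF am] abelian_monoid.l_zero[OF am] module.smult_closed[OF M]
    module.smult_l_null[OF M] module.smult_l_distr[OF M] module.smult_r_distr[OF M]
    module.smult_assoc1[OF M] module.smult_one[OF M]
  note defs = prod_module_def PiE_iff fun_eq_iff extensional_def
  let ?P = "prod_module I M"
  show "f \<oplus>\<^bsub>?P\<^esub> g = g \<oplus>\<^bsub>?P\<^esub> f" if "f \<in> carrier ?P" "g \<in> carrier ?P" for f g
    using that abelian_monoid.a_comm[OF am] by (simp add: defs)
  show "f \<oplus>\<^bsub>?P\<^esub> g \<in> carrier ?P" if "f \<in> carrier ?P" "g \<in> carrier ?P" for f g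
    using that by (simp add: defs rules)
  show "(f \<oplus>\<^bsub>?P\<^esub> g) \<oplus>\<^bsub>?P\<^esub> h = f \<oplus>\<^bsub>?P\<^esub> (g \<oplus>\<^bsub>?P\<^esub> h)"
    if "f \<in> carrier ?P" "g \<in> carrier ?P" "h \<in> carrier ?P" for f g h
    using that by (simp add: defs rules)
  show "\<zero>\<^bsub>?P\<^esub> \<in> carrier ?P" by (simp add: defs rules)
  show "\<zero>\<^bsub>?P\<^esub> \<oplus>\<^bsub>?P\<^esub> f = f" if "f \<in> carrier ?P" for f using that by (simp add: defs rules)
  show "r \<odot>\<^bsub>?P\<^esub> f \<in> carrier ?P" if "r \<in> carrier R" "f \<in> carrier ?P" for r f
    using that by (simp add: defs rules)
  show "\<zero>\<^bsub>R\<^esub> \<odot>\<^bsub>?P\<^esub> f = \<zero>\<^bsub>?P\<^esub>" if "f \<in> carrier ?P" for f using that by (simp add: defs rules)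
  show "\<one>\<^bsub>R\<^esub> \<odot>\<^bsub>?P\<^esub> f = f" if "f \<in> carrier ?P" for f using that by (simp add: defs rules)
  show "(a \<oplus>\<^bsub>R\<^esub> b) \<odot>\<^bsub>?P\<^esub> f = a \<odot>\<^bsub>?P\<^esub> f \<oplus>\<^bsub>?P\<^esub> b \<odot>\<^bsub>?P\<^esub> f"
    if "a \<in> carrier R" "b \<in> carrier R" "f \<in> carrier ?P" for a b f
    using that by (simp add: defs rules)
  show "a \<odot>\<^bsub>?P\<^esub> (f \<oplus>\<^bsub>?P\<^esub> g) = a \<odot>\<^bsub>?P\<^esub> f \<oplus>\<^bsub>?P\<^esub> a \<odot>\<^bsub>?P\<^esub> g"
    if "a \<in> carrier R" "f \<in> carrier ?P" "g \<in> carrier ?P" for a f g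
    using that by (simp add: defs rules)
  show "(a \<otimes>\<^bsub>R\<^esub> b) \<odot>\<^bsub>?P\<^esub> f = a \<odot>\<^bsub>?P\<^esub> (b \<odot>\<^bsub>?P\<^esub> f)"
    if "a \<in> carrier R" "b \<in> carrier R" "f \<in> carrier ?P" for a b f
    using that by (simp add: defs rules)
qed

context small_cring
begin

text \<open>
  The braiding identifies tensoring on the right with tensoring on the left.
\<close>

lemma tensor_right_cocontinuous:
  assumes M: "M \<in> small_modules R"
  shows "cocontinuous TYPE('u) (Mod R) (Mod R)
    \<lparr>fobj = (\<lambda>y. tobj (Mod R) y M), farr = (\<lambda>f. tarr (Mod R) f (idn (Mod R) M))\<rparr>"
    (is "cocontinuous _ _ _ ?G")
proof -
  let ?F = "\<lparr>fobj = tobj (Mod R) M, farr = tarr (Mod R) (idn (Mod R) M)\<rparr>"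
  have M': "M \<in> obj (Mod R)" using M by simp
  note TF = tensor_functor[OF Mod_symmetric_monoidal M']
  have nat: "nat_iso (Mod R) (Mod R) ?F ?G (\<lambda>N. brd (Mod R) M N)"
    unfolding nat_iso_def nat_trans_def
  proof (intro conjI ballI)
    fix N assume "N \<in> obj (Mod R)"
    then have b: "brd (Mod R) M N \<in> iso_set (Mod R) (tens R M N) (tens R N M)" using brd_iso[OF M] by simp
    then show "is_iso (Mod R) (brd (Mod R) M N)"
      and "brd (Mod R) M N \<in> hom_set (Mod R) (fobj ?F N) (fobj ?G N)" by (auto simp: iso_set_def)
  next
    fix f assume "f \<in> arr (Mod R)"
    then show "brd (Mod R) M (tgt (Mod R) f) \<cdot>\<^bsub>Mod R\<^esub> farr ?F f = farr ?G f \<cdot>\<^bsub>Mod R\<^esub> brd (Mod R) M (src (Mod R) f)"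
      using M by (auto simp: brd_natural)
  qed
  show ?thesis
    using tensor_left_cocontinuous[OF M] preserves_colimits_nat_iso[OF TF nat]
    unfolding cocontinuous_def by blast
qed

lemma Mod_locally_small: "locally_small TYPE('u) (Mod R)"
  unfolding locally_small_def
proof (intro ballI)
  fix M N assume "M \<in> obj (Mod R)" "N \<in> obj (Mod R)"
  then have "small TYPE('u) (carrier M \<rightarrow>\<^sub>E carrier N)"
    by (intro small_PiE universe) (simp_all add: small_modules_small)
  then have "small TYPE('u) (mod_hom R M N)" by (rule small_subset) (auto simp: mod_hom_def)
  moreover have "hom_set (Mod R) M N \<subseteq> (\<lambda>f. (M, f, N)) ` mod_hom R M N"
    by (auto elim: hom_set_ModE)
  ultimately show "small TYPE('u) (hom_set (Mod R) M N)" by (blast intro: small_subset small_image)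
qed

text \<open>Arrows out of the tensor unit are the same thing as elements of their target.\<close>

lemma pt_linear:
  assumes "M \<in> small_modules R" "x \<in> carrier M"
  shows "linear R II M (\<lambda>r. r \<odot>\<^bsub>M\<^esub> x)"
  using bilinear_map_linear(2)[OF lun_bilinear[OF assms(1)] assms(2)] .

lemma pt_hom: "M \<in> small_modules R \<Longrightarrow> x \<in> carrier M \<Longrightarrow> pt R M x \<in> hom_set (Mod R) II M"
  unfolding pt_def by (intro mk_arr_hom pt_linear unit_small)

lemma mfun_pt: "r \<in> carrier R \<Longrightarrow> mfun (pt R M x) r = r \<odot>\<^bsub>M\<^esub> x"
  by (simp add: pt_def)

lemma one_closed: "\<one>\<^bsub>R\<^esub> \<in> carrier R"
  using cring by (simp add: cring_def ring.is_monoid monoid.one_closed)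

lemma mfun_pt_one: "M \<in> small_modules R \<Longrightarrow> x \<in> carrier M \<Longrightarrow> mfun (pt R M x) \<one>\<^bsub>R\<^esub> = x"
  by (simp add: mfun_pt one_closed module.smult_one[OF small_modulesD])

lemma unit_arr_eval:
  assumes a: "a \<in> hom_set (Mod R) II M" and r: "r \<in> carrier R"
  shows "mfun a r = r \<odot>\<^bsub>M\<^esub> mfun a \<one>\<^bsub>R\<^esub>"
proof -
  interpret R: cring R by (rule cring)
  show ?thesis using linear_smult[OF mfun_linear[OF a] r, of "\<one>\<^bsub>R\<^esub>"] r by simp
qed

lemma unit_arr_eqI:
  assumes a: "a \<in> hom_set (Mod R) II M" and b: "b \<in> hom_set (Mod R) II M"
    and "mfun a \<one>\<^bsub>R\<^esub> = mfun b \<one>\<^bsub>R\<^esub>"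
  shows "a = b"
  using assms by (intro Mod_arr_eqI[OF a b]) (simp add: unit_arr_eval)

lemma unit_arr_eq_pt:
  assumes a: "a \<in> hom_set (Mod R) II M"
  shows "a = pt R M (mfun a \<one>\<^bsub>R\<^esub>)"
proof (rule unit_arr_eqI[OF a])
  have M: "M \<in> small_modules R" and x: "mfun a \<one>\<^bsub>R\<^esub> \<in> carrier M"
    using hom_set_Mod_obj(2)[OF a] mfun_closed[OF a] one_closed by simp_all
  show "pt R M (mfun a \<one>\<^bsub>R\<^esub>) \<in> hom_set (Mod R) II M" using M x by (rule pt_hom)
  show "mfun a \<one>\<^bsub>R\<^esub> = mfun (pt R M (mfun a \<one>\<^bsub>R\<^esub>)) \<one>\<^bsub>R\<^esub>" using mfun_pt_one[OF M x] by simp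
qed

lemma cmp_pt:
  assumes a: "a \<in> hom_set (Mod R) M N" and x: "x \<in> carrier M"
  shows "a \<cdot>\<^bsub>Mod R\<^esub> pt R M x = pt R N (mfun a x)"
proof -
  note M = hom_set_Mod_obj(1)[OF a] and N = hom_set_Mod_obj(2)[OF a]
  note p = pt_hom[OF M x] and q = pt_hom[OF N mfun_closed[OF a x]]
  have "mfun (a \<cdot>\<^bsub>Mod R\<^esub> pt R M x) \<one>\<^bsub>R\<^esub> = mfun a x"
    using mfun_cmp[OF p a] one_closed mfun_pt_one[OF M x] by simp
  then show ?thesis
    by (intro unit_arr_eqI[OF category_cmp[OF Mod_is_category p a] q])
      (simp add: mfun_pt_one[OF N mfun_closed[OF a x]])
qed

text \<open>
  The union of the images is a submodule, and the projection onto its quotient agrees with zero on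
  every member of the diagram, hence is zero.
\<close>

lemma directed_colimit_surjective:
  assumes E: "is_functor J (Mod R) E" and c: "is_colimit (Mod R) J E c \<iota>" and ne: "obj J \<noteq> {}"
    and dir: "\<And>j k. j \<in> obj J \<Longrightarrow> k \<in> obj J \<Longrightarrow> \<exists>l u v. u \<in> hom_set J j l \<and> v \<in> hom_set J k l"
    and y: "y \<in> carrier c"
  shows "\<exists>j\<in>obj J. \<exists>x\<in>carrier (fobj E j). y = mfun (\<iota> j) x"
proof -
  have cc: "is_cocone (Mod R) J E c \<iota>" using c by (simp add: is_colimit_def)
  note cs = cocone_Mod(1)[OF E cc] and \<iota> = mfun_linear[OF cocone_Mod(2)[OF E cc]]
  interpret c: module R c using cs by (rule small_modulesD)
  have o: "fobj E j \<in> small_modules R" if "j \<in> obj J" for j using functor_obj[OF E that] by simp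
  define N where "N = {y. \<exists>j\<in>obj J. \<exists>x\<in>carrier (fobj E j). y = mfun (\<iota> j) x}"
  have shift: "mfun (farr E u) x \<in> carrier (fobj E l)" "mfun (\<iota> l) (mfun (farr E u) x) = mfun (\<iota> j) x"
    if "u \<in> hom_set J j l" "x \<in> carrier (fobj E j)" for u j l x
    using mfun_closed[OF functor_hom[OF E that(1)] that(2)]
      cocone_Mod(3)[OF E cc hom_set_arr[OF that(1)]] that by (auto simp: hom_set_def)
  have N: "N \<subseteq> carrier c" using linear_closed[OF \<iota>] by (auto simp: N_def)
  have N0: "\<zero>\<^bsub>c\<^esub> \<in> N"
  proof -
    obtain j where j: "j \<in> obj J" using ne by blast
    interpret Ej: module R "fobj E j" using o[OF j] by (rule small_modulesD)
    show ?thesis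
      using linear_zero[OF \<iota>[OF j] Ej.module_axioms c.module_axioms] j
      by (auto simp: N_def intro!: bexI[of _ j] bexI[of _ "\<zero>\<^bsub>fobj E j\<^esub>"])
  qed
  have N_add: "a \<oplus>\<^bsub>c\<^esub> b \<in> N" if "a \<in> N" "b \<in> N" for a b
  proof -
    obtain j x where j: "j \<in> obj J" and x: "x \<in> carrier (fobj E j)" and a: "a = mfun (\<iota> j) x"
      using \<open>a \<in> N\<close> by (auto simp: N_def)
    obtain k z where k: "k \<in> obj J" and z: "z \<in> carrier (fobj E k)" and b: "b = mfun (\<iota> k) z"
      using \<open>b \<in> N\<close> by (auto simp: N_def)
    obtain l u v where u: "u \<in> hom_set J j l" and v: "v \<in> hom_set J k l" using dir[OF j k] by blast
    have l: "l \<in> obj J" using category_tgt[OF functor_source[OF E] hom_set_arr[OF u]] u by (simp add: hom_set_def)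
    interpret El: module R "fobj E l" using o[OF l] by (rule small_modulesD)
    let ?w = "mfun (farr E u) x \<oplus>\<^bsub>fobj E l\<^esub> mfun (farr E v) z"
    have "mfun (\<iota> l) ?w = a \<oplus>\<^bsub>c\<^esub> b"
      using linear_add[OF \<iota>[OF l] shift(1)[OF u x] shift(1)[OF v z]] shift(2)[OF u x] shift(2)[OF v z] a b by simp
    moreover have "?w \<in> carrier (fobj E l)" using shift(1)[OF u x] shift(1)[OF v z] by simp
    ultimately show ?thesis using l by (auto simp: N_def intro!: bexI[of _ l] bexI[of _ ?w])
  qed
  have N_smult: "r \<odot>\<^bsub>c\<^esub> a \<in> N" if r: "r \<in> carrier R" and "a \<in> N" for r a
  proof -
    obtain j x where j: "j \<in> obj J" and x: "x \<in> carrier (fobj E j)" and a: "a = mfun (\<iota> j) x"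
      using \<open>a \<in> N\<close> by (auto simp: N_def)
    interpret Ej: module R "fobj E j" using o[OF j] by (rule small_modulesD)
    show ?thesis using linear_smult[OF \<iota>[OF j] r x] a j Ej.smult_closed[OF r x]
      by (auto simp: N_def intro!: bexI[of _ j] bexI[of _ "r \<odot>\<^bsub>fobj E j\<^esub> x"])
  qed
  obtain Q q where Q: "Q \<in> small_modules R" "linear R c Q q"
    "\<And>x. x \<in> carrier c \<Longrightarrow> q x = \<zero>\<^bsub>Q\<^esub> \<longleftrightarrow> x \<in> N"
    using quotient_module[OF c.module_axioms small_modules_small[OF cs] N N0 N_add N_smult] by metis
  interpret Q: module R Q using Q(1) by (rule small_modulesD)
  have z: "linear R c Q (\<lambda>_. \<zero>\<^bsub>Q\<^esub>)" by (rule linearI) simp_all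
  have "q y = \<zero>\<^bsub>Q\<^esub>"
    by (rule colimit_Mod_ext[OF E c Q(1) Q(2) z _ y])
      (use Q(3) N in \<open>auto simp: N_def\<close>)
  then show ?thesis using Q(3)[OF y] by (auto simp: N_def)
qed

end


lemma in_hom_set_small_sets:
  "(A, f, B) \<in> hom_set (small_sets U) X Y \<longleftrightarrow>
     A = X \<and> B = Y \<and> small U X \<and> small U Y \<and> f \<in> X \<rightarrow>\<^sub>E Y"
  by (auto simp: hom_set_def small_sets_def)

context small_cring
begin

text \<open>
  The product of all members of the diagram modulo the families that eventually vanish receives a
  cocone whose kernels consist exactly of the elements that die at some stage.  An element that dies
  in the colimit dies under every cocone, in particular under this one.
\<close>

lemma directed_colimit_kernel:
  fixes J :: "('i, 'j, 'x) category_scheme"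
  assumes E: "is_functor J (Mod R) E" and c: "is_colimit (Mod R) J E c \<iota>"
    and J: "small TYPE('u) (obj J)"
    and thin: "\<And>j k u v. u \<in> hom_set J j k \<Longrightarrow> v \<in> hom_set J j k \<Longrightarrow> u = v"
    and dir: "\<And>j k. j \<in> obj J \<Longrightarrow> k \<in> obj J \<Longrightarrow> \<exists>l u v. u \<in> hom_set J j l \<and> v \<in> hom_set J k l"
    and j: "j \<in> obj J" and x: "x \<in> carrier (fobj E j)" and null: "mfun (\<iota> j) x = \<zero>\<^bsub>c\<^esub>"
  shows "\<exists>k u. u \<in> hom_set J j k \<and> mfun (farr E u) x = \<zero>\<^bsub>fobj E k\<^esub>"
proof -
  note Jc = functor_source[OF E]
  have o: "fobj E k \<in> small_modules R" if "k \<in> obj J" for k using functor_obj[OF E that] by simp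
  have om: "module R (fobj E k)" if "k \<in> obj J" for k using o[OF that] by (rule small_modulesD)
  have tgt: "l \<in> obj J" if "u \<in> hom_set J k l" for u k l
    using category_tgt[OF Jc hom_set_arr[OF that]] that by (simp add: hom_set_def)
  have src: "k \<in> obj J" if "u \<in> hom_set J k l" for u k l
    using category_src[OF Jc hom_set_arr[OF that]] that by (simp add: hom_set_def)
  define F where "F = prod_module (obj J) (fobj E)"
  interpret F: module R F unfolding F_def by (rule prod_module_module[OF cring om])
  have sF: "small TYPE('u) (carrier F)"
    unfolding F_def prod_module_def using small_PiE[OF universe J small_modules_small[OF o]] by simp
  have F_at: "f k \<in> carrier (fobj E k)" if "f \<in> carrier F" "k \<in> obj J" for f k
    using that by (auto simp: F_def prod_module_def)
  have F_ops: "(f \<oplus>\<^bsub>F\<^esub> g) k = f k \<oplus>\<^bsub>fobj E k\<^esub> g k" "(r \<odot>\<^bsub>F\<^esub> f) k = r \<odot>\<^bsub>fobj E k\<^esub> f k"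
    "\<zero>\<^bsub>F\<^esub> k = \<zero>\<^bsub>fobj E k\<^esub>" if "k \<in> obj J" for f g k r
    using that by (auto simp: F_def prod_module_def)
  define N where "N = {f \<in> carrier F. \<exists>m\<in>obj J. \<forall>k u. u \<in> hom_set J m k \<longrightarrow> f k = \<zero>\<^bsub>fobj E k\<^esub>}"
  have N: "N \<subseteq> carrier F" by (auto simp: N_def)
  have N0: "\<zero>\<^bsub>F\<^esub> \<in> N" unfolding N_def using F_ops(3)[OF tgt] j F.M.zero_closed by blast
  have N_add: "f \<oplus>\<^bsub>F\<^esub> g \<in> N" if f: "f \<in> N" and g: "g \<in> N" for f g
  proof -
    obtain m where m: "m \<in> obj J" "\<And>k u. u \<in> hom_set J m k \<Longrightarrow> f k = \<zero>\<^bsub>fobj E k\<^esub>"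
      using f by (auto simp: N_def)
    obtain n where n: "n \<in> obj J" "\<And>k u. u \<in> hom_set J n k \<Longrightarrow> g k = \<zero>\<^bsub>fobj E k\<^esub>"
      using g by (auto simp: N_def)
    obtain l u v where u: "u \<in> hom_set J m l" and v: "v \<in> hom_set J n l" using dir[OF m(1) n(1)] by blast
    have "(f \<oplus>\<^bsub>F\<^esub> g) k = \<zero>\<^bsub>fobj E k\<^esub>" if w: "w \<in> hom_set J l k" for k w
    proof -
      interpret Ek: module R "fobj E k" using tgt[OF w] by (rule om)
      show ?thesis
        using F_ops(1)[OF tgt[OF w]] m(2)[OF category_cmp[OF Jc u w]] n(2)[OF category_cmp[OF Jc v w]] by simp
    qed
    then show ?thesis using tgt[OF u] f g by (auto simp: N_def)
  qed
  have N_smult: "r \<odot>\<^bsub>F\<^esub> f \<in> N" if r: "r \<in> carrier R" and f: "f \<in> N" for r f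
  proof -
    obtain m where m: "m \<in> obj J" "\<And>k u. u \<in> hom_set J m k \<Longrightarrow> f k = \<zero>\<^bsub>fobj E k\<^esub>"
      using f by (auto simp: N_def)
    have "(r \<odot>\<^bsub>F\<^esub> f) k = \<zero>\<^bsub>fobj E k\<^esub>" if w: "w \<in> hom_set J m k" for k w
      using F_ops(2)[OF tgt[OF w]] m(2)[OF w] module.smult_r_null[OF om[OF tgt[OF w]] r] by simp
    then show ?thesis using m(1) r f by (auto simp: N_def)
  qed
  obtain Q q where Q: "Q \<in> small_modules R" "linear R F Q q"
    "\<And>f. f \<in> carrier F \<Longrightarrow> q f = \<zero>\<^bsub>Q\<^esub> \<longleftrightarrow> f \<in> N"
    using quotient_module[OF F.module_axioms sF N N0 N_add N_smult] by metis
  interpret Q: module R Q using Q(1) by (rule small_modulesD)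
  define s where "s i x = (\<lambda>k\<in>obj J. if hom_set J i k = {} then \<zero>\<^bsub>fobj E k\<^esub>
    else mfun (farr E (SOME u. u \<in> hom_set J i k)) x)" for i x
  have s_at: "s i y k = mfun (farr E u) y" if u: "u \<in> hom_set J i k" for i y k u
  proof -
    have "(SOME v. v \<in> hom_set J i k) = u" using thin someI[of "\<lambda>v. v \<in> hom_set J i k", OF u] u by blast
    then show ?thesis using tgt[OF u] u by (auto simp: s_def)
  qed
  have s_none: "s i y k = \<zero>\<^bsub>fobj E k\<^esub>" if "hom_set J i k = {}" "k \<in> obj J" for i y k
    using that by (simp add: s_def)
  have lin: "linear R (fobj E i) (fobj E k) (mfun (farr E u))" if "u \<in> hom_set J i k" for i k u
    using mfun_linear[OF functor_hom[OF E that]] .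
  have sF_in: "s i y \<in> carrier F" if i: "i \<in> obj J" and y: "y \<in> carrier (fobj E i)" for i y
  proof -
    have "s i y k \<in> carrier (fobj E k)" if k: "k \<in> obj J" for k
    proof (cases "hom_set J i k = {}")
      case True
      interpret Ek: module R "fobj E k" using k by (rule om)
      show ?thesis using s_none[OF True k] by simp
    next
      case False
      then obtain u where u: "u \<in> hom_set J i k" by blast
      show ?thesis using s_at[OF u] linear_closed[OF lin[OF u] y] by simp
    qed
    then show ?thesis by (auto simp: F_def prod_module_def s_def)
  qed
  have F_eqI: "f = g" if "f \<in> carrier F" "g \<in> carrier F" "\<And>k. k \<in> obj J \<Longrightarrow> f k = g k" for f g
    using that by (auto simp: F_def prod_module_def intro: PiE_ext)
  have s_lin: "linear R (fobj E i) F (s i)" if i: "i \<in> obj J" for i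
  proof (rule linearI)
    interpret Ei: module R "fobj E i" using i by (rule om)
    show "s i y \<in> carrier F" if "y \<in> carrier (fobj E i)" for y using i that by (rule sF_in)
    show "s i (y \<oplus>\<^bsub>fobj E i\<^esub> z) = s i y \<oplus>\<^bsub>F\<^esub> s i z"
      if y: "y \<in> carrier (fobj E i)" and z: "z \<in> carrier (fobj E i)" for y z
    proof (rule F_eqI)
      fix k assume k: "k \<in> obj J"
      interpret Ek: module R "fobj E k" using k by (rule om)
      show "s i (y \<oplus>\<^bsub>fobj E i\<^esub> z) k = (s i y \<oplus>\<^bsub>F\<^esub> s i z) k"
      proof (cases "hom_set J i k = {}")
        case True
        show ?thesis by (simp add: F_ops[OF k] s_none[OF True k])
      next
        case False
        then obtain u where u: "u \<in> hom_set J i k" by blast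
        show ?thesis by (simp add: F_ops[OF k] s_at[OF u] linear_add[OF lin[OF u] y z])
      qed
    qed (use i y z in \<open>simp_all add: sF_in\<close>)
    show "s i (r \<odot>\<^bsub>fobj E i\<^esub> y) = r \<odot>\<^bsub>F\<^esub> s i y"
      if r: "r \<in> carrier R" and y: "y \<in> carrier (fobj E i)" for r y
    proof (rule F_eqI)
      fix k assume k: "k \<in> obj J"
      interpret Ek: module R "fobj E k" using k by (rule om)
      show "s i (r \<odot>\<^bsub>fobj E i\<^esub> y) k = (r \<odot>\<^bsub>F\<^esub> s i y) k"
      proof (cases "hom_set J i k = {}")
        case True
        show ?thesis using r by (simp add: F_ops[OF k] s_none[OF True k])
      next
        case False
        then obtain u where u: "u \<in> hom_set J i k" by blast
        show ?thesis by (simp add: F_ops[OF k] s_at[OF u] linear_smult[OF lin[OF u] r y])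
      qed
    qed (use i r y in \<open>simp_all add: sF_in\<close>)
  qed
  \<comment> \<open>The families \<open>s\<close> are compatible only up to an eventually vanishing error.\<close>
  have compat: "q (s (tgt J u) (mfun (farr E u) y)) = q (s (src J u) y)"
    if u: "u \<in> arr J" and y: "y \<in> carrier (fobj E (src J u))" for u y
  proof -
    let ?i = "src J u" and ?k = "tgt J u"
    note u' = arr_in_hom_set[OF u]
    have i: "?i \<in> obj J" and k: "?k \<in> obj J" using src[OF u'] tgt[OF u'] by simp_all
    have uy: "mfun (farr E u) y \<in> carrier (fobj E ?k)" using linear_closed[OF lin[OF u'] y] .
    have inF: "s ?i y \<in> carrier F" "s ?k (mfun (farr E u) y) \<in> carrier F"
      using sF_in[OF i y] sF_in[OF k uy] by simp_all
    have "s ?k (mfun (farr E u) y) \<ominus>\<^bsub>F\<^esub> s ?i y \<in> N"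
    proof -
      have "(s ?k (mfun (farr E u) y) \<ominus>\<^bsub>F\<^esub> s ?i y) l = \<zero>\<^bsub>fobj E l\<^esub>" if v: "v \<in> hom_set J ?k l" for v l
      proof -
        note l = tgt[OF v]
        interpret El: module R "fobj E l" using l by (rule om)
        have "mfun (farr E v) (mfun (farr E u) y) = mfun (farr E (v \<cdot>\<^bsub>J\<^esub> u)) y"
          using mfun_cmp[OF functor_hom[OF E u'] functor_hom[OF E v] y] functor_cmp[OF E u' v] by simp
        then have e: "s ?k (mfun (farr E u) y) l = s ?i y l"
          by (simp add: s_at[OF v] s_at[OF category_cmp[OF Jc u' v]])
        have "linear R F (fobj E l) (\<lambda>f. f l)"
          by (rule linearI) (simp_all add: F_at[OF _ l] F_ops[OF l])
        from linear_minus[OF this F.module_axioms El.module_axioms inF(2,1)]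
        show ?thesis using e El.eq_iff_diff_zero[OF F_at[OF inF(1) l] F_at[OF inF(1) l]] by simp
      qed
      then show ?thesis using k inF by (auto simp: N_def)
    qed
    then have "q (s ?k (mfun (farr E u) y) \<ominus>\<^bsub>F\<^esub> s ?i y) = \<zero>\<^bsub>Q\<^esub>" using Q(3) inF by simp
    then have "q (s ?k (mfun (farr E u) y)) \<ominus>\<^bsub>Q\<^esub> q (s ?i y) = \<zero>\<^bsub>Q\<^esub>"
      by (simp add: linear_minus[OF Q(2) F.module_axioms Q.module_axioms inF(2,1)])
    then show ?thesis
      using Q.eq_iff_diff_zero[OF linear_closed[OF Q(2) inF(2)] linear_closed[OF Q(2) inF(1)]] by simp
  qed
  obtain h where h: "linear R c Q h"
    "\<And>j x. j \<in> obj J \<Longrightarrow> x \<in> carrier (fobj E j) \<Longrightarrow> h (mfun (\<iota> j) x) = q (s j x)"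
  proof (rule colimit_Mod_desc[OF E c Q(1), of "\<lambda>j x. q (s j x)"])
    show "linear R (fobj E i) Q (\<lambda>x. q (s i x))" if "i \<in> obj J" for i
      using linear_comp[OF s_lin[OF that] Q(2)] .
  qed (use compat in auto)
  have "c \<in> small_modules R" using c by (simp add: is_colimit_def is_cocone_def)
  then have "q (s j x) = \<zero>\<^bsub>Q\<^esub>"
    using h(2)[OF j x] null linear_zero[OF h(1) small_modulesD Q.module_axioms] by simp
  then have "s j x \<in> N" using Q(3) sF_in[OF j x] by blast
  then obtain m where m: "m \<in> obj J" "\<And>k u. u \<in> hom_set J m k \<Longrightarrow> s j x k = \<zero>\<^bsub>fobj E k\<^esub>"
    by (auto simp: N_def)
  obtain l u v where u: "u \<in> hom_set J j l" and v: "v \<in> hom_set J m l" using dir[OF j m(1)] by blast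
  then show ?thesis using m(2)[OF v] s_at[OF u] by metis
qed

text \<open>
  \<open>Hom(R, -)\<close> is the underlying set functor.  A map out of the colimit is defined by lifting an
  element to some stage, which is possible by surjectivity; two lifts agree at a later stage because
  their difference dies in the colimit.
\<close>

lemma unit_hom_directed_colimit:
  fixes J :: "('u, 'u) category"
  assumes E: "is_functor J (Mod R) E" and c: "is_colimit (Mod R) J E c \<iota>"
    and J: "small TYPE('u) (obj J)" and ne: "obj J \<noteq> {}"
    and thin: "\<And>j k u v. u \<in> hom_set J j k \<Longrightarrow> v \<in> hom_set J j k \<Longrightarrow> u = v"
    and dir: "\<And>j k. j \<in> obj J \<Longrightarrow> k \<in> obj J \<Longrightarrow> \<exists>l u v. u \<in> hom_set J j l \<and> v \<in> hom_set J k l"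
  shows "is_colimit (small_sets TYPE('u)) J (comp_fctr (hom_fctr TYPE('u) (Mod R) II) E)
    (fobj (hom_fctr TYPE('u) (Mod R) II) c) (\<lambda>j. farr (hom_fctr TYPE('u) (Mod R) II) (\<iota> j))"
proof -
  have cc: "is_cocone (Mod R) J E c \<iota>" using c by (simp add: is_colimit_def)
  note cs = cocone_Mod(1)[OF E cc] and \<iota> = cocone_Mod(2)[OF E cc]
  note Jc = functor_source[OF E] and C = category_cmp[OF Mod_is_category] and A = category_assoc[OF Mod_is_category]
  have o: "fobj E k \<in> small_modules R" if "k \<in> obj J" for k using functor_obj[OF E that] by simp
  define H where "H M = hom_set (Mod R) II M" for M
  have sH: "small TYPE('u) (Inl ` H M :: ('u mod_arr + 'u) set)" if "M \<in> small_modules R" for M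
    using Mod_locally_small that unfolding locally_small_def H_def by (simp add: small_image)
  have e: "farr E u \<in> hom_set (Mod R) (fobj E (src J u)) (fobj E (tgt J u))" if "u \<in> arr J" for u
    using functor_hom[OF E arr_in_hom_set[OF that]] .
  have st: "src J u \<in> obj J" "tgt J u \<in> obj J" if "u \<in> arr J" for u
    using category_src[OF Jc that] category_tgt[OF Jc that] .
  have hf: "farr (hom_fctr TYPE('u) (Mod R) II) a =
      (Inl ` H M, \<lambda>g \<in> Inl ` H M. Inl (a \<cdot>\<^bsub>Mod R\<^esub> projl g), Inl ` H N)"
    if "a \<in> hom_set (Mod R) M N" for a M N
    using that by (simp add: hom_fctr_def H_def hom_set_src hom_set_tgt)
  have ho: "fobj (hom_fctr TYPE('u) (Mod R) II) M = Inl ` H M" for M by (simp add: hom_fctr_def H_def)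
  have hs: "(Inl ` H M, \<lambda>g \<in> Inl ` H M. Inl (a \<cdot>\<^bsub>Mod R\<^esub> projl g), Inl ` H N :: ('u mod_arr + 'u) set)
      \<in> hom_set (small_sets TYPE('u)) (Inl ` H M) (Inl ` H N)" if "a \<in> hom_set (Mod R) M N" for a M N
    unfolding in_hom_set_small_sets
  proof (intro conjI refl sH[OF hom_set_Mod_obj(1)[OF that]] sH[OF hom_set_Mod_obj(2)[OF that]])
    show "(\<lambda>g \<in> Inl ` H M. Inl (a \<cdot>\<^bsub>Mod R\<^esub> projl g)) \<in> Inl ` H M \<rightarrow>\<^sub>E (Inl ` H N :: ('u mod_arr + 'u) set)"
      using C[OF _ that] unfolding H_def by (intro restrict_PiE_iff[THEN iffD2] ballI) force
  qed
  \<comment> \<open>The element picked out by the arrow comes from some stage.\<close>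
  have factor: "\<exists>j g. j \<in> obj J \<and> g \<in> H (fobj E j) \<and> a = \<iota> j \<cdot>\<^bsub>Mod R\<^esub> g" if a: "a \<in> H c" for a
  proof -
    have a': "a \<in> hom_set (Mod R) II c" using a by (simp add: H_def)
    obtain j x where j: "j \<in> obj J" and x: "x \<in> carrier (fobj E j)" and eq: "mfun a \<one>\<^bsub>R\<^esub> = mfun (\<iota> j) x"
      using directed_colimit_surjective[OF E c ne dir, of "mfun a \<one>\<^bsub>R\<^esub>"] mfun_closed[OF a'] one_closed by auto
    have "\<iota> j \<cdot>\<^bsub>Mod R\<^esub> pt R (fobj E j) x = a"
      using cmp_pt[OF \<iota>[OF j] x] unit_arr_eq_pt[OF a'] eq by simp
    then show ?thesis using j pt_hom[OF o[OF j] x] unfolding H_def by metis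
  qed
  \<comment> \<open>The difference of the two elements, taken at a common stage, dies in the colimit.\<close>
  have glue: "\<exists>l u v. u \<in> hom_set J j l \<and> v \<in> hom_set J k l \<and> farr E u \<cdot>\<^bsub>Mod R\<^esub> g = farr E v \<cdot>\<^bsub>Mod R\<^esub> g'"
    if j: "j \<in> obj J" and k: "k \<in> obj J" and g: "g \<in> H (fobj E j)" and g': "g' \<in> H (fobj E k)"
      and eq: "\<iota> j \<cdot>\<^bsub>Mod R\<^esub> g = \<iota> k \<cdot>\<^bsub>Mod R\<^esub> g'" for j k g g'
  proof -
    obtain l u v where u: "u \<in> hom_set J j l" and v: "v \<in> hom_set J k l" using dir[OF j k] by blast
    note g = g[unfolded H_def] and g' = g'[unfolded H_def]
    note eu = functor_hom[OF E u] and ev = functor_hom[OF E v]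
    have l: "l \<in> obj J" using st(2)[OF hom_set_arr[OF u]] u by (simp add: hom_set_def)
    interpret El: module R "fobj E l" using o[OF l] by (rule small_modulesD)
    interpret c: module R c using cs by (rule small_modulesD)
    define x where "x = mfun (farr E u) (mfun g \<one>\<^bsub>R\<^esub>) \<ominus>\<^bsub>fobj E l\<^esub> mfun (farr E v) (mfun g' \<one>\<^bsub>R\<^esub>)"
    have m: "mfun g \<one>\<^bsub>R\<^esub> \<in> carrier (fobj E j)" "mfun g' \<one>\<^bsub>R\<^esub> \<in> carrier (fobj E k)"
      using mfun_closed[OF g] mfun_closed[OF g'] one_closed by simp_all
    note m' = mfun_closed[OF eu m(1)] mfun_closed[OF ev m(2)]
    have "mfun (\<iota> l) (mfun (farr E u) (mfun g \<one>\<^bsub>R\<^esub>)) = mfun (\<iota> j) (mfun g \<one>\<^bsub>R\<^esub>)"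
      using cocone_Mod(3)[OF E cc hom_set_arr[OF u]] m u by (simp add: hom_set_def)
    moreover have "mfun (\<iota> l) (mfun (farr E v) (mfun g' \<one>\<^bsub>R\<^esub>)) = mfun (\<iota> k) (mfun g' \<one>\<^bsub>R\<^esub>)"
      using cocone_Mod(3)[OF E cc hom_set_arr[OF v]] m v by (simp add: hom_set_def)
    moreover have "mfun (\<iota> j) (mfun g \<one>\<^bsub>R\<^esub>) = mfun (\<iota> k) (mfun g' \<one>\<^bsub>R\<^esub>)"
      using mfun_cmp[OF g \<iota>[OF j]] mfun_cmp[OF g' \<iota>[OF k]] eq one_closed by simp
    ultimately have null: "mfun (\<iota> l) x = \<zero>\<^bsub>c\<^esub>"
      unfolding x_def linear_minus[OF mfun_linear[OF \<iota>[OF l]] El.module_axioms c.module_axioms m']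
      using c.eq_iff_diff_zero[OF mfun_closed[OF \<iota>[OF k] m(2)] mfun_closed[OF \<iota>[OF k] m(2)]] by simp
    have xl: "x \<in> carrier (fobj E l)" using m' by (simp add: x_def)
    have "\<exists>n w. w \<in> hom_set J l n \<and> mfun (farr E w) x = \<zero>\<^bsub>fobj E n\<^esub>"
      by (rule directed_colimit_kernel[OF E c J _ _ l xl null]) (fact thin, fact dir)
    then obtain n w where w: "w \<in> hom_set J l n" and w0: "mfun (farr E w) x = \<zero>\<^bsub>fobj E n\<^esub>" by blast
    note ew = functor_hom[OF E w]
    have n: "n \<in> obj J" using st(2)[OF hom_set_arr[OF w]] w by (simp add: hom_set_def)
    interpret En: module R "fobj E n" using o[OF n] by (rule small_modulesD)
    have "mfun (farr E w) (mfun (farr E u) (mfun g \<one>\<^bsub>R\<^esub>)) = mfun (farr E w) (mfun (farr E v) (mfun g' \<one>\<^bsub>R\<^esub>))"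
      using w0 linear_minus[OF mfun_linear[OF ew] El.module_axioms En.module_axioms m']
        En.eq_iff_diff_zero[OF mfun_closed[OF ew m'(1)] mfun_closed[OF ew m'(2)]] by (simp add: x_def)
    then have "mfun (farr E (w \<cdot>\<^bsub>J\<^esub> u) \<cdot>\<^bsub>Mod R\<^esub> g) \<one>\<^bsub>R\<^esub> = mfun (farr E (w \<cdot>\<^bsub>J\<^esub> v) \<cdot>\<^bsub>Mod R\<^esub> g') \<one>\<^bsub>R\<^esub>"
      using mfun_cmp[OF g C[OF eu ew]] mfun_cmp[OF g' C[OF ev ew]] one_closed
        mfun_cmp[OF eu ew m(1)] mfun_cmp[OF ev ew m(2)]
      by (simp add: functor_cmp[OF E u w] functor_cmp[OF E v w])
    then have "farr E (w \<cdot>\<^bsub>J\<^esub> u) \<cdot>\<^bsub>Mod R\<^esub> g = farr E (w \<cdot>\<^bsub>J\<^esub> v) \<cdot>\<^bsub>Mod R\<^esub> g'"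
      by (intro unit_arr_eqI[OF C[OF g functor_hom[OF E category_cmp[OF Jc u w]]]
            C[OF g' functor_hom[OF E category_cmp[OF Jc v w]]]])
    then show ?thesis using category_cmp[OF Jc u w] category_cmp[OF Jc v w] by blast
  qed
  show ?thesis
    unfolding is_colimit_def
  proof (intro conjI allI impI)
    show "is_cocone (small_sets TYPE('u)) J (comp_fctr (hom_fctr TYPE('u) (Mod R) II) E)
      (fobj (hom_fctr TYPE('u) (Mod R) II) c) (\<lambda>j. farr (hom_fctr TYPE('u) (Mod R) II) (\<iota> j))"
      unfolding is_cocone_def
    proof (intro conjI ballI)
      show "fobj (hom_fctr TYPE('u) (Mod R) II) c \<in> obj (small_sets TYPE('u))"
        using sH[OF cs] by (simp add: ho small_sets_def)
      show "farr (hom_fctr TYPE('u) (Mod R) II) (\<iota> j) \<in> hom_set (small_sets TYPE('u))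
        (fobj (comp_fctr (hom_fctr TYPE('u) (Mod R) II) E) j) (fobj (hom_fctr TYPE('u) (Mod R) II) c)"
        if "j \<in> obj J" for j
        using hs[OF \<iota>[OF that]] by (simp add: ho hf[OF \<iota>[OF that]])
      fix u assume u: "u \<in> arr J"
      have "\<iota> (tgt J u) \<cdot>\<^bsub>Mod R\<^esub> farr E u = \<iota> (src J u)" using cc u by (simp add: is_cocone_def)
      then have "\<iota> (tgt J u) \<cdot>\<^bsub>Mod R\<^esub> farr E u \<cdot>\<^bsub>Mod R\<^esub> g = \<iota> (src J u) \<cdot>\<^bsub>Mod R\<^esub> g"
        if "g \<in> H (fobj E (src J u))" for g
        using A[OF that[unfolded H_def] e[OF u] \<iota>[OF st(2)[OF u]]] by simp
      moreover have "farr E u \<cdot>\<^bsub>Mod R\<^esub> g \<in> H (fobj E (tgt J u))" if "g \<in> H (fobj E (src J u))" for g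
        using C[OF _ e[OF u]] that unfolding H_def by blast
      ultimately show "farr (hom_fctr TYPE('u) (Mod R) II) (\<iota> (tgt J u)) \<cdot>\<^bsub>small_sets TYPE('u)\<^esub>
          farr (comp_fctr (hom_fctr TYPE('u) (Mod R) II) E) u = farr (hom_fctr TYPE('u) (Mod R) II) (\<iota> (src J u))"
        by (auto simp: hf[OF e[OF u]] hf[OF \<iota>[OF st(1)[OF u]]] hf[OF \<iota>[OF st(2)[OF u]]] small_sets_def
            compose_def fun_eq_iff) metis
    qed
  next
    fix D \<kappa>
    assume \<kappa>: "is_cocone (small_sets TYPE('u)) J (comp_fctr (hom_fctr TYPE('u) (Mod R) II) E) D \<kappa>"
    define K where "K j g = fst (snd (\<kappa> j)) (Inl g)" for j g
    have sD: "small TYPE('u) D" using \<kappa> by (simp add: is_cocone_def small_sets_def)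
    have \<kappa>_eq: "\<exists>f. \<kappa> j = (Inl ` H (fobj E j), f, D) \<and> f \<in> Inl ` H (fobj E j) \<rightarrow>\<^sub>E D" if "j \<in> obj J" for j
      using \<kappa> that by (auto simp: is_cocone_def small_sets_def hom_set_def ho)
    have K_in: "K j g \<in> D" if "j \<in> obj J" "g \<in> H (fobj E j)" for j g
      using \<kappa>_eq[OF that(1)] that(2) by (auto simp: K_def)
    have K_compat: "K l (farr E u \<cdot>\<^bsub>Mod R\<^esub> g) = K k g" if u: "u \<in> hom_set J k l" and g: "g \<in> H (fobj E k)" for u k l g
    proof -
      have u': "u \<in> arr J" "src J u = k" "tgt J u = l" using u by (simp_all add: hom_set_def)
      have eq: "\<kappa> l \<cdot>\<^bsub>small_sets TYPE('u)\<^esub> farr (hom_fctr TYPE('u) (Mod R) II) (farr E u) = \<kappa> k"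
        using \<kappa> u' by (auto simp: is_cocone_def)
      obtain f where f: "\<kappa> l = (Inl ` H (fobj E l), f, D)" using \<kappa>_eq st(2)[OF u'(1)] u'(3) by blast
      show ?thesis
        using arg_cong[OF eq, of "\<lambda>a. fst (snd a) (Inl g)"] g hf[OF functor_hom[OF E u]]
        by (simp add: K_def f small_sets_def compose_def)
    qed
    have K_glue: "K j g = K k g'" if jk: "j \<in> obj J" "k \<in> obj J" and g: "g \<in> H (fobj E j)" and g': "g' \<in> H (fobj E k)"
      and eq: "\<iota> j \<cdot>\<^bsub>Mod R\<^esub> g = \<iota> k \<cdot>\<^bsub>Mod R\<^esub> g'" for j k g g'
      using glue[OF jk g g' eq] K_compat[OF _ g] K_compat[OF _ g'] by metis
    have "\<exists>j g. j \<in> obj J \<and> g \<in> H (fobj E j) \<and> a = \<iota> j \<cdot>\<^bsub>Mod R\<^esub> g" if "a \<in> H c" for a using factor[OF that] .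
    then obtain jj gg where jg: "\<And>a. a \<in> H c \<Longrightarrow> jj a \<in> obj J" "\<And>a. a \<in> H c \<Longrightarrow> gg a \<in> H (fobj E (jj a))"
      "\<And>a. a \<in> H c \<Longrightarrow> a = \<iota> (jj a) \<cdot>\<^bsub>Mod R\<^esub> gg a" by metis
    define h :: "'u mod_arr + 'u \<Rightarrow> 'u mod_arr + 'u" where
      "h = (\<lambda>b \<in> Inl ` H c. K (jj (projl b)) (gg (projl b)))"
    have h_in: "h \<in> Inl ` H c \<rightarrow>\<^sub>E D" using K_in[OF jg(1,2)] by (auto simp: h_def)
    have h_eq: "h (Inl (\<iota> j \<cdot>\<^bsub>Mod R\<^esub> g)) = K j g" if j: "j \<in> obj J" and g: "g \<in> H (fobj E j)" for j g
    proof -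
      have a: "\<iota> j \<cdot>\<^bsub>Mod R\<^esub> g \<in> H c" using C[OF _ \<iota>[OF j]] g by (simp add: H_def)
      show ?thesis using K_glue[OF jg(1)[OF a] j jg(2)[OF a] g jg(3)[OF a, symmetric]] a by (simp add: h_def)
    qed
    show "\<exists>!h. h \<in> hom_set (small_sets TYPE('u)) (fobj (hom_fctr TYPE('u) (Mod R) II) c) D \<and>
      (\<forall>j\<in>obj J. h \<cdot>\<^bsub>small_sets TYPE('u)\<^esub> farr (hom_fctr TYPE('u) (Mod R) II) (\<iota> j) = \<kappa> j)"
    proof (rule ex_ex1I)
      have "(Inl ` H c, h, D) \<cdot>\<^bsub>small_sets TYPE('u)\<^esub> farr (hom_fctr TYPE('u) (Mod R) II) (\<iota> j) = \<kappa> j"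
        if j: "j \<in> obj J" for j
      proof -
        obtain f where f: "\<kappa> j = (Inl ` H (fobj E j), f, D)" "f \<in> Inl ` H (fobj E j) \<rightarrow>\<^sub>E D"
          using \<kappa>_eq[OF j] by blast
        have "compose (Inl ` H (fobj E j)) h (\<lambda>g \<in> Inl ` H (fobj E j). Inl (\<iota> j \<cdot>\<^bsub>Mod R\<^esub> projl g)) = f"
        proof
          fix b
          show "compose (Inl ` H (fobj E j)) h (\<lambda>g \<in> Inl ` H (fobj E j). Inl (\<iota> j \<cdot>\<^bsub>Mod R\<^esub> projl g)) b = f b"
          proof (cases "b \<in> Inl ` H (fobj E j)")
            case True
            then obtain g where g: "b = Inl g" "g \<in> H (fobj E j)" by blast
            then show ?thesis using h_eq[OF j g(2)] by (simp add: compose_def K_def f(1))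
          next
            case False
            then show ?thesis using f(2) by (simp add: compose_def PiE_arb[OF f(2) False])
          qed
        qed
        then show ?thesis by (simp add: hf[OF \<iota>[OF j]] f(1) small_sets_def)
      qed
      then show "\<exists>h. h \<in> hom_set (small_sets TYPE('u)) (fobj (hom_fctr TYPE('u) (Mod R) II) c) D \<and>
        (\<forall>j\<in>obj J. h \<cdot>\<^bsub>small_sets TYPE('u)\<^esub> farr (hom_fctr TYPE('u) (Mod R) II) (\<iota> j) = \<kappa> j)"
        using h_in sH[OF cs] sD
        by (intro exI[of _ "(Inl ` H c, h, D)"]) (simp add: hom_set_def small_sets_def ho)
    next
      fix a b
      assume a: "a \<in> hom_set (small_sets TYPE('u)) (fobj (hom_fctr TYPE('u) (Mod R) II) c) D \<and>
        (\<forall>j\<in>obj J. a \<cdot>\<^bsub>small_sets TYPE('u)\<^esub> farr (hom_fctr TYPE('u) (Mod R) II) (\<iota> j) = \<kappa> j)"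
      assume b: "b \<in> hom_set (small_sets TYPE('u)) (fobj (hom_fctr TYPE('u) (Mod R) II) c) D \<and>
        (\<forall>j\<in>obj J. b \<cdot>\<^bsub>small_sets TYPE('u)\<^esub> farr (hom_fctr TYPE('u) (Mod R) II) (\<iota> j) = \<kappa> j)"
      obtain f where f: "a = (Inl ` H c, f, D)" "f \<in> Inl ` H c \<rightarrow>\<^sub>E D"
        using a by (auto simp: hom_set_def small_sets_def ho)
      obtain f' where f': "b = (Inl ` H c, f', D)" "f' \<in> Inl ` H c \<rightarrow>\<^sub>E D"
        using b by (auto simp: hom_set_def small_sets_def ho)
      have "f d = f' d" if "d \<in> Inl ` H c" for d
      proof -
        obtain x where x: "x \<in> H c" "d = Inl x" using \<open>d \<in> Inl ` H c\<close> by blast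
        obtain j g where j: "j \<in> obj J" and g: "g \<in> H (fobj E j)" and eq: "x = \<iota> j \<cdot>\<^bsub>Mod R\<^esub> g"
          using factor[OF x(1)] by blast
        have "a \<cdot>\<^bsub>small_sets TYPE('u)\<^esub> farr (hom_fctr TYPE('u) (Mod R) II) (\<iota> j) =
            b \<cdot>\<^bsub>small_sets TYPE('u)\<^esub> farr (hom_fctr TYPE('u) (Mod R) II) (\<iota> j)" using a b j by simp
        from arg_cong[OF this, of "\<lambda>a. fst (snd a) (Inl g)"]
        show ?thesis using g by (simp add: f(1) f'(1) hf[OF \<iota>[OF j]] small_sets_def compose_def eq x(2))
      qed
      then show "a = b" using f f' by (auto intro: PiE_ext)
    qed
  qed
qed

end


lemma colimit_closedD:
  fixes C :: "('o, 'a, 'z) category_scheme" and E :: "('u, 'u, 'o, 'a) fctr"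
  assumes "colimit_closed TYPE('u) C P" "small_category TYPE('u) J" "is_functor J C E"
    "is_colimit C J E c \<iota>" "\<And>j. j \<in> obj J \<Longrightarrow> fobj E j \<in> P"
  shows "c \<in> P"
  using assms unfolding colimit_closed_def by blast

lemma discrete_category_is_category: "is_category (discrete_category X)"
  unfolding is_category_def by (auto simp: discrete_category_def hom_set_def)

lemma hom_set_discrete: "hom_set (discrete_category X) x y = (if x = y \<and> x \<in> X then {x} else {})"
  by (auto simp: discrete_category_def hom_set_def)

lemma discrete_simps [simp]:
  "obj (discrete_category X) = X" "arr (discrete_category X) = X" "src (discrete_category X) x = x"
  "tgt (discrete_category X) x = x" "idn (discrete_category X) x = x" "cmp (discrete_category X) y x = x"
  by (simp_all add: discrete_category_def)

lemma small_discrete: "small U X \<Longrightarrow> small_category U (discrete_category X)"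
  by (simp add: small_category_def discrete_category_is_category)

lemma discrete_functor:
  assumes "is_category C" "\<And>x. x \<in> X \<Longrightarrow> f x \<in> obj C"
  shows "is_functor (discrete_category X) C \<lparr>fobj = f, farr = (\<lambda>x. idn C (f x))\<rparr>"
  unfolding is_functor_def
  using assms category_idn[OF assms(1)] category_idn_left[OF assms(1) category_idn[OF assms(1)]]
  by (auto simp: discrete_category_is_category hom_set_discrete split: if_splits)

text \<open>
  The shape of a coequalizer: two arrows \<open>c\<close> and \<open>d\<close> from \<open>a\<close> to \<open>b\<close>, with objects serving as their
  own identities.  In a composable pair the first arrow is \<open>a\<close> or the second one is \<open>b\<close>, which
  explains the formula for composition.
\<close>

definition parallel_pair :: "'u \<Rightarrow> 'u \<Rightarrow> 'u \<Rightarrow> 'u \<Rightarrow> ('u, 'u) category" where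
  "parallel_pair a b c d =
     \<lparr>obj = {a, b}, arr = {a, b, c, d}, src = (\<lambda>u. if u = b then b else a),
      tgt = (\<lambda>u. if u = a then a else b), idn = (\<lambda>x. x), cmp = (\<lambda>v u. if u = a then v else u)\<rparr>"

lemma parallel_pair_simps:
  "obj (parallel_pair a b c d) = {a, b}" "arr (parallel_pair a b c d) = {a, b, c, d}"
  "src (parallel_pair a b c d) u = (if u = b then b else a)"
  "tgt (parallel_pair a b c d) u = (if u = a then a else b)" "idn (parallel_pair a b c d) x = x"
  "cmp (parallel_pair a b c d) v u = (if u = a then v else u)"
  by (simp_all add: parallel_pair_def)

lemma parallel_pair_composable:
  assumes "a \<noteq> b" "u \<in> hom_set (parallel_pair a b c d) x y" "v \<in> hom_set (parallel_pair a b c d) y z"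
  shows "u = a \<and> x = a \<and> y = a \<or> v = b \<and> u \<noteq> a \<and> y = b \<and> z = b"
  using assms by (auto simp: hom_set_def parallel_pair_simps split: if_splits)

lemma parallel_pair_is_category:
  assumes "a \<noteq> b"
  shows "is_category (parallel_pair a b c d)"
  unfolding is_category_def
proof (intro conjI ballI allI impI)
  fix x y z f g
  assume fg: "f \<in> hom_set (parallel_pair a b c d) x y" "g \<in> hom_set (parallel_pair a b c d) y z"
  show "g \<cdot>\<^bsub>parallel_pair a b c d\<^esub> f \<in> hom_set (parallel_pair a b c d) x z"
    using parallel_pair_composable[OF assms fg] fg by (auto simp: parallel_pair_simps)
next
  fix w x y z f g h
  show "(h \<cdot>\<^bsub>parallel_pair a b c d\<^esub> g) \<cdot>\<^bsub>parallel_pair a b c d\<^esub> f =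
      h \<cdot>\<^bsub>parallel_pair a b c d\<^esub> (g \<cdot>\<^bsub>parallel_pair a b c d\<^esub> f)"
    by (simp add: parallel_pair_simps)
next
  fix x y f assume "f \<in> hom_set (parallel_pair a b c d) x y"
  then show "f \<cdot>\<^bsub>parallel_pair a b c d\<^esub> idn (parallel_pair a b c d) x = f"
    and "idn (parallel_pair a b c d) y \<cdot>\<^bsub>parallel_pair a b c d\<^esub> f = f"
    using assms by (auto simp: hom_set_def parallel_pair_simps split: if_splits)
next
  fix x assume "x \<in> obj (parallel_pair a b c d)"
  then show "idn (parallel_pair a b c d) x \<in> hom_set (parallel_pair a b c d) x x"
    using assms by (auto simp: hom_set_def parallel_pair_simps)
qed (auto simp: parallel_pair_simps)

lemma parallel_pair_functor:
  assumes dist: "distinct [a, b, c, d]" and C: "is_category C"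
    and f: "f \<in> hom_set C x y" and g: "g \<in> hom_set C x y" and x: "x \<in> obj C" and y: "y \<in> obj C"
  shows "is_functor (parallel_pair a b c d) C
    \<lparr>fobj = (\<lambda>i. if i = a then x else y),
     farr = (\<lambda>u. if u = a then idn C x else if u = b then idn C y else if u = c then f else g)\<rparr>"
    (is "is_functor ?J C ?E")
proof -
  have ab: "a \<noteq> b" using dist by simp
  have hom: "farr ?E u \<in> hom_set C (fobj ?E i) (fobj ?E j)" if u: "u \<in> hom_set ?J i j" for u i j
  proof -
    have i: "i = (if u = b then b else a)" and j: "j = (if u = a then a else b)" and "u \<in> {a, b, c, d}"
      using u by (auto simp: hom_set_def parallel_pair_simps)
    then show ?thesis using dist f g category_idn[OF C x] category_idn[OF C y] by auto
  qed
  show ?thesis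
    unfolding is_functor_def
  proof (intro conjI ballI allI C hom parallel_pair_is_category[OF ab])
    fix i j k u v assume u: "u \<in> hom_set ?J i j" and v: "v \<in> hom_set ?J j k"
    show "farr ?E (v \<cdot>\<^bsub>?J\<^esub> u) = farr ?E v \<cdot>\<^bsub>C\<^esub> farr ?E u"
      using parallel_pair_composable[OF ab u v]
    proof
      assume *: "u = a \<and> i = a \<and> j = a"
      have "farr ?E v \<cdot>\<^bsub>C\<^esub> idn C (fobj ?E j) = farr ?E v" using category_idn_right[OF C hom[OF v]] .
      then show ?thesis using * by (simp add: parallel_pair_simps)
    next
      assume *: "v = b \<and> u \<noteq> a \<and> j = b \<and> k = b"
      have "idn C (fobj ?E j) \<cdot>\<^bsub>C\<^esub> farr ?E u = farr ?E u" using category_idn_left[OF C hom[OF u]] .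
      then show ?thesis using * ab by (simp add: parallel_pair_simps)
    qed
  next
    show "fobj ?E i \<in> obj C" for i using x y by simp
    show "farr ?E (idn ?J i) = idn C (fobj ?E i)" if "i \<in> obj ?J" for i
      using that ab by (auto simp: parallel_pair_simps)
  qed
qed

definition free_on :: "'u ring \<Rightarrow> 'u set \<Rightarrow> ('u, 'u) module \<Rightarrow> ('u \<Rightarrow> 'u) \<Rightarrow> bool" where
  "free_on R X F \<gamma> \<longleftrightarrow> F \<in> small_modules R \<and> \<gamma> \<in> X \<rightarrow> carrier F \<and>
     (\<forall>M\<in>small_modules R. \<forall>\<beta>\<in>X \<rightarrow> carrier M. \<exists>h. linear R F M h \<and> (\<forall>x\<in>X. h (\<gamma> x) = \<beta> x)) \<and>
     (\<forall>M\<in>small_modules R. \<forall>f g. linear R F M f \<longrightarrow> linear R F M g \<longrightarrow>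
        (\<forall>x\<in>X. f (\<gamma> x) = g (\<gamma> x)) \<longrightarrow> (\<forall>y\<in>carrier F. f y = g y))"

lemma free_onD:
  assumes "free_on R X F \<gamma>"
  shows free_on_small: "F \<in> small_modules R"
    and free_on_closed: "x \<in> X \<Longrightarrow> \<gamma> x \<in> carrier F"
    and free_on_lift: "M \<in> small_modules R \<Longrightarrow> \<beta> \<in> X \<rightarrow> carrier M \<Longrightarrow>
      \<exists>h. linear R F M h \<and> (\<forall>x\<in>X. h (\<gamma> x) = \<beta> x)"
    and free_on_ext: "\<lbrakk>M \<in> small_modules R; linear R F M f; linear R F M g;
      \<And>x. x \<in> X \<Longrightarrow> f (\<gamma> x) = g (\<gamma> x); y \<in> carrier F\<rbrakk> \<Longrightarrow> f y = g y"
  using assms unfolding free_on_def by blast+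

context small_cring
begin

text \<open>
  A poset in which any set with fewer than three elements has an upper bound is directed and
  inhabited, so a set with three elements serves as the cardinal.  It is small even if the universe
  is countable, where no infinite cardinal would be.
\<close>

lemma unit_little: "little TYPE('u) (Mod R) II"
proof -
  have inf: "infinite (UNIV :: 'u set)" using universe by (simp add: universe_def)
  then obtain K :: "'u set" where K: "finite K" "card K = 3"
    using infinite_arbitrarily_large by blast
  have "preserves_colimits J (Mod R) (small_sets TYPE('u)) (hom_fctr TYPE('u) (Mod R) II)"
    if J: "small_category TYPE('u) J" and dp: "directed_poset K J" for J :: "('u, 'u) category"
    unfolding preserves_colimits_def
  proof (intro allI impI)
    fix E :: "('u, 'u, ('u, 'u) module, 'u mod_arr) fctr" and c \<iota>
    assume E: "is_functor J (Mod R) E" and c: "is_colimit (Mod R) J E c \<iota>"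
    have bound: "\<exists>u\<in>obj J. \<forall>x\<in>X. hom_set J x u \<noteq> {}" if X: "X \<subseteq> obj J" "finite X" "card X < 3" for X
    proof -
      have "X \<prec> K"
        using X K eqpoll_iff_card[of X K] lepoll_iff_card_le[of X K] by (auto simp: lesspoll_def)
      then show ?thesis using dp X(1) by (simp add: directed_poset_def)
    qed
    show "is_colimit (small_sets TYPE('u)) J (comp_fctr (hom_fctr TYPE('u) (Mod R) II) E)
      (fobj (hom_fctr TYPE('u) (Mod R) II) c) (\<lambda>j. farr (hom_fctr TYPE('u) (Mod R) II) (\<iota> j))"
    proof (rule unit_hom_directed_colimit[OF E c])
      show "small TYPE('u) (obj J)" using J by (simp add: small_category_def)
      show "obj J \<noteq> {}" using bound[of "{}"] by auto
      show "u = v" if "u \<in> hom_set J j k" "v \<in> hom_set J j k" for j k u v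
        using dp that unfolding directed_poset_def by blast
      show "\<exists>l u v. u \<in> hom_set J j l \<and> v \<in> hom_set J k l" if "j \<in> obj J" "k \<in> obj J" for j k
      proof -
        have "card {j, k} < 3" by (rule le_less_trans[OF card_insert_le_m1[of 2]]) auto
        then show ?thesis using bound[of "{j, k}"] that by auto
      qed
    qed
  qed
  then show ?thesis
    using small_finite[OF universe K(1)] unfolding little_def by auto
qed

text \<open>A coproduct of copies of the unit is a free module.\<close>

lemma free_in_colimit_closed:
  assumes P: "colimit_closed TYPE('u) (Mod R) P" "II \<in> P" and X: "small TYPE('u) (X :: 'u set)"
  shows "\<exists>F\<in>P. \<exists>\<gamma>. free_on R X F \<gamma>"
proof -
  let ?J = "discrete_category X"
  let ?E = "\<lparr>fobj = (\<lambda>_. II), farr = (\<lambda>_. idn (Mod R) II)\<rparr> :: ('u, 'u, ('u, 'u) module, 'u mod_arr) fctr"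
  have E: "is_functor ?J (Mod R) ?E"
    using discrete_functor[OF Mod_is_category, of X "\<lambda>_. II"] by (simp del: Mod_simps(5))
  obtain F \<iota> where F: "is_colimit (Mod R) ?J ?E F \<iota>"
    using Mod_cocomplete small_discrete[OF X] E unfolding cocomplete_def by blast
  have cc: "is_cocone (Mod R) ?J ?E F \<iota>" using F by (simp add: is_colimit_def)
  note Fs = cocone_Mod(1)[OF E cc]
  have \<iota>: "\<iota> x \<in> hom_set (Mod R) II F" if "x \<in> X" for x using cocone_Mod(2)[OF E cc] that by simp
  define \<gamma> where "\<gamma> x = mfun (\<iota> x) \<one>\<^bsub>R\<^esub>" for x
  have \<gamma>: "\<gamma> x \<in> carrier F" if "x \<in> X" for x
    using mfun_closed[OF \<iota>[OF that]] one_closed by (simp add: \<gamma>_def)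
  have "F \<in> P"
    by (rule colimit_closedD[OF P(1) small_discrete[OF X] E F]) (simp add: P(2))
  moreover have "free_on R X F \<gamma>"
    unfolding free_on_def
  proof (intro conjI ballI allI impI Fs)
    show "\<gamma> \<in> X \<rightarrow> carrier F" using \<gamma> by blast
  next
    fix M \<beta> assume M: "M \<in> small_modules R" and "\<beta> \<in> X \<rightarrow> carrier M"
    then have \<beta>: "\<beta> x \<in> carrier M" if "x \<in> X" for x using that by blast
    show "\<exists>h. linear R F M h \<and> (\<forall>x\<in>X. h (\<gamma> x) = \<beta> x)"
    proof (rule colimit_Mod_desc[OF E F M, of "\<lambda>x r. r \<odot>\<^bsub>M\<^esub> \<beta> x"])
      show "linear R (fobj ?E x) M (\<lambda>r. r \<odot>\<^bsub>M\<^esub> \<beta> x)" if "x \<in> obj ?J" for x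
        using pt_linear[OF M \<beta>] that by simp
      show "mfun (farr ?E u) r \<odot>\<^bsub>M\<^esub> \<beta> (tgt ?J u) = r \<odot>\<^bsub>M\<^esub> \<beta> (src ?J u)"
        if "u \<in> arr ?J" "r \<in> carrier (fobj ?E (src ?J u))" for u r using that by simp
      show ?thesis if h: "linear R F M h"
        "\<And>x r. x \<in> obj ?J \<Longrightarrow> r \<in> carrier (fobj ?E x) \<Longrightarrow> h (mfun (\<iota> x) r) = r \<odot>\<^bsub>M\<^esub> \<beta> x" for h
        using h one_closed module.smult_one[OF small_modulesD[OF M] \<beta>]
        by (intro exI[of _ h]) (simp add: \<gamma>_def)
    qed
  next
    fix M f g y
    assume M: "M \<in> small_modules R" and f: "linear R F M f" and g: "linear R F M g"
      and eq: "\<forall>x\<in>X. f (\<gamma> x) = g (\<gamma> x)" and y: "y \<in> carrier F"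
    show "f y = g y"
    proof (rule colimit_Mod_ext[OF E F M f g _ y])
      fix x r assume "x \<in> obj ?J" and "r \<in> carrier (fobj ?E x)"
      then have x: "x \<in> X" and r: "r \<in> carrier R" by simp_all
      show "f (mfun (\<iota> x) r) = g (mfun (\<iota> x) r)"
        using unit_arr_eval[OF \<iota>[OF x] r] linear_smult[OF f r \<gamma>[OF x]] linear_smult[OF g r \<gamma>[OF x]] eq x
        by (simp add: \<gamma>_def)
    qed
  qed
  ultimately show ?thesis by blast
qed

text \<open>
  Every module is the cokernel of a map between free modules, namely of the map from the free
  module on the kernel of the projection from the free module on its elements.  Both free modules are
  coproducts of copies of the unit.
\<close>

lemma unit_generates:
  assumes P: "colimit_closed TYPE('u) (Mod R) P" "II \<in> P" and M: "M \<in> small_modules R"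
  shows "M \<in> P"
proof -
  interpret M: module R M using M by (rule small_modulesD)
  obtain F \<gamma> where "F \<in> P" and free: "free_on R (carrier M) F \<gamma>"
    using free_in_colimit_closed[OF P small_modules_small[OF M]] by blast
  note F = \<open>F \<in> P\<close> free_on_small[OF free] and \<gamma> = free_on_closed[OF free]
  interpret F: module R F using F(2) by (rule small_modulesD)
  obtain \<pi> where \<pi>: "linear R F M \<pi>" "\<And>x. x \<in> carrier M \<Longrightarrow> \<pi> (\<gamma> x) = x"
    using free_on_lift[OF free M, of "\<lambda>x. x"] by auto
  define K where "K = {k \<in> carrier F. \<pi> k = \<zero>\<^bsub>M\<^esub>}"
  have K: "small TYPE('u) K"
    by (rule small_subset[OF small_modules_small[OF F(2)]]) (auto simp: K_def)
  obtain G \<delta> where "G \<in> P" and free': "free_on R K G \<delta>"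
    using free_in_colimit_closed[OF P K] by blast
  note G = \<open>G \<in> P\<close> free_on_small[OF free'] and \<delta> = free_on_closed[OF free']
  interpret G: module R G using G(2) by (rule small_modulesD)
  obtain d where d: "linear R G F d" "\<And>k. k \<in> K \<Longrightarrow> d (\<delta> k) = k"
    using free_on_lift[OF free' F(2), of "\<lambda>k. k"] by (auto simp: K_def)
  have zero: "linear R A B (\<lambda>_. \<zero>\<^bsub>B\<^esub>)" if "module R B" for A B :: "('u, 'u) module"
  proof -
    interpret B: module R B by fact
    show ?thesis by (rule linearI) simp_all
  qed
  have \<pi>K: "\<pi> k = \<zero>\<^bsub>M\<^esub>" if "k \<in> K" for k using that by (simp add: K_def)
  have \<pi>d: "\<pi> (d y) = \<zero>\<^bsub>M\<^esub>" if y: "y \<in> carrier G" for y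
    using free_on_ext[OF free' M linear_comp[OF d(1) \<pi>(1)] zero[OF M.module_axioms] _ y] d(2) \<pi>K by simp
  have inf: "infinite (UNIV :: 'u set)" using universe by (simp add: universe_def)
  obtain a b u v :: 'u where dist: "distinct [a, b, u, v]"
  proof -
    obtain T :: "'u set" where T: "finite T" "card T = 4" using infinite_arbitrarily_large[OF inf] by blast
    obtain xs where xs: "set xs = T" "distinct xs" using finite_distinct_list[OF T(1)] by blast
    have "length xs = Suc (Suc (Suc (Suc 0)))" using distinct_card[OF xs(2)] xs(1) T(2) by simp
    then show ?thesis using that xs(2) unfolding length_Suc_conv by blast
  qed
  have ne: "b \<noteq> a" "u \<noteq> a" "u \<noteq> b" "v \<noteq> a" "v \<noteq> b" "v \<noteq> u" using dist by auto
  let ?J = "parallel_pair a b u v"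
  let ?z = "\<lambda>y. \<zero>\<^bsub>F\<^esub>"
  let ?E = "\<lparr>fobj = (\<lambda>i. if i = a then G else F),
    farr = (\<lambda>w. if w = a then idn (Mod R) G else if w = b then idn (Mod R) F else
      if w = u then mk_arr G F d else mk_arr G F ?z)\<rparr> :: ('u, 'u, ('u, 'u) module, 'u mod_arr) fctr"
  have hd: "mk_arr G F d \<in> hom_set (Mod R) G F" "mk_arr G F ?z \<in> hom_set (Mod R) G F"
    using mk_arr_hom[OF G(2) F(2) d(1)] mk_arr_hom[OF G(2) F(2) zero[OF F.module_axioms]] .
  have E: "is_functor ?J (Mod R) ?E"
    using parallel_pair_functor[OF dist Mod_is_category hd] G(2) F(2) by (simp del: Mod_simps(2-))
  have J: "small_category TYPE('u) ?J"
    using parallel_pair_is_category[of a b u v] dist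
    by (simp add: small_category_def parallel_pair_simps small_finite universe)
  have Js: "obj ?J = {a, b}" "arr ?J = {a, b, u, v}" by (simp_all add: parallel_pair_simps)
  let ?\<iota> = "\<lambda>i. if i = a then mk_arr G M (\<lambda>_. \<zero>\<^bsub>M\<^esub>) else mk_arr F M \<pi>"
  have cc: "is_cocone (Mod R) ?J ?E M ?\<iota>"
  proof (rule cocone_ModI[OF E M])
    show "?\<iota> j \<in> hom_set (Mod R) (fobj ?E j) M" if "j \<in> obj ?J" for j
      using mk_arr_hom[OF G(2) M zero[OF M.module_axioms]] mk_arr_hom[OF F(2) M \<pi>(1)] by simp
    show "mfun (?\<iota> (tgt ?J w)) (mfun (farr ?E w) x) = mfun (?\<iota> (src ?J w)) x"
      if w: "w \<in> arr ?J" and x: "x \<in> carrier (fobj ?E (src ?J w))" for w x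
      using w x dist \<pi>d linear_closed[OF d(1)] linear_zero[OF \<pi>(1) F.module_axioms M.module_axioms]
      by (auto simp: parallel_pair_simps split: if_splits)
  qed
  have "is_colimit (Mod R) ?J ?E M ?\<iota>"
  proof (rule colimit_ModI[OF E cc])
    fix Q \<kappa> assume Q: "Q \<in> small_modules R" and k: "\<And>j. j \<in> obj ?J \<Longrightarrow> linear R (fobj ?E j) Q (\<kappa> j)"
      and compat: "\<And>w x. w \<in> arr ?J \<Longrightarrow> x \<in> carrier (fobj ?E (src ?J w)) \<Longrightarrow>
        \<kappa> (tgt ?J w) (mfun (farr ?E w) x) = \<kappa> (src ?J w) x"
    interpret Q: module R Q using Q by (rule small_modulesD)
    have kb: "linear R F Q (\<kappa> b)" using k[of b] ne by (simp add: Js)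
    have kd: "\<kappa> b (d y) = \<kappa> a y" if "y \<in> carrier G" for y
      using compat[of u y] that ne by (simp add: parallel_pair_simps)
    have kz: "\<kappa> b \<zero>\<^bsub>F\<^esub> = \<kappa> a y" if "y \<in> carrier G" for y
      using compat[of v y] that ne by (simp add: parallel_pair_simps)
    have kK: "\<kappa> b x = \<zero>\<^bsub>Q\<^esub>" if "x \<in> K" for x
      using kd[OF \<delta>[OF that]] kz[OF \<delta>[OF that]] d(2)[OF that]
        linear_zero[OF kb F.module_axioms Q.module_axioms] by simp
    \<comment> \<open>The difference lies in the kernel of \<open>\<pi>\<close>, where \<open>\<kappa> b\<close> vanishes.\<close>
    have k\<pi>: "\<kappa> b x = \<kappa> b y" if x: "x \<in> carrier F" and y: "y \<in> carrier F" and "\<pi> x = \<pi> y" for x y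
    proof -
      have "x \<ominus>\<^bsub>F\<^esub> y \<in> K"
        using that linear_minus[OF \<pi>(1) F.module_axioms M.module_axioms x y]
          M.eq_iff_diff_zero[OF linear_closed[OF \<pi>(1) x] linear_closed[OF \<pi>(1) y]] by (simp add: K_def)
      from kK[OF this] show ?thesis
        using linear_minus[OF kb F.module_axioms Q.module_axioms x y]
          Q.eq_iff_diff_zero[OF linear_closed[OF kb x] linear_closed[OF kb y]] by simp
    qed
    have "linear R M Q (\<lambda>x. \<kappa> b (\<gamma> x))"
    proof (rule linearI)
      show "\<kappa> b (\<gamma> x) \<in> carrier Q" if "x \<in> carrier M" for x using linear_closed[OF kb \<gamma>[OF that]] .
      show "\<kappa> b (\<gamma> (x \<oplus>\<^bsub>M\<^esub> y)) = \<kappa> b (\<gamma> x) \<oplus>\<^bsub>Q\<^esub> \<kappa> b (\<gamma> y)"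
        if x: "x \<in> carrier M" and y: "y \<in> carrier M" for x y
      proof -
        have "\<kappa> b (\<gamma> (x \<oplus>\<^bsub>M\<^esub> y)) = \<kappa> b (\<gamma> x \<oplus>\<^bsub>F\<^esub> \<gamma> y)"
          using x y by (intro k\<pi>) (simp_all add: \<gamma> \<pi>(2) linear_add[OF \<pi>(1)])
        then show ?thesis using linear_add[OF kb \<gamma>[OF x] \<gamma>[OF y]] by simp
      qed
      show "\<kappa> b (\<gamma> (r \<odot>\<^bsub>M\<^esub> x)) = r \<odot>\<^bsub>Q\<^esub> \<kappa> b (\<gamma> x)" if r: "r \<in> carrier R" and x: "x \<in> carrier M" for r x
      proof -
        have "\<kappa> b (\<gamma> (r \<odot>\<^bsub>M\<^esub> x)) = \<kappa> b (r \<odot>\<^bsub>F\<^esub> \<gamma> x)"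
          using r x by (intro k\<pi>) (simp_all add: \<gamma> \<pi>(2) linear_smult[OF \<pi>(1)])
        then show ?thesis using linear_smult[OF kb r \<gamma>[OF x]] by simp
      qed
    qed
    moreover have "\<kappa> b (\<gamma> \<zero>\<^bsub>M\<^esub>) = \<kappa> a y" if "y \<in> carrier G" for y
      using kz[OF that] k\<pi>[of "\<gamma> \<zero>\<^bsub>M\<^esub>" "\<zero>\<^bsub>F\<^esub>"] \<gamma> \<pi>(2) linear_zero[OF \<pi>(1) F.module_axioms M.module_axioms]
      by simp
    moreover have "\<kappa> b (\<gamma> (\<pi> x)) = \<kappa> b x" if "x \<in> carrier F" for x
      using that linear_closed[OF \<pi>(1) that] by (intro k\<pi>) (simp_all add: \<gamma> \<pi>(2))
    ultimately show "\<exists>h. linear R M Q h \<and> (\<forall>j\<in>obj ?J. \<forall>x\<in>carrier (fobj ?E j). h (mfun (?\<iota> j) x) = \<kappa> j x)"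
      using ne by (intro exI[of _ "\<lambda>x. \<kappa> b (\<gamma> x)"]) (simp add: Js)
  next
    fix Q f g x
    assume eq: "\<And>j x. j \<in> obj ?J \<Longrightarrow> x \<in> carrier (fobj ?E j) \<Longrightarrow> f (mfun (?\<iota> j) x) = g (mfun (?\<iota> j) x)"
      and x: "x \<in> carrier M"
    show "f x = g x" using eq[of b "\<gamma> x"] \<gamma>[OF x] \<pi>(2)[OF x] ne by (simp add: Js)
  qed
  from colimit_closedD[OF P(1) J E this] show ?thesis using F(1) G(1) by simp
qed

lemma Mod_generated:
  assumes "colimit_closed TYPE('u) (Mod R) P" "II \<in> P" "P \<subseteq> small_modules R"
  shows "P = small_modules R"
  using assms unit_generates by blast

theorem Mod_com_two_ring: "com_two_ring TYPE('u) (Mod R)"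
proof -
  have "presentable TYPE('u) (Mod R)"
    unfolding presentable_def
    using Mod_is_category Mod_locally_small Mod_cocomplete unit_little Mod_generated
      small_finite[OF universe, of "{II}"]
    by (intro conjI exI[of _ "{II}"]) auto
  then show ?thesis
    using Mod_symmetric_monoidal tensor_left_cocontinuous tensor_right_cocontinuous
    unfolding com_two_ring_def by (simp del: Mod_simps(2-))
qed

end


section \<open>Extension of scalars\<close>

text \<open>
  Only the scalar multiplication changes, so that maps into a restricted module are maps into the
  original one.
\<close>

definition restrict_scalars :: "('u \<Rightarrow> 'u) \<Rightarrow> ('u, 'u) module \<Rightarrow> ('u, 'u) module" where
  "restrict_scalars \<phi> N = N\<lparr>smult := (\<lambda>r. smult N (\<phi> r))\<rparr>"

lemma restrict_scalars_simps [simp]: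
  "carrier (restrict_scalars \<phi> N) = carrier N" "add (restrict_scalars \<phi> N) = add N"
  "zero (restrict_scalars \<phi> N) = zero N" "smult (restrict_scalars \<phi> N) r = smult N (\<phi> r)"
  by (simp_all add: restrict_scalars_def)

locale scalar_extension = R: small_cring R + S: small_cring S
  for R S :: "'u ring" +
  fixes \<phi> :: "'u \<Rightarrow> 'u"
  assumes hom: "\<phi> \<in> ring_hom R S"
begin

abbreviation "S\<phi> \<equiv> scalar_module \<phi> S"
abbreviation "E \<equiv> ext_module R S \<phi>"

text \<open>The unit of the adjunction between extension and restriction of scalars.\<close>

definition eta :: "('u, 'u) module \<Rightarrow> 'u \<Rightarrow> 'u" where
  "eta M x = tmul R S\<phi> M \<one>\<^bsub>S\<^esub> x"

lemma scalar_simps [simp]: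
  "carrier S\<phi> = carrier S" "add S\<phi> = add S" "zero S\<phi> = zero S" "smult S\<phi> r s = \<phi> r \<otimes>\<^bsub>S\<^esub> s"
  by (simp_all add: scalar_module_def)

lemma hom_simps:
  "r \<in> carrier R \<Longrightarrow> \<phi> r \<in> carrier S"
  "r \<in> carrier R \<Longrightarrow> r' \<in> carrier R \<Longrightarrow> \<phi> (r \<oplus>\<^bsub>R\<^esub> r') = \<phi> r \<oplus>\<^bsub>S\<^esub> \<phi> r'"
  "r \<in> carrier R \<Longrightarrow> r' \<in> carrier R \<Longrightarrow> \<phi> (r \<otimes>\<^bsub>R\<^esub> r') = \<phi> r \<otimes>\<^bsub>S\<^esub> \<phi> r'"
  "\<phi> \<one>\<^bsub>R\<^esub> = \<one>\<^bsub>S\<^esub>"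
  using hom by (simp_all add: ring_hom_closed ring_hom_add ring_hom_mult ring_hom_one)

lemma hom_zero: "\<phi> \<zero>\<^bsub>R\<^esub> = \<zero>\<^bsub>S\<^esub>"
  using ring_hom_zero[OF hom] R.cring S.cring by (simp add: cring_def)

lemma restrict_scalars_small [simp]:
  assumes N: "N \<in> small_modules S"
  shows "restrict_scalars \<phi> N \<in> small_modules R"
proof -
  interpret N: module S N using N by (rule small_modulesD)
  have "module R (restrict_scalars \<phi> N)"
    by (rule module_by_equations)
      (simp_all add: R.cring hom_simps hom_zero N.a_ac N.smult_l_distr N.smult_r_distr N.smult_assoc1)
  then show ?thesis using small_modules_small[OF N] by (simp add: small_modules_def)
qed

lemma scalar_small [simp]: "S\<phi> \<in> small_modules R"
proof -
  interpret S': cring S by (rule S.cring)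
  have "module R S\<phi>"
    by (rule module_by_equations)
      (simp_all add: R.cring hom_simps hom_zero S'.a_ac S'.l_distr S'.r_distr S'.m_assoc)
  then show ?thesis using S.small_carrier by (simp add: small_modules_def)
qed

lemma ext_simps [simp]:
  "carrier (E M) = carrier (tens R S\<phi> M)" "add (E M) = add (tens R S\<phi> M)" "zero (E M) = zero (tens R S\<phi> M)"
  by (simp_all add: ext_module_def Let_def)

lemma ext_smult:
  "smult (E M) s = tens_map R S\<phi> M S\<phi> M (\<lambda>t\<in>carrier S. s \<otimes>\<^bsub>S\<^esub> t) (\<lambda>x\<in>carrier M. x)"
  by (simp add: ext_module_def Let_def)

context
  fixes M assumes M: "M \<in> small_modules R"
begin

lemma mult_hom: "s \<in> carrier S \<Longrightarrow> (\<lambda>t\<in>carrier S. s \<otimes>\<^bsub>S\<^esub> t) \<in> mod_hom R S\<phi> S\<phi>"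
proof -
  assume s: "s \<in> carrier S"
  interpret S': cring S by (rule S.cring)
  have "linear R S\<phi> S\<phi> (\<lambda>t. s \<otimes>\<^bsub>S\<^esub> t)"
    by (rule linearI) (use s in \<open>simp_all add: hom_simps S'.r_distr S'.m_lcomm\<close>)
  from restrict_mod_hom[OF this small_modulesD[OF scalar_small]] show ?thesis by simp
qed

lemma ext_smult_linear: "s \<in> carrier S \<Longrightarrow> linear R (tens R S\<phi> M) (tens R S\<phi> M) (smult (E M) s)"
  unfolding ext_smult using M by (intro mod_hom_linear R.tens_map_hom mult_hom) simp_all

lemma ext_smult_tmul:
  "\<lbrakk>s \<in> carrier S; t \<in> carrier S; x \<in> carrier M\<rbrakk> \<Longrightarrow>
     s \<odot>\<^bsub>E M\<^esub> tmul R S\<phi> M t x = tmul R S\<phi> M (s \<otimes>\<^bsub>S\<^esub> t) x"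
  unfolding ext_smult using M R.tens_map_tmul[OF _ M _ M mult_hom R.id_mod_hom_small[OF M], of s t x] by simp

lemma ext_action:
  assumes "r \<in> carrier R" "y \<in> carrier (tens R S\<phi> M)"
  shows "r \<odot>\<^bsub>tens R S\<phi> M\<^esub> y = \<phi> r \<odot>\<^bsub>E M\<^esub> y"
proof (rule R.tens_ext[OF scalar_small M _ _ ext_smult_linear _ assms(2)])
  have id: "linear R (tens R S\<phi> M) (tens R S\<phi> M) (\<lambda>y. y)" by (rule linearI) simp_all
  show "linear R (tens R S\<phi> M) (tens R S\<phi> M) (\<lambda>y. r \<odot>\<^bsub>tens R S\<phi> M\<^esub> y)"
    using linear_scale[OF small_modulesD id assms(1)] M by simp
  show "r \<odot>\<^bsub>tens R S\<phi> M\<^esub> tmul R S\<phi> M t x = \<phi> r \<odot>\<^bsub>E M\<^esub> tmul R S\<phi> M t x"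
    if "t \<in> carrier S\<phi>" "x \<in> carrier M" for t x
    using that assms(1) M R.tmul_smult_left[OF scalar_small M assms(1), of t x]
    by (simp add: ext_smult_tmul hom_simps)
qed (use M assms hom_simps in simp_all)

lemma ext_small [simp]: "E M \<in> small_modules S"
proof -
  interpret S': cring S by (rule S.cring)
  let ?T = "tens R S\<phi> M"
  have Ts: "?T \<in> small_modules R" using M by simp
  interpret T: module R ?T using Ts by (rule small_modulesD)
  note L = ext_smult_linear and ext = R.tens_ext[OF scalar_small M Ts]
  have id: "linear R ?T ?T (\<lambda>y. y)" by (rule linearI) simp_all
  have zero: "linear R ?T ?T (\<lambda>y. \<zero>\<^bsub>?T\<^esub>)" by (rule linearI) simp_all
  have "module S (E M)"
  proof (rule module_by_equations[OF S.cring])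
    fix s assume s: "s \<in> carrier S"
    show "s \<odot>\<^bsub>E M\<^esub> x \<in> carrier (E M)" if "x \<in> carrier (E M)" for x
      using linear_closed[OF L[OF s]] that by simp
    show "s \<odot>\<^bsub>E M\<^esub> (x \<oplus>\<^bsub>E M\<^esub> y) = s \<odot>\<^bsub>E M\<^esub> x \<oplus>\<^bsub>E M\<^esub> s \<odot>\<^bsub>E M\<^esub> y"
      if "x \<in> carrier (E M)" "y \<in> carrier (E M)" for x y
      using linear_add[OF L[OF s]] that by simp
    fix s' x assume s': "s' \<in> carrier S" and "x \<in> carrier (E M)"
    then have x: "x \<in> carrier ?T" by simp
    have "(s \<oplus>\<^bsub>S\<^esub> s') \<odot>\<^bsub>E M\<^esub> x = s \<odot>\<^bsub>E M\<^esub> x \<oplus>\<^bsub>?T\<^esub> s' \<odot>\<^bsub>E M\<^esub> x"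
      by (rule ext[OF L linear_sum[OF T.module_axioms L L] _ x])
        (use s s' M in \<open>simp_all add: ext_smult_tmul S'.l_distr R.tmul_add_left[OF scalar_small M, simplified]\<close>)
    then show "(s \<oplus>\<^bsub>S\<^esub> s') \<odot>\<^bsub>E M\<^esub> x = s \<odot>\<^bsub>E M\<^esub> x \<oplus>\<^bsub>E M\<^esub> s' \<odot>\<^bsub>E M\<^esub> x" by simp
    show "(s \<otimes>\<^bsub>S\<^esub> s') \<odot>\<^bsub>E M\<^esub> x = s \<odot>\<^bsub>E M\<^esub> (s' \<odot>\<^bsub>E M\<^esub> x)"
      by (rule ext[OF L linear_comp[OF L L] _ x])
        (use s s' in \<open>simp_all add: ext_smult_tmul S'.m_assoc\<close>)
  next
    fix x assume "x \<in> carrier (E M)"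
    then have x: "x \<in> carrier ?T" by simp
    show "\<one>\<^bsub>S\<^esub> \<odot>\<^bsub>E M\<^esub> x = x" by (rule ext[OF L id _ x]) (simp_all add: ext_smult_tmul)
    have "\<zero>\<^bsub>S\<^esub> \<odot>\<^bsub>E M\<^esub> x = \<zero>\<^bsub>?T\<^esub>"
    proof (rule ext[OF L zero _ x])
      fix t y assume "t \<in> carrier S\<phi>" and y: "y \<in> carrier M"
      then show "\<zero>\<^bsub>S\<^esub> \<odot>\<^bsub>E M\<^esub> tmul R S\<phi> M t y = \<zero>\<^bsub>?T\<^esub>"
        using linear_zero[OF bilinear_map_linear(2)[OF R.tmul_bilinear[OF scalar_small M] y]
            small_modulesD[OF scalar_small] T.module_axioms]
        by (simp add: ext_smult_tmul)
    qed simp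
    then show "\<zero>\<^bsub>S\<^esub> \<odot>\<^bsub>E M\<^esub> x = \<zero>\<^bsub>E M\<^esub>" by simp
  qed (simp_all add: T.a_ac)
  then show ?thesis using small_modules_small[OF Ts] by (simp add: small_modules_def)
qed

lemma eta_closed [simp]: "x \<in> carrier M \<Longrightarrow> eta M x \<in> carrier (tens R S\<phi> M)"
  unfolding eta_def using M S.one_closed by simp

lemma tmul_eta: "s \<in> carrier S \<Longrightarrow> x \<in> carrier M \<Longrightarrow> tmul R S\<phi> M s x = s \<odot>\<^bsub>E M\<^esub> eta M x"
proof -
  interpret S': cring S by (rule S.cring)
  show "s \<in> carrier S \<Longrightarrow> x \<in> carrier M \<Longrightarrow> ?thesis" unfolding eta_def by (simp add: ext_smult_tmul)
qed

lemma eta_linear: "linear R M (restrict_scalars \<phi> (E M)) (eta M)"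
proof (rule linearI)
  note b = R.tmul_bilinear[OF scalar_small M]
  show "eta M (x \<oplus>\<^bsub>M\<^esub> y) = eta M x \<oplus>\<^bsub>restrict_scalars \<phi> (E M)\<^esub> eta M y" if "x \<in> carrier M" "y \<in> carrier M" for x y
    using linear_add[OF bilinear_map_linear(1)[OF b, of "\<one>\<^bsub>S\<^esub>"] that] S.one_closed by (simp add: eta_def)
  show "eta M (r \<odot>\<^bsub>M\<^esub> x) = r \<odot>\<^bsub>restrict_scalars \<phi> (E M)\<^esub> eta M x" if "r \<in> carrier R" "x \<in> carrier M" for r x
    using linear_smult[OF bilinear_map_linear(1)[OF b, of "\<one>\<^bsub>S\<^esub>"] that] S.one_closed that
      ext_action[OF that(1) eta_closed[OF that(2)]] by (simp add: eta_def)
qed simp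

text \<open>
  Existence in the adjunction between extension and restriction of scalars: the extension of \<open>g\<close> is
  \<open>s \<otimes> x \<mapsto> s g(x)\<close>.
\<close>

lemma ext_lift:
  assumes N: "N \<in> small_modules S" and g: "linear R M (restrict_scalars \<phi> N) g"
  shows "\<exists>h. h \<in> mod_hom S (E M) N \<and> (\<forall>x\<in>carrier M. h (eta M x) = g x)"
proof -
  interpret N: module S N using N by (rule small_modulesD)
  let ?T = "tens R S\<phi> M" and ?\<beta> = "\<lambda>s x. s \<odot>\<^bsub>N\<^esub> g x"
  note gc = linear_closed[OF g, simplified] and ga = linear_add[OF g, simplified]
    and gs = linear_smult[OF g, simplified]
  have "bilinear_map R S\<phi> M (restrict_scalars \<phi> N) ?\<beta>"
    by (rule bilinear_mapI)
      (simp_all add: gc ga gs hom_simps N.smult_l_distr N.smult_r_distr N.smult_assoc1[symmetric] N.R.m_comm)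
  note l = R.tens_lift[OF scalar_small M restrict_scalars_small[OF N] this]
  let ?h = "tens_lift R S\<phi> M (restrict_scalars \<phi> N) ?\<beta>"
  note hl = mod_hom_linear[OF l(1)]
  have "linear S (E M) N ?h"
  proof (rule linearI)
    show "?h y \<in> carrier N" if "y \<in> carrier (E M)" for y using linear_closed[OF hl, simplified] that by simp
    show "?h (y \<oplus>\<^bsub>E M\<^esub> z) = ?h y \<oplus>\<^bsub>N\<^esub> ?h z" if "y \<in> carrier (E M)" "z \<in> carrier (E M)" for y z
      using linear_add[OF hl, simplified] that by simp
    show "?h (s \<odot>\<^bsub>E M\<^esub> y) = s \<odot>\<^bsub>N\<^esub> ?h y" if s: "s \<in> carrier S" and "y \<in> carrier (E M)" for s y
    proof -
      have y: "y \<in> carrier ?T" using that by simp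
      have c: "linear R ?T (restrict_scalars \<phi> N) (\<lambda>y. s \<odot>\<^bsub>N\<^esub> ?h y)"
        by (rule linearI) (simp_all add: s linear_closed[OF hl, simplified] linear_add[OF hl, simplified]
          linear_smult[OF hl, simplified] hom_simps N.smult_r_distr N.smult_assoc1[symmetric] N.R.m_comm)
      show ?thesis
        by (rule R.tens_ext[OF scalar_small M restrict_scalars_small[OF N]
              linear_comp[OF ext_smult_linear[OF s] hl] c _ y])
          (use s in \<open>simp_all add: ext_smult_tmul l(2) gc N.smult_assoc1\<close>)
    qed
  qed
  then have "?h \<in> mod_hom S (E M) N" using l(1) by (simp add: mod_hom_iff)
  moreover have "?h (eta M x) = g x" if "x \<in> carrier M" for x
    unfolding eta_def using l(2)[of "\<one>\<^bsub>S\<^esub>" x] that by (simp add: gc)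
  ultimately show ?thesis by blast
qed

text \<open>
  The elements \<open>1 \<otimes> x\<close> span over \<open>S\<close>, since \<open>s \<otimes> x\<close> is \<open>s\<close> times \<open>1 \<otimes> x\<close>.
\<close>

lemma ext_agree:
  assumes N: "N \<in> small_modules S" and f: "linear S (E M) N f" and g: "linear S (E M) N g"
    and eq: "\<And>x. x \<in> carrier M \<Longrightarrow> f (eta M x) = g (eta M x)" and y: "y \<in> carrier (E M)"
  shows "f y = g y"
proof -
  let ?T = "tens R S\<phi> M"
  have lin: "linear R ?T (restrict_scalars \<phi> N) h" if h: "linear S (E M) N h" for h
    by (rule linearI) (use linear_closed[OF h] linear_add[OF h] linear_smult[OF h] ext_action hom_simps in simp_all)
  show ?thesis
  proof (rule R.tens_ext[OF scalar_small M restrict_scalars_small[OF N] lin[OF f] lin[OF g]])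
    show "f (tmul R S\<phi> M s x) = g (tmul R S\<phi> M s x)" if "s \<in> carrier S\<phi>" "x \<in> carrier M" for s x
      using that linear_smult[OF f, of s "eta M x"] linear_smult[OF g, of s "eta M x"] eq
      by (simp add: tmul_eta)
    show "y \<in> carrier ?T" using y by simp
  qed
qed

end

lemma ext_map_eval:
  assumes M: "M \<in> small_modules R" and N: "N \<in> small_modules R" and f: "f \<in> mod_hom R M N"
  defines "h \<equiv> tens_map R S\<phi> M S\<phi> N (\<lambda>t\<in>carrier S. t) f"
  shows "h \<in> mod_hom S (E M) (E N)" and "x \<in> carrier M \<Longrightarrow> h (eta M x) = eta N (f x)"
proof -
  have id: "(\<lambda>t\<in>carrier S. t) \<in> mod_hom R S\<phi> S\<phi>" using R.id_mod_hom_small[OF scalar_small] by simp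
  note m = R.tens_map[OF scalar_small M scalar_small N id f, folded h_def]
  note hl = mod_hom_linear[OF m(1)]
  interpret S': cring S by (rule S.cring)
  have "linear S (E M) (E N) h"
  proof (rule linearI)
    show "h (s \<odot>\<^bsub>E M\<^esub> y) = s \<odot>\<^bsub>E N\<^esub> h y" if s: "s \<in> carrier S" and "y \<in> carrier (E M)" for s y
    proof -
      have y: "y \<in> carrier (tens R S\<phi> M)" using that by simp
      show ?thesis
        by (rule R.tens_ext[OF scalar_small M _ linear_comp[OF ext_smult_linear[OF M s] hl]
              linear_comp[OF hl ext_smult_linear[OF N s]] _ y])
          (use s M N mod_hom_closed[OF f] in \<open>simp_all add: ext_smult_tmul m(2)\<close>)
    qed
  qed (simp_all add: linear_closed[OF hl] linear_add[OF hl])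
  then show "h \<in> mod_hom S (E M) (E N)" using m(1) by (simp add: mod_hom_iff)
  show "x \<in> carrier M \<Longrightarrow> h (eta M x) = eta N (f x)" unfolding eta_def using m(2)[of "\<one>\<^bsub>S\<^esub>" x] by simp
qed

text \<open>
  The adjunction in two variables: a bilinear map is extended first in the left argument for each
  fixed right argument, and then in the right argument.
\<close>

lemma ext_bilinear:
  assumes M: "M \<in> small_modules R" and N: "N \<in> small_modules R" and P: "P \<in> small_modules S"
    and \<beta>: "bilinear_map R M N (restrict_scalars \<phi> P) \<beta>"
  shows "\<exists>\<gamma>. bilinear_map S (E M) (E N) P \<gamma> \<and>
    (\<forall>x\<in>carrier M. \<forall>y\<in>carrier N. \<gamma> (eta M x) (eta N y) = \<beta> x y)"
proof -
  have Pm: "module S P" using P by (rule small_modulesD)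
  have "\<exists>h. h \<in> mod_hom S (E M) P \<and> (\<forall>x\<in>carrier M. h (eta M x) = \<beta> x y)" if "y \<in> carrier N" for y
    using ext_lift[OF M P bilinear_map_linear(2)[OF \<beta> that]] .
  then obtain f where "\<And>y. y \<in> carrier N \<Longrightarrow> f y \<in> mod_hom S (E M) P"
    and fe: "\<And>x y. y \<in> carrier N \<Longrightarrow> x \<in> carrier M \<Longrightarrow> f y (eta M x) = \<beta> x y" by metis
  then have f: "linear S (E M) P (f y)" if "y \<in> carrier N" for y using that by (simp add: mod_hom_linear)
  interpret N: module R N using N by (rule small_modulesD)
  note b2 = bilinear_map_linear(1)[OF \<beta>]
  have fy: "linear R N (restrict_scalars \<phi> P) (\<lambda>y. f y a)" if a: "a \<in> carrier (E M)" for a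
  proof (rule linearI)
    show "f y a \<in> carrier (restrict_scalars \<phi> P)" if "y \<in> carrier N" for y
      using linear_closed[OF f[OF that] a] by simp
    have "f (y \<oplus>\<^bsub>N\<^esub> z) a = f y a \<oplus>\<^bsub>P\<^esub> f z a" if y: "y \<in> carrier N" and z: "z \<in> carrier N" for y z
      by (rule ext_agree[OF M P f linear_sum[OF Pm f f] _ a])
        (use y z linear_add[OF b2] in \<open>simp_all add: fe\<close>)
    then show "f (y \<oplus>\<^bsub>N\<^esub> z) a = f y a \<oplus>\<^bsub>restrict_scalars \<phi> P\<^esub> f z a"
      if "y \<in> carrier N" "z \<in> carrier N" for y z using that by simp
    have "f (r \<odot>\<^bsub>N\<^esub> y) a = \<phi> r \<odot>\<^bsub>P\<^esub> f y a" if r: "r \<in> carrier R" and y: "y \<in> carrier N" for r y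
      by (rule ext_agree[OF M P f linear_scale[OF Pm f] _ a])
        (use r y linear_smult[OF b2] hom_simps in \<open>simp_all add: fe\<close>)
    then show "f (r \<odot>\<^bsub>N\<^esub> y) a = r \<odot>\<^bsub>restrict_scalars \<phi> P\<^esub> f y a"
      if "r \<in> carrier R" "y \<in> carrier N" for r y using that by simp
  qed
  have "\<exists>h. h \<in> mod_hom S (E N) P \<and> (\<forall>y\<in>carrier N. h (eta N y) = f y a)" if "a \<in> carrier (E M)" for a
    using ext_lift[OF N P fy[OF that]] .
  then obtain \<gamma> where "\<And>a. a \<in> carrier (E M) \<Longrightarrow> \<gamma> a \<in> mod_hom S (E N) P"
    and ge: "\<And>a y. a \<in> carrier (E M) \<Longrightarrow> y \<in> carrier N \<Longrightarrow> \<gamma> a (eta N y) = f y a" by metis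
  then have g: "linear S (E N) P (\<gamma> a)" if "a \<in> carrier (E M)" for a using that by (simp add: mod_hom_linear)
  interpret EM: module S "E M" using ext_small[OF M] by (rule small_modulesD)
  have "bilinear_map S (E M) (E N) P \<gamma>"
  proof (rule bilinear_mapI)
    show "\<gamma> (a \<oplus>\<^bsub>E M\<^esub> a') b = \<gamma> a b \<oplus>\<^bsub>P\<^esub> \<gamma> a' b"
      if a: "a \<in> carrier (E M)" and a': "a' \<in> carrier (E M)" and b: "b \<in> carrier (E N)" for a a' b
      by (rule ext_agree[OF N P g[OF EM.a_closed[OF a a']] linear_sum[OF Pm g[OF a] g[OF a']] _ b])
        (use ge[OF EM.a_closed[OF a a']] ge[OF a] ge[OF a'] linear_add[OF f a a'] in simp)
    show "\<gamma> (s \<odot>\<^bsub>E M\<^esub> a) b = s \<odot>\<^bsub>P\<^esub> \<gamma> a b"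
      if s: "s \<in> carrier S" and a: "a \<in> carrier (E M)" and b: "b \<in> carrier (E N)" for s a b
      by (rule ext_agree[OF N P g[OF EM.smult_closed[OF s a]] linear_scale[OF Pm g[OF a] s] _ b])
        (use ge[OF EM.smult_closed[OF s a]] ge[OF a] linear_smult[OF f s a] in simp)
  qed (simp_all add: linear_closed[OF g, simplified] linear_add[OF g, simplified]
    linear_smult[OF g, simplified])
  moreover have "\<gamma> (eta M x) (eta N y) = \<beta> x y" if "x \<in> carrier M" "y \<in> carrier N" for x y
    using ge[of "eta M x" y] fe that M by simp
  ultimately show ?thesis by blast
qed

lemma ext_tens_agree:
  assumes M: "M \<in> small_modules R" and N: "N \<in> small_modules R" and P: "P \<in> small_modules S"
    and f: "linear S (tens S (E M) (E N)) P f" and g: "linear S (tens S (E M) (E N)) P g"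
    and eq: "\<And>x y. x \<in> carrier M \<Longrightarrow> y \<in> carrier N \<Longrightarrow>
      f (tmul S (E M) (E N) (eta M x) (eta N y)) = g (tmul S (E M) (E N) (eta M x) (eta N y))"
    and t: "t \<in> carrier (tens S (E M) (E N))"
  shows "f t = g t"
proof (rule S.tens_ext[OF ext_small[OF M] ext_small[OF N] P f g _ t])
  note b = S.tmul_bilinear[OF ext_small[OF M] ext_small[OF N]]
  fix a c assume a: "a \<in> carrier (E M)" and c: "c \<in> carrier (E N)"
  show "f (tmul S (E M) (E N) a c) = g (tmul S (E M) (E N) a c)"
  proof (rule ext_agree[OF N P linear_comp[OF bilinear_map_linear(1)[OF b a] f]
        linear_comp[OF bilinear_map_linear(1)[OF b a] g] _ c])
    fix y assume y: "y \<in> carrier N"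
    then have ey: "eta N y \<in> carrier (E N)" using N by simp
    show "f (tmul S (E M) (E N) a (eta N y)) = g (tmul S (E M) (E N) a (eta N y))"
      by (rule ext_agree[OF M P linear_comp[OF bilinear_map_linear(2)[OF b ey] f]
          linear_comp[OF bilinear_map_linear(2)[OF b ey] g] _ a]) (simp add: eq y)
  qed
qed

end


lemma iso_set_hom: "f \<in> iso_set C x y \<Longrightarrow> f \<in> hom_set C x y"
  and iso_set_iso: "f \<in> iso_set C x y \<Longrightarrow> is_iso C f"
  by (simp_all add: iso_set_def)

context small_cring
begin

lemmas asc_hom = asc_iso[THEN iso_set_hom]
lemmas lun_in_hom = lun_iso(1)[THEN iso_set_hom]
lemmas run_in_hom = lun_iso(2)[THEN iso_set_hom]
lemmas brd_in_hom = brd_iso[THEN iso_set_hom]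

lemma mfun_structure:
  "\<lbrakk>M \<in> small_modules R; N \<in> small_modules R; P \<in> small_modules R; x \<in> carrier M; y \<in> carrier N; z \<in> carrier P\<rbrakk> \<Longrightarrow>
    mfun (asc (Mod R) M N P) (tmul R (tens R M N) P (tmul R M N x y) z) = tmul R M (tens R N P) x (tmul R N P y z)"
  "\<lbrakk>M \<in> small_modules R; r \<in> carrier R; x \<in> carrier M\<rbrakk> \<Longrightarrow> mfun (lun (Mod R) M) (tmul R II M r x) = r \<odot>\<^bsub>M\<^esub> x"
  "\<lbrakk>M \<in> small_modules R; r \<in> carrier R; x \<in> carrier M\<rbrakk> \<Longrightarrow> mfun (run (Mod R) M) (tmul R M II x r) = r \<odot>\<^bsub>M\<^esub> x"
  "\<lbrakk>M \<in> small_modules R; N \<in> small_modules R; x \<in> carrier M; y \<in> carrier N\<rbrakk> \<Longrightarrow>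
    mfun (brd (Mod R) M N) (tmul R M N x y) = tmul R N M y x"
  by (simp_all add: tens_eval)

lemma tarr_in_hom:
  "a \<in> hom_set (Mod R) M M' \<Longrightarrow> b \<in> hom_set (Mod R) N N' \<Longrightarrow>
     tarr (Mod R) a b \<in> hom_set (Mod R) (tens R M N) (tens R M' N')"
  using smc_tarr[OF Mod_symmetric_monoidal] by simp

lemma idn_in_hom: "M \<in> small_modules R \<Longrightarrow> idn (Mod R) M \<in> hom_set (Mod R) M M"
  by simp

lemma cmp_in_hom:
  "a \<in> hom_set (Mod R) M N \<Longrightarrow> b \<in> hom_set (Mod R) N P \<Longrightarrow> b \<cdot>\<^bsub>Mod R\<^esub> a \<in> hom_set (Mod R) M P"
  by (rule category_cmp[OF Mod_is_category])

lemma unit_tens_agree: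
  assumes M: "M \<in> small_modules R" and P: "P \<in> small_modules R"
    and f: "linear R (tens R II M) P f" and g: "linear R (tens R II M) P g"
    and eq: "\<And>x. x \<in> carrier M \<Longrightarrow> f (tmul R II M \<one>\<^bsub>R\<^esub> x) = g (tmul R II M \<one>\<^bsub>R\<^esub> x)"
    and t: "t \<in> carrier (tens R II M)"
  shows "f t = g t"
proof (rule tens_ext[OF unit_small M P f g _ t])
  interpret R: cring R by (rule cring)
  fix r x assume "r \<in> carrier II" and x: "x \<in> carrier M"
  then have r: "r \<in> carrier R" by simp
  have "tmul R II M r x = r \<odot>\<^bsub>tens R II M\<^esub> tmul R II M \<one>\<^bsub>R\<^esub> x"
    using tmul_smult_left[OF unit_small M r, of "\<one>\<^bsub>R\<^esub>" x] r x by simp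
  then show "f (tmul R II M r x) = g (tmul R II M r x)"
    using linear_smult[OF f r] linear_smult[OF g r] eq[OF x] M x by simp
qed

lemma tens_unit_agree:
  assumes M: "M \<in> small_modules R" and P: "P \<in> small_modules R"
    and f: "linear R (tens R M II) P f" and g: "linear R (tens R M II) P g"
    and eq: "\<And>x. x \<in> carrier M \<Longrightarrow> f (tmul R M II x \<one>\<^bsub>R\<^esub>) = g (tmul R M II x \<one>\<^bsub>R\<^esub>)"
    and t: "t \<in> carrier (tens R M II)"
  shows "f t = g t"
proof (rule tens_ext[OF M unit_small P f g _ t])
  interpret R: cring R by (rule cring)
  fix x r assume x: "x \<in> carrier M" and "r \<in> carrier II"
  then have r: "r \<in> carrier R" by simp
  have "tmul R M II x r = r \<odot>\<^bsub>tens R M II\<^esub> tmul R M II x \<one>\<^bsub>R\<^esub>"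
    using tmul_smult_right[OF M unit_small r, of x "\<one>\<^bsub>R\<^esub>"] r x by simp
  then show "f (tmul R M II x r) = g (tmul R M II x r)"
    using linear_smult[OF f r] linear_smult[OF g r] eq[OF x] M x by simp
qed

end

context scalar_extension
begin

abbreviation "EE \<equiv> ext_scalars R S \<phi>"

lemma EE_simps [simp]:
  "fobj EE = E" "farr EE = ext_map R S \<phi>" "fmul EE = ext_mul R S \<phi>" "fone EE = ext_one R S \<phi>"
  by (simp_all add: ext_scalars_def)

lemma ext_map_hom:
  assumes a: "a \<in> hom_set (Mod R) M N"
  shows "ext_map R S \<phi> a \<in> hom_set (Mod S) (E M) (E N)"
    and "x \<in> carrier M \<Longrightarrow> mfun (ext_map R S \<phi> a) (eta M x) = eta N (mfun a x)"
proof -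
  obtain f where f: "a = (M, f, N)" "M \<in> small_modules R" "N \<in> small_modules R" "f \<in> mod_hom R M N"
    using a by (rule hom_set_ModE)
  note e = ext_map_eval[OF f(2-4)]
  show "ext_map R S \<phi> a \<in> hom_set (Mod S) (E M) (E N)" using f e(1) by (simp add: ext_map_def)
  show "x \<in> carrier M \<Longrightarrow> mfun (ext_map R S \<phi> a) (eta M x) = eta N (mfun a x)"
    using f e(2) by (simp add: ext_map_def)
qed

lemma ext_arr_eqI:
  assumes M: "M \<in> small_modules R"
    and a: "a \<in> hom_set (Mod S) (E M) N" and b: "b \<in> hom_set (Mod S) (E M) N"
    and eq: "\<And>x. x \<in> carrier M \<Longrightarrow> mfun a (eta M x) = mfun b (eta M x)"
  shows "a = b"
  by (rule Mod_arr_eqI[OF a b])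
    (rule ext_agree[OF M hom_set_Mod_obj(2)[OF a] mfun_linear[OF a] mfun_linear[OF b] eq])

lemma ext_tens_arr_eqI:
  assumes M: "M \<in> small_modules R" and N: "N \<in> small_modules R"
    and a: "a \<in> hom_set (Mod S) (tens S (E M) (E N)) P" and b: "b \<in> hom_set (Mod S) (tens S (E M) (E N)) P"
    and eq: "\<And>x y. x \<in> carrier M \<Longrightarrow> y \<in> carrier N \<Longrightarrow>
      mfun a (tmul S (E M) (E N) (eta M x) (eta N y)) = mfun b (tmul S (E M) (E N) (eta M x) (eta N y))"
  shows "a = b"
  by (rule Mod_arr_eqI[OF a b])
    (rule ext_tens_agree[OF M N hom_set_Mod_obj(2)[OF a] mfun_linear[OF a] mfun_linear[OF b] eq])

lemma ext_functor: "is_functor (Mod R) (Mod S) EE"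
  unfolding is_functor_def
proof (intro conjI ballI allI Mod_is_category)
  show "fobj EE M \<in> obj (Mod S)" if "M \<in> obj (Mod R)" for M using that by simp
  show "farr EE a \<in> hom_set (Mod S) (fobj EE M) (fobj EE N)" if "a \<in> hom_set (Mod R) M N" for M N a
    using ext_map_hom(1)[OF that] by simp
  show "farr EE (idn (Mod R) M) = idn (Mod S) (fobj EE M)" if "M \<in> obj (Mod R)" for M
  proof -
    have M: "M \<in> small_modules R" using that by simp
    note i = R.idn_in_hom[OF M]
    show ?thesis unfolding EE_simps
    proof (rule ext_arr_eqI[OF M ext_map_hom(1)[OF i] S.idn_in_hom[OF ext_small[OF M]]])
      fix x assume x: "x \<in> carrier M"
      show "mfun (ext_map R S \<phi> (idn (Mod R) M)) (eta M x) = mfun (idn (Mod S) (E M)) (eta M x)"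
        using ext_map_hom(2)[OF i x] x eta_closed[OF M x] by simp
    qed
  qed
  fix M N P a b assume a: "a \<in> hom_set (Mod R) M N" and b: "b \<in> hom_set (Mod R) N P"
  note M = hom_set_Mod_obj(1)[OF a]
  note A = ext_map_hom[OF a] and B = ext_map_hom[OF b] and C = ext_map_hom[OF R.cmp_in_hom[OF a b]]
  show "farr EE (b \<cdot>\<^bsub>Mod R\<^esub> a) = farr EE b \<cdot>\<^bsub>Mod S\<^esub> farr EE a"
    unfolding EE_simps
  proof (rule ext_arr_eqI[OF M C(1) S.cmp_in_hom[OF A(1) B(1)]])
    fix x assume x: "x \<in> carrier M"
    show "mfun (ext_map R S \<phi> (b \<cdot>\<^bsub>Mod R\<^esub> a)) (eta M x) = mfun (ext_map R S \<phi> b \<cdot>\<^bsub>Mod S\<^esub> ext_map R S \<phi> a) (eta M x)"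
      using mfun_cmp[OF A(1) B(1)] C(2)[OF x] A(2)[OF x] B(2)[OF mfun_closed[OF a x]] mfun_cmp[OF a b x]
        eta_closed[OF M x] by simp
  qed
qed

text \<open>
  By adjunction, a cocone under the extended diagram corresponds to a cocone under the original
  diagram with vertex the restriction of scalars.
\<close>

lemma ext_cocontinuous: "cocontinuous TYPE('u) (Mod R) (Mod S) EE"
  unfolding cocontinuous_def preserves_colimits_def
proof (intro allI impI)
  fix J :: "('u, 'u) category" and D :: "('u, 'u, ('u, 'u) module, 'u mod_arr) fctr" and c \<iota>
  assume D: "is_functor J (Mod R) D" and c: "is_colimit (Mod R) J D c \<iota>"
  have cc: "is_cocone (Mod R) J D c \<iota>" using c by (simp add: is_colimit_def)
  note \<iota> = cocone_Mod(2)[OF D cc] and cs = cocone_Mod(1)[OF D cc]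
  have o: "fobj D j \<in> small_modules R" if "j \<in> obj J" for j using functor_obj[OF D that] by simp
  show "is_colimit (Mod S) J (comp_fctr EE D) (fobj EE c) (\<lambda>j. farr EE (\<iota> j))"
  proof (rule colimit_ModI[OF is_functor_comp[OF D ext_functor] functor_cocone[OF ext_functor D cc]])
    fix P \<kappa> assume P: "P \<in> small_modules S"
      and \<kappa>: "\<And>j. j \<in> obj J \<Longrightarrow> linear S (fobj (comp_fctr EE D) j) P (\<kappa> j)"
      and compat: "\<And>u x. u \<in> arr J \<Longrightarrow> x \<in> carrier (fobj (comp_fctr EE D) (src J u)) \<Longrightarrow>
        \<kappa> (tgt J u) (mfun (farr (comp_fctr EE D) u) x) = \<kappa> (src J u) x"
    have k: "linear S (E (fobj D j)) P (\<kappa> j)" if "j \<in> obj J" for j using \<kappa>[OF that] by simp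
    have res: "linear R A (restrict_scalars \<phi> P) f" if "linear R A (restrict_scalars \<phi> (E B)) g"
      "linear S (E B) P h" "\<And>x. f x = h (g x)" for A B f g h
      using linear_closed[OF that(1)] linear_add[OF that(1)] linear_smult[OF that(1)] linear_closed[OF that(2)]
        linear_add[OF that(2)] linear_smult[OF that(2)] hom_simps that(3) by (intro linearI) simp_all
    have g: "linear R (fobj D j) (restrict_scalars \<phi> P) (\<lambda>x. \<kappa> j (eta (fobj D j) x))" if "j \<in> obj J" for j
      by (rule res[OF eta_linear[OF o[OF that]] k[OF that] refl])
    obtain f where f: "linear R c (restrict_scalars \<phi> P) f"
      "\<And>j x. j \<in> obj J \<Longrightarrow> x \<in> carrier (fobj D j) \<Longrightarrow> f (mfun (\<iota> j) x) = \<kappa> j (eta (fobj D j) x)"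
    proof (rule colimit_Mod_desc[OF D c restrict_scalars_small[OF P] g])
      fix u x assume u: "u \<in> arr J" and x: "x \<in> carrier (fobj D (src J u))"
      have "eta (fobj D (src J u)) x \<in> carrier (fobj (comp_fctr EE D) (src J u))"
        using eta_closed[OF o[OF category_src[OF functor_source[OF D] u]] x] by simp
      from compat[OF u this]
      show "\<kappa> (tgt J u) (eta (fobj D (tgt J u)) (mfun (farr D u) x)) = \<kappa> (src J u) (eta (fobj D (src J u)) x)"
        using ext_map_hom(2)[OF functor_hom[OF D arr_in_hom_set[OF u]] x] by simp
    qed auto
    obtain h where h: "h \<in> mod_hom S (E c) P" "\<forall>x\<in>carrier c. h (eta c x) = f x"
      using ext_lift[OF cs P f(1)] by blast
    have "h (mfun (ext_map R S \<phi> (\<iota> j)) y) = \<kappa> j y" if j: "j \<in> obj J" and y: "y \<in> carrier (E (fobj D j))" for j y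
    proof (rule ext_agree[OF o[OF j] P linear_comp[OF mfun_linear[OF ext_map_hom(1)[OF \<iota>[OF j]]]
            mod_hom_linear[OF h(1)]] k[OF j] _ y])
      show "h (mfun (ext_map R S \<phi> (\<iota> j)) (eta (fobj D j) x)) = \<kappa> j (eta (fobj D j) x)"
        if x: "x \<in> carrier (fobj D j)" for x
        using ext_map_hom(2)[OF \<iota>[OF j] x] h(2) mfun_closed[OF \<iota>[OF j] x] f(2)[OF j x] by simp
    qed
    then show "\<exists>h. linear S (fobj EE c) P h \<and>
        (\<forall>j\<in>obj J. \<forall>x\<in>carrier (fobj (comp_fctr EE D) j). h (mfun (farr EE (\<iota> j)) x) = \<kappa> j x)"
      using mod_hom_linear[OF h(1)] by (intro exI[of _ h]) simp
  next
    fix P f g y assume P: "P \<in> small_modules S" and "linear S (fobj EE c) P f" "linear S (fobj EE c) P g"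
      and eq: "\<And>j x. j \<in> obj J \<Longrightarrow> x \<in> carrier (fobj (comp_fctr EE D) j) \<Longrightarrow>
        f (mfun (farr EE (\<iota> j)) x) = g (mfun (farr EE (\<iota> j)) x)"
      and y: "y \<in> carrier (fobj EE c)"
    then have f: "linear S (E c) P f" and g: "linear S (E c) P g" by simp_all
    have res: "linear R c (restrict_scalars \<phi> P) (\<lambda>x. h (eta c x))" if "linear S (E c) P h" for h
      using linear_closed[OF that] linear_add[OF that] linear_smult[OF that] linear_closed[OF eta_linear[OF cs]]
        linear_add[OF eta_linear[OF cs]] linear_smult[OF eta_linear[OF cs]] hom_simps
      by (intro linearI) simp_all
    show "f y = g y"
    proof (rule ext_agree[OF cs P f g])
      show "y \<in> carrier (E c)" using y by simp
      show "f (eta c x) = g (eta c x)" if "x \<in> carrier c" for x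
      proof (rule colimit_Mod_ext[OF D c restrict_scalars_small[OF P] res[OF f] res[OF g] _ that])
        fix j x assume j: "j \<in> obj J" and x: "x \<in> carrier (fobj D j)"
        show "f (eta c (mfun (\<iota> j) x)) = g (eta c (mfun (\<iota> j) x))"
          using eq[OF j, of "eta (fobj D j) x"] eta_closed[OF o[OF j] x] ext_map_hom(2)[OF \<iota>[OF j] x] by simp
      qed
    qed
  qed
qed

lemma ext_one_iso: "ext_one R S \<phi> \<in> iso_set (Mod S) S.II (E R.II)"
  and mfun_ext_one: "mfun (ext_one R S \<phi>) \<one>\<^bsub>S\<^esub> = eta R.II \<one>\<^bsub>R\<^esub>"
proof -
  interpret S': cring S by (rule S.cring)
  interpret R': cring R by (rule R.cring)
  let ?f = "\<lambda>s. tmul R S\<phi> R.II s \<one>\<^bsub>R\<^esub>"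
  have e: "?f s = s \<odot>\<^bsub>E R.II\<^esub> eta R.II \<one>\<^bsub>R\<^esub>" if "s \<in> carrier S" for s
    using tmul_eta[OF R.unit_small that] by simp
  have e1: "eta R.II \<one>\<^bsub>R\<^esub> \<in> carrier (E R.II)" using eta_closed[OF R.unit_small] by simp
  have lin: "linear S S.II (E R.II) ?f"
    by (rule linear_cong[OF S.pt_linear[OF ext_small[OF R.unit_small] e1] _ small_modulesD[OF S.unit_small]])
      (simp add: e)
  have "linear R R.II (restrict_scalars \<phi> S.II) \<phi>" by (rule linearI) (simp_all add: hom_simps)
  then obtain h where h: "h \<in> mod_hom S (E R.II) S.II" "\<forall>r\<in>carrier R. h (eta R.II r) = \<phi> r"
    using ext_lift[OF R.unit_small S.unit_small] by auto
  note hl = mod_hom_linear[OF h(1)]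
  have id: "linear S (E R.II) (E R.II) (\<lambda>y. y)" by (rule linearI) simp_all
  have eta_r: "eta R.II r = \<phi> r \<odot>\<^bsub>E R.II\<^esub> eta R.II \<one>\<^bsub>R\<^esub>" if "r \<in> carrier R" for r
    using linear_smult[OF eta_linear[OF R.unit_small] that, of "\<one>\<^bsub>R\<^esub>"] that by simp
  have fh: "?f (h y) = y" if y: "y \<in> carrier (E R.II)" for y
    by (rule ext_agree[OF R.unit_small ext_small[OF R.unit_small] linear_comp[OF hl lin] id _ y])
      (use h(2) in \<open>simp add: e hom_simps eta_r[symmetric]\<close>)
  have hf: "h (?f s) = s" if "s \<in> carrier S" for s
    using linear_smult[OF hl that e1] h(2) that by (simp add: e hom_simps)
  have m: "restrict ?f (carrier S) \<in> mod_hom S S.II (E R.II)"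
    using restrict_mod_hom[OF lin small_modulesD[OF S.unit_small]] by simp
  have "(S.II, restrict ?f (carrier S), E R.II) \<in> iso_set (Mod S) S.II (E R.II)"
    by (rule iso_set_Mod[OF S.unit_small ext_small[OF R.unit_small] m hl])
      (use linear_closed[OF hl] fh hf in simp_all)
  then show "ext_one R S \<phi> \<in> iso_set (Mod S) S.II (E R.II)" by (simp add: ext_one_def)
  show "mfun (ext_one R S \<phi>) \<one>\<^bsub>S\<^esub> = eta R.II \<one>\<^bsub>R\<^esub>" by (simp add: ext_one_def eta_def)
qed

text \<open>
  The structure map sends \<open>(1 \<otimes> x) \<otimes> (1 \<otimes> y)\<close> to \<open>1 \<otimes> (x \<otimes> y)\<close>, which determines it by linearity; it
  exists by extension in two variables, and its inverse exists by the adjunction.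
\<close>

context
  fixes M N assumes M: "M \<in> small_modules R" and N: "N \<in> small_modules R"
begin

lemma ext_mul_iso: "ext_mul R S \<phi> M N \<in> iso_set (Mod S) (tens S (E M) (E N)) (E (tens R M N))"
  and mfun_ext_mul: "x \<in> carrier M \<Longrightarrow> y \<in> carrier N \<Longrightarrow>
    mfun (ext_mul R S \<phi> M N) (tmul S (E M) (E N) (eta M x) (eta N y)) = eta (tens R M N) (tmul R M N x y)"
proof -
  interpret S': cring S by (rule S.cring)
  let ?T = "tens R M N" and ?D = "tens S (E M) (E N)"
  have T: "?T \<in> small_modules R" and D: "?D \<in> small_modules S" using M N by simp_all
  note EM = ext_small[OF M] and EN = ext_small[OF N] and ET = ext_small[OF T]
  note eM = eta_closed[OF M] and eN = eta_closed[OF N] and eT = eta_closed[OF T]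
  interpret ET: module S "E ?T" using ET by (rule small_modulesD)
  note eta_T = linear_comp[OF _ eta_linear[OF T]]
  have "bilinear_map R M N (restrict_scalars \<phi> (E ?T)) (\<lambda>x y. eta ?T (tmul R M N x y))"
    by (rule bilinear_mapI)
      (use M N linear_add[OF eta_linear[OF T]] linear_smult[OF eta_linear[OF T]] in \<open>simp_all add: R.tmul_simps eT\<close>)
  then obtain \<gamma> where \<gamma>: "bilinear_map S (E M) (E N) (E ?T) \<gamma>"
    "\<forall>x\<in>carrier M. \<forall>y\<in>carrier N. \<gamma> (eta M x) (eta N y) = eta ?T (tmul R M N x y)"
    using ext_bilinear[OF M N ET] by blast
  define h where "h = tens_lift S (E M) (E N) (E ?T) \<gamma>"
  note l = S.tens_lift[OF EM EN ET \<gamma>(1), folded h_def]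
  have he: "h (tmul S (E M) (E N) (eta M x) (eta N y)) = eta ?T (tmul R M N x y)"
    if "x \<in> carrier M" "y \<in> carrier N" for x y
    using l(2)[of "eta M x" "eta N y"] \<gamma>(2) that eM eN by simp
  have pure: "tmul S (E M) (E N) (tmul R S\<phi> M s x) (tmul R S\<phi> N t y) =
      (s \<otimes>\<^bsub>S\<^esub> t) \<odot>\<^bsub>?D\<^esub> tmul S (E M) (E N) (eta M x) (eta N y)"
    if "s \<in> carrier S" "t \<in> carrier S" "x \<in> carrier M" "y \<in> carrier N" for s t x y
  proof -
    interpret D: module S ?D using D by (rule small_modulesD)
    have a: "eta M x \<in> carrier (E M)" "eta N y \<in> carrier (E N)" using that eM eN by simp_all
    have b: "t \<odot>\<^bsub>E N\<^esub> eta N y \<in> carrier (E N)" using module.smult_closed[OF small_modulesD[OF EN] that(2) a(2)] .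
    show ?thesis
      using S.tmul_smult_left[OF EM EN that(1) a(1) b] S.tmul_smult_right[OF EM EN that(2) a]
        D.smult_assoc1[OF that(1,2) S.tmul_closed[OF EM EN a]]
      by (simp add: tmul_eta[OF M that(1,3)] tmul_eta[OF N that(2,4)])
  qed
  have ev: "g (tmul S (E M) (E N) (tmul R S\<phi> M s x) (tmul R S\<phi> N t y)) = tmul R S\<phi> ?T (s \<otimes>\<^bsub>S\<^esub> t) (tmul R M N x y)
      \<longleftrightarrow> (s \<otimes>\<^bsub>S\<^esub> t) \<odot>\<^bsub>E ?T\<^esub> g (tmul S (E M) (E N) (eta M x) (eta N y)) = (s \<otimes>\<^bsub>S\<^esub> t) \<odot>\<^bsub>E ?T\<^esub> eta ?T (tmul R M N x y)"
    if g: "g \<in> mod_hom S ?D (E ?T)" and c: "s \<in> carrier S" "t \<in> carrier S" "x \<in> carrier M" "y \<in> carrier N"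
    for g s t x y
    using linear_smult[OF mod_hom_linear[OF g], of "s \<otimes>\<^bsub>S\<^esub> t"] c pure[OF c] eM eN EM EN
      tmul_eta[OF T, of "s \<otimes>\<^bsub>S\<^esub> t" "tmul R M N x y"] M N by simp
  let ?C = "\<lambda>h. h \<in> mod_hom S ?D (E ?T) \<and> (\<forall>s\<in>carrier S. \<forall>t\<in>carrier S. \<forall>x\<in>carrier M. \<forall>y\<in>carrier N.
    h (tmul S (E M) (E N) (tmul R S\<phi> M s x) (tmul R S\<phi> N t y)) = tmul R S\<phi> ?T (s \<otimes>\<^bsub>S\<^esub> t) (tmul R M N x y))"
  have "(THE h. ?C h) = h"
  proof (rule the_equality)
    have "h (tmul S (E M) (E N) (tmul R S\<phi> M s x) (tmul R S\<phi> N t y)) = tmul R S\<phi> ?T (s \<otimes>\<^bsub>S\<^esub> t) (tmul R M N x y)"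
      if c: "s \<in> carrier S" "t \<in> carrier S" "x \<in> carrier M" "y \<in> carrier N" for s t x y
      by (rule iffD2[OF ev[OF l(1) c]]) (simp only: he[OF c(3,4)])
    then show "?C h" using l(1) by blast
    fix g assume g: "?C g"
    then have gm: "g \<in> mod_hom S ?D (E ?T)" by blast
    have "g (tmul S (E M) (E N) (eta M x) (eta N y)) = h (tmul S (E M) (E N) (eta M x) (eta N y))"
      if "x \<in> carrier M" "y \<in> carrier N" for x y
    proof -
      have c: "tmul S (E M) (E N) (eta M x) (eta N y) \<in> carrier ?D"
        using EM EN eM[OF that(1)] eN[OF that(2)] by simp
      have c': "eta ?T (tmul R M N x y) \<in> carrier (E ?T)" using eT[of "tmul R M N x y"] that M N by simp
      have "g (tmul S (E M) (E N) (tmul R S\<phi> M \<one>\<^bsub>S\<^esub> x) (tmul R S\<phi> N \<one>\<^bsub>S\<^esub> y)) =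
          tmul R S\<phi> ?T (\<one>\<^bsub>S\<^esub> \<otimes>\<^bsub>S\<^esub> \<one>\<^bsub>S\<^esub>) (tmul R M N x y)"
        using g that by blast
      from iffD1[OF ev[OF gm S'.one_closed S'.one_closed that] this] show ?thesis
        using ET.smult_one[OF mod_hom_closed[OF gm c]] ET.smult_one[OF c'] by (simp only: he[OF that] S'.l_one[OF S'.one_closed])
    qed
    then have "g t = h t" if "t \<in> carrier ?D" for t
      by (rule ext_tens_agree[OF M N ET mod_hom_linear[OF gm] mod_hom_linear[OF l(1)] _ that])
    then show "g = h" by (rule mod_hom_eqI[OF gm l(1)])
  qed
  then have mul: "ext_mul R S \<phi> M N = (?D, h, E ?T)" by (simp add: ext_mul_def Let_def)
  show "x \<in> carrier M \<Longrightarrow> y \<in> carrier N \<Longrightarrow>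
    mfun (ext_mul R S \<phi> M N) (tmul S (E M) (E N) (eta M x) (eta N y)) = eta ?T (tmul R M N x y)"
    by (simp add: mul he)
  have "bilinear_map R M N (restrict_scalars \<phi> ?D) (\<lambda>x y. tmul S (E M) (E N) (eta M x) (eta N y))"
    by (rule bilinear_mapI)
      (use EM EN linear_add[OF eta_linear[OF M]] linear_smult[OF eta_linear[OF M]]
        linear_add[OF eta_linear[OF N]] linear_smult[OF eta_linear[OF N]]
        S.tmul_add_left[OF EM EN] S.tmul_add_right[OF EM EN] S.tmul_smult_left[OF EM EN] S.tmul_smult_right[OF EM EN]
        in \<open>simp_all add: eM eN hom_simps\<close>)
  note b = R.tens_lift[OF M N restrict_scalars_small[OF D] this]
  obtain k where k: "k \<in> mod_hom S (E ?T) ?D" "\<forall>t\<in>carrier ?T. k (eta ?T t) =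
      tens_lift R M N (restrict_scalars \<phi> ?D) (\<lambda>x y. tmul S (E M) (E N) (eta M x) (eta N y)) t"
    using ext_lift[OF T D mod_hom_linear[OF b(1)]] by blast
  note hl = mod_hom_linear[OF l(1)] and kl = mod_hom_linear[OF k(1)]
  have id: "linear S A A (\<lambda>y. y)" for A :: "('u, 'u) module" by (rule linearI) simp_all
  have ke: "k (eta ?T (tmul R M N x y)) = tmul S (E M) (E N) (eta M x) (eta N y)"
    if "x \<in> carrier M" "y \<in> carrier N" for x y using k(2) b(2) that M N by simp
  have res: "linear R ?T (restrict_scalars \<phi> (E ?T)) (\<lambda>t. g (eta ?T t))" if "linear S (E ?T) (E ?T) g" for g
    using linear_closed[OF that] linear_add[OF that] linear_smult[OF that]
      linear_add[OF eta_linear[OF T]] linear_smult[OF eta_linear[OF T]] eT hom_simps by (intro linearI) simp_all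
  have "(?D, h, E ?T) \<in> iso_set (Mod S) ?D (E ?T)"
  proof (rule iso_set_Mod[OF D ET l(1) kl])
    show "k (h y) = y" if "y \<in> carrier ?D" for y
      by (rule ext_tens_agree[OF M N D linear_comp[OF hl kl] id _ that]) (simp add: he ke)
    show "h (k y) = y" if "y \<in> carrier (E ?T)" for y
    proof (rule ext_agree[OF T ET linear_comp[OF kl hl] id _ that])
      show "h (k (eta ?T t)) = eta ?T t" if "t \<in> carrier ?T" for t
        by (rule R.tens_ext[OF M N restrict_scalars_small[OF ET] res[OF linear_comp[OF kl hl]] eta_linear[OF T] _ that])
          (simp add: he ke)
    qed
  qed
  then show "ext_mul R S \<phi> M N \<in> iso_set (Mod S) ?D (E ?T)" by (simp add: mul)
qed

end

lemmas ext_mul_hom = ext_mul_iso[THEN iso_set_hom]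
lemmas ext_one_hom = ext_one_iso[THEN iso_set_hom]

end


context small_cring
begin

lemma mfun_cmp3:
  assumes "a \<in> hom_set (Mod R) A B" "b \<in> hom_set (Mod R) B C" "c \<in> hom_set (Mod R) C D" "w \<in> carrier A"
  shows "mfun (c \<cdot>\<^bsub>Mod R\<^esub> b \<cdot>\<^bsub>Mod R\<^esub> a) w = mfun c (mfun b (mfun a w))"
  using mfun_cmp[OF cmp_in_hom[OF assms(1,2)] assms(3,4)] mfun_cmp[OF assms(1,2,4)] by simp

end

context scalar_extension
begin

lemma ext_tens_arr_eqI3:
  assumes M: "M \<in> small_modules R" and N: "N \<in> small_modules R" and P: "P \<in> small_modules R"
    and a: "a \<in> hom_set (Mod S) (tens S (tens S (E M) (E N)) (E P)) Q"
    and b: "b \<in> hom_set (Mod S) (tens S (tens S (E M) (E N)) (E P)) Q"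
    and eq: "\<And>x y z. \<lbrakk>x \<in> carrier M; y \<in> carrier N; z \<in> carrier P\<rbrakk> \<Longrightarrow>
      mfun a (tmul S (tens S (E M) (E N)) (E P) (tmul S (E M) (E N) (eta M x) (eta N y)) (eta P z)) =
      mfun b (tmul S (tens S (E M) (E N)) (E P) (tmul S (E M) (E N) (eta M x) (eta N y)) (eta P z))"
  shows "a = b"
proof (rule Mod_arr_eqI[OF a b])
  let ?D = "tens S (E M) (E N)"
  have D: "?D \<in> small_modules S" using M N by simp
  note EP = ext_small[OF P] and Q = hom_set_Mod_obj(2)[OF a] and al = mfun_linear[OF a] and bl = mfun_linear[OF b]
  note t = S.tmul_bilinear[OF D EP]
  fix w assume w: "w \<in> carrier (tens S ?D (E P))"
  show "mfun a w = mfun b w"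
  proof (rule S.tens_ext[OF D EP Q al bl _ w])
    fix d c assume d: "d \<in> carrier ?D" and c: "c \<in> carrier (E P)"
    note l = bilinear_map_linear(1)[OF t d]
    show "mfun a (tmul S ?D (E P) d c) = mfun b (tmul S ?D (E P) d c)"
    proof (rule ext_agree[OF P Q linear_comp[OF l al] linear_comp[OF l bl] _ c])
      fix z assume z: "z \<in> carrier P"
      have "eta P z \<in> carrier (E P)" using eta_closed[OF P z] by simp
      note l = bilinear_map_linear(2)[OF t this]
      show "mfun a (tmul S ?D (E P) d (eta P z)) = mfun b (tmul S ?D (E P) d (eta P z))"
        by (rule ext_tens_agree[OF M N Q linear_comp[OF l al] linear_comp[OF l bl] _ d]) (rule eq[OF _ _ z])
    qed
  qed
qed

text \<open>
  All coherence conditions are equations between \<open>S\<close>-linear maps out of tensor products of extended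
  modules, hence are checked on tensors of elements \<open>1 \<otimes> x\<close>, where both sides unfold to the same
  expression.
\<close>

lemma ext_mul_natural:
  assumes a: "a \<in> hom_set (Mod R) M M'" and b: "b \<in> hom_set (Mod R) N N'"
  shows "ext_mul R S \<phi> M' N' \<cdot>\<^bsub>Mod S\<^esub> tarr (Mod S) (ext_map R S \<phi> a) (ext_map R S \<phi> b) =
    ext_map R S \<phi> (tarr (Mod R) a b) \<cdot>\<^bsub>Mod S\<^esub> ext_mul R S \<phi> M N"
proof -
  note M = hom_set_Mod_obj(1)[OF a] and N = hom_set_Mod_obj(1)[OF b]
    and M' = hom_set_Mod_obj(2)[OF a] and N' = hom_set_Mod_obj(2)[OF b]
  note A = ext_map_hom[OF a] and B = ext_map_hom[OF b] and C = ext_map_hom[OF R.tarr_in_hom[OF a b]]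
  note T = S.tarr_in_hom[OF A(1) B(1)]
  show ?thesis
  proof (rule ext_tens_arr_eqI[OF M N S.cmp_in_hom[OF T ext_mul_hom[OF M' N']] S.cmp_in_hom[OF ext_mul_hom[OF M N] C(1)]])
    fix x y assume x: "x \<in> carrier M" and y: "y \<in> carrier N"
    note ex = eta_closed[OF M x, folded ext_simps] and ey = eta_closed[OF N y, folded ext_simps]
    have t: "tmul S (E M) (E N) (eta M x) (eta N y) \<in> carrier (tens S (E M) (E N))"
      by (rule S.tmul_closed[OF ext_small[OF M] ext_small[OF N] ex ey])
    show "mfun (ext_mul R S \<phi> M' N' \<cdot>\<^bsub>Mod S\<^esub> tarr (Mod S) (ext_map R S \<phi> a) (ext_map R S \<phi> b))
        (tmul S (E M) (E N) (eta M x) (eta N y)) =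
      mfun (ext_map R S \<phi> (tarr (Mod R) a b) \<cdot>\<^bsub>Mod S\<^esub> ext_mul R S \<phi> M N)
        (tmul S (E M) (E N) (eta M x) (eta N y))"
      unfolding mfun_cmp[OF T ext_mul_hom[OF M' N'] t] mfun_cmp[OF ext_mul_hom[OF M N] C(1) t]
        S.mfun_tarr[OF A(1) B(1) ex ey] A(2)[OF x] B(2)[OF y] mfun_ext_mul[OF M N x y]
        mfun_ext_mul[OF M' N' mfun_closed[OF a x] mfun_closed[OF b y]] C(2)[OF R.tmul_closed[OF M N x y]]
        R.mfun_tarr[OF a b x y] by (rule refl)
  qed
qed

lemma ext_assoc:
  assumes M: "M \<in> small_modules R" and N: "N \<in> small_modules R" and P: "P \<in> small_modules R"
  shows "ext_map R S \<phi> (asc (Mod R) M N P) \<cdot>\<^bsub>Mod S\<^esub> ext_mul R S \<phi> (tens R M N) P \<cdot>\<^bsub>Mod S\<^esub>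
      tarr (Mod S) (ext_mul R S \<phi> M N) (idn (Mod S) (E P)) =
    ext_mul R S \<phi> M (tens R N P) \<cdot>\<^bsub>Mod S\<^esub> tarr (Mod S) (idn (Mod S) (E M)) (ext_mul R S \<phi> N P) \<cdot>\<^bsub>Mod S\<^esub>
      asc (Mod S) (E M) (E N) (E P)"
proof -
  note EM = ext_small[OF M] and EN = ext_small[OF N] and EP = ext_small[OF P]
  note MN = R.tens_small[OF M N] and NP = R.tens_small[OF N P]
  note A = ext_map_hom[OF R.asc_hom[OF M N P]]
  note mMN = ext_mul_hom[OF M N] and mNP = ext_mul_hom[OF N P] and m1 = ext_mul_hom[OF MN P] and m2 = ext_mul_hom[OF M NP]
  note iP = S.idn_in_hom[OF EP] and iM = S.idn_in_hom[OF EM]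
  note t1 = S.tarr_in_hom[OF mMN iP] and t2 = S.tarr_in_hom[OF iM mNP] and as = S.asc_hom[OF EM EN EP]
  show ?thesis
  proof (rule ext_tens_arr_eqI3[OF M N P S.cmp_in_hom[OF S.cmp_in_hom[OF t1 m1] A(1)]
        S.cmp_in_hom[OF S.cmp_in_hom[OF as t2] m2]])
    fix x y z assume x: "x \<in> carrier M" and y: "y \<in> carrier N" and z: "z \<in> carrier P"
    note ex = eta_closed[OF M x, folded ext_simps] and ey = eta_closed[OF N y, folded ext_simps]
      and ez = eta_closed[OF P z, folded ext_simps]
    note xy = S.tmul_closed[OF EM EN ex ey] and yz = S.tmul_closed[OF EN EP ey ez]
    note xyz = S.tmul_closed[OF S.tens_small[OF EM EN] EP xy ez]
    show "mfun (ext_map R S \<phi> (asc (Mod R) M N P) \<cdot>\<^bsub>Mod S\<^esub> ext_mul R S \<phi> (tens R M N) P \<cdot>\<^bsub>Mod S\<^esub>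
          tarr (Mod S) (ext_mul R S \<phi> M N) (idn (Mod S) (E P)))
        (tmul S (tens S (E M) (E N)) (E P) (tmul S (E M) (E N) (eta M x) (eta N y)) (eta P z)) =
      mfun (ext_mul R S \<phi> M (tens R N P) \<cdot>\<^bsub>Mod S\<^esub> tarr (Mod S) (idn (Mod S) (E M)) (ext_mul R S \<phi> N P) \<cdot>\<^bsub>Mod S\<^esub>
          asc (Mod S) (E M) (E N) (E P))
        (tmul S (tens S (E M) (E N)) (E P) (tmul S (E M) (E N) (eta M x) (eta N y)) (eta P z))"
      unfolding S.mfun_cmp3[OF t1 m1 A(1) xyz] S.mfun_cmp3[OF as t2 m2 xyz] S.mfun_tarr[OF mMN iP xy ez]
        mfun_ext_mul[OF M N x y] mfun_idn[OF ez] mfun_ext_mul[OF MN P R.tmul_closed[OF M N x y] z]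
        A(2)[OF R.tmul_closed[OF MN P R.tmul_closed[OF M N x y] z]]
        R.mfun_structure(1)[OF M N P x y z] S.mfun_structure(1)[OF EM EN EP ex ey ez]
        S.mfun_tarr[OF iM mNP ex yz] mfun_idn[OF ex] mfun_ext_mul[OF N P y z]
        mfun_ext_mul[OF M NP x R.tmul_closed[OF N P y z]] by (rule refl)
  qed
qed

lemma ext_brd:
  assumes M: "M \<in> small_modules R" and N: "N \<in> small_modules R"
  shows "ext_map R S \<phi> (brd (Mod R) M N) \<cdot>\<^bsub>Mod S\<^esub> ext_mul R S \<phi> M N =
    ext_mul R S \<phi> N M \<cdot>\<^bsub>Mod S\<^esub> brd (Mod S) (E M) (E N)"
proof -
  note EM = ext_small[OF M] and EN = ext_small[OF N]
  note A = ext_map_hom[OF R.brd_in_hom[OF M N]] and m = ext_mul_hom[OF M N] and m' = ext_mul_hom[OF N M]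
    and b = S.brd_in_hom[OF EM EN]
  show ?thesis
  proof (rule ext_tens_arr_eqI[OF M N S.cmp_in_hom[OF m A(1)] S.cmp_in_hom[OF b m']])
    fix x y assume x: "x \<in> carrier M" and y: "y \<in> carrier N"
    note ex = eta_closed[OF M x, folded ext_simps] and ey = eta_closed[OF N y, folded ext_simps]
    note t = S.tmul_closed[OF EM EN ex ey]
    show "mfun (ext_map R S \<phi> (brd (Mod R) M N) \<cdot>\<^bsub>Mod S\<^esub> ext_mul R S \<phi> M N) (tmul S (E M) (E N) (eta M x) (eta N y)) =
      mfun (ext_mul R S \<phi> N M \<cdot>\<^bsub>Mod S\<^esub> brd (Mod S) (E M) (E N)) (tmul S (E M) (E N) (eta M x) (eta N y))"
      unfolding mfun_cmp[OF m A(1) t] mfun_cmp[OF b m' t] mfun_ext_mul[OF M N x y]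
        A(2)[OF R.tmul_closed[OF M N x y]] R.mfun_structure(4)[OF M N x y] S.mfun_structure(4)[OF EM EN ex ey]
        mfun_ext_mul[OF N M y x] by (rule refl)
  qed
qed

lemma ext_units:
  assumes M: "M \<in> small_modules R"
  shows "ext_map R S \<phi> (lun (Mod R) M) \<cdot>\<^bsub>Mod S\<^esub> ext_mul R S \<phi> R.II M \<cdot>\<^bsub>Mod S\<^esub>
      tarr (Mod S) (ext_one R S \<phi>) (idn (Mod S) (E M)) = lun (Mod S) (E M)"
    and "ext_map R S \<phi> (run (Mod R) M) \<cdot>\<^bsub>Mod S\<^esub> ext_mul R S \<phi> M R.II \<cdot>\<^bsub>Mod S\<^esub>
      tarr (Mod S) (idn (Mod S) (E M)) (ext_one R S \<phi>) = run (Mod S) (E M)"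
proof -
  note EM = ext_small[OF M] and I = R.unit_small and i = S.idn_in_hom[OF ext_small[OF M]]
  note L = ext_map_hom[OF R.lun_in_hom[OF M]] and Rr = ext_map_hom[OF R.run_in_hom[OF M]]
  note ml = ext_mul_hom[OF I M] and mr = ext_mul_hom[OF M I]
  note tl = S.tarr_in_hom[OF ext_one_hom i] and tr = S.tarr_in_hom[OF i ext_one_hom]
  note l = S.lun_in_hom[OF EM] and r = S.run_in_hom[OF EM]
  note lc = S.cmp_in_hom[OF S.cmp_in_hom[OF tl ml] L(1)] and rc = S.cmp_in_hom[OF S.cmp_in_hom[OF tr mr] Rr(1)]
  have oS: "\<one>\<^bsub>S\<^esub> \<in> carrier S.II" and oR: "\<one>\<^bsub>R\<^esub> \<in> carrier R.II" using S.one_closed R.one_closed by simp_all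
  note sm = module.smult_one[OF small_modulesD[OF EM]] and rm = module.smult_one[OF small_modulesD[OF M]]
  show "ext_map R S \<phi> (lun (Mod R) M) \<cdot>\<^bsub>Mod S\<^esub> ext_mul R S \<phi> R.II M \<cdot>\<^bsub>Mod S\<^esub>
      tarr (Mod S) (ext_one R S \<phi>) (idn (Mod S) (E M)) = lun (Mod S) (E M)" (is "?l = _")
  proof (rule Mod_arr_eqI[OF lc l], rule S.unit_tens_agree[OF EM EM mfun_linear[OF lc] mfun_linear[OF l]])
    note b = linear_comp[OF bilinear_map_linear(1)[OF S.tmul_bilinear[OF S.unit_small EM] oS]]
    fix c assume c: "c \<in> carrier (E M)"
    show "mfun ?l (tmul S S.II (E M) \<one>\<^bsub>S\<^esub> c) = mfun (lun (Mod S) (E M)) (tmul S S.II (E M) \<one>\<^bsub>S\<^esub> c)"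
    proof (rule ext_agree[OF M EM b[OF mfun_linear[OF lc]] b[OF mfun_linear[OF l]] _ c])
      fix x assume x: "x \<in> carrier M"
      note ex = eta_closed[OF M x, folded ext_simps]
      note t = S.tmul_closed[OF S.unit_small EM oS ex]
      show "mfun ?l (tmul S S.II (E M) \<one>\<^bsub>S\<^esub> (eta M x)) = mfun (lun (Mod S) (E M)) (tmul S S.II (E M) \<one>\<^bsub>S\<^esub> (eta M x))"
        unfolding S.mfun_cmp3[OF tl ml L(1) t] S.mfun_tarr[OF ext_one_hom i oS ex] mfun_ext_one mfun_idn[OF ex]
          mfun_ext_mul[OF I M oR x] L(2)[OF R.tmul_closed[OF I M oR x]] R.mfun_structure(2)[OF M R.one_closed x]
          S.mfun_structure(2)[OF EM S.one_closed ex] sm[OF ex] rm[OF x] by (rule refl)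
    qed
  qed
  show "ext_map R S \<phi> (run (Mod R) M) \<cdot>\<^bsub>Mod S\<^esub> ext_mul R S \<phi> M R.II \<cdot>\<^bsub>Mod S\<^esub>
      tarr (Mod S) (idn (Mod S) (E M)) (ext_one R S \<phi>) = run (Mod S) (E M)" (is "?r = _")
  proof (rule Mod_arr_eqI[OF rc r], rule S.tens_unit_agree[OF EM EM mfun_linear[OF rc] mfun_linear[OF r]])
    note b = linear_comp[OF bilinear_map_linear(2)[OF S.tmul_bilinear[OF EM S.unit_small] oS]]
    fix c assume c: "c \<in> carrier (E M)"
    show "mfun ?r (tmul S (E M) S.II c \<one>\<^bsub>S\<^esub>) = mfun (run (Mod S) (E M)) (tmul S (E M) S.II c \<one>\<^bsub>S\<^esub>)"
    proof (rule ext_agree[OF M EM b[OF mfun_linear[OF rc]] b[OF mfun_linear[OF r]] _ c])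
      fix x assume x: "x \<in> carrier M"
      note ex = eta_closed[OF M x, folded ext_simps]
      note t = S.tmul_closed[OF EM S.unit_small ex oS]
      show "mfun ?r (tmul S (E M) S.II (eta M x) \<one>\<^bsub>S\<^esub>) = mfun (run (Mod S) (E M)) (tmul S (E M) S.II (eta M x) \<one>\<^bsub>S\<^esub>)"
        unfolding S.mfun_cmp3[OF tr mr Rr(1) t] S.mfun_tarr[OF i ext_one_hom ex oS] mfun_ext_one mfun_idn[OF ex]
          mfun_ext_mul[OF M I x oR] Rr(2)[OF R.tmul_closed[OF M I x oR]] R.mfun_structure(3)[OF M R.one_closed x]
          S.mfun_structure(3)[OF EM S.one_closed ex] sm[OF ex] rm[OF x] by (rule refl)
    qed
  qed
qed

theorem ext_monoidal: "strong_symmetric_monoidal_functor (Mod R) (Mod S) EE"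
proof -
  note out = Mod_simps(1,7,9) EE_simps
  show ?thesis
    unfolding strong_symmetric_monoidal_functor_def out
  proof (intro conjI ballI)
    show "is_functor (Mod R) (Mod S) EE" by (rule ext_functor)
    show "ext_one R S \<phi> \<in> iso_set (Mod S) S.II (E R.II)" by (rule ext_one_iso)
    fix a b assume "a \<in> arr (Mod R)" "b \<in> arr (Mod R)"
    then show "ext_mul R S \<phi> (tgt (Mod R) a) (tgt (Mod R) b) \<cdot>\<^bsub>Mod S\<^esub>
        tarr (Mod S) (ext_map R S \<phi> a) (ext_map R S \<phi> b) =
      ext_map R S \<phi> (tarr (Mod R) a b) \<cdot>\<^bsub>Mod S\<^esub> ext_mul R S \<phi> (src (Mod R) a) (src (Mod R) b)"
      by (intro ext_mul_natural arr_in_hom_set)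
  qed (simp_all only: ext_mul_iso ext_assoc ext_units ext_brd)
qed

end


section \<open>Monoidal functors and their transformations\<close>

lemma strong_symmetric_monoidal_functorD:
  assumes "strong_symmetric_monoidal_functor A B F"
  shows smf_functor: "is_functor A B F"
    and smf_fone: "fone F \<in> iso_set B (tunit B) (fobj F (tunit A))"
    and smf_fmul: "x \<in> obj A \<Longrightarrow> y \<in> obj A \<Longrightarrow>
      fmul F x y \<in> iso_set B (tobj B (fobj F x) (fobj F y)) (fobj F (tobj A x y))"
    and smf_fmul_natural: "f \<in> hom_set A x x' \<Longrightarrow> g \<in> hom_set A y y' \<Longrightarrow>
      fmul F x' y' \<cdot>\<^bsub>B\<^esub> tarr B (farr F f) (farr F g) = farr F (tarr A f g) \<cdot>\<^bsub>B\<^esub> fmul F x y"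
    and smf_lun: "x \<in> obj A \<Longrightarrow>
      farr F (lun A x) \<cdot>\<^bsub>B\<^esub> fmul F (tunit A) x \<cdot>\<^bsub>B\<^esub> tarr B (fone F) (idn B (fobj F x)) = lun B (fobj F x)"
proof -
  note a = assms[unfolded strong_symmetric_monoidal_functor_def]
  show "is_functor A B F" using a by (elim conjE) assumption
  show "fone F \<in> iso_set B (tunit B) (fobj F (tunit A))" using a by (elim conjE) assumption
  have "\<forall>x\<in>obj A. \<forall>y\<in>obj A.
      fmul F x y \<in> iso_set B (tobj B (fobj F x) (fobj F y)) (fobj F (tobj A x y))" using a by (elim conjE) assumption
  then show "x \<in> obj A \<Longrightarrow> y \<in> obj A \<Longrightarrow>
      fmul F x y \<in> iso_set B (tobj B (fobj F x) (fobj F y)) (fobj F (tobj A x y))" by blast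
  have "\<forall>f\<in>arr A. \<forall>g\<in>arr A. fmul F (tgt A f) (tgt A g) \<cdot>\<^bsub>B\<^esub> tarr B (farr F f) (farr F g) =
        farr F (tarr A f g) \<cdot>\<^bsub>B\<^esub> fmul F (src A f) (src A g)" using a by (elim conjE) assumption
  then show "f \<in> hom_set A x x' \<Longrightarrow> g \<in> hom_set A y y' \<Longrightarrow>
      fmul F x' y' \<cdot>\<^bsub>B\<^esub> tarr B (farr F f) (farr F g) = farr F (tarr A f g) \<cdot>\<^bsub>B\<^esub> fmul F x y"
    using hom_set_arr hom_set_src hom_set_tgt by metis
  have "\<forall>x\<in>obj A. farr F (lun A x) \<cdot>\<^bsub>B\<^esub> fmul F (tunit A) x \<cdot>\<^bsub>B\<^esub> tarr B (fone F) (idn B (fobj F x)) = lun B (fobj F x)"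
    using a by (elim conjE) assumption
  then show "x \<in> obj A \<Longrightarrow>
      farr F (lun A x) \<cdot>\<^bsub>B\<^esub> fmul F (tunit A) x \<cdot>\<^bsub>B\<^esub> tarr B (fone F) (idn B (fobj F x)) = lun B (fobj F x)" by blast
qed

lemma monoidal_nat_transD:
  assumes "monoidal_nat_trans A B F G \<alpha>"
  shows mnt_nat_trans: "nat_trans A B F G \<alpha>"
    and mnt_fone: "\<alpha> (tunit A) \<cdot>\<^bsub>B\<^esub> fone F = fone G"
    and mnt_fmul: "x \<in> obj A \<Longrightarrow> y \<in> obj A \<Longrightarrow>
      \<alpha> (tobj A x y) \<cdot>\<^bsub>B\<^esub> fmul F x y = fmul G x y \<cdot>\<^bsub>B\<^esub> tarr B (\<alpha> x) (\<alpha> y)"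
  using assms by (simp_all add: monoidal_nat_trans_def)

lemma monoidal_nat_trans_restrict:
  assumes A: "symmetric_monoidal_category A"
  shows "monoidal_nat_trans A B F G (restrict \<alpha> (obj A)) \<longleftrightarrow> monoidal_nat_trans A B F G \<alpha>"
  using smc_tunit[OF A] smc_tobj[OF A] category_src[OF smc_category[OF A]] category_tgt[OF smc_category[OF A]]
  by (simp add: monoidal_nat_trans_def nat_trans_def)

locale monoidal_functors =
  fixes A :: "('o, 'a, 'y) smcat_scheme" and B :: "('p, 'b, 'z) smcat_scheme"
  assumes A: "symmetric_monoidal_category A" and B: "symmetric_monoidal_category B"
begin

lemmas B_cat = smc_category[OF B]
lemmas B_cmp = category_cmp[OF B_cat]
lemmas B_assoc = category_assoc[OF B_cat]

lemma monoidal_nat_trans_idn: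
  assumes F: "strong_symmetric_monoidal_functor A B F"
  shows "monoidal_nat_trans A B F F (\<lambda>x. idn B (fobj F x))"
  unfolding monoidal_nat_trans_def nat_trans_def
proof (intro conjI ballI)
  note Ff = smf_functor[OF F]
  show "idn B (fobj F x) \<in> hom_set B (fobj F x) (fobj F x)" if "x \<in> obj A" for x
    using category_idn[OF B_cat functor_obj[OF Ff that]] .
  show "idn B (fobj F (tgt A f)) \<cdot>\<^bsub>B\<^esub> farr F f = farr F f \<cdot>\<^bsub>B\<^esub> idn B (fobj F (src A f))" if "f \<in> arr A" for f
    using functor_hom[OF Ff arr_in_hom_set[OF that]] category_idn_left[OF B_cat] category_idn_right[OF B_cat] by metis
  show "idn B (fobj F (tunit A)) \<cdot>\<^bsub>B\<^esub> fone F = fone F"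
    using category_idn_left[OF B_cat iso_set_hom[OF smf_fone[OF F]]] .
  fix x y assume x: "x \<in> obj A" and y: "y \<in> obj A"
  note m = iso_set_hom[OF smf_fmul[OF F x y]]
  show "idn B (fobj F (tobj A x y)) \<cdot>\<^bsub>B\<^esub> fmul F x y = fmul F x y \<cdot>\<^bsub>B\<^esub> tarr B (idn B (fobj F x)) (idn B (fobj F y))"
    using category_idn_left[OF B_cat m] category_idn_right[OF B_cat m]
      smc_tarr_idn[OF B functor_obj[OF Ff x] functor_obj[OF Ff y]] by simp
qed

lemma monoidal_nat_trans_cmp:
  assumes F: "strong_symmetric_monoidal_functor A B F" and G: "strong_symmetric_monoidal_functor A B G"
    and H: "strong_symmetric_monoidal_functor A B H"
    and \<alpha>: "monoidal_nat_trans A B F G \<alpha>" and \<beta>: "monoidal_nat_trans A B G H \<beta>"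
  shows "monoidal_nat_trans A B F H (\<lambda>x. \<beta> x \<cdot>\<^bsub>B\<^esub> \<alpha> x)"
  unfolding monoidal_nat_trans_def nat_trans_def
proof (intro conjI ballI)
  note a = nat_trans_hom[OF mnt_nat_trans[OF \<alpha>]] and b = nat_trans_hom[OF mnt_nat_trans[OF \<beta>]]
  show "\<beta> x \<cdot>\<^bsub>B\<^esub> \<alpha> x \<in> hom_set B (fobj F x) (fobj H x)" if "x \<in> obj A" for x
    using B_cmp[OF a[OF that] b[OF that]] .
  show "(\<beta> (tgt A f) \<cdot>\<^bsub>B\<^esub> \<alpha> (tgt A f)) \<cdot>\<^bsub>B\<^esub> farr F f = farr H f \<cdot>\<^bsub>B\<^esub> (\<beta> (src A f) \<cdot>\<^bsub>B\<^esub> \<alpha> (src A f))" if f: "f \<in> arr A" for f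
  proof -
    note h = arr_in_hom_set[OF f]
    have s: "src A f \<in> obj A" and t: "tgt A f \<in> obj A"
      using f category_src[OF smc_category[OF A]] category_tgt[OF smc_category[OF A]] by blast+
    show ?thesis
      using B_assoc[OF functor_hom[OF smf_functor[OF F] h] a[OF t] b[OF t]]
        B_assoc[OF a[OF s] functor_hom[OF smf_functor[OF G] h] b[OF t]]
        B_assoc[OF a[OF s] b[OF s] functor_hom[OF smf_functor[OF H] h]]
        nat_trans_natural[OF mnt_nat_trans[OF \<alpha>] h] nat_trans_natural[OF mnt_nat_trans[OF \<beta>] h] by simp
  qed
  show "(\<beta> (tunit A) \<cdot>\<^bsub>B\<^esub> \<alpha> (tunit A)) \<cdot>\<^bsub>B\<^esub> fone F = fone H"
    using B_assoc[OF iso_set_hom[OF smf_fone[OF F]] a[OF smc_tunit[OF A]] b[OF smc_tunit[OF A]]]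
      mnt_fone[OF \<alpha>] mnt_fone[OF \<beta>] by simp
  fix x y assume x: "x \<in> obj A" and y: "y \<in> obj A"
  note xy = smc_tobj[OF A x y]
  note ta = smc_tarr[OF B a[OF x] a[OF y]] and tb = smc_tarr[OF B b[OF x] b[OF y]]
  show "(\<beta> (tobj A x y) \<cdot>\<^bsub>B\<^esub> \<alpha> (tobj A x y)) \<cdot>\<^bsub>B\<^esub> fmul F x y = fmul H x y \<cdot>\<^bsub>B\<^esub> tarr B (\<beta> x \<cdot>\<^bsub>B\<^esub> \<alpha> x) (\<beta> y \<cdot>\<^bsub>B\<^esub> \<alpha> y)"
    using B_assoc[OF iso_set_hom[OF smf_fmul[OF F x y]] a[OF xy] b[OF xy]] mnt_fmul[OF \<alpha> x y] mnt_fmul[OF \<beta> x y]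
      B_assoc[OF ta iso_set_hom[OF smf_fmul[OF G x y]] b[OF xy]]
      B_assoc[OF ta tb iso_set_hom[OF smf_fmul[OF H x y]]]
      smc_tarr_cmp[OF B a[OF x] b[OF x] a[OF y] b[OF y]] by simp
qed

text \<open>
  The conditions on \<open>\<beta>\<close> follow from those on \<open>\<alpha>\<close> by composing with components of \<open>\<alpha>\<close>.
\<close>

lemma monoidal_nat_trans_inverse:
  assumes F: "strong_symmetric_monoidal_functor A B F" and G: "strong_symmetric_monoidal_functor A B G"
    and \<alpha>: "monoidal_nat_trans A B F G \<alpha>"
    and \<beta>: "\<And>x. x \<in> obj A \<Longrightarrow> \<beta> x \<in> hom_set B (fobj G x) (fobj F x)"
      "\<And>x. x \<in> obj A \<Longrightarrow> \<beta> x \<cdot>\<^bsub>B\<^esub> \<alpha> x = idn B (fobj F x)"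
      "\<And>x. x \<in> obj A \<Longrightarrow> \<alpha> x \<cdot>\<^bsub>B\<^esub> \<beta> x = idn B (fobj G x)"
  shows "monoidal_nat_trans A B G F \<beta>"
proof -
  note a = nat_trans_hom[OF mnt_nat_trans[OF \<alpha>]]
  \<comment> \<open>Composing further with \<open>\<beta> x\<close> recovers the arrows.\<close>
  have cancel: "p = q" if x: "x \<in> obj A" and p: "p \<in> hom_set B z (fobj F x)" and q: "q \<in> hom_set B z (fobj F x)"
    and "\<alpha> x \<cdot>\<^bsub>B\<^esub> p = \<alpha> x \<cdot>\<^bsub>B\<^esub> q" for x z p q
    using B_assoc[OF p a[OF x] \<beta>(1)[OF x]] B_assoc[OF q a[OF x] \<beta>(1)[OF x]] \<beta>(2)[OF x] that(4)
      category_idn_left[OF B_cat p] category_idn_left[OF B_cat q] by simp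
  show ?thesis
    unfolding monoidal_nat_trans_def nat_trans_def
  proof (intro conjI ballI \<beta>(1))
    show "\<beta> (tgt A f) \<cdot>\<^bsub>B\<^esub> farr G f = farr F f \<cdot>\<^bsub>B\<^esub> \<beta> (src A f)" if f: "f \<in> arr A" for f
    proof -
      note h = arr_in_hom_set[OF f]
      note Fh = functor_hom[OF smf_functor[OF F] h] and Gh = functor_hom[OF smf_functor[OF G] h]
      have s: "src A f \<in> obj A" and t: "tgt A f \<in> obj A"
        using f category_src[OF smc_category[OF A]] category_tgt[OF smc_category[OF A]] by blast+
      show ?thesis
      proof (rule cancel[OF t B_cmp[OF Gh \<beta>(1)[OF t]] B_cmp[OF \<beta>(1)[OF s] Fh]])
        show "\<alpha> (tgt A f) \<cdot>\<^bsub>B\<^esub> (\<beta> (tgt A f) \<cdot>\<^bsub>B\<^esub> farr G f) = \<alpha> (tgt A f) \<cdot>\<^bsub>B\<^esub> (farr F f \<cdot>\<^bsub>B\<^esub> \<beta> (src A f))"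
          using B_assoc[OF Gh \<beta>(1)[OF t] a[OF t]] B_assoc[OF \<beta>(1)[OF s] Fh a[OF t]] \<beta>(3)[OF t] \<beta>(3)[OF s]
            B_assoc[OF \<beta>(1)[OF s] a[OF s] Gh] nat_trans_natural[OF mnt_nat_trans[OF \<alpha>] h]
            category_idn_left[OF B_cat Gh] category_idn_right[OF B_cat Gh] by simp
      qed
    qed
    note u = smc_tunit[OF A] and fF = iso_set_hom[OF smf_fone[OF F]] and fG = iso_set_hom[OF smf_fone[OF G]]
    show "\<beta> (tunit A) \<cdot>\<^bsub>B\<^esub> fone G = fone F"
      using B_assoc[OF fF a[OF u] \<beta>(1)[OF u]] \<beta>(2)[OF u] category_idn_left[OF B_cat fF] mnt_fone[OF \<alpha>] by simp
    fix x y assume x: "x \<in> obj A" and y: "y \<in> obj A"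
    note xy = smc_tobj[OF A x y]
    note mF = iso_set_hom[OF smf_fmul[OF F x y]] and mG = iso_set_hom[OF smf_fmul[OF G x y]]
    note ta = smc_tarr[OF B a[OF x] a[OF y]] and tb = smc_tarr[OF B \<beta>(1)[OF x] \<beta>(1)[OF y]]
    show "\<beta> (tobj A x y) \<cdot>\<^bsub>B\<^esub> fmul G x y = fmul F x y \<cdot>\<^bsub>B\<^esub> tarr B (\<beta> x) (\<beta> y)"
    proof (rule cancel[OF xy B_cmp[OF mG \<beta>(1)[OF xy]] B_cmp[OF tb mF]])
      have "tarr B (\<alpha> x) (\<alpha> y) \<cdot>\<^bsub>B\<^esub> tarr B (\<beta> x) (\<beta> y) = idn B (tobj B (fobj G x) (fobj G y))"
        using smc_tarr_cmp[OF B \<beta>(1)[OF x] a[OF x] \<beta>(1)[OF y] a[OF y]] \<beta>(3)[OF x] \<beta>(3)[OF y]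
          smc_tarr_idn[OF B functor_obj[OF smf_functor[OF G] x] functor_obj[OF smf_functor[OF G] y]] by simp
      then show "\<alpha> (tobj A x y) \<cdot>\<^bsub>B\<^esub> (\<beta> (tobj A x y) \<cdot>\<^bsub>B\<^esub> fmul G x y) =
          \<alpha> (tobj A x y) \<cdot>\<^bsub>B\<^esub> (fmul F x y \<cdot>\<^bsub>B\<^esub> tarr B (\<beta> x) (\<beta> y))"
        using B_assoc[OF mG \<beta>(1)[OF xy] a[OF xy]] \<beta>(3)[OF xy] category_idn_left[OF B_cat mG]
          B_assoc[OF tb mF a[OF xy]] mnt_fmul[OF \<alpha> x y] B_assoc[OF tb ta mG] category_idn_right[OF B_cat mG] by simp
    qed
  qed
qed

abbreviation "HC U \<equiv> com_two_ring_hom U A B"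

lemma hom_category_simps:
  "obj (HC U) = {F. strong_symmetric_monoidal_functor A B F \<and> cocontinuous U A B F}"
  "arr (HC U) = {(F, \<alpha>, G). F \<in> obj (HC U) \<and> G \<in> obj (HC U) \<and> monoidal_nat_trans A B F G \<alpha> \<and>
     \<alpha> \<in> extensional (obj A)}"
  "src (HC U) (F, \<alpha>, G) = F" "tgt (HC U) (F, \<alpha>, G) = G"
  "idn (HC U) F = (F, \<lambda>x\<in>obj A. idn B (fobj F x), F)"
  "cmp (HC U) (G', \<beta>, H) (F, \<alpha>, G) = (F, \<lambda>x\<in>obj A. \<beta> x \<cdot>\<^bsub>B\<^esub> \<alpha> x, H)"
  by (auto simp: com_two_ring_hom_def Let_def)

lemma hom_category_hom:
  "(F', \<alpha>, G') \<in> hom_set (HC U) F G \<longleftrightarrow> F' = F \<and> G' = G \<and> F \<in> obj (HC U) \<and> G \<in> obj (HC U) \<and>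
     monoidal_nat_trans A B F G \<alpha> \<and> \<alpha> \<in> extensional (obj A)"
  by (auto simp: hom_set_def hom_category_simps)

lemma hom_category_homE:
  assumes "f \<in> hom_set (HC U) F G"
  obtains \<alpha> where "f = (F, \<alpha>, G)" "strong_symmetric_monoidal_functor A B F" "cocontinuous U A B F"
    "strong_symmetric_monoidal_functor A B G" "cocontinuous U A B G"
    "monoidal_nat_trans A B F G \<alpha>" "\<alpha> \<in> extensional (obj A)"
  using assms by (cases f) (auto simp: hom_category_hom hom_category_simps(1))

lemma hom_category_is_category: "is_category (HC U)"
  unfolding is_category_def
proof (intro conjI ballI allI impI)
  fix F assume F: "F \<in> obj (HC U)"
  then show "idn (HC U) F \<in> hom_set (HC U) F F"
    using monoidal_nat_trans_idn[of F] by (simp add: hom_category_simps(1,5) hom_category_hom monoidal_nat_trans_restrict[OF A])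
next
  fix F G H f g assume f: "f \<in> hom_set (HC U) F G" and g: "g \<in> hom_set (HC U) G H"
  obtain \<alpha> where \<alpha>: "f = (F, \<alpha>, G)" "strong_symmetric_monoidal_functor A B F" "cocontinuous U A B F"
    "strong_symmetric_monoidal_functor A B G" "cocontinuous U A B G"
    "monoidal_nat_trans A B F G \<alpha>" "\<alpha> \<in> extensional (obj A)" using f by (rule hom_category_homE)
  obtain \<beta> where \<beta>: "g = (G, \<beta>, H)" "strong_symmetric_monoidal_functor A B G" "cocontinuous U A B G"
    "strong_symmetric_monoidal_functor A B H" "cocontinuous U A B H"
    "monoidal_nat_trans A B G H \<beta>" "\<beta> \<in> extensional (obj A)" using g by (rule hom_category_homE)
  show "g \<cdot>\<^bsub>HC U\<^esub> f \<in> hom_set (HC U) F H"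
    using monoidal_nat_trans_cmp[OF \<alpha>(2,4) \<beta>(4) \<alpha>(6) \<beta>(6)] \<alpha> \<beta>
    by (simp add: hom_category_simps(1,6) hom_category_hom monoidal_nat_trans_restrict[OF A])
next
  fix F G f assume f: "f \<in> hom_set (HC U) F G"
  obtain \<alpha> where \<alpha>: "f = (F, \<alpha>, G)" "monoidal_nat_trans A B F G \<alpha>" "\<alpha> \<in> extensional (obj A)"
    using f by (rule hom_category_homE)
  note a = nat_trans_hom[OF mnt_nat_trans[OF \<alpha>(2)]]
  show "f \<cdot>\<^bsub>HC U\<^esub> idn (HC U) F = f"
    using \<alpha>(3) category_idn_right[OF B_cat a]
    by (auto simp: \<alpha>(1) hom_category_simps(5,6) extensional_def fun_eq_iff)
  show "idn (HC U) G \<cdot>\<^bsub>HC U\<^esub> f = f"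
    using \<alpha>(3) category_idn_left[OF B_cat a]
    by (auto simp: \<alpha>(1) hom_category_simps(5,6) extensional_def fun_eq_iff)
next
  fix F G H K f g h
  assume f: "f \<in> hom_set (HC U) F G" and g: "g \<in> hom_set (HC U) G H" and h: "h \<in> hom_set (HC U) H K"
  obtain \<alpha> where \<alpha>: "f = (F, \<alpha>, G)" "monoidal_nat_trans A B F G \<alpha>" using f by (rule hom_category_homE)
  obtain \<beta> where \<beta>: "g = (G, \<beta>, H)" "monoidal_nat_trans A B G H \<beta>" using g by (rule hom_category_homE)
  obtain \<gamma> where \<gamma>: "h = (H, \<gamma>, K)" "monoidal_nat_trans A B H K \<gamma>" using h by (rule hom_category_homE)
  have "(\<gamma> x \<cdot>\<^bsub>B\<^esub> \<beta> x) \<cdot>\<^bsub>B\<^esub> \<alpha> x = \<gamma> x \<cdot>\<^bsub>B\<^esub> \<beta> x \<cdot>\<^bsub>B\<^esub> \<alpha> x" if "x \<in> obj A" for x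
    using B_assoc nat_trans_hom[OF mnt_nat_trans[OF \<alpha>(2)] that] nat_trans_hom[OF mnt_nat_trans[OF \<beta>(2)] that]
      nat_trans_hom[OF mnt_nat_trans[OF \<gamma>(2)] that] by blast
  then show "(h \<cdot>\<^bsub>HC U\<^esub> g) \<cdot>\<^bsub>HC U\<^esub> f = h \<cdot>\<^bsub>HC U\<^esub> (g \<cdot>\<^bsub>HC U\<^esub> f)"
    by (simp add: \<alpha>(1) \<beta>(1) \<gamma>(1) hom_category_simps(6) cong: restrict_cong)
next
  fix f assume "f \<in> arr (HC U)"
  then show "src (HC U) f \<in> obj (HC U)" "tgt (HC U) f \<in> obj (HC U)"
    by (auto simp: hom_category_simps(2,3,4))
qed

text \<open>
  Isomorphisms of the hom-category are detected on components, because the family of inverses is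
  again natural and monoidal.
\<close>

lemma hom_category_iso:
  assumes f: "(F, \<alpha>, G) \<in> hom_set (HC U) F G" and iso: "\<And>x. x \<in> obj A \<Longrightarrow> is_iso B (\<alpha> x)"
  shows "is_iso (HC U) (F, \<alpha>, G)"
proof -
  obtain \<alpha>' where "(F, \<alpha>, G) = (F, \<alpha>', G)" "strong_symmetric_monoidal_functor A B F" "cocontinuous U A B F"
    "strong_symmetric_monoidal_functor A B G" "cocontinuous U A B G"
    "monoidal_nat_trans A B F G \<alpha>'" "\<alpha>' \<in> extensional (obj A)" using f by (rule hom_category_homE)
  then have F: "strong_symmetric_monoidal_functor A B F" and G: "strong_symmetric_monoidal_functor A B G"
    and \<alpha>: "monoidal_nat_trans A B F G \<alpha>" and o: "F \<in> obj (HC U)" "G \<in> obj (HC U)"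
    by (simp_all add: hom_category_simps(1))
  note a = nat_trans_hom[OF mnt_nat_trans[OF \<alpha>]]
  have "\<exists>b. b \<in> hom_set B (fobj G x) (fobj F x) \<and> b \<cdot>\<^bsub>B\<^esub> \<alpha> x = idn B (fobj F x) \<and> \<alpha> x \<cdot>\<^bsub>B\<^esub> b = idn B (fobj G x)"
    if "x \<in> obj A" for x using is_isoE[OF a[OF that] iso[OF that]] by blast
  then obtain \<beta> where \<beta>: "\<And>x. x \<in> obj A \<Longrightarrow> \<beta> x \<in> hom_set B (fobj G x) (fobj F x)"
      "\<And>x. x \<in> obj A \<Longrightarrow> \<beta> x \<cdot>\<^bsub>B\<^esub> \<alpha> x = idn B (fobj F x)"
      "\<And>x. x \<in> obj A \<Longrightarrow> \<alpha> x \<cdot>\<^bsub>B\<^esub> \<beta> x = idn B (fobj G x)" by metis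
  have "monoidal_nat_trans A B G F (restrict \<beta> (obj A))"
    unfolding monoidal_nat_trans_restrict[OF A] by (rule monoidal_nat_trans_inverse[OF F G \<alpha> \<beta>])
  then have "(G, restrict \<beta> (obj A), F) \<in> hom_set (HC U) G F" using o by (simp add: hom_category_hom)
  moreover have "(\<lambda>x\<in>obj A. restrict \<beta> (obj A) x \<cdot>\<^bsub>B\<^esub> \<alpha> x) = (\<lambda>x\<in>obj A. idn B (fobj F x))"
    "(\<lambda>x\<in>obj A. \<alpha> x \<cdot>\<^bsub>B\<^esub> restrict \<beta> (obj A) x) = (\<lambda>x\<in>obj A. idn B (fobj G x))"
    using \<beta>(2,3) by (auto intro!: restrict_ext)
  ultimately show ?thesis
    using hom_set_arr[OF f] unfolding is_iso_def hom_category_simps(3,4)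
    by (intro conjI bexI[of _ "(G, restrict \<beta> (obj A), F)"]) (simp_all add: hom_category_simps(5,6))
qed

end


section \<open>Cocontinuous monoidal functors between module categories\<close>

text \<open>
  The inverses on the diagram form a cocone, and the arrow that it induces on the colimit is inverse
  to \<open>\<alpha> c\<close> by uniqueness.
\<close>

lemma nat_trans_iso_colimit:
  fixes C :: "('o, 'a, 'y) category_scheme" and D :: "('p, 'b, 'z) category_scheme"
    and J :: "('i, 'j, 'x) category_scheme" and E :: "('i, 'j, 'o, 'a) fctr"
  assumes F: "is_functor C D F" and G: "is_functor C D G" and \<alpha>: "nat_trans C D F G \<alpha>"
    and E: "is_functor J C E" and c: "is_colimit C J E c \<iota>"
    and pF: "preserves_colimits J C D F" and pG: "preserves_colimits J C D G"
    and iso: "\<And>j. j \<in> obj J \<Longrightarrow> is_iso D (\<alpha> (fobj E j))"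
  shows "is_iso D (\<alpha> c)"
proof -
  note D = functor_target[OF F] and J = functor_source[OF E]
  note D_cmp = category_cmp[OF D] and D_assoc = category_assoc[OF D]
  note ah = nat_trans_hom[OF \<alpha>] and nat = nat_trans_natural[OF \<alpha>]
  have cc: "is_cocone C J E c \<iota>" using c by (simp add: is_colimit_def)
  have co: "c \<in> obj C" and \<iota>: "\<And>j. j \<in> obj J \<Longrightarrow> \<iota> j \<in> hom_set C (fobj E j) c"
    using cc by (simp_all add: is_cocone_def)
  note a = ah[OF functor_obj[OF E]] and F\<iota> = functor_hom[OF F \<iota>] and G\<iota> = functor_hom[OF G \<iota>]
  have Fc: "is_colimit D J (comp_fctr F E) (fobj F c) (\<lambda>j. farr F (\<iota> j))"
    using pF E c by (simp add: preserves_colimits_def)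
  have Gc: "is_colimit D J (comp_fctr G E) (fobj G c) (\<lambda>j. farr G (\<iota> j))"
    using pG E c by (simp add: preserves_colimits_def)
  have "\<exists>b. b \<in> hom_set D (fobj G (fobj E j)) (fobj F (fobj E j)) \<and>
      b \<cdot>\<^bsub>D\<^esub> \<alpha> (fobj E j) = idn D (fobj F (fobj E j)) \<and> \<alpha> (fobj E j) \<cdot>\<^bsub>D\<^esub> b = idn D (fobj G (fobj E j))"
    if "j \<in> obj J" for j using is_isoE[OF a[OF that] iso[OF that]] by blast
  then obtain b where b: "\<And>j. j \<in> obj J \<Longrightarrow> b j \<in> hom_set D (fobj G (fobj E j)) (fobj F (fobj E j))"
      "\<And>j. j \<in> obj J \<Longrightarrow> b j \<cdot>\<^bsub>D\<^esub> \<alpha> (fobj E j) = idn D (fobj F (fobj E j))"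
      "\<And>j. j \<in> obj J \<Longrightarrow> \<alpha> (fobj E j) \<cdot>\<^bsub>D\<^esub> b j = idn D (fobj G (fobj E j))" by metis
  \<comment> \<open>Naturality of \<open>\<alpha>\<close> passes to the inverses.\<close>
  have "is_cocone D J (comp_fctr G E) (fobj F c) (\<lambda>j. farr F (\<iota> j) \<cdot>\<^bsub>D\<^esub> b j)"
    unfolding is_cocone_def
  proof (intro conjI ballI)
    show "fobj F c \<in> obj D" using functor_obj[OF F co] .
    show "farr F (\<iota> j) \<cdot>\<^bsub>D\<^esub> b j \<in> hom_set D (fobj (comp_fctr G E) j) (fobj F c)" if "j \<in> obj J" for j
      using D_cmp[OF b(1) F\<iota>] that by simp
    fix u assume u: "u \<in> arr J"
    note s = category_src[OF J u] and t = category_tgt[OF J u] and e = functor_hom[OF E arr_in_hom_set[OF u]]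
    note Fe = functor_hom[OF F e] and Ge = functor_hom[OF G e]
    have n: "b (tgt J u) \<cdot>\<^bsub>D\<^esub> farr G (farr E u) = farr F (farr E u) \<cdot>\<^bsub>D\<^esub> b (src J u)"
    proof -
      have "b (tgt J u) \<cdot>\<^bsub>D\<^esub> farr G (farr E u) =
          b (tgt J u) \<cdot>\<^bsub>D\<^esub> (farr G (farr E u) \<cdot>\<^bsub>D\<^esub> (\<alpha> (fobj E (src J u)) \<cdot>\<^bsub>D\<^esub> b (src J u)))"
        using b(3)[OF s] category_idn_right[OF D Ge] by simp
      also have "\<dots> = b (tgt J u) \<cdot>\<^bsub>D\<^esub> ((\<alpha> (fobj E (tgt J u)) \<cdot>\<^bsub>D\<^esub> farr F (farr E u)) \<cdot>\<^bsub>D\<^esub> b (src J u))"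
        using D_assoc[OF b(1)[OF s] a[OF s] Ge] nat[OF e] by simp
      also have "\<dots> = (b (tgt J u) \<cdot>\<^bsub>D\<^esub> \<alpha> (fobj E (tgt J u))) \<cdot>\<^bsub>D\<^esub> (farr F (farr E u) \<cdot>\<^bsub>D\<^esub> b (src J u))"
        using D_assoc[OF b(1)[OF s] Fe a[OF t]] D_assoc[OF D_cmp[OF b(1)[OF s] Fe] a[OF t] b(1)[OF t]] by simp
      also have "\<dots> = farr F (farr E u) \<cdot>\<^bsub>D\<^esub> b (src J u)"
        using b(2)[OF t] category_idn_left[OF D D_cmp[OF b(1)[OF s] Fe]] by simp
      finally show ?thesis .
    qed
    have "farr F (\<iota> (tgt J u)) \<cdot>\<^bsub>D\<^esub> farr F (farr E u) = farr F (\<iota> (src J u))"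
      using functor_cmp[OF F e \<iota>[OF t]] cc u by (simp add: is_cocone_def)
    then show "(farr F (\<iota> (tgt J u)) \<cdot>\<^bsub>D\<^esub> b (tgt J u)) \<cdot>\<^bsub>D\<^esub> farr (comp_fctr G E) u = farr F (\<iota> (src J u)) \<cdot>\<^bsub>D\<^esub> b (src J u)"
      using D_assoc[OF Ge b(1)[OF t] F\<iota>[OF t]] n D_assoc[OF b(1)[OF s] Fe F\<iota>[OF t]] by simp
  qed
  then obtain h where h: "h \<in> hom_set D (fobj G c) (fobj F c)"
    "\<And>j. j \<in> obj J \<Longrightarrow> h \<cdot>\<^bsub>D\<^esub> farr G (\<iota> j) = farr F (\<iota> j) \<cdot>\<^bsub>D\<^esub> b j"
    using Gc unfolding is_colimit_def by (metis (no_types, lifting))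
  have uniq: "p = q" if c': "is_colimit D J K c' \<kappa>" and p: "p \<in> hom_set D c' d" and q: "q \<in> hom_set D c' d"
    and eq: "\<And>j. j \<in> obj J \<Longrightarrow> p \<cdot>\<^bsub>D\<^esub> \<kappa> j = q \<cdot>\<^bsub>D\<^esub> \<kappa> j" and K: "is_functor J D K"
    for K :: "('i, 'j, 'p, 'b) fctr" and c' \<kappa> d p q
  proof -
    have k: "is_cocone D J K c' \<kappa>" using c' by (simp add: is_colimit_def)
    have "is_cocone D J K d (\<lambda>j. p \<cdot>\<^bsub>D\<^esub> \<kappa> j)"
      unfolding is_cocone_def
    proof (intro conjI ballI)
      show "d \<in> obj D" using category_tgt[OF D hom_set_arr[OF p]] p by (simp add: hom_set_def)
      show "p \<cdot>\<^bsub>D\<^esub> \<kappa> j \<in> hom_set D (fobj K j) d" if "j \<in> obj J" for j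
        using D_cmp[OF _ p] k that by (simp add: is_cocone_def)
      fix u assume u: "u \<in> arr J"
      show "(p \<cdot>\<^bsub>D\<^esub> \<kappa> (tgt J u)) \<cdot>\<^bsub>D\<^esub> farr K u = p \<cdot>\<^bsub>D\<^esub> \<kappa> (src J u)"
        using D_assoc[OF functor_hom[OF K arr_in_hom_set[OF u]] _ p] k u category_tgt[OF J u]
        by (simp add: is_cocone_def)
    qed
    then have "\<exists>!h. h \<in> hom_set D c' d \<and> (\<forall>j\<in>obj J. h \<cdot>\<^bsub>D\<^esub> \<kappa> j = p \<cdot>\<^bsub>D\<^esub> \<kappa> j)"
      using c' by (simp add: is_colimit_def)
    then show ?thesis using p q eq by (metis (no_types, lifting))
  qed
  have "h \<cdot>\<^bsub>D\<^esub> \<alpha> c = idn D (fobj F c)"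
  proof (rule uniq[OF Fc D_cmp[OF ah[OF co] h(1)] category_idn[OF D functor_obj[OF F co]] _ is_functor_comp[OF E F]])
    fix j assume j: "j \<in> obj J"
    show "(h \<cdot>\<^bsub>D\<^esub> \<alpha> c) \<cdot>\<^bsub>D\<^esub> farr F (\<iota> j) = idn D (fobj F c) \<cdot>\<^bsub>D\<^esub> farr F (\<iota> j)"
      using D_assoc[OF F\<iota>[OF j] ah[OF co] h(1)] nat[OF \<iota>[OF j]] D_assoc[OF a[OF j] G\<iota>[OF j] h(1)] h(2)[OF j]
        D_assoc[OF a[OF j] b(1)[OF j] F\<iota>[OF j]] b(2)[OF j] category_idn_right[OF D F\<iota>[OF j]]
        category_idn_left[OF D F\<iota>[OF j]] by simp
  qed
  moreover have "\<alpha> c \<cdot>\<^bsub>D\<^esub> h = idn D (fobj G c)"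
  proof (rule uniq[OF Gc D_cmp[OF h(1) ah[OF co]] category_idn[OF D functor_obj[OF G co]] _ is_functor_comp[OF E G]])
    fix j assume j: "j \<in> obj J"
    show "(\<alpha> c \<cdot>\<^bsub>D\<^esub> h) \<cdot>\<^bsub>D\<^esub> farr G (\<iota> j) = idn D (fobj G c) \<cdot>\<^bsub>D\<^esub> farr G (\<iota> j)"
      using D_assoc[OF G\<iota>[OF j] h(1) ah[OF co]] h(2)[OF j] D_assoc[OF b(1)[OF j] F\<iota>[OF j] ah[OF co]] nat[OF \<iota>[OF j]]
        D_assoc[OF b(1)[OF j] a[OF j] G\<iota>[OF j]] b(3)[OF j] category_idn_right[OF D G\<iota>[OF j]]
        category_idn_left[OF D G\<iota>[OF j]] by simp
  qed
  ultimately show ?thesis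
    using h(1) ah[OF co] unfolding is_iso_def by (auto simp: hom_set_src hom_set_tgt hom_set_arr)
qed

lemma zero_linear:
  assumes "module R N"
  shows "linear R M N (\<lambda>_. \<zero>\<^bsub>N\<^esub>)"
proof -
  interpret N: module R N by fact
  show ?thesis by (rule linearI) simp_all
qed

lemma iso_set_Mod_inverse:
  assumes "a \<in> iso_set (Mod R) M N"
  shows "\<exists>f h. a = (M, f, N) \<and> M \<in> small_modules R \<and> N \<in> small_modules R \<and> f \<in> mod_hom R M N \<and>
    h \<in> mod_hom R N M \<and> (\<forall>x\<in>carrier M. h (f x) = x) \<and> (\<forall>y\<in>carrier N. f (h y) = y)"
  using assms
proof (rule iso_set_ModE)
  fix f h assume "a = (M, f, N)" "M \<in> small_modules R" "N \<in> small_modules R" "f \<in> mod_hom R M N"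
    "h \<in> mod_hom R N M" "\<And>x. x \<in> carrier M \<Longrightarrow> h (f x) = x" "\<And>y. y \<in> carrier N \<Longrightarrow> f (h y) = y"
  then show ?thesis by (intro exI[of _ f] exI[of _ h]) simp
qed

type_synonym 'u mod_smfctr = "(('u, 'u) module, 'u mod_arr, ('u, 'u) module, 'u mod_arr) smfctr"

text \<open>
  A monoidal functor has a distinguished element in its value at the unit, the image of \<open>1\<close> under
  its unit constraint; an element of a module, seen as an arrow from the unit, transports it to an
  element of the value at that module.
\<close>

definition unit_elt :: "'u ring \<Rightarrow> 'u mod_smfctr \<Rightarrow> 'u" where
  "unit_elt S F = mfun (fone F) \<one>\<^bsub>S\<^esub>"

definition gen :: "'u ring \<Rightarrow> 'u ring \<Rightarrow> 'u mod_smfctr \<Rightarrow> ('u, 'u) module \<Rightarrow> 'u \<Rightarrow> 'u" where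
  "gen R S F M x = mfun (farr F (pt R M x)) (unit_elt S F)"

text \<open>
  The scalar by which an endomorphism \<open>r\<close> of the unit acts on the distinguished element.
\<close>

definition base_hom :: "'u ring \<Rightarrow> 'u ring \<Rightarrow> 'u mod_smfctr \<Rightarrow> 'u \<Rightarrow> 'u" where
  "base_hom R S F = (\<lambda>r\<in>carrier R. THE s. s \<in> carrier S \<and>
     mfun (fone F) s = gen R S F (scalar_module (\<lambda>r. r) R) r)"

locale mod_functor = R: small_cring R + S: small_cring S
  for R S :: "'u ring" +
  fixes F :: "'u mod_smfctr"
  assumes smf: "strong_symmetric_monoidal_functor (Mod R) (Mod S) F"
    and cocont: "cocontinuous TYPE('u) (Mod R) (Mod S) F"
begin

lemmas Ff = smf_functor[OF smf]
lemmas F_hom = functor_hom[OF Ff]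

lemma F_small: "M \<in> small_modules R \<Longrightarrow> fobj F M \<in> small_modules S"
  using functor_obj[OF Ff] by simp

abbreviation "u \<equiv> unit_elt S F"
abbreviation "g \<equiv> gen R S F"

lemma fone_iso: "fone F \<in> iso_set (Mod S) S.II (fobj F R.II)"
  using smf_fone[OF smf] by simp

lemmas fone_hom = fone_iso[THEN iso_set_hom]

lemma u_closed: "u \<in> carrier (fobj F R.II)"
  unfolding unit_elt_def using mfun_closed[OF fone_hom] S.one_closed by simp

lemma fone_eval: "s \<in> carrier S \<Longrightarrow> mfun (fone F) s = s \<odot>\<^bsub>fobj F R.II\<^esub> u"
  unfolding unit_elt_def by (rule S.unit_arr_eval[OF fone_hom])

lemma unit_unique: "w \<in> carrier (fobj F R.II) \<Longrightarrow> \<exists>!s. s \<in> carrier S \<and> mfun (fone F) s = w"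
proof -
  assume w: "w \<in> carrier (fobj F R.II)"
  obtain f h where f: "fone F = (S.II, f, fobj F R.II)" "S.II \<in> small_modules S" "fobj F R.II \<in> small_modules S"
    "f \<in> mod_hom S S.II (fobj F R.II)" "h \<in> mod_hom S (fobj F R.II) S.II"
    "\<forall>s\<in>carrier S.II. h (f s) = s" "\<forall>w\<in>carrier (fobj F R.II). f (h w) = w"
    using iso_set_Mod_inverse[OF fone_iso] by blast
  show ?thesis
  proof (rule ex1I[of _ "h w"])
    show "h w \<in> carrier S \<and> mfun (fone F) (h w) = w" using mod_hom_closed[OF f(5) w] f(7) w by (simp add: f(1))
    show "s = h w" if "s \<in> carrier S \<and> mfun (fone F) s = w" for s using that f(6) by (auto simp: f(1))
  qed
qed

lemma smult_u_cancel:
  assumes "s \<in> carrier S" "t \<in> carrier S" "s \<odot>\<^bsub>fobj F R.II\<^esub> u = t \<odot>\<^bsub>fobj F R.II\<^esub> u"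
  shows "s = t"
proof -
  have "mfun (fone F) s = mfun (fone F) t" using fone_eval[OF assms(1)] fone_eval[OF assms(2)] assms(3) by simp
  moreover have "s \<in> carrier S.II" using assms(1) by simp
  ultimately show ?thesis using unit_unique[OF mfun_closed[OF fone_hom]] assms(1,2) by metis
qed

lemma gen_closed: "M \<in> small_modules R \<Longrightarrow> x \<in> carrier M \<Longrightarrow> g M x \<in> carrier (fobj F M)"
  unfolding gen_def using mfun_closed[OF F_hom[OF R.pt_hom] u_closed] .

lemma gen_natural:
  assumes a: "a \<in> hom_set (Mod R) M N" and x: "x \<in> carrier M"
  shows "mfun (farr F a) (g M x) = g N (mfun a x)"
proof -
  note p = R.pt_hom[OF hom_set_Mod_obj(1)[OF a] x]
  show ?thesis
    unfolding gen_def using mfun_cmp[OF F_hom[OF p] F_hom[OF a] u_closed] functor_cmp[OF Ff p a] R.cmp_pt[OF a x] by simp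
qed

lemma gen_one: "g R.II \<one>\<^bsub>R\<^esub> = u"
proof -
  note i = R.idn_in_hom[OF R.unit_small]
  have "idn (Mod R) R.II = pt R R.II (mfun (idn (Mod R) R.II) \<one>\<^bsub>R\<^esub>)" by (rule R.unit_arr_eq_pt[OF i])
  then have "pt R R.II \<one>\<^bsub>R\<^esub> = idn (Mod R) R.II" using R.one_closed by simp
  then show ?thesis
    unfolding gen_def using functor_idn[OF Ff] mfun_idn[OF u_closed] R.unit_small by (simp del: Mod_simps(5))
qed

lemma F_colimit:
  fixes J :: "('u, 'u) category" and D :: "('u, 'u, ('u, 'u) module, 'u mod_arr) fctr"
  assumes "small_category TYPE('u) J" "is_functor J (Mod R) D" "is_colimit (Mod R) J D c \<iota>"
  shows "is_colimit (Mod S) J (comp_fctr F D) (fobj F c) (\<lambda>j. farr F (\<iota> j))"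
  using cocont assms unfolding cocontinuous_def preserves_colimits_def by blast

text \<open>A zero map factors through the empty colimit, which the functor preserves.\<close>

lemma F_zero:
  assumes M: "M \<in> small_modules R" and N: "N \<in> small_modules R" and z: "z \<in> carrier (fobj F M)"
  shows "mfun (farr F (mk_arr M N (\<lambda>_. \<zero>\<^bsub>N\<^esub>))) z = \<zero>\<^bsub>fobj F N\<^esub>"
proof -
  let ?J = "discrete_category {} :: ('u, 'u) category"
  let ?D = "\<lparr>fobj = (\<lambda>_. R.II), farr = (\<lambda>_. idn (Mod R) R.II)\<rparr> :: ('u, 'u, ('u, 'u) module, 'u mod_arr) fctr"
  have D: "is_functor ?J (Mod R) ?D"
    using discrete_functor[OF Mod_is_category, of "{}" "\<lambda>_. R.II"] by (simp del: Mod_simps(5))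
  have J: "small_category TYPE('u) ?J" by (rule small_discrete) (simp add: small_finite R.universe)
  obtain Z \<iota> where Z: "is_colimit (Mod R) ?J ?D Z \<iota>"
    using R.Mod_cocomplete J D unfolding cocomplete_def by blast
  have Zs: "Z \<in> small_modules R" using Z by (simp add: is_colimit_def is_cocone_def)
  interpret FZ: module S "fobj F Z" using F_small[OF Zs] by (rule small_modulesD)
  have id: "linear S (fobj F Z) (fobj F Z) (\<lambda>z. z)" by (rule linearI) simp_all
  have null: "y = \<zero>\<^bsub>fobj F Z\<^esub>" if "y \<in> carrier (fobj F Z)" for y
    by (rule colimit_Mod_ext[OF is_functor_comp[OF D Ff] F_colimit[OF J D Z] F_small[OF Zs] id
          zero_linear[OF FZ.module_axioms] _ that]) simp
  let ?a = "mk_arr M Z (\<lambda>_. \<zero>\<^bsub>Z\<^esub>)" and ?b = "mk_arr Z N (\<lambda>_. \<zero>\<^bsub>N\<^esub>)"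
  have a: "?a \<in> hom_set (Mod R) M Z" by (rule mk_arr_hom[OF M Zs zero_linear[OF small_modulesD[OF Zs]]])
  have b: "?b \<in> hom_set (Mod R) Z N" by (rule mk_arr_hom[OF Zs N zero_linear[OF small_modulesD[OF N]]])
  have c: "mk_arr M N (\<lambda>_. \<zero>\<^bsub>N\<^esub>) \<in> hom_set (Mod R) M N" by (rule mk_arr_hom[OF M N zero_linear[OF small_modulesD[OF N]]])
  have ab: "?b \<cdot>\<^bsub>Mod R\<^esub> ?a = mk_arr M N (\<lambda>_. \<zero>\<^bsub>N\<^esub>)"
  proof (rule Mod_arr_eqI[OF R.cmp_in_hom[OF a b] c])
    fix x assume x: "x \<in> carrier M"
    show "mfun (?b \<cdot>\<^bsub>Mod R\<^esub> ?a) x = mfun (mk_arr M N (\<lambda>_. \<zero>\<^bsub>N\<^esub>)) x"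
      using mfun_cmp[OF a b x] x mfun_closed[OF a x] by simp
  qed
  have "mfun (farr F ?b) (mfun (farr F ?a) z) = \<zero>\<^bsub>fobj F N\<^esub>"
    using null[OF mfun_closed[OF F_hom[OF a] z]]
      linear_zero[OF mfun_linear[OF F_hom[OF b]] FZ.module_axioms small_modulesD[OF F_small[OF N]]] by simp
  then show ?thesis
    using mfun_cmp[OF F_hom[OF a] F_hom[OF b] z] functor_cmp[OF Ff a b] ab by simp
qed

text \<open>
  The universal case of a sum of two elements is the sum of the two coprojections into
  the coproduct of two copies of the unit, and the functor preserves this coproduct and zero maps.
\<close>

lemma gen_add:
  assumes M: "M \<in> small_modules R" and x: "x \<in> carrier M" and y: "y \<in> carrier M"
  shows "g M (x \<oplus>\<^bsub>M\<^esub> y) = g M x \<oplus>\<^bsub>fobj F M\<^esub> g M y"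
proof -
  interpret M: module R M using M by (rule small_modulesD)
  interpret I: module R R.II using R.unit_small by (rule small_modulesD)
  obtain a b :: 'u where ab: "a \<noteq> b"
  proof -
    have "infinite (UNIV :: 'u set)" using R.universe by (simp add: universe_def)
    then have "\<exists>b. b \<notin> {undefined :: 'u}" by (intro ex_new_if_finite) auto
    then show ?thesis using that by blast
  qed
  let ?J = "discrete_category {a, b}"
  let ?D = "\<lparr>fobj = (\<lambda>_. R.II), farr = (\<lambda>_. idn (Mod R) R.II)\<rparr> :: ('u, 'u, ('u, 'u) module, 'u mod_arr) fctr"
  have D: "is_functor ?J (Mod R) ?D"
    using discrete_functor[OF Mod_is_category, of "{a, b}" "\<lambda>_. R.II"] by (simp del: Mod_simps(5))
  have J: "small_category TYPE('u) ?J" by (rule small_discrete) (simp add: small_finite R.universe)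
  obtain c \<iota> where c: "is_colimit (Mod R) ?J ?D c \<iota>"
    using R.Mod_cocomplete J D unfolding cocomplete_def by blast
  have cc: "is_cocone (Mod R) ?J ?D c \<iota>" using c by (simp add: is_colimit_def)
  note cs = cocone_Mod(1)[OF D cc]
  interpret c: module R c using cs by (rule small_modulesD)
  have \<iota>: "\<iota> a \<in> hom_set (Mod R) R.II c" "\<iota> b \<in> hom_set (Mod R) R.II c"
    using cocone_Mod(2)[OF D cc, of a] cocone_Mod(2)[OF D cc, of b] by simp_all
  have copair: "\<exists>h. h \<in> hom_set (Mod R) c N \<and> (\<forall>r\<in>carrier R. mfun h (mfun (\<iota> a) r) = p r \<and> mfun h (mfun (\<iota> b) r) = q r)"
    if N: "N \<in> small_modules R" and p: "linear R R.II N p" and q: "linear R R.II N q" for N p q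
  proof (rule colimit_Mod_desc[OF D c N, of "\<lambda>j. if j = a then p else q"])
    show "linear R (fobj ?D j) N (if j = a then p else q)" if "j \<in> obj ?J" for j using p q by simp
    show "(if tgt ?J w = a then p else q) (mfun (farr ?D w) r) = (if src ?J w = a then p else q) r"
      if "w \<in> arr ?J" "r \<in> carrier (fobj ?D (src ?J w))" for w r using that by simp
    show ?thesis if h: "linear R c N h"
      "\<And>j r. j \<in> obj ?J \<Longrightarrow> r \<in> carrier (fobj ?D j) \<Longrightarrow> h (mfun (\<iota> j) r) = (if j = a then p else q) r" for h
      using h(2)[of a] h(2)[of b] ab mfun_closed[OF \<iota>(1)] mfun_closed[OF \<iota>(2)]
      by (intro exI[of _ "mk_arr c N h"] conjI mk_arr_hom[OF cs N h(1)]) auto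
  qed
  have id: "linear R R.II R.II (\<lambda>r. r)" by (rule linearI) simp_all
  let ?z = "\<lambda>_. \<zero>\<^bsub>R\<^esub>"
  have zero: "linear R R.II R.II ?z" using zero_linear[OF I.module_axioms, of R.II] by simp
  obtain pa where pa: "pa \<in> hom_set (Mod R) c R.II"
    "\<And>r. r \<in> carrier R \<Longrightarrow> mfun pa (mfun (\<iota> a) r) = r" "\<And>r. r \<in> carrier R \<Longrightarrow> mfun pa (mfun (\<iota> b) r) = \<zero>\<^bsub>R\<^esub>"
    using copair[OF R.unit_small id zero] by blast
  obtain pb where pb: "pb \<in> hom_set (Mod R) c R.II"
    "\<And>r. r \<in> carrier R \<Longrightarrow> mfun pb (mfun (\<iota> a) r) = \<zero>\<^bsub>R\<^esub>" "\<And>r. r \<in> carrier R \<Longrightarrow> mfun pb (mfun (\<iota> b) r) = r"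
    using copair[OF R.unit_small zero id] by blast
  have cmp_id: "p \<cdot>\<^bsub>Mod R\<^esub> j = idn (Mod R) R.II"
    if j: "j \<in> hom_set (Mod R) R.II c" and p: "p \<in> hom_set (Mod R) c R.II"
      and e: "\<And>r. r \<in> carrier R \<Longrightarrow> mfun p (mfun j r) = r" for j p
  proof (rule Mod_arr_eqI[OF R.cmp_in_hom[OF j p] R.idn_in_hom[OF R.unit_small]])
    fix r assume "r \<in> carrier R.II"
    then show "mfun (p \<cdot>\<^bsub>Mod R\<^esub> j) r = mfun (idn (Mod R) R.II) r" using mfun_cmp[OF j p] e by simp
  qed
  have cmp_zero: "p \<cdot>\<^bsub>Mod R\<^esub> j = mk_arr R.II R.II (\<lambda>_. \<zero>\<^bsub>R.II\<^esub>)"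
    if j: "j \<in> hom_set (Mod R) R.II c" and p: "p \<in> hom_set (Mod R) c R.II"
      and e: "\<And>r. r \<in> carrier R \<Longrightarrow> mfun p (mfun j r) = \<zero>\<^bsub>R\<^esub>" for j p
  proof (rule Mod_arr_eqI[OF R.cmp_in_hom[OF j p] mk_arr_hom[OF R.unit_small R.unit_small zero_linear[OF I.module_axioms]]])
    fix r assume "r \<in> carrier R.II"
    then show "mfun (p \<cdot>\<^bsub>Mod R\<^esub> j) r = mfun (mk_arr R.II R.II (\<lambda>_. \<zero>\<^bsub>R.II\<^esub>)) r" using mfun_cmp[OF j p] e by simp
  qed
  let ?F = "\<lambda>h. mfun (farr F h)"
  interpret Fc: module S "fobj F c" using F_small[OF cs] by (rule small_modulesD)
  have Fid: "?F p (?F j z) = z" if j: "j \<in> hom_set (Mod R) R.II c" and p: "p \<in> hom_set (Mod R) c R.II"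
      and e: "\<And>r. r \<in> carrier R \<Longrightarrow> mfun p (mfun j r) = r" and z: "z \<in> carrier (fobj F R.II)" for j p z
    using mfun_cmp[OF F_hom[OF j] F_hom[OF p] z] functor_cmp[OF Ff j p] cmp_id[OF j p e]
      functor_idn[OF Ff] R.unit_small mfun_idn[OF z, where R = S] by (simp del: Mod_simps(5))
  have Fz: "?F p (?F j z) = \<zero>\<^bsub>fobj F R.II\<^esub>" if j: "j \<in> hom_set (Mod R) R.II c" and p: "p \<in> hom_set (Mod R) c R.II"
      and e: "\<And>r. r \<in> carrier R \<Longrightarrow> mfun p (mfun j r) = \<zero>\<^bsub>R\<^esub>" and z: "z \<in> carrier (fobj F R.II)" for j p z
    using mfun_cmp[OF F_hom[OF j] F_hom[OF p] z] functor_cmp[OF Ff j p] cmp_zero[OF j p e]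
      F_zero[OF R.unit_small R.unit_small z] by simp
  note la = mfun_linear[OF F_hom[OF \<iota>(1)]] and lb = mfun_linear[OF F_hom[OF \<iota>(2)]]
    and qa = mfun_linear[OF F_hom[OF pa(1)]] and qb = mfun_linear[OF F_hom[OF pb(1)]]
  note FI = small_modulesD[OF F_small[OF R.unit_small]]
  have split: "?F (\<iota> a) (?F pa w) \<oplus>\<^bsub>fobj F c\<^esub> ?F (\<iota> b) (?F pb w) = w" if w: "w \<in> carrier (fobj F c)" for w
  proof (rule colimit_Mod_ext[OF is_functor_comp[OF D Ff] F_colimit[OF J D c] F_small[OF cs] _ _ _ w])
    show "linear S (fobj F c) (fobj F c) (\<lambda>w. ?F (\<iota> a) (?F pa w) \<oplus>\<^bsub>fobj F c\<^esub> ?F (\<iota> b) (?F pb w))"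
      by (rule linear_sum[OF Fc.module_axioms linear_comp[OF qa la] linear_comp[OF qb lb]])
    show "linear S (fobj F c) (fobj F c) (\<lambda>w. w)" by (rule linearI) simp_all
    fix j z assume "j \<in> obj ?J" and "z \<in> carrier (fobj (comp_fctr F ?D) j)"
    then have j: "j = a \<or> j = b" and z: "z \<in> carrier (fobj F R.II)" by auto
    show "?F (\<iota> a) (?F pa (?F (\<iota> j) z)) \<oplus>\<^bsub>fobj F c\<^esub> ?F (\<iota> b) (?F pb (?F (\<iota> j) z)) = ?F (\<iota> j) z"
      using j
    proof
      assume "j = a"
      then show ?thesis
        using Fid[OF \<iota>(1) pa(1) pa(2) z] Fz[OF \<iota>(1) pb(1) pb(2) z] linear_zero[OF lb FI Fc.module_axioms]
          linear_closed[OF la z] by simp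
    next
      assume "j = b"
      then show ?thesis
        using Fid[OF \<iota>(2) pb(1) pb(3) z] Fz[OF \<iota>(2) pa(1) pa(3) z] linear_zero[OF la FI Fc.module_axioms]
          linear_closed[OF lb z] by simp
    qed
  qed
  define ia where "ia = mfun (\<iota> a) \<one>\<^bsub>R\<^esub>"
  define ib where "ib = mfun (\<iota> b) \<one>\<^bsub>R\<^esub>"
  have o: "\<one>\<^bsub>R\<^esub> \<in> carrier R.II" using R.one_closed by simp
  have i: "ia \<in> carrier c" "ib \<in> carrier c" using mfun_closed[OF \<iota>(1) o] mfun_closed[OF \<iota>(2) o] by (simp_all add: ia_def ib_def)
  have pai: "mfun pa (ia \<oplus>\<^bsub>c\<^esub> ib) = \<one>\<^bsub>R\<^esub>" "mfun pb (ia \<oplus>\<^bsub>c\<^esub> ib) = \<one>\<^bsub>R\<^esub>"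
    using linear_add[OF mfun_linear[OF pa(1)] i] linear_add[OF mfun_linear[OF pb(1)] i] pa(2,3) pb(2,3)
      I.r_zero[of "\<one>\<^bsub>R\<^esub>"] I.l_zero[of "\<one>\<^bsub>R\<^esub>"] R.one_closed by (simp_all add: ia_def ib_def)
  have univ: "g c (ia \<oplus>\<^bsub>c\<^esub> ib) = g c ia \<oplus>\<^bsub>fobj F c\<^esub> g c ib"
  proof -
    have ii: "ia \<oplus>\<^bsub>c\<^esub> ib \<in> carrier c" using i by simp
    have "g c (ia \<oplus>\<^bsub>c\<^esub> ib) = ?F (\<iota> a) (?F pa (g c (ia \<oplus>\<^bsub>c\<^esub> ib))) \<oplus>\<^bsub>fobj F c\<^esub> ?F (\<iota> b) (?F pb (g c (ia \<oplus>\<^bsub>c\<^esub> ib)))"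
      using split[OF gen_closed[OF cs ii]] by simp
    also have "\<dots> = ?F (\<iota> a) (g R.II \<one>\<^bsub>R\<^esub>) \<oplus>\<^bsub>fobj F c\<^esub> ?F (\<iota> b) (g R.II \<one>\<^bsub>R\<^esub>)"
      using gen_natural[OF pa(1) ii] gen_natural[OF pb(1) ii] pai by simp
    also have "\<dots> = g c ia \<oplus>\<^bsub>fobj F c\<^esub> g c ib"
      using gen_natural[OF \<iota>(1) o] gen_natural[OF \<iota>(2) o] by (simp add: ia_def ib_def)
    finally show ?thesis .
  qed
  obtain h where h: "h \<in> hom_set (Mod R) c M"
    "\<forall>r\<in>carrier R. mfun h (mfun (\<iota> a) r) = r \<odot>\<^bsub>M\<^esub> x \<and> mfun h (mfun (\<iota> b) r) = r \<odot>\<^bsub>M\<^esub> y"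
    using copair[OF M R.pt_linear[OF M x] R.pt_linear[OF M y]] by blast
  have hi: "mfun h ia = x" "mfun h ib = y" using h(2) R.one_closed x y by (simp_all add: ia_def ib_def)
  have "?F h (g c (ia \<oplus>\<^bsub>c\<^esub> ib)) = ?F h (g c ia) \<oplus>\<^bsub>fobj F M\<^esub> ?F h (g c ib)"
    unfolding univ by (rule linear_add[OF mfun_linear[OF F_hom[OF h(1)]] gen_closed[OF cs i(1)] gen_closed[OF cs i(2)]])
  then show ?thesis
    using gen_natural[OF h(1)] i linear_add[OF mfun_linear[OF h(1)] i] hi by simp
qed

end


text \<open>
  Applied to the unit constraints, this makes the comparison at the unit invertible.
\<close>

lemma is_iso_cancel_right:
  assumes C: "is_category C" and p: "p \<in> hom_set C y z" and q: "q \<in> iso_set C x y" and pq: "p \<cdot>\<^bsub>C\<^esub> q \<in> iso_set C x z"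
  shows "is_iso C p"
proof -
  note qh = iso_set_hom[OF q] and rh = iso_set_hom[OF pq]
  note K = category_cmp[OF C] and A = category_assoc[OF C]
  obtain q' where q': "q' \<in> hom_set C y x" "q \<cdot>\<^bsub>C\<^esub> q' = idn C y" using is_isoE[OF qh iso_set_iso[OF q]] by blast
  obtain r' where r': "r' \<in> hom_set C z x" "r' \<cdot>\<^bsub>C\<^esub> (p \<cdot>\<^bsub>C\<^esub> q) = idn C x" "(p \<cdot>\<^bsub>C\<^esub> q) \<cdot>\<^bsub>C\<^esub> r' = idn C z"
    using is_isoE[OF rh iso_set_iso[OF pq]] by blast
  have "p \<cdot>\<^bsub>C\<^esub> (q \<cdot>\<^bsub>C\<^esub> r') = idn C z" using A[OF r'(1) qh p] r'(3) by simp
  moreover have "(q \<cdot>\<^bsub>C\<^esub> r') \<cdot>\<^bsub>C\<^esub> p = idn C y"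
  proof -
    have "r' \<cdot>\<^bsub>C\<^esub> p = (r' \<cdot>\<^bsub>C\<^esub> p) \<cdot>\<^bsub>C\<^esub> (q \<cdot>\<^bsub>C\<^esub> q')" using q'(2) category_idn_right[OF C K[OF p r'(1)]] by simp
    also have "\<dots> = (r' \<cdot>\<^bsub>C\<^esub> (p \<cdot>\<^bsub>C\<^esub> q)) \<cdot>\<^bsub>C\<^esub> q'" using A[OF q'(1) qh K[OF p r'(1)]] A[OF qh p r'(1)] by simp
    also have "\<dots> = q'" using r'(2) category_idn_left[OF C q'(1)] by simp
    finally show ?thesis using A[OF p r'(1) qh] q'(2) by simp
  qed
  ultimately show ?thesis using K[OF r'(1) qh] hom_set_arr[OF p] hom_set_src[OF p] hom_set_tgt[OF p] unfolding is_iso_def by auto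
qed

context mod_functor
begin

abbreviation "\<phi> \<equiv> base_hom R S F"

lemma base_hom_eval:
  assumes r: "r \<in> carrier R"
  shows "\<phi> r \<in> carrier S" and "\<phi> r \<odot>\<^bsub>fobj F R.II\<^esub> u = g R.II r"
proof -
  have "g R.II r \<in> carrier (fobj F R.II)" using gen_closed[OF R.unit_small] r by simp
  from theI'[OF unit_unique[OF this]]
  have *: "\<phi> r \<in> carrier S \<and> mfun (fone F) (\<phi> r) = g R.II r" using r by (simp add: base_hom_def)
  then show "\<phi> r \<in> carrier S" by blast
  from fone_eval[OF this] show "\<phi> r \<odot>\<^bsub>fobj F R.II\<^esub> u = g R.II r" using * by metis
qed

lemma base_hom_unique: "r \<in> carrier R \<Longrightarrow> s \<in> carrier S \<Longrightarrow> s \<odot>\<^bsub>fobj F R.II\<^esub> u = g R.II r \<Longrightarrow> \<phi> r = s"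
  using base_hom_eval smult_u_cancel by simp

lemma gen_smult:
  assumes M: "M \<in> small_modules R" and r: "r \<in> carrier R" and x: "x \<in> carrier M"
  shows "g M (r \<odot>\<^bsub>M\<^esub> x) = \<phi> r \<odot>\<^bsub>fobj F M\<^esub> g M x"
proof -
  note p = R.pt_hom[OF M x]
  have "g M (r \<odot>\<^bsub>M\<^esub> x) = mfun (farr F (pt R M x)) (g R.II r)"
    using gen_natural[OF p, of r] r R.mfun_pt[OF r] by simp
  also have "\<dots> = \<phi> r \<odot>\<^bsub>fobj F M\<^esub> g M x"
    unfolding base_hom_eval(2)[OF r, symmetric] gen_def[of R S F M x]
    by (rule linear_smult[OF mfun_linear[OF F_hom[OF p]] base_hom_eval(1)[OF r] u_closed])
  finally show ?thesis .
qed

lemma base_hom_cring_hom: "\<phi> \<in> cring_hom R S"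
proof -
  interpret R': cring R by (rule R.cring)
  interpret S': cring S by (rule S.cring)
  interpret FI: module S "fobj F R.II" using F_small[OF R.unit_small] by (rule small_modulesD)
  note I = R.unit_small
  have "\<phi> \<in> ring_hom R S"
  proof (rule ring_hom_memI)
    show "\<phi> r \<in> carrier S" if "r \<in> carrier R" for r using that by (rule base_hom_eval)
    show "\<phi> (r \<otimes>\<^bsub>R\<^esub> s) = \<phi> r \<otimes>\<^bsub>S\<^esub> \<phi> s" if r: "r \<in> carrier R" and s: "s \<in> carrier R" for r s
    proof (rule base_hom_unique)
      show "(\<phi> r \<otimes>\<^bsub>S\<^esub> \<phi> s) \<odot>\<^bsub>fobj F R.II\<^esub> u = g R.II (r \<otimes>\<^bsub>R\<^esub> s)"
        using FI.smult_assoc1[OF base_hom_eval(1)[OF r] base_hom_eval(1)[OF s] u_closed] base_hom_eval(2)[OF s]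
          gen_smult[OF I r, of s] s by simp
    qed (use r s base_hom_eval(1) in simp_all)
    show "\<phi> (r \<oplus>\<^bsub>R\<^esub> s) = \<phi> r \<oplus>\<^bsub>S\<^esub> \<phi> s" if r: "r \<in> carrier R" and s: "s \<in> carrier R" for r s
    proof (rule base_hom_unique)
      show "(\<phi> r \<oplus>\<^bsub>S\<^esub> \<phi> s) \<odot>\<^bsub>fobj F R.II\<^esub> u = g R.II (r \<oplus>\<^bsub>R\<^esub> s)"
        using FI.smult_l_distr[OF base_hom_eval(1)[OF r] base_hom_eval(1)[OF s] u_closed] base_hom_eval(2)[OF r]
          base_hom_eval(2)[OF s] gen_add[OF I, of r s] r s by simp
    qed (use r s base_hom_eval(1) in simp_all)
    show "\<phi> \<one>\<^bsub>R\<^esub> = \<one>\<^bsub>S\<^esub>" by (rule base_hom_unique) (simp_all add: gen_one u_closed)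
  qed
  then show ?thesis by (simp add: cring_hom_def base_hom_def)
qed

sublocale ext: scalar_extension R S "base_hom R S F"
  using base_hom_cring_hom by unfold_locales (simp add: cring_hom_def)

lemma gen_linear:
  assumes M: "M \<in> small_modules R"
  shows "linear R M (restrict_scalars \<phi> (fobj F M)) (g M)"
  by (rule linearI) (simp_all add: gen_closed[OF M] gen_add[OF M] gen_smult[OF M])

text \<open>
  The comparison \<open>s \<otimes> x \<mapsto> s F(x)(u)\<close> from extension of scalars to the functor: its restriction
  along \<open>x \<mapsto> 1 \<otimes> x\<close> is the linear map of the preceding lemma.
\<close>

definition compare :: "('u, 'u) module \<Rightarrow> 'u mod_arr" where
  "compare M = (ext.E M, SOME h. h \<in> mod_hom S (ext.E M) (fobj F M) \<and>
     (\<forall>x\<in>carrier M. h (ext.eta M x) = g M x), fobj F M)"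

context
  fixes M assumes M: "M \<in> small_modules R"
begin

lemma compare_hom: "compare M \<in> hom_set (Mod S) (ext.E M) (fobj F M)"
  and compare_eta: "x \<in> carrier M \<Longrightarrow> mfun (compare M) (ext.eta M x) = g M x"
proof -
  have "\<exists>h. h \<in> mod_hom S (ext.E M) (fobj F M) \<and> (\<forall>x\<in>carrier M. h (ext.eta M x) = g M x)"
    by (rule ext.ext_lift[OF M F_small[OF M] gen_linear[OF M]])
  from someI_ex[OF this]
  show "compare M \<in> hom_set (Mod S) (ext.E M) (fobj F M)"
    and "x \<in> carrier M \<Longrightarrow> mfun (compare M) (ext.eta M x) = g M x"
    using ext.ext_small[OF M] F_small[OF M] by (simp_all add: compare_def)
qed

end

lemma compare_nat_trans: "nat_trans (Mod R) (Mod S) ext.EE F compare"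
  unfolding nat_trans_def
proof (intro conjI ballI)
  show "compare M \<in> hom_set (Mod S) (fobj ext.EE M) (fobj F M)" if "M \<in> obj (Mod R)" for M
    using compare_hom[of M] that by simp
  fix a assume ar: "a \<in> arr (Mod R)"
  define M where "M = src (Mod R) a"
  define N where "N = tgt (Mod R) a"
  have a: "a \<in> hom_set (Mod R) M N" unfolding M_def N_def by (rule arr_in_hom_set[OF ar])
  note M = hom_set_Mod_obj(1)[OF a] and N = hom_set_Mod_obj(2)[OF a]
  note A = ext.ext_map_hom[OF a] and cM = compare_hom[OF M] and cN = compare_hom[OF N]
  have "compare N \<cdot>\<^bsub>Mod S\<^esub> ext_map R S \<phi> a = farr F a \<cdot>\<^bsub>Mod S\<^esub> compare M"
  proof (rule ext.ext_arr_eqI[OF M S.cmp_in_hom[OF A(1) cN] S.cmp_in_hom[OF cM F_hom[OF a]]])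
    fix x assume x: "x \<in> carrier M"
    note ex = ext.eta_closed[OF M x, folded ext.ext_simps]
    show "mfun (compare N \<cdot>\<^bsub>Mod S\<^esub> ext_map R S \<phi> a) (ext.eta M x) = mfun (farr F a \<cdot>\<^bsub>Mod S\<^esub> compare M) (ext.eta M x)"
      unfolding mfun_cmp[OF A(1) cN ex] mfun_cmp[OF cM F_hom[OF a] ex] A(2)[OF x] compare_eta[OF M x]
        compare_eta[OF N mfun_closed[OF a x]] gen_natural[OF a x] by (rule refl)
  qed
  then show "compare (tgt (Mod R) a) \<cdot>\<^bsub>Mod S\<^esub> farr ext.EE a = farr F a \<cdot>\<^bsub>Mod S\<^esub> compare (src (Mod R) a)"
    unfolding ext.EE_simps M_def N_def .
qed

lemma compare_one: "compare R.II \<cdot>\<^bsub>Mod S\<^esub> ext_one R S \<phi> = fone F"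
proof (rule S.unit_arr_eqI[OF S.cmp_in_hom[OF ext.ext_one_hom compare_hom[OF R.unit_small]] fone_hom])
  have o: "\<one>\<^bsub>S\<^esub> \<in> carrier S.II" "\<one>\<^bsub>R\<^esub> \<in> carrier R.II" using S.one_closed R.one_closed by simp_all
  show "mfun (compare R.II \<cdot>\<^bsub>Mod S\<^esub> ext_one R S \<phi>) \<one>\<^bsub>S\<^esub> = mfun (fone F) \<one>\<^bsub>S\<^esub>"
    unfolding mfun_cmp[OF ext.ext_one_hom compare_hom[OF R.unit_small] o(1)] ext.mfun_ext_one
      compare_eta[OF R.unit_small o(2)] gen_one unit_elt_def by (rule refl)
qed

text \<open>
  The comparison is invertible at the unit by the previous lemma, hence everywhere, because both
  functors preserve colimits and the unit generates under colimits.
\<close>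

lemma compare_iso:
  assumes "M \<in> small_modules R"
  shows "is_iso (Mod S) (compare M)"
proof -
  let ?P = "{M \<in> small_modules R. is_iso (Mod S) (compare M)}"
  have "R.II \<in> ?P"
    using is_iso_cancel_right[OF Mod_is_category compare_hom[OF R.unit_small] ext.ext_one_iso] fone_iso
    by (simp add: compare_one)
  moreover have "colimit_closed TYPE('u) (Mod R) ?P"
    unfolding colimit_closed_def
  proof (intro allI impI)
    fix J :: "('u, 'u) category" and D :: "('u, 'u, ('u, 'u) module, 'u mod_arr) fctr" and c \<iota>
    assume J: "small_category TYPE('u) J" and D: "is_functor J (Mod R) D"
      and iso: "\<forall>j\<in>obj J. fobj D j \<in> ?P" and c: "is_colimit (Mod R) J D c \<iota>"
    have "preserves_colimits J (Mod R) (Mod S) ext.EE" "preserves_colimits J (Mod R) (Mod S) F"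
      using J ext.ext_cocontinuous cocont by (simp_all add: cocontinuous_def)
    then have "is_iso (Mod S) (compare c)"
      by (rule nat_trans_iso_colimit[OF ext.ext_functor Ff compare_nat_trans D c]) (use iso in simp)
    then show "c \<in> ?P" using c by (simp add: is_colimit_def is_cocone_def)
  qed
  ultimately show ?thesis using R.unit_generates assms by blast
qed

text \<open>
  Both arguments are transports of the distinguished element, so naturality reduces the claim to
  the product of that element with itself, and there it is the unit axiom.
\<close>

lemma gen_mul:
  assumes M: "M \<in> small_modules R" and N: "N \<in> small_modules R" and x: "x \<in> carrier M" and y: "y \<in> carrier N"
  shows "mfun (fmul F M N) (tmul S (fobj F M) (fobj F N) (g M x) (g N y)) = g (tens R M N) (tmul R M N x y)"
proof -
  note I = R.unit_small and FI = F_small[OF R.unit_small]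
  have II: "tens R R.II R.II \<in> small_modules R" using I by simp
  have mh: "fmul F A B \<in> hom_set (Mod S) (tens S (fobj F A) (fobj F B)) (fobj F (tens R A B))"
    if "A \<in> small_modules R" "B \<in> small_modules R" for A B
    using iso_set_hom[OF smf_fmul[OF smf, of A B]] that by simp
  have o: "\<one>\<^bsub>R\<^esub> \<in> carrier R.II" "\<one>\<^bsub>S\<^esub> \<in> carrier S.II" using R.one_closed S.one_closed by simp_all
  let ?uu = "tmul S (fobj F R.II) (fobj F R.II) u u" and ?oo = "tmul R R.II R.II \<one>\<^bsub>R\<^esub> \<one>\<^bsub>R\<^esub>"
  have uu: "?uu \<in> carrier (tens S (fobj F R.II) (fobj F R.II))" by (rule S.tmul_closed[OF FI FI u_closed u_closed])
  have oo: "?oo \<in> carrier (tens R R.II R.II)" by (rule R.tmul_closed[OF I I o(1) o(1)])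
  interpret FI: module S "fobj F R.II" using FI by (rule small_modulesD)
  \<comment> \<open>The unit axiom computes the product of the distinguished element with itself.\<close>
  let ?l = "lun (Mod R) R.II"
  note l = R.lun_in_hom[OF I] and i = S.idn_in_hom[OF FI]
  have "farr F ?l \<cdot>\<^bsub>Mod S\<^esub> fmul F R.II R.II \<cdot>\<^bsub>Mod S\<^esub> tarr (Mod S) (fone F) (idn (Mod S) (fobj F R.II)) =
      lun (Mod S) (fobj F R.II)"
    using smf_lun[OF smf, of R.II] I by (simp del: Mod_simps(5,6,8,11))
  moreover have "mfun (farr F ?l \<cdot>\<^bsub>Mod S\<^esub> fmul F R.II R.II \<cdot>\<^bsub>Mod S\<^esub> tarr (Mod S) (fone F) (idn (Mod S) (fobj F R.II)))
      (tmul S S.II (fobj F R.II) \<one>\<^bsub>S\<^esub> u) = mfun (farr F ?l) (mfun (fmul F R.II R.II) ?uu)"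
    unfolding S.mfun_cmp3[OF S.tarr_in_hom[OF fone_hom i] mh[OF I I] F_hom[OF l] S.tmul_closed[OF S.unit_small FI o(2) u_closed]]
      S.mfun_tarr[OF fone_hom i o(2) u_closed] mfun_idn[OF u_closed] unit_elt_def[symmetric] by (rule refl)
  ultimately have lu: "mfun (farr F ?l) (mfun (fmul F R.II R.II) ?uu) = u"
    using S.mfun_structure(2)[OF FI S.one_closed u_closed] FI.smult_one[OF u_closed] by simp
  have lo: "mfun (farr F ?l) (g (tens R R.II R.II) ?oo) = u"
    using gen_natural[OF l oo] R.mfun_structure(2)[OF I R.one_closed o(1)] gen_one
      module.smult_one[OF small_modulesD[OF I] o(1)] by simp
  obtain b where b: "b \<in> hom_set (Mod R) R.II (tens R R.II R.II)" "b \<cdot>\<^bsub>Mod R\<^esub> ?l = idn (Mod R) (tens R R.II R.II)"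
    using is_isoE[OF l iso_set_iso[OF R.lun_iso(1)[OF I]]] by blast
  have cancel: "mfun (farr F b) (mfun (farr F ?l) w) = w" if w: "w \<in> carrier (fobj F (tens R R.II R.II))" for w
  proof -
    have "farr F b \<cdot>\<^bsub>Mod S\<^esub> farr F ?l = idn (Mod S) (fobj F (tens R R.II R.II))"
      using functor_cmp[OF Ff l b(1)] b(2) functor_idn[OF Ff, of "tens R R.II R.II"] II by (simp del: Mod_simps(5,6,11))
    then show ?thesis using mfun_cmp[OF F_hom[OF l] F_hom[OF b(1)] w] mfun_idn[OF w, where R = S] by metis
  qed
  have uu_eq: "mfun (fmul F R.II R.II) ?uu = g (tens R R.II R.II) ?oo"
    using cancel[OF mfun_closed[OF mh[OF I I] uu]] cancel[OF gen_closed[OF II oo]] lu lo by metis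
  note px = R.pt_hom[OF M x] and py = R.pt_hom[OF N y]
  have "fmul F M N \<cdot>\<^bsub>Mod S\<^esub> tarr (Mod S) (farr F (pt R M x)) (farr F (pt R N y)) =
      farr F (tarr (Mod R) (pt R M x) (pt R N y)) \<cdot>\<^bsub>Mod S\<^esub> fmul F R.II R.II"
    by (rule smf_fmul_natural[OF smf px py])
  from arg_cong[OF this, of "\<lambda>a. mfun a ?uu"]
  have "mfun (fmul F M N) (tmul S (fobj F M) (fobj F N) (g M x) (g N y)) =
      mfun (farr F (tarr (Mod R) (pt R M x) (pt R N y))) (g (tens R R.II R.II) ?oo)"
    unfolding mfun_cmp[OF S.tarr_in_hom[OF F_hom[OF px] F_hom[OF py]] mh[OF M N] uu]
      S.mfun_tarr[OF F_hom[OF px] F_hom[OF py] u_closed u_closed]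
      mfun_cmp[OF mh[OF I I] F_hom[OF R.tarr_in_hom[OF px py]] uu] uu_eq gen_def .
  then show ?thesis
    unfolding gen_natural[OF R.tarr_in_hom[OF px py] oo] R.mfun_tarr[OF px py o(1) o(1)]
      R.mfun_pt_one[OF M x] R.mfun_pt_one[OF N y] .
qed

lemma compare_monoidal: "monoidal_nat_trans (Mod R) (Mod S) ext.EE F compare"
  unfolding monoidal_nat_trans_def
proof (intro conjI ballI)
  show "nat_trans (Mod R) (Mod S) ext.EE F compare" by (rule compare_nat_trans)
  show "compare (tunit (Mod R)) \<cdot>\<^bsub>Mod S\<^esub> fone ext.EE = fone F" using compare_one by simp
  fix M N assume "M \<in> obj (Mod R)" "N \<in> obj (Mod R)"
  then have M: "M \<in> small_modules R" and N: "N \<in> small_modules R" by simp_all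
  note MN = R.tens_small[OF M N]
  note cM = compare_hom[OF M] and cN = compare_hom[OF N] and cMN = compare_hom[OF MN] and m = ext.ext_mul_hom[OF M N]
  have fm: "fmul F M N \<in> hom_set (Mod S) (tens S (fobj F M) (fobj F N)) (fobj F (tens R M N))"
    using iso_set_hom[OF smf_fmul[OF smf, of M N]] M N by simp
  have "compare (tens R M N) \<cdot>\<^bsub>Mod S\<^esub> ext_mul R S \<phi> M N = fmul F M N \<cdot>\<^bsub>Mod S\<^esub> tarr (Mod S) (compare M) (compare N)"
  proof (rule ext.ext_tens_arr_eqI[OF M N S.cmp_in_hom[OF m cMN] S.cmp_in_hom[OF S.tarr_in_hom[OF cM cN] fm]])
    fix x y assume x: "x \<in> carrier M" and y: "y \<in> carrier N"
    note ex = ext.eta_closed[OF M x, folded ext.ext_simps] and ey = ext.eta_closed[OF N y, folded ext.ext_simps]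
    note t = S.tmul_closed[OF ext.ext_small[OF M] ext.ext_small[OF N] ex ey]
    show "mfun (compare (tens R M N) \<cdot>\<^bsub>Mod S\<^esub> ext_mul R S \<phi> M N) (tmul S (ext.E M) (ext.E N) (ext.eta M x) (ext.eta N y)) =
      mfun (fmul F M N \<cdot>\<^bsub>Mod S\<^esub> tarr (Mod S) (compare M) (compare N)) (tmul S (ext.E M) (ext.E N) (ext.eta M x) (ext.eta N y))"
      unfolding mfun_cmp[OF m cMN t] mfun_cmp[OF S.tarr_in_hom[OF cM cN] fm t] ext.mfun_ext_mul[OF M N x y]
        compare_eta[OF MN R.tmul_closed[OF M N x y]] S.mfun_tarr[OF cM cN ex ey] compare_eta[OF M x]
        compare_eta[OF N y] gen_mul[OF M N x y] by (rule refl)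
  qed
  then show "compare (tobj (Mod R) M N) \<cdot>\<^bsub>Mod S\<^esub> fmul ext.EE M N =
      fmul F M N \<cdot>\<^bsub>Mod S\<^esub> tarr (Mod S) (compare M) (compare N)" by simp
qed

end

section \<open>The equivalence\<close>

text \<open>
  Compatibility with the unit constraints fixes the distinguished element, and naturality then fixes
  its transports.
\<close>

lemma monoidal_nat_trans_gen:
  assumes F: "mod_functor R S F" and G: "mod_functor R S G"
    and \<alpha>: "monoidal_nat_trans (Mod R) (Mod S) F G \<alpha>" and M: "M \<in> small_modules R" and x: "x \<in> carrier M"
  shows "mfun (\<alpha> M) (gen R S F M x) = gen R S G M x"
proof -
  interpret F: mod_functor R S F by fact
  interpret G: mod_functor R S G by fact
  note a = nat_trans_hom[OF mnt_nat_trans[OF \<alpha>]]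
  have aI: "\<alpha> F.R.II \<in> hom_set (Mod S) (fobj F F.R.II) (fobj G F.R.II)"
    and aM: "\<alpha> M \<in> hom_set (Mod S) (fobj F M) (fobj G M)" using a F.R.unit_small M by simp_all
  note p = F.R.pt_hom[OF M x]
  have o: "\<one>\<^bsub>S\<^esub> \<in> carrier F.S.II" using F.S.one_closed by simp
  have "mfun (\<alpha> F.R.II) (unit_elt S F) = unit_elt S G"
    unfolding unit_elt_def using mfun_cmp[OF F.fone_hom aI o] mnt_fone[OF \<alpha>] by simp
  then show ?thesis
    unfolding gen_def
    using mfun_cmp[OF F.F_hom[OF p] aM F.u_closed] mfun_cmp[OF aI G.F_hom[OF p] F.u_closed]
      nat_trans_natural[OF mnt_nat_trans[OF \<alpha>] p] by simp
qed

lemma base_hom_eq: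
  assumes F: "mod_functor R S F" and G: "mod_functor R S G"
    and \<alpha>: "monoidal_nat_trans (Mod R) (Mod S) F G \<alpha>"
  shows "base_hom R S F = base_hom R S G"
proof
  interpret F: mod_functor R S F by fact
  interpret G: mod_functor R S G by fact
  note I = F.R.unit_small
  have aI: "\<alpha> F.R.II \<in> hom_set (Mod S) (fobj F F.R.II) (fobj G F.R.II)"
    using nat_trans_hom[OF mnt_nat_trans[OF \<alpha>]] I by simp
  have o: "\<one>\<^bsub>R\<^esub> \<in> carrier F.R.II" using F.R.one_closed by simp
  fix r
  show "base_hom R S F r = base_hom R S G r"
  proof (cases "r \<in> carrier R")
    case True
    have "base_hom R S F r \<odot>\<^bsub>fobj G F.R.II\<^esub> unit_elt S G = gen R S G F.R.II r"
      using arg_cong[OF F.base_hom_eval(2)[OF True], of "mfun (\<alpha> F.R.II)"]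
        linear_smult[OF mfun_linear[OF aI] F.base_hom_eval(1)[OF True] F.u_closed]
        monoidal_nat_trans_gen[OF F G \<alpha> I, of r] monoidal_nat_trans_gen[OF F G \<alpha> I o] F.gen_one G.gen_one True by simp
    then show ?thesis using G.base_hom_unique[OF True F.base_hom_eval(1)[OF True]] by simp
  next
    case False
    then show ?thesis by (simp add: base_hom_def)
  qed
qed

context scalar_extension
begin

lemma EE_mod_functor: "mod_functor R S EE"
  by unfold_locales (rule ext_monoidal, rule ext_cocontinuous)

lemma EE_gen:
  assumes M: "M \<in> small_modules R" and x: "x \<in> carrier M"
  shows "gen R S EE M x = eta M x"
proof -
  have o: "\<one>\<^bsub>R\<^esub> \<in> carrier R.II" using R.one_closed by simp
  show ?thesis
    unfolding gen_def unit_elt_def EE_simps mfun_ext_one ext_map_hom(2)[OF R.pt_hom[OF M x] o] R.mfun_pt_one[OF M x]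
    by (rule refl)
qed

text \<open>
  On the unit, \<open>1 \<otimes> r\<close> equals \<open>\<phi> r\<close> times \<open>1 \<otimes> 1\<close>, so \<open>\<phi>\<close> can be read off.
\<close>

lemma base_hom_EE:
  assumes "\<phi> \<in> extensional (carrier R)"
  shows "base_hom R S EE = \<phi>"
proof
  interpret EE: mod_functor R S EE by (rule EE_mod_functor)
  interpret R': cring R by (rule R.cring)
  fix r
  show "base_hom R S EE r = \<phi> r"
  proof (cases "r \<in> carrier R")
    case True
    have "eta R.II (r \<odot>\<^bsub>R.II\<^esub> \<one>\<^bsub>R\<^esub>) = \<phi> r \<odot>\<^bsub>E R.II\<^esub> eta R.II \<one>\<^bsub>R\<^esub>"
      using linear_smult[OF eta_linear[OF R.unit_small] True, of "\<one>\<^bsub>R\<^esub>"] by simp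
    then show ?thesis
      using EE.base_hom_unique[OF True hom_simps(1)[OF True]] EE_gen[OF R.unit_small, of r] True
      by (simp add: unit_elt_def mfun_ext_one)
  next
    case False
    then show ?thesis using assms by (simp add: base_hom_def extensional_def)
  qed
qed

text \<open>
  Both transformations have the same value at every \<open>1 \<otimes> x\<close>, and these elements span.
\<close>

lemma monoidal_nat_trans_unique:
  assumes G: "mod_functor R S G"
    and \<alpha>: "monoidal_nat_trans (Mod R) (Mod S) EE G \<alpha>" and \<beta>: "monoidal_nat_trans (Mod R) (Mod S) EE G \<beta>"
    and M: "M \<in> small_modules R"
  shows "\<alpha> M = \<beta> M"
proof (rule ext_arr_eqI[OF M])
  show "\<alpha> M \<in> hom_set (Mod S) (E M) (fobj G M)" "\<beta> M \<in> hom_set (Mod S) (E M) (fobj G M)"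
    using nat_trans_hom[OF mnt_nat_trans[OF \<alpha>], of M] nat_trans_hom[OF mnt_nat_trans[OF \<beta>], of M] M by simp_all
  fix x assume x: "x \<in> carrier M"
  show "mfun (\<alpha> M) (eta M x) = mfun (\<beta> M) (eta M x)"
    using monoidal_nat_trans_gen[OF EE_mod_functor G \<alpha> M x] monoidal_nat_trans_gen[OF EE_mod_functor G \<beta> M x] EE_gen[OF M x]
    by simp
qed

end

locale small_cring_pair = R: small_cring R + S: small_cring S for R S :: "'u ring"
begin

sublocale H: monoidal_functors "Mod R" "Mod S"
  by unfold_locales (rule R.Mod_symmetric_monoidal, rule S.Mod_symmetric_monoidal)

abbreviation "H \<equiv> com_two_ring_hom TYPE('u) (Mod R) (Mod S)"

lemma obj_H: "F \<in> obj H \<longleftrightarrow> mod_functor R S F"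
  using R.small_cring_axioms S.small_cring_axioms
  by (simp add: H.hom_category_simps(1) mod_functor_def mod_functor_axioms_def)

lemma scalar_extension_cring_hom: "\<phi> \<in> cring_hom R S \<Longrightarrow> scalar_extension R S \<phi>"
  by unfold_locales (simp add: cring_hom_def)

lemma ext_scalars_obj: "\<phi> \<in> cring_hom R S \<Longrightarrow> ext_scalars R S \<phi> \<in> obj H"
  using scalar_extension.EE_mod_functor[OF scalar_extension_cring_hom] obj_H by blast

lemma base_hom_in: "F \<in> obj H \<Longrightarrow> base_hom R S F \<in> cring_hom R S"
  using mod_functor.base_hom_cring_hom obj_H by blast

lemma base_hom_ext: "\<phi> \<in> cring_hom R S \<Longrightarrow> base_hom R S (ext_scalars R S \<phi>) = \<phi>"
  using scalar_extension.base_hom_EE[OF scalar_extension_cring_hom] by (simp add: cring_hom_def)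

lemma base_hom_arr: "f \<in> hom_set H F G \<Longrightarrow> base_hom R S F = base_hom R S G"
  using base_hom_eq obj_H by (cases f) (auto simp: H.hom_category_hom)

lemma hom_from_ext_unique:
  assumes \<phi>: "\<phi> \<in> cring_hom R S" and f: "f \<in> hom_set H (ext_scalars R S \<phi>) G" and g: "g \<in> hom_set H (ext_scalars R S \<phi>) G"
  shows "f = g"
proof -
  interpret scalar_extension R S \<phi> using \<phi> by (rule scalar_extension_cring_hom)
  obtain \<alpha> where \<alpha>: "f = (EE, \<alpha>, G)" "monoidal_nat_trans (Mod R) (Mod S) EE G \<alpha>" "\<alpha> \<in> extensional (obj (Mod R))"
    using f by (rule H.hom_category_homE)
  obtain \<beta> where \<beta>: "g = (EE, \<beta>, G)" "monoidal_nat_trans (Mod R) (Mod S) EE G \<beta>" "\<beta> \<in> extensional (obj (Mod R))"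
    using g by (rule H.hom_category_homE)
  have "mod_functor R S G" using f obj_H by (cases f) (auto simp: H.hom_category_hom)
  then have "\<alpha> = \<beta>"
    using monoidal_nat_trans_unique[OF _ \<alpha>(2) \<beta>(2)] by (intro extensionalityI[OF \<alpha>(3) \<beta>(3)]) simp
  then show ?thesis by (simp add: \<alpha>(1) \<beta>(1))
qed

text \<open>
  The counit of the equivalence.  The comparison is cut down to the objects of \<open>Mod R\<close> because arrows
  of the hom-category are extensional.
\<close>

definition counit where
  "counit F = (ext_scalars R S (base_hom R S F), restrict (mod_functor.compare R S F) (obj (Mod R)), F)"

lemma counit_hom:
  assumes F: "F \<in> obj H"
  shows "counit F \<in> hom_set H (ext_scalars R S (base_hom R S F)) F" and "is_iso H (counit F)"
proof -
  interpret F: mod_functor R S F using F obj_H by blast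
  show c: "counit F \<in> hom_set H (ext_scalars R S (base_hom R S F)) F"
    using F ext_scalars_obj[OF base_hom_in[OF F]] F.compare_monoidal
    by (simp add: counit_def H.hom_category_hom monoidal_nat_trans_restrict[OF R.Mod_symmetric_monoidal] del: Mod_simps)
  show "is_iso H (counit F)"
    using H.hom_category_iso[OF c[unfolded counit_def]] F.compare_iso by (simp add: counit_def)
qed

text \<open>
  A quasi-inverse sends a functor to its ring homomorphism.  Naturality of the counit needs no
  computation: both sides are arrows out of the same extension of scalars.
\<close>

theorem ext_scalars_equivalence: "is_equivalence (discrete_category (cring_hom R S)) H (ext_scalars_fctr R S)"
proof -
  let ?X = "cring_hom R S"
  let ?D = "discrete_category ?X"
  let ?G = "\<lparr>fobj = base_hom R S, farr = (\<lambda>f. base_hom R S (src H f))\<rparr>"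
  note Hc = H.hom_category_is_category
  have K: "is_functor ?D H (ext_scalars_fctr R S)"
    unfolding ext_scalars_fctr_def by (rule discrete_functor[OF Hc ext_scalars_obj])
  have ff: "fobj (ext_scalars_fctr R S) = ext_scalars R S"
    "farr (ext_scalars_fctr R S) \<phi> = idn H (ext_scalars R S \<phi>)" for \<phi> by (simp_all add: ext_scalars_fctr_def)
  have G: "is_functor H ?D ?G"
    unfolding is_functor_def
  proof (intro conjI ballI allI Hc discrete_category_is_category)
    show "fobj ?G F \<in> obj ?D" if "F \<in> obj H" for F using base_hom_in[OF that] by simp
    show "farr ?G f \<in> hom_set ?D (fobj ?G F) (fobj ?G G)" if f: "f \<in> hom_set H F G" for F G f
      using base_hom_arr[OF f] base_hom_in[of F] category_src[OF Hc hom_set_arr[OF f]] hom_set_src[OF f]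
      by (simp add: hom_set_discrete)
    show "farr ?G (idn H F) = idn ?D (fobj ?G F)" if "F \<in> obj H" for F
      using hom_set_src[OF category_idn[OF Hc that]] by simp
    show "farr ?G (g \<cdot>\<^bsub>H\<^esub> f) = farr ?G g \<cdot>\<^bsub>?D\<^esub> farr ?G f"
      if "f \<in> hom_set H F G" "g \<in> hom_set H G K" for F G K f g
      using hom_set_src[OF category_cmp[OF Hc that]] hom_set_src[OF that(1)] by simp
  qed
  have "nat_iso ?D ?D id_fctr (comp_fctr ?G (ext_scalars_fctr R S)) (\<lambda>\<phi>. \<phi>)"
    unfolding nat_iso_def nat_trans_def
  proof (intro conjI ballI)
    show "\<phi> \<in> hom_set ?D (fobj id_fctr \<phi>) (fobj (comp_fctr ?G (ext_scalars_fctr R S)) \<phi>)" if "\<phi> \<in> obj ?D" for \<phi>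
      using that base_hom_ext by (simp add: id_fctr_def ff hom_set_discrete)
    show "tgt ?D \<phi> \<cdot>\<^bsub>?D\<^esub> farr id_fctr \<phi> = farr (comp_fctr ?G (ext_scalars_fctr R S)) \<phi> \<cdot>\<^bsub>?D\<^esub> src ?D \<phi>" for \<phi>
      by (simp add: id_fctr_def)
    show "is_iso ?D \<phi>" if "\<phi> \<in> obj ?D" for \<phi> using that by (simp add: is_iso_def hom_set_discrete)
  qed
  moreover have "nat_iso H H (comp_fctr (ext_scalars_fctr R S) ?G) id_fctr counit"
    unfolding nat_iso_def nat_trans_def
  proof (intro conjI ballI)
    show "counit F \<in> hom_set H (fobj (comp_fctr (ext_scalars_fctr R S) ?G) F) (fobj id_fctr F)" if "F \<in> obj H" for F
      using counit_hom(1)[OF that] by (simp add: ff id_fctr_def)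
    show "is_iso H (counit F)" if "F \<in> obj H" for F using counit_hom(2)[OF that] .
    fix f assume f: "f \<in> arr H"
    let ?F = "src H f" and ?K = "tgt H f"
    note fh = arr_in_hom_set[OF f]
    note F = category_src[OF Hc f] and Kk = category_tgt[OF Hc f]
    note b = base_hom_in[OF F]
    have i: "idn H (ext_scalars R S (base_hom R S ?F)) \<in>
        hom_set H (ext_scalars R S (base_hom R S ?F)) (ext_scalars R S (base_hom R S ?F))"
      by (rule category_idn[OF Hc ext_scalars_obj[OF b]])
    have c: "counit ?K \<in> hom_set H (ext_scalars R S (base_hom R S ?F)) ?K"
      using counit_hom(1)[OF Kk] base_hom_arr[OF fh] by simp
    have "counit ?K \<cdot>\<^bsub>H\<^esub> idn H (ext_scalars R S (base_hom R S ?F)) = f \<cdot>\<^bsub>H\<^esub> counit ?F"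
      by (rule hom_from_ext_unique[OF b category_cmp[OF Hc i c] category_cmp[OF Hc counit_hom(1)[OF F] fh]])
    then show "counit ?K \<cdot>\<^bsub>H\<^esub> farr (comp_fctr (ext_scalars_fctr R S) ?G) f = farr id_fctr f \<cdot>\<^bsub>H\<^esub> counit ?F"
      by (simp add: ff id_fctr_def)
  qed
  ultimately show ?thesis unfolding is_equivalence_def using K G by blast
qed

end

theorem proposition2p3p9:
  fixes R S :: "'u ring"
  assumes "universe TYPE('u)"
    and "cring R" and "small TYPE('u) (carrier R)"
    and "cring S" and "small TYPE('u) (carrier S)"
  shows "com_two_ring TYPE('u) (Mod R) \<and> com_two_ring TYPE('u) (Mod S) \<and>
    is_equivalence (discrete_category (cring_hom R S))
      (com_two_ring_hom TYPE('u) (Mod R) (Mod S)) (ext_scalars_fctr R S)"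
proof -
  interpret small_cring_pair R S
    using assms by (simp add: small_cring_pair_def small_cring_def)
  show ?thesis using R.Mod_com_two_ring S.Mod_com_two_ring ext_scalars_equivalence by blast
qed

end
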